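(* Let $D\ge4$ and consider the system, for unknowns $P_I(t,\theta)$, $Q_I(t,\theta)$, $I=3,\dots,D-1$, $$\mathcal D^2P_I-t^2\partial_\theta^2P_I=-\tfrac12e^{-2(P+P_I)}\big[(\mathcal DQ_I)^2-(t\partial_\theta Q_I)^2\big],\qquad \mathcal D^2Q_I-t^2\partial_\theta^2Q_I=2\big[\mathcal D(P+P_I)\mathcal DQ_I-t^2\partial_\theta(P+P_I)\partial_\theta Q_I\big],$$ where $\mathcal D=t\partial_t$ and $P=\sum_JP_J$. Let $p_{I0},p_{I1},q_{I0},q_{I1}$ be smooth functions of $\theta$, set $k_I=\sum_Jp_{J0}+p_{I0}$, suppose $1/2<k_I<5/6$ for all $\theta$ and all $I$, and define $$\alpha_I(\theta)=\frac12\Big(\frac{\partial_\theta q_{I0}}{2-2k_I}\Big)^2\exp\Big[-2\Big(p_{I1}+\sum_{J=3}^{D-1}p_{J1}\Big)\Big].$$ Let $\epsilon_J$ satisfy $2(k_I+k_J)-3<\epsilon_J<\min\{2k_I-1,2-2k_I\}$ for all $I,J$. Then for each $\theta_0$ there exists a solution of the system in a neighbourhood of $\theta=\theta_0$ (for small $t>0$) of the form $$P_I=p_{I0}\ln t+p_{I1}+\alpha_I(\theta)t^{2-2k_I}+t^{2-2k_I+\epsilon_I}\pi_I(t,\theta),\qquad Q_I=q_{I0}+t^{2k_I}q_{I1}+t^{2k_I}\kappa_I(t,\theta),$$ where $\pi_I$ and $\kappa_I$ are regular and tend to $0$ as $t\to0$. Given the form of the expansion and the choice of the $\epsilon_I$,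 the solution is unique.
   Context: A function $u(t,\theta)$ defined on an open subset $\Omega\subset[0,\infty)\times\mathbb R$ is called regular if it is $C^\infty$ for $t>0$ and all its partial derivatives of any order with respect to $\theta$ extend continuously to $t=0$ (within $\bar\Omega$). The system is the reduced vacuum Einstein equations for $T^{D-2}$-symmetric spacetimes on $T^{D-1}\times\mathbb R$ in areal time with diagonal orbit metric $e^{2P_I}\delta_{IJ}$ and twist potentials $Q_I$. *)

theory Defs
  imports "HOL-Analysis.Analysis"
begin

definition dt :: "(real \<times> real \<Rightarrow> real) \<Rightarrow> real \<times> real \<Rightarrow> real" where
  "dt u x = deriv (\<lambda>s. u (s, snd x)) (fst x)"

definition dth :: "(real \<times> real \<Rightarrow> real) \<Rightarrow> real \<times> real \<Rightarrow> real" where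
  "dth u x = deriv (\<lambda>s. u (fst x, s)) (snd x)"

definition Dop :: "(real \<times> real \<Rightarrow> real) \<Rightarrow> real \<times> real \<Rightarrow> real" where
  "Dop u x = fst x * dt u x"

fun pderivs :: "bool list \<Rightarrow> (real \<times> real \<Rightarrow> real) \<Rightarrow> real \<times> real \<Rightarrow> real" where
  "pderivs [] u = u"
| "pderivs (True # w) u = dt (pderivs w u)"
| "pderivs (False # w) u = dth (pderivs w u)"

definition smooth2_on :: "(real \<times> real) set \<Rightarrow> (real \<times> real \<Rightarrow> real) \<Rightarrow> bool" where
  "smooth2_on U u \<longleftrightarrow>
     (\<forall>w. continuous_on U (pderivs w u) \<and>
          (\<forall>x\<in>U. (\<lambda>s. pderivs w u (s, snd x)) differentiable (at (fst x)) \<and>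
                  (\<lambda>s. pderivs w u (fst x, s)) differentiable (at (snd x))))"

definition regular_on :: "(real \<times> real) set \<Rightarrow> (real \<times> real \<Rightarrow> real) \<Rightarrow> bool" where
  "regular_on \<Omega> u \<longleftrightarrow>
     smooth2_on (\<Omega> \<inter> {x. fst x > 0}) u \<and>
     (\<forall>n::nat. \<exists>g. continuous_on ((\<Omega> \<inter> {x. fst x > 0}) \<union> (closure \<Omega> \<inter> {x. fst x = 0})) g \<and>
                  (\<forall>x\<in>\<Omega> \<inter> {x. fst x > 0}. g x = (dth ^^ n) u x))"

definition smooth1 :: "(real \<Rightarrow> real) \<Rightarrow> bool" where
  "smooth1 f \<longleftrightarrow> (\<forall>n::nat. \<forall>x. ((deriv ^^ n) f) differentiable (at x))"

definition kI :: "nat \<Rightarrow> (nat \<Rightarrow> real \<Rightarrow> real) \<Rightarrow> nat \<Rightarrow> real \<Rightarrow> real" where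
  "kI D p0 I \<theta> = (\<Sum>J=3..D-1. p0 J \<theta>) + p0 I \<theta>"

definition alphaI :: "nat \<Rightarrow> (nat \<Rightarrow> real \<Rightarrow> real) \<Rightarrow> (nat \<Rightarrow> real \<Rightarrow> real) \<Rightarrow> (nat \<Rightarrow> real \<Rightarrow> real)
    \<Rightarrow> nat \<Rightarrow> real \<Rightarrow> real" where
  "alphaI D p0 p1 q0 I \<theta> =
     1/2 * (deriv (q0 I) \<theta> / (2 - 2 * kI D p0 I \<theta>))\<^sup>2 *
     exp (- 2 * (p1 I \<theta> + (\<Sum>J=3..D-1. p1 J \<theta>)))"

definition Pform :: "nat \<Rightarrow> (nat \<Rightarrow> real \<Rightarrow> real) \<Rightarrow> (nat \<Rightarrow> real \<Rightarrow> real) \<Rightarrow> (nat \<Rightarrow> real \<Rightarrow> real)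
    \<Rightarrow> (nat \<Rightarrow> real) \<Rightarrow> (nat \<Rightarrow> real \<times> real \<Rightarrow> real) \<Rightarrow> nat \<Rightarrow> real \<times> real \<Rightarrow> real" where
  "Pform D p0 p1 q0 \<epsilon> \<pi> I x =
     (let t = fst x; \<theta> = snd x in
      p0 I \<theta> * ln t + p1 I \<theta> + alphaI D p0 p1 q0 I \<theta> * t powr (2 - 2 * kI D p0 I \<theta>)
      + t powr (2 - 2 * kI D p0 I \<theta> + \<epsilon> I) * \<pi> I x)"

definition Qform :: "nat \<Rightarrow> (nat \<Rightarrow> real \<Rightarrow> real) \<Rightarrow> (nat \<Rightarrow> real \<Rightarrow> real) \<Rightarrow> (nat \<Rightarrow> real \<Rightarrow> real)
    \<Rightarrow> (nat \<Rightarrow> real \<times> real \<Rightarrow> real) \<Rightarrow> nat \<Rightarrow> real \<times> real \<Rightarrow> real" where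
  "Qform D p0 q0 q1 \<kappa> I x =
     (let t = fst x; \<theta> = snd x in
      q0 I \<theta> + t powr (2 * kI D p0 I \<theta>) * q1 I \<theta> + t powr (2 * kI D p0 I \<theta>) * \<kappa> I x)"

definition einstein_sys :: "nat \<Rightarrow> (nat \<Rightarrow> real \<times> real \<Rightarrow> real) \<Rightarrow> (nat \<Rightarrow> real \<times> real \<Rightarrow> real)
    \<Rightarrow> nat \<Rightarrow> real \<times> real \<Rightarrow> bool" where
  "einstein_sys D P Q I x \<longleftrightarrow>
     (let t = fst x; PP = (\<lambda>y. (\<Sum>J=3..D-1. P J y) + P I y) in
       Dop (Dop (P I)) x - t\<^sup>2 * dth (dth (P I)) x
         = - 1/2 * exp (- 2 * PP x) * ((Dop (Q I) x)\<^sup>2 - (t * dth (Q I) x)\<^sup>2)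
     \<and> Dop (Dop (Q I)) x - t\<^sup>2 * dth (dth (Q I)) x
         = 2 * (Dop PP x * Dop (Q I) x - t\<^sup>2 * dth PP x * dth (Q I) x))"

definition is_expansion_solution ::
  "nat \<Rightarrow> (nat \<Rightarrow> real \<Rightarrow> real) \<Rightarrow> (nat \<Rightarrow> real \<Rightarrow> real) \<Rightarrow> (nat \<Rightarrow> real \<Rightarrow> real) \<Rightarrow> (nat \<Rightarrow> real \<Rightarrow> real)
   \<Rightarrow> (nat \<Rightarrow> real) \<Rightarrow> real \<Rightarrow> real \<Rightarrow> real
   \<Rightarrow> (nat \<Rightarrow> real \<times> real \<Rightarrow> real) \<Rightarrow> (nat \<Rightarrow> real \<times> real \<Rightarrow> real) \<Rightarrow> bool" where
  "is_expansion_solution D p0 p1 q0 q1 \<epsilon> T a b \<pi> \<kappa> \<longleftrightarrow>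
     0 < T \<and> a < b \<and>
     (\<forall>I\<in>{3..D-1}.
        regular_on ({0<..<T} \<times> {a<..<b}) (\<pi> I) \<and>
        regular_on ({0<..<T} \<times> {a<..<b}) (\<kappa> I) \<and>
        (\<forall>\<theta>\<in>{a<..<b}. ((\<lambda>t. \<pi> I (t, \<theta>)) \<longlongrightarrow> 0) (at_right 0)) \<and>
        (\<forall>\<theta>\<in>{a<..<b}. ((\<lambda>t. \<kappa> I (t, \<theta>)) \<longlongrightarrow> 0) (at_right 0)) \<and>
        (\<forall>x\<in>{0<..<T} \<times> {a<..<b}.
           einstein_sys D (Pform D p0 p1 q0 \<epsilon> \<pi>) (Qform D p0 q0 q1 \<kappa>) I x))"

end

theory Submission
  imports Defs "HOL-Computational_Algebra.Formal_Power_Series"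
begin

unbundle no vec_syntax
unbundle fps_syntax

text \<open>
  With \<open>PP\<^sub>I = P + P\<^sub>I\<close>, the functions \<open>V\<^sub>I = D P\<^sub>I\<close>, \<open>W\<^sub>I = t \<partial>\<^sub>\<theta> P\<^sub>I\<close>, \<open>X\<^sub>I = exp (- PP\<^sub>I) D Q\<^sub>I\<close> and
  \<open>Y\<^sub>I = exp (- PP\<^sub>I) t \<partial>\<^sub>\<theta> Q\<^sub>I\<close> solve a quadratic system in which \<open>V \<plusminus> W\<close> and \<open>X \<plusminus> Y\<close> are transported by
  \<open>D \<minusplus> t \<partial>\<^sub>\<theta>\<close>. In the limit \<open>t \<rightarrow> 0\<close> its coefficients only involve \<open>k\<^sub>I\<close>, and since \<open>0 \<le> k\<^sub>I \<le> 1\<close> the absolute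
  row sums of the singular coefficient matrix are at most \<open>1\<close>. Integration along characteristics from \<open>t = 0\<close>
  divides a bound \<open>O(t\<^sup>\<mu>)\<close> by \<open>\<mu>\<close>, hence is a contraction on \<open>O(t\<^sup>\<mu>)\<close> for every \<open>\<mu> > 1\<close> and small \<open>t\<close>.

  Existence: an explicit approximate solution of second order in \<open>t powr (2 - 2 * k\<^sub>I)\<close> has a residual
  \<open>O(t\<^sup>\<mu>)\<close> with \<open>\<mu> > 1\<close> because \<open>k\<^sub>I < 5/6\<close>, and the error is a fixed point. To control all
  \<open>\<theta>\<close>-derivatives the iteration is run on Taylor jets in \<open>\<theta>\<close>, viewed as formal power series and measured in
  the norm \<open>\<Sum>\<^sub>j \<eta>\<^sup>j \<bar>F\<^sub>j\<bar>\<close>; for small \<open>\<eta>\<close> the contraction constant is as good as for functions.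

  Uniqueness: regularity bounds \<open>\<theta>\<close>-derivatives, so that the momenta \<open>exp (- 2 PP\<^sub>I) D Q\<^sub>I\<close> and the equations for
  \<open>P\<^sub>I\<close> can be integrated in \<open>t\<close>; this improves the difference of two solutions step by step to \<open>O(t\<^sup>\<mu>)\<close> with
  \<open>\<mu> > 1\<close>, where the same contraction shows that it vanishes.
\<close>

subsection \<open>Power bounds stable under scaling derivatives\<close>

text \<open>The threshold mu > 1 is used three times. It lets the contraction beat the row sum 1, it
  makes f / t continuous up to t = 0 in the integrals along characteristics, and it kills the
  defects W - t dth P and exp(PP) Y - t dth Q, which solve D g = g and are thus multiples of t on
  each line. The last point permits solving the frame equations as a free first order system and
  recovering P and Q afterwards by integration in t. The two bounds on k_I act on different
  components: k_I > 1/2 puts X^2 = O(t^(2 k_I)) beyond order t, while Y^2 = O(t^(2 - 2 k_I)) stays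
  below it and is the quadratic term that needs corrections. Since k_I varies with theta, each
  theta-derivative of a power of t costs a logarithm. Exponents are therefore frozen at a centre and
  given a margin e, and the construction is local in theta. Uniqueness meets another obstacle:
  regularity says nothing about t-derivatives of the remainders at t = 0, so the limits of the
  momentum and of D P_I are first shown to exist by their evolution equations and then identified
  with the data.\<close>

text \<open>The flag \<open>c\<close> selects \<open>t \<partial>\<^sub>t\<close> (\<^const>\<open>True\<close>) or \<open>\<partial>\<^sub>\<theta>\<close> (\<^const>\<open>False\<close>).\<close>

definition line :: "bool \<Rightarrow> real \<times> real \<Rightarrow> real \<Rightarrow> real \<times> real" where
  "line c x s = (if c then (s, snd x) else (fst x, s))"

definition crd :: "bool \<Rightarrow> real \<times> real \<Rightarrow> real" where
  "crd c x = (if c then fst x else snd x)"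

definition wt :: "bool \<Rightarrow> real \<times> real \<Rightarrow> real" where
  "wt c x = (if c then inverse (fst x) else 1)"

text \<open>A relation instead of an equation for \<open>deriv\<close>, so that existence of the
  derivative is included. The weight \<open>wt\<close> turns the time direction into t d/dt, under
  which powers of t keep their order.\<close>

definition pder :: "bool \<Rightarrow> (real \<times> real) set \<Rightarrow> (real \<times> real \<Rightarrow> real) \<Rightarrow> (real \<times> real \<Rightarrow> real) \<Rightarrow> bool" where
  "pder c S f f' \<longleftrightarrow>
     (\<forall>x\<in>S. ((\<lambda>s. f (line c x s)) has_real_derivative wt c x * f' x) (at (crd c x)))"

text \<open>Times below 1 make powers of t decreasing in the exponent; bounded theta makes smooth
  functions of theta bounded.\<close>

definition region :: "(real \<times> real) set \<Rightarrow> bool" where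
  "region S \<longleftrightarrow> open S \<and> (\<forall>x\<in>S. 0 < fst x \<and> fst x < 1) \<and> (\<exists>M. \<forall>x\<in>S. \<bar>snd x\<bar> \<le> M)"

section \<open>Calculus of the two scaling derivatives\<close>

lemma line_crd [simp]: "line c x (crd c x) = x"
  by (simp add: line_def crd_def)

lemma pder_add: "pder c S f f' \<Longrightarrow> pder c S g g' \<Longrightarrow> pder c S (\<lambda>x. f x + g x) (\<lambda>x. f' x + g' x)"
  unfolding pder_def by (auto intro!: derivative_eq_intros simp: algebra_simps)

lemma pder_diff: "pder c S f f' \<Longrightarrow> pder c S g g' \<Longrightarrow> pder c S (\<lambda>x. f x - g x) (\<lambda>x. f' x - g' x)"
  unfolding pder_def by (auto intro!: derivative_eq_intros simp: algebra_simps)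

lemma pder_cmult: "pder c S f f' \<Longrightarrow> pder c S (\<lambda>x. r * f x) (\<lambda>x. r * f' x)"
  unfolding pder_def by (auto intro!: derivative_eq_intros)

lemma pder_mult:
  "pder c S f f' \<Longrightarrow> pder c S g g' \<Longrightarrow> pder c S (\<lambda>x. f x * g x) (\<lambda>x. f' x * g x + f x * g' x)"
  unfolding pder_def by (auto intro!: derivative_eq_intros simp: algebra_simps)

lemma pder_exp: "pder c S f f' \<Longrightarrow> pder c S (\<lambda>x. exp (f x)) (\<lambda>x. f' x * exp (f x))"
  unfolding pder_def by (auto intro!: derivative_eq_intros simp: algebra_simps)

lemma pder_inverse:
  "pder c S f f' \<Longrightarrow> \<forall>x\<in>S. f x \<noteq> 0 \<Longrightarrow>
   pder c S (\<lambda>x. inverse (f x)) (\<lambda>x. - (f' x * (inverse (f x) * inverse (f x))))"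
  unfolding pder_def by (auto intro!: derivative_eq_intros simp: algebra_simps)

lemma pder_const: "pder c S (\<lambda>x. r) (\<lambda>x. 0)"
  unfolding pder_def by auto

lemma pder_sum:
  "(\<And>i. i \<in> A \<Longrightarrow> pder c S (f i) (f' i)) \<Longrightarrow>
   pder c S (\<lambda>x. \<Sum>i\<in>A. f i x) (\<lambda>x. \<Sum>i\<in>A. f' i x)"
  unfolding pder_def by (auto intro!: derivative_eq_intros simp: sum_distrib_left)

lemma pder_subset: "pder c S f f' \<Longrightarrow> S' \<subseteq> S \<Longrightarrow> pder c S' f f'"
  unfolding pder_def by auto

lemma pder_cong_deriv: "pder c S f f' \<Longrightarrow> (\<And>x. x \<in> S \<Longrightarrow> f' x = g' x) \<Longrightarrow> pder c S f g'"
  unfolding pder_def by auto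

lemma isCont_line: "isCont (line c x) (crd c x)"
  unfolding line_def by (cases c) (auto intro!: continuous_intros)

lemma eventually_line:
  assumes "open S" "x \<in> S"
  shows "\<forall>\<^sub>F s in nhds (crd c x). line c x s \<in> S"
proof -
  have "(line c x \<longlongrightarrow> x) (nhds (crd c x))"
    using isCont_line[of c x] tendsto_at_iff_tendsto_nhds[of "line c x" "crd c x"]
    unfolding isCont_def by simp
  then show ?thesis
    using assms topological_tendstoD by blast
qed

lemma pder_cong:
  assumes "pder c S f f'" "open S" "\<And>x. x \<in> S \<Longrightarrow> f x = g x"
  shows "pder c S g f'"
  unfolding pder_def
proof
  fix x assume x: "x \<in> S"
  have "\<forall>\<^sub>F s in nhds (crd c x). f (line c x s) = g (line c x s)"
    using eventually_line[OF assms(2) x, of c] by eventually_elim (use assms(3) in auto)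
  note ev = this
  show "((\<lambda>s. g (line c x s)) has_real_derivative wt c x * f' x) (at (crd c x))"
    using assms(1) x DERIV_cong_ev[OF refl ev refl] unfolding pder_def by blast
qed

lemma pder_unique:
  assumes "pder c S f f'" "pder c S f g'" "x \<in> S" "0 < fst x"
  shows "f' x = g' x"
proof -
  have "wt c x * f' x = wt c x * g' x"
    using assms unfolding pder_def by (blast intro: DERIV_unique)
  then show ?thesis using assms(4) by (auto simp: wt_def split: if_splits)
qed

lemma pder_True_Dop: "pder True S f f' \<Longrightarrow> x \<in> S \<Longrightarrow> 0 < fst x \<Longrightarrow> Dop f x = f' x"
  unfolding pder_def Dop_def dt_def line_def crd_def wt_def
  by (auto dest!: bspec DERIV_imp_deriv)

lemma pder_False_dth: "pder False S f f' \<Longrightarrow> x \<in> S \<Longrightarrow> dth f x = f' x"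
  unfolding pder_def dth_def line_def crd_def wt_def
  by (auto dest!: bspec DERIV_imp_deriv)

text \<open>\<open>b\<close> selects whether the scaling derivative \<open>Dop\<close> is included besides \<open>dth\<close>, and
  \<open>d\<close> whether the bounds \<open>O(t\<^sup>a)\<close> are imposed.\<close>

definition Ob0 :: "bool \<Rightarrow> (real \<times> real) set \<Rightarrow> real \<Rightarrow> (real \<times> real \<Rightarrow> real) \<Rightarrow> bool" where
  "Ob0 d S a f \<longleftrightarrow> continuous_on S f \<and> (d \<longrightarrow> (\<exists>C. \<forall>x\<in>S. \<bar>f x\<bar> \<le> C * fst x powr a))"

text \<open>The derivative is quantified existentially at each level; \<open>pder_unique\<close>
  makes the choice harmless on a region. One exponent serves all orders, which is the benefit of
  scaling derivatives.\<close>

primrec Ob :: "bool \<Rightarrow> bool \<Rightarrow> (real \<times> real) set \<Rightarrow> nat \<Rightarrow> real \<Rightarrow> (real \<times> real \<Rightarrow> real) \<Rightarrow> bool" where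
  "Ob b d S 0 a f = Ob0 d S a f"
| "Ob b d S (Suc n) a f =
     (Ob0 d S a f \<and> (\<forall>c. (c \<longrightarrow> b) \<longrightarrow> (\<exists>f'. pder c S f f' \<and> Ob b d S n a f')))"

definition BO :: "bool \<Rightarrow> bool \<Rightarrow> (real \<times> real) set \<Rightarrow> real \<Rightarrow> (real \<times> real \<Rightarrow> real) \<Rightarrow> bool" where
  "BO b d S a f \<longleftrightarrow> (\<forall>n. Ob b d S n a f)"

section \<open>Closure properties of the power bounds\<close>

lemma Ob_SucI:
  assumes "Ob0 d S a f" "\<And>c. (c \<longrightarrow> b) \<Longrightarrow> \<exists>f'. pder c S f f' \<and> Ob b d S n a f'"
  shows "Ob b d S (Suc n) a f"
  unfolding Ob.simps using assms by blast

lemma Ob_SucD: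
  "Ob b d S (Suc n) a f \<Longrightarrow> c \<longrightarrow> b \<Longrightarrow> \<exists>f'. pder c S f f' \<and> Ob b d S n a f'"
  unfolding Ob.simps by blast

lemma Ob_SucE:
  assumes "Ob b d S (Suc n) a f" "c \<longrightarrow> b"
  obtains f' where "pder c S f f'" "Ob b d S n a f'"
  using assms unfolding Ob.simps by blast

lemma Ob_imp_Ob0: "Ob b d S n a f \<Longrightarrow> Ob0 d S a f"
  by (cases n) auto

lemma Ob_Suc_imp: "Ob b d S (Suc n) a f \<Longrightarrow> Ob b d S n a f"
proof (induction n arbitrary: f)
  case (Suc n)
  show ?case
  proof (rule Ob_SucI)
    show "Ob0 d S a f" using Suc.prems by (rule Ob_imp_Ob0)
    fix c assume "c \<longrightarrow> b"
    then show "\<exists>f'. pder c S f f' \<and> Ob b d S n a f'"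
      using Suc.IH Ob_SucD[OF Suc.prems] by blast
  qed
qed simp

lemma BO_imp_Ob0: "BO b d S a f \<Longrightarrow> Ob0 d S a f"
  using Ob_imp_Ob0 BO_def by blast

lemma BO_cont: "BO b d S a f \<Longrightarrow> continuous_on S f"
  using BO_imp_Ob0 Ob0_def by blast

lemma Ob0_bound:
  assumes "Ob0 d S a f" d
  obtains C where "C > 0" "\<And>x. x \<in> S \<Longrightarrow> \<bar>f x\<bar> \<le> C * fst x powr a"
proof -
  obtain C where C: "\<forall>x\<in>S. \<bar>f x\<bar> \<le> C * fst x powr a" using assms unfolding Ob0_def by auto
  have "\<bar>f x\<bar> \<le> (\<bar>C\<bar> + 1) * fst x powr a" if "x \<in> S" for x
    using C that mult_right_mono[of C "\<bar>C\<bar> + 1" "fst x powr a"] by fastforce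
  then show ?thesis using that[of "\<bar>C\<bar> + 1"] by auto
qed

lemma BO_bound:
  assumes "BO b True S a f"
  obtains C where "C > 0" "\<And>x. x \<in> S \<Longrightarrow> \<bar>f x\<bar> \<le> C * fst x powr a"
  using Ob0_bound[OF BO_imp_Ob0[OF assms]] by blast

lemma Ob0_cong: "Ob0 d S a f \<Longrightarrow> (\<And>x. x \<in> S \<Longrightarrow> f x = g x) \<Longrightarrow> Ob0 d S a g"
  unfolding Ob0_def by (metis (full_types) continuous_on_cong)

lemma Ob_cong: "Ob b d S n a f \<Longrightarrow> open S \<Longrightarrow> (\<And>x. x \<in> S \<Longrightarrow> f x = g x) \<Longrightarrow> Ob b d S n a g"
proof (cases n)
  case 0
  then show "Ob b d S n a f \<Longrightarrow> open S \<Longrightarrow> (\<And>x. x \<in> S \<Longrightarrow> f x = g x) \<Longrightarrow> Ob b d S n a g"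
    using Ob0_cong by auto
next
  case (Suc m)
  then show "Ob b d S n a f \<Longrightarrow> open S \<Longrightarrow> (\<And>x. x \<in> S \<Longrightarrow> f x = g x) \<Longrightarrow> Ob b d S n a g"
    using Ob0_cong[of d S a f g] pder_cong[of _ S f _ g] unfolding Suc Ob.simps by metis
qed

lemma BO_cong: "BO b d S a f \<Longrightarrow> open S \<Longrightarrow> (\<And>x. x \<in> S \<Longrightarrow> f x = g x) \<Longrightarrow> BO b d S a g"
  unfolding BO_def using Ob_cong by blast

lemma Ob0_subset: "Ob0 d S a f \<Longrightarrow> S' \<subseteq> S \<Longrightarrow> Ob0 d S' a f"
  unfolding Ob0_def by (meson continuous_on_subset subsetD)

lemma Ob_subset: "Ob b d S n a f \<Longrightarrow> S' \<subseteq> S \<Longrightarrow> Ob b d S' n a f"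
proof (induction n arbitrary: f)
  case (Suc n)
  show ?case
  proof (rule Ob_SucI)
    show "Ob0 d S' a f" using Suc.prems Ob0_subset Ob_imp_Ob0 by blast
    fix c assume "c \<longrightarrow> b"
    then show "\<exists>f'. pder c S' f f' \<and> Ob b d S' n a f'"
      using Suc.IH Ob_SucD[OF Suc.prems(1)] Suc.prems(2) pder_subset by blast
  qed
qed (simp add: Ob0_subset)

lemma BO_subset: "BO b d S a f \<Longrightarrow> S' \<subseteq> S \<Longrightarrow> BO b d S' a f"
  unfolding BO_def using Ob_subset by blast

lemma powr_mono_01: "0 < (t::real) \<Longrightarrow> t < 1 \<Longrightarrow> a' \<le> a \<Longrightarrow> t powr a \<le> t powr a'"
  by (rule powr_mono') auto

lemma Ob0_weaken:
  assumes "Ob0 d S a f" "region S" "d \<Longrightarrow> a' \<le> a"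
  shows "Ob0 d S a' f"
proof (cases d)
  case True
  then obtain C where C: "C > 0" "\<And>x. x \<in> S \<Longrightarrow> \<bar>f x\<bar> \<le> C * fst x powr a"
    using Ob0_bound[OF assms(1)] by blast
  have "\<bar>f x\<bar> \<le> C * fst x powr a'" if "x \<in> S" for x
  proof -
    have "fst x powr a \<le> fst x powr a'"
      using assms(2,3) True that by (intro powr_mono_01) (auto simp: region_def)
    then show ?thesis using C that by (meson mult_left_mono less_imp_le order_trans)
  qed
  then show ?thesis using assms(1) unfolding Ob0_def by blast
qed (use assms Ob0_def in auto)

lemma Ob_weaken:
  assumes "Ob b d S n a f" "region S" "d \<Longrightarrow> a' \<le> a"
  shows "Ob b d S n a' f"
  using assms(1)
proof (induction n arbitrary: f)
  case (Suc n)
  show ?case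
  proof (rule Ob_SucI)
    show "Ob0 d S a' f" using Suc.prems Ob0_weaken[OF _ assms(2)] assms(3) Ob_imp_Ob0 by blast
    fix c assume "c \<longrightarrow> b"
    then show "\<exists>f'. pder c S f f' \<and> Ob b d S n a' f'"
      using Suc.IH Ob_SucD[OF Suc.prems] by blast
  qed
qed (use Ob0_weaken assms in auto)

lemma BO_weaken:
  assumes "BO b d S a f" "region S" "d \<Longrightarrow> a' \<le> a"
  shows "BO b d S a' f"
  using assms Ob_weaken unfolding BO_def by blast

lemma Ob0_add: "Ob0 d S a f \<Longrightarrow> Ob0 d S a g \<Longrightarrow> Ob0 d S a (\<lambda>x. f x + g x)"
proof -
  assume f: "Ob0 d S a f" and g: "Ob0 d S a g"
  have "\<exists>C. \<forall>x\<in>S. \<bar>f x + g x\<bar> \<le> C * fst x powr a" if d: d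
  proof -
    obtain C where C: "C > 0" "\<And>x. x \<in> S \<Longrightarrow> \<bar>f x\<bar> \<le> C * fst x powr a" using Ob0_bound[OF f d] by blast
    obtain C' where C': "C' > 0" "\<And>x. x \<in> S \<Longrightarrow> \<bar>g x\<bar> \<le> C' * fst x powr a" using Ob0_bound[OF g d] by blast
    have "\<bar>f x + g x\<bar> \<le> (C + C') * fst x powr a" if "x \<in> S" for x
      using C(2)[OF that] C'(2)[OF that] by (simp add: distrib_right)
    then show ?thesis by blast
  qed
  then show ?thesis using f g unfolding Ob0_def by (auto intro: continuous_on_add)
qed

lemma Ob_add: "Ob b d S n a f \<Longrightarrow> Ob b d S n a g \<Longrightarrow> Ob b d S n a (\<lambda>x. f x + g x)"
proof (induction n arbitrary: f g)
  case (Suc n)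
  show ?case
  proof (rule Ob_SucI)
    show "Ob0 d S a (\<lambda>x. f x + g x)" using Suc.prems Ob0_add Ob_imp_Ob0 by blast
    fix c assume c: "c \<longrightarrow> b"
    obtain f' where "pder c S f f'" "Ob b d S n a f'" using Suc.prems(1) c by (rule Ob_SucE)
    moreover obtain g' where "pder c S g g'" "Ob b d S n a g'" using Suc.prems(2) c by (rule Ob_SucE)
    ultimately show "\<exists>h. pder c S (\<lambda>x. f x + g x) h \<and> Ob b d S n a h"
      using pder_add Suc.IH by blast
  qed
qed (simp add: Ob0_add)

lemma Ob0_mult:
  assumes "Ob0 d S a f" "Ob0 d S a' g" "region S" "d \<Longrightarrow> e \<le> a + a'"
  shows "Ob0 d S e (\<lambda>x. f x * g x)"
proof -
  have "\<exists>C. \<forall>x\<in>S. \<bar>f x * g x\<bar> \<le> C * fst x powr (a + a')" if d: d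
  proof -
    obtain C where C: "C > 0" "\<And>x. x \<in> S \<Longrightarrow> \<bar>f x\<bar> \<le> C * fst x powr a" using Ob0_bound[OF assms(1) d] by blast
    obtain C' where C': "\<And>x. x \<in> S \<Longrightarrow> \<bar>g x\<bar> \<le> C' * fst x powr a'" using Ob0_bound[OF assms(2) d] by blast
    have "\<bar>f x * g x\<bar> \<le> C * C' * fst x powr (a + a')" if "x \<in> S" for x
    proof -
      have "\<bar>f x\<bar> * \<bar>g x\<bar> \<le> (C * fst x powr a) * (C' * fst x powr a')"
        using C C' that by (intro mult_mono) auto
      then show ?thesis by (simp add: abs_mult powr_add algebra_simps)
    qed
    then show ?thesis by blast
  qed
  then have "Ob0 d S (a + a') (\<lambda>x. f x * g x)"
    using assms unfolding Ob0_def by (auto intro: continuous_on_mult)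
  then show ?thesis using Ob0_weaken assms by blast
qed

lemma Ob_mult:
  assumes "Ob b d S n a f" "Ob b d S n a' g" "region S" "d \<Longrightarrow> e \<le> a + a'"
  shows "Ob b d S n e (\<lambda>x. f x * g x)"
  using assms(1,2)
proof (induction n arbitrary: f g)
  case (Suc n)
  have f: "Ob b d S n a f" and g: "Ob b d S n a' g" using Suc Ob_Suc_imp by blast+
  show ?case
  proof (rule Ob_SucI)
    show "Ob0 d S e (\<lambda>x. f x * g x)" using Ob0_mult assms(3,4) Suc.prems Ob_imp_Ob0 by blast
    fix c assume c: "c \<longrightarrow> b"
    obtain f' where "pder c S f f'" "Ob b d S n a f'" using Suc.prems(1) c by (rule Ob_SucE)
    moreover obtain g' where "pder c S g g'" "Ob b d S n a' g'" using Suc.prems(2) c by (rule Ob_SucE)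
    ultimately show "\<exists>h. pder c S (\<lambda>x. f x * g x) h \<and> Ob b d S n e h"
      using pder_mult[of c S f f' g g'] Suc.IH f g Ob_add by blast
  qed
qed (use Ob0_mult assms(3,4) in auto)

lemma Ob_const: "d \<longrightarrow> a \<le> 0 \<Longrightarrow> region S \<Longrightarrow> Ob b d S n a (\<lambda>x. r)"
proof (induction n arbitrary: r)
  case 0
  have "Ob0 d S 0 (\<lambda>x. r)" unfolding Ob0_def
    by (intro conjI continuous_on_const impI exI[of _ "\<bar>r\<bar>"] ballI) (use 0 in \<open>auto simp: region_def powr_zero_eq_one\<close>)
  then show ?case using 0 Ob0_weaken by auto
next
  case (Suc n)
  show ?case by (rule Ob_SucI) (use Suc pder_const[of _ S r] Ob_imp_Ob0 in blast)+
qed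

lemma BO_const: "(d \<Longrightarrow> a \<le> 0) \<Longrightarrow> region S \<Longrightarrow> BO b d S a (\<lambda>x. r)"
  unfolding BO_def using Ob_const by blast

lemma BO_add: "BO b d S a f \<Longrightarrow> BO b d S a g \<Longrightarrow> BO b d S a (\<lambda>x. f x + g x)"
  unfolding BO_def using Ob_add by blast

lemma BO_mult:
  "BO b d S a f \<Longrightarrow> BO b d S a' g \<Longrightarrow> region S \<Longrightarrow> (d \<Longrightarrow> e \<le> a + a') \<Longrightarrow> BO b d S e (\<lambda>x. f x * g x)"
  unfolding BO_def using Ob_mult by blast

lemma BO_cmult: "BO b d S a f \<Longrightarrow> region S \<Longrightarrow> BO b d S a (\<lambda>x. r * f x)"
  using BO_mult[OF BO_const[of d 0 S b r]] by force

lemma BO_minus: "BO b d S a f \<Longrightarrow> region S \<Longrightarrow> BO b d S a (\<lambda>x. - f x)"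
  using BO_cmult[of b d S a f "-1"] by simp

lemma BO_diff: "BO b d S a f \<Longrightarrow> BO b d S a g \<Longrightarrow> region S \<Longrightarrow> BO b d S a (\<lambda>x. f x - g x)"
  using BO_add[of b d S a f "\<lambda>x. - g x"] BO_minus by simp

lemma BO_zero: "BO b d S a (\<lambda>x. 0)"
proof -
  have "Ob b d S n a (\<lambda>x. 0)" for n
  proof (induction n)
    case 0
    show ?case by (auto simp: Ob0_def intro!: exI[of _ 0])
  next
    case (Suc n)
    then show ?case by (intro Ob_SucI) (use pder_const[of _ S 0] Ob_imp_Ob0 in blast)+
  qed
  then show ?thesis by (simp add: BO_def)
qed

lemma BO_sum:
  "(\<And>i. i \<in> A \<Longrightarrow> BO b d S a (f i)) \<Longrightarrow> BO b d S a (\<lambda>x. \<Sum>i\<in>A. f i x)"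
  by (induction A rule: infinite_finite_induct) (auto intro: BO_zero BO_add)

text \<open>Spares the induction on the order whenever the derivative is assembled from functions
  already known to be in the class.\<close>

lemma BO_intro:
  assumes "Ob0 d S a f" "\<And>c. c \<longrightarrow> b \<Longrightarrow> \<exists>f'. pder c S f f' \<and> BO b d S a f'"
  shows "BO b d S a f"
proof -
  have "Ob b d S n a f" for n
  proof (cases n)
    case (Suc m)
    show ?thesis unfolding Suc by (rule Ob_SucI) (use assms BO_def in blast)+
  qed (use assms in simp)
  then show ?thesis by (simp add: BO_def)
qed

text \<open>For each order n the definition yields a derivative of its own; uniqueness of
  derivatives at t > 0 merges them into one function that is good for all n.\<close>

lemma BO_pder:
  assumes "BO b d S a f" "c \<longrightarrow> b" "region S"
  obtains f' where "pder c S f f'" "BO b d S a f'"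
proof -
  obtain f' where f': "pder c S f f'" "Ob b d S 0 a f'"
    using assms(1,2) Ob_SucD unfolding BO_def by blast
  have "Ob b d S n a f'" for n
  proof -
    obtain g where g: "pder c S f g" "Ob b d S n a g"
      using assms(1,2) Ob_SucD unfolding BO_def by blast
    have "g x = f' x" if "x \<in> S" for x
      using pder_unique[OF g(1) f'(1) that] assms(3) that by (auto simp: region_def)
    then show ?thesis using Ob_cong g(2) assms(3) region_def by blast
  qed
  then show ?thesis using that f' by (auto simp: BO_def)
qed

lemma BO_Dop:
  assumes "BO True d S a f" "region S"
  shows "pder True S f (Dop f)" "BO True d S a (Dop f)"
proof -
  obtain f' where f': "pder True S f f'" "BO True d S a f'"
    using BO_pder[OF assms(1) _ assms(2), of True] by blast
  have eq: "x \<in> S \<Longrightarrow> f' x = Dop f x" for x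
    using pder_True_Dop[OF f'(1)] assms(2) by (auto simp: region_def)
  show "pder True S f (Dop f)" using pder_cong_deriv[OF f'(1)] eq by blast
  show "BO True d S a (Dop f)" using BO_cong[OF f'(2)] eq assms(2) by (simp add: region_def)
qed

lemma BO_dth:
  assumes "BO b d S a f" "region S"
  shows "pder False S f (dth f)" "BO b d S a (dth f)"
proof -
  obtain f' where f': "pder False S f f'" "BO b d S a f'"
    using BO_pder[OF assms(1) _ assms(2), of False] by blast
  have eq: "x \<in> S \<Longrightarrow> f' x = dth f x" for x
    using pder_False_dth[OF f'(1)] by auto
  show "pder False S f (dth f)" using pder_cong_deriv[OF f'(1)] eq by blast
  show "BO b d S a (dth f)" using BO_cong[OF f'(2)] eq assms(2) by (simp add: region_def)
qed

lemma BO_mode: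
  assumes "BO b d S a f" "b' \<Longrightarrow> b" "d' \<Longrightarrow> d"
  shows "BO b' d' S a f"
proof -
  have "Ob b d S n a f \<Longrightarrow> Ob b' d' S n a f" for n f
  proof (induction n arbitrary: f)
    case (Suc n)
    show ?case
    proof (rule Ob_SucI)
      show "Ob0 d' S a f" using Suc.prems assms(3) by (auto simp: Ob0_def)
      fix c assume "c \<longrightarrow> b'"
      then show "\<exists>f'. pder c S f f' \<and> Ob b' d' S n a f'"
        using Suc.IH Ob_SucD[OF Suc.prems] assms(2) by blast
    qed
  qed (use assms(3) in \<open>auto simp: Ob0_def\<close>)
  then show ?thesis using assms by (auto simp: BO_def)
qed

lemma BO_smooth_any:
  assumes "BO b False S a f" "region S" shows "BO b False S a' f"
  using BO_weaken[OF assms] by blast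

section \<open>Exponentials and reciprocals\<close>

lemma Ob_exp:
  assumes "Ob b d S n 0 f" "region S"
  shows "Ob b d S n 0 (\<lambda>x. exp (f x))"
  using assms(1)
proof (induction n arbitrary: f)
  case 0
  have "\<exists>C. \<forall>x\<in>S. \<bar>exp (f x)\<bar> \<le> C * fst x powr 0" if d: d
  proof -
    obtain C where C: "C > 0" "\<And>x. x \<in> S \<Longrightarrow> \<bar>f x\<bar> \<le> C * fst x powr 0"
      using Ob0_bound[of d S 0 f] 0 d by auto
    have "\<bar>exp (f x)\<bar> \<le> exp C * fst x powr 0" if "x \<in> S" for x
      using C(2)[OF that] assms(2) that by (auto simp: region_def)
    then show ?thesis by blast
  qed
  then show ?case using 0 by (auto simp: Ob0_def intro!: continuous_intros)
next
  case (Suc n)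
  have IH: "Ob b d S n 0 (\<lambda>x. exp (f x))" using Suc.IH Ob_Suc_imp[OF Suc.prems] by blast
  show ?case
  proof (rule Ob_SucI)
    show "Ob0 d S 0 (\<lambda>x. exp (f x))" using IH Ob_imp_Ob0 by blast
    fix c assume c: "c \<longrightarrow> b"
    obtain f' where f': "pder c S f f'" "Ob b d S n 0 f'" using Ob_SucD[OF Suc.prems c] by blast
    show "\<exists>h. pder c S (\<lambda>x. exp (f x)) h \<and> Ob b d S n 0 h"
      using pder_exp[OF f'(1)] Ob_mult[OF f'(2) IH assms(2), of 0] by auto
  qed
qed

lemma BO_exp: "BO b d S 0 f \<Longrightarrow> region S \<Longrightarrow> BO b d S 0 (\<lambda>x. exp (f x))"
  unfolding BO_def using Ob_exp by blast

lemma Ob_inverse: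
  assumes "Ob b d S n 0 f" "region S" "r > 0" "\<And>x. x \<in> S \<Longrightarrow> r \<le> \<bar>f x\<bar>"
  shows "Ob b d S n 0 (\<lambda>x. inverse (f x))"
  using assms(1)
proof (induction n)
  case 0
  have "\<bar>inverse (f x)\<bar> \<le> inverse r * fst x powr 0" if "x \<in> S" for x
  proof -
    have "inverse \<bar>f x\<bar> \<le> inverse r" using assms(3) assms(4)[OF that] by (intro le_imp_inverse_le) auto
    then show ?thesis using assms(2) that by (auto simp: region_def)
  qed
  moreover have "\<forall>x\<in>S. f x \<noteq> 0" using assms(3,4) by force
  ultimately show ?case using 0 unfolding Ob.simps Ob0_def by (blast intro: continuous_on_inverse)
next
  case (Suc n)
  have IH: "Ob b d S n 0 (\<lambda>x. inverse (f x))" using Suc.IH Ob_Suc_imp[OF Suc.prems] by blast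
  have nz: "\<forall>x\<in>S. f x \<noteq> 0" using assms(3,4) by force
  show ?case
  proof (rule Ob_SucI)
    show "Ob0 d S 0 (\<lambda>x. inverse (f x))" using IH Ob_imp_Ob0 by blast
    fix c assume c: "c \<longrightarrow> b"
    obtain f' where f': "pder c S f f'" "Ob b d S n 0 f'" using Ob_SucD[OF Suc.prems c] by blast
    have "Ob b d S n 0 (\<lambda>x. (- 1) * (f' x * (inverse (f x) * inverse (f x))))"
      by (intro Ob_mult[where a=0 and a'=0] f' IH Ob_const assms(2)) auto
    then show "\<exists>h. pder c S (\<lambda>x. inverse (f x)) h \<and> Ob b d S n 0 h"
      using pder_inverse[OF f'(1) nz] by auto
  qed
qed

lemma BO_inverse:
  "BO b d S 0 f \<Longrightarrow> region S \<Longrightarrow> r > 0 \<Longrightarrow> (\<And>x. x \<in> S \<Longrightarrow> r \<le> \<bar>f x\<bar>) \<Longrightarrow> BO b d S 0 (\<lambda>x. inverse (f x))"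
  unfolding BO_def using Ob_inverse by blast

lemma abs_expm1_le: "\<bar>exp y - 1\<bar> \<le> \<bar>y\<bar> * exp \<bar>y\<bar>" for y :: real
proof (cases "y \<ge> 0")
  case True
  have "exp y * (1 - y) \<le> exp y * exp (- y)"
    using exp_ge_add_one_self[of "- y"] by (intro mult_left_mono) auto
  then have "exp y - 1 \<le> y * exp y" by (simp add: exp_minus algebra_simps)
  then show ?thesis using True by simp
next
  case False
  have "1 - exp y \<le> - y" using exp_ge_add_one_self[of y] by linarith
  moreover have "- y * 1 \<le> - y * exp (- y)" using False by (intro mult_left_mono) auto
  ultimately have "1 - exp y \<le> - y * exp (- y)" by linarith
  then show ?thesis using False by simp
qed

text \<open>Keeping the factor exp y - 1 instead of y^2 avoids any smallness condition on y: the
  squared rate then comes from \<open>BO_expm1\<close>.\<close>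

lemma abs_exp_taylor2: "\<bar>exp y - 1 - y\<bar> \<le> \<bar>y\<bar> * \<bar>exp y - 1\<bar>" for y :: real
proof -
  have "exp y * (1 - y) \<le> exp y * exp (- y)"
    using exp_ge_add_one_self[of "- y"] by (intro mult_left_mono) auto
  then have "exp y - 1 - y \<le> y * (exp y - 1)" by (simp add: exp_minus algebra_simps)
  moreover have "0 \<le> exp y - 1 - y" using exp_ge_add_one_self[of y] by linarith
  ultimately show ?thesis by (simp add: abs_mult[symmetric])
qed

lemma BO_expm1:
  assumes "BO b d S a f" "region S" "d \<Longrightarrow> 0 \<le> a"
  shows "BO b d S a (\<lambda>x. exp (f x) - 1)"
proof (rule BO_intro)
  have f0: "BO b d S 0 f" using BO_weaken assms by blast
  have ex: "BO b d S 0 (\<lambda>x. exp (f x))" using BO_exp[OF f0] assms by blast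
  have "\<exists>C. \<forall>x\<in>S. \<bar>exp (f x) - 1\<bar> \<le> C * fst x powr a" if d: d
  proof -
    obtain C where C: "C > 0" "\<And>x. x \<in> S \<Longrightarrow> \<bar>f x\<bar> \<le> C * fst x powr a"
      using Ob0_bound[OF BO_imp_Ob0[OF assms(1)] d] by blast
    obtain K where K: "K > 0" "\<And>x. x \<in> S \<Longrightarrow> \<bar>f x\<bar> \<le> K * fst x powr 0"
      using Ob0_bound[OF BO_imp_Ob0[OF f0] d] by blast
    have "\<bar>exp (f x) - 1\<bar> \<le> (C * exp K) * fst x powr a" if "x \<in> S" for x
    proof -
      have "\<bar>f x\<bar> * exp \<bar>f x\<bar> \<le> (C * fst x powr a) * exp K"
        using C(2)[OF that] K(2)[OF that] assms(2) that by (intro mult_mono) (auto simp: region_def)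
      then show ?thesis using abs_expm1_le[of "f x"] by (simp add: algebra_simps)
    qed
    then show ?thesis by blast
  qed
  then show "Ob0 d S a (\<lambda>x. exp (f x) - 1)"
    using BO_cont[OF ex] by (auto simp: Ob0_def intro!: continuous_intros)
  fix c assume c: "c \<longrightarrow> b"
  obtain f' where f': "pder c S f f'" "BO b d S a f'" using BO_pder[OF assms(1) c assms(2)] by blast
  have "pder c S (\<lambda>x. exp (f x) - 1) (\<lambda>x. f' x * exp (f x))"
    using pder_diff[OF pder_exp[OF f'(1)] pder_const[of c S 1]] by simp
  moreover have "BO b d S a (\<lambda>x. f' x * exp (f x))" using BO_mult[OF f'(2) ex assms(2)] by simp
  ultimately show "\<exists>h. pder c S (\<lambda>x. exp (f x) - 1) h \<and> BO b d S a h" by blast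
qed

text \<open>The derivative of the remainder is \<open>f' * (exp f - 1)\<close>, a product of two
  terms of order \<open>a\<close>, so the order doubles for derivatives as well.\<close>

lemma BO_exp_taylor2:
  assumes "BO b d S a f" "region S" "d \<Longrightarrow> 0 \<le> a"
  shows "BO b d S (2 * a) (\<lambda>x. exp (f x) - 1 - f x)"
proof (rule BO_intro)
  have ex: "BO b d S a (\<lambda>x. exp (f x) - 1)" using BO_expm1 assms by blast
  have ff: "BO b d S (2 * a) (\<lambda>x. f x * (exp (f x) - 1))" using BO_mult[OF assms(1) ex assms(2)] by simp
  have "\<exists>C. \<forall>x\<in>S. \<bar>exp (f x) - 1 - f x\<bar> \<le> C * fst x powr (2 * a)" if d: d
  proof -
    obtain C where C: "C > 0" "\<And>x. x \<in> S \<Longrightarrow> \<bar>f x * (exp (f x) - 1)\<bar> \<le> C * fst x powr (2 * a)"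
      using Ob0_bound[OF BO_imp_Ob0[OF ff] d] by blast
    then show ?thesis using abs_exp_taylor2 by (metis (no_types, lifting) abs_mult order_trans)
  qed
  then show "Ob0 d S (2 * a) (\<lambda>x. exp (f x) - 1 - f x)"
    using BO_cont[OF ex] BO_cont[OF assms(1)] by (auto simp: Ob0_def intro!: continuous_on_diff)
  fix c assume c: "c \<longrightarrow> b"
  obtain f' where f': "pder c S f f'" "BO b d S a f'" using BO_pder[OF assms(1) c assms(2)] by blast
  have "pder c S (\<lambda>x. exp (f x) - 1 - f x) (\<lambda>x. f' x * exp (f x) - 0 - f' x)"
    by (intro pder_diff pder_exp f' pder_const)
  then have "pder c S (\<lambda>x. exp (f x) - 1 - f x) (\<lambda>x. f' x * (exp (f x) - 1))"
    by (simp add: algebra_simps)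
  moreover have "BO b d S (2 * a) (\<lambda>x. f' x * (exp (f x) - 1))" using BO_mult[OF f'(2) ex assms(2)] by simp
  ultimately show "\<exists>h. pder c S (\<lambda>x. exp (f x) - 1 - f x) h \<and> BO b d S (2 * a) h" by blast
qed

section \<open>Logarithms and powers with variable exponent\<close>

lemma abs_ln_le:
  assumes "0 < t" "t < 1" "0 < (a::real)"
  shows "\<bar>ln t\<bar> \<le> inverse a * t powr (- a)"
proof -
  have "ln (inverse t) \<le> (inverse t) powr a / a"
    using assms by (intro ln_powr_bound) (auto simp: one_le_inverse)
  moreover have "inverse t powr a = t powr (- a)" using assms by (simp add: powr_minus inverse_powr)
  moreover have "ln t < 0" using assms by simp
  ultimately show ?thesis using assms by (simp add: ln_inverse divide_inverse mult.commute)
qed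

lemma pder_ln: "region S \<Longrightarrow> pder c S (\<lambda>x. ln (fst x)) (\<lambda>x. if c then 1 else 0)"
  unfolding pder_def line_def crd_def wt_def region_def
  by (cases c) (auto intro!: derivative_eq_intros simp: divide_inverse)

lemma BO_ln:
  assumes "region S" "d \<Longrightarrow> a < 0"
  shows "BO b d S a (\<lambda>x. ln (fst x))"
proof (rule BO_intro)
  have "\<forall>x\<in>S. \<bar>ln (fst x)\<bar> \<le> inverse (- a) * fst x powr a" if d
    using abs_ln_le[of _ "- a"] assms that by (auto simp: region_def)
  moreover have "continuous_on S (\<lambda>x. ln (fst x))"
    using assms by (intro continuous_intros) (auto simp: region_def)
  ultimately show "Ob0 d S a (\<lambda>x. ln (fst x))" unfolding Ob0_def by blast
  fix c assume "c \<longrightarrow> b"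
  have "BO b d S a (\<lambda>x. if c then 1 else 0)" using BO_const[of d a S b "if c then 1 else 0"] assms by force
  then show "\<exists>h. pder c S (\<lambda>x. ln (fst x)) h \<and> BO b d S a h" using pder_ln assms by blast
qed

lemma pder_powr:
  assumes "pder c S h h'" "region S"
  shows "pder c S (\<lambda>x. fst x powr h x) (\<lambda>x. (h' x * ln (fst x) + h x * (if c then 1 else 0)) * fst x powr h x)"
proof -
  have "pder c S (\<lambda>x. exp (h x * ln (fst x)))
     (\<lambda>x. (h' x * ln (fst x) + h x * (if c then 1 else 0)) * exp (h x * ln (fst x)))"
    using assms by (intro pder_exp pder_mult pder_ln)
  then have "pder c S (\<lambda>x. fst x powr h x)
     (\<lambda>x. (h' x * ln (fst x) + h x * (if c then 1 else 0)) * exp (h x * ln (fst x)))"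
    by (rule pder_cong) (use assms(2) in \<open>fastforce simp: region_def powr_def\<close>)+
  then show ?thesis
    by (rule pder_cong_deriv) (use assms(2) in \<open>fastforce simp: region_def powr_def\<close>)
qed

text \<open>A theta-derivative of t powr h(theta) brings down h' * ln t, so the exponent
  \<open>e\<close> itself cannot be kept. A strict gap between \<open>a\<close> and
  \<open>e\<close>, halved at each order, pays for one logarithm per derivative at all
  orders.\<close>

lemma Ob_powr:
  assumes h: "BO b d S 0 h" and S: "region S"
  shows "(d \<Longrightarrow> a < e) \<Longrightarrow> (d \<Longrightarrow> \<forall>x\<in>S. e \<le> h x) \<Longrightarrow> Ob b d S n a (\<lambda>x. fst x powr h x)"
proof (induction n arbitrary: a)
  case 0
  have "\<forall>x\<in>S. \<bar>fst x powr h x\<bar> \<le> 1 * fst x powr a" if d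
  proof
    fix x assume "x \<in> S"
    then have "a \<le> h x" using 0 that by force
    then show "\<bar>fst x powr h x\<bar> \<le> 1 * fst x powr a"
      using S \<open>x \<in> S\<close> by (auto intro!: powr_mono_01 simp: region_def)
  qed
  moreover have "continuous_on S (\<lambda>x. fst x powr h x)"
    using S BO_cont[OF h] by (intro continuous_on_powr continuous_intros) (auto simp: region_def)
  ultimately show ?case unfolding Ob.simps Ob0_def by blast
next
  case (Suc n)
  define m where "m = (a + e) / 2"
  have IH: "Ob b d S n m (\<lambda>x. fst x powr h x)" using Suc.prems by (intro Suc.IH) (auto simp: m_def)
  show ?case
  proof (rule Ob_SucI)
    show "Ob0 d S a (\<lambda>x. fst x powr h x)"
      using Ob_imp_Ob0[OF IH] Ob0_weaken S Suc.prems unfolding m_def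
      by (metis (no_types, lifting) field_sum_of_halves add_divide_distrib add_strict_left_mono divide_strict_right_mono less_eq_real_def zero_less_numeral)
    fix c assume c: "c \<longrightarrow> b"
    obtain h' where h': "pder c S h h'" "BO b d S 0 h'" using BO_pder[OF h c S] by blast
    have l: "BO b d S (a - m) (\<lambda>x. ln (fst x))"
      using S Suc.prems by (intro BO_ln) (auto simp: m_def)
    have "BO b d S 0 (\<lambda>x. h x * (if c then 1 else 0))"
      using BO_cmult[OF h S, of "if c then 1 else 0"] by (simp add: mult.commute)
    then have "BO b d S (a - m) (\<lambda>x. h x * (if c then 1 else 0))"
      using BO_weaken S Suc.prems unfolding m_def by (force simp: field_simps)
    moreover have "BO b d S (a - m) (\<lambda>x. h' x * ln (fst x))"
      using BO_mult[OF h'(2) l S] by simp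
    ultimately have "BO b d S (a - m) (\<lambda>x. h' x * ln (fst x) + h x * (if c then 1 else 0))"
      by (intro BO_add)
    then have "Ob b d S n a (\<lambda>x. (h' x * ln (fst x) + h x * (if c then 1 else 0)) * fst x powr h x)"
      using IH S unfolding BO_def by (intro Ob_mult[where a="a - m" and a'=m]) auto
    then show "\<exists>g. pder c S (\<lambda>x. fst x powr h x) g \<and> Ob b d S n a g"
      using pder_powr[OF h'(1) S] by blast
  qed
qed

lemma BO_powr:
  assumes "BO b d S 0 h" "region S" "d \<Longrightarrow> a < e" "d \<Longrightarrow> \<forall>x\<in>S. e \<le> h x"
  shows "BO b d S a (\<lambda>x. fst x powr h x)"
  using Ob_powr[OF assms(1,2)] assms(3,4) unfolding BO_def by blast

lemma pder_fst: "region S \<Longrightarrow> pder c S fst (\<lambda>x. if c then fst x else 0)"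
  unfolding pder_def line_def crd_def wt_def region_def
  by (cases c) (auto intro!: derivative_eq_intros)

lemma BO_fst:
  assumes "region S" shows "BO b d S 1 fst"
proof -
  have "Ob b d S n 1 fst" for n
  proof (induction n)
    case 0
    have "\<forall>x\<in>S. \<bar>fst x\<bar> \<le> 1 * fst x powr 1" using assms by (auto simp: region_def)
    then show ?case unfolding Ob.simps Ob0_def using continuous_on_fst[OF continuous_on_id] by blast
  next
    case (Suc n)
    show ?case
    proof (rule Ob_SucI)
      show "Ob0 d S 1 fst" using Suc Ob_imp_Ob0 by blast
      fix c assume "c \<longrightarrow> b"
      have "Ob b d S n 1 (\<lambda>x. if c then fst x else 0)"
        using Suc BO_zero[of b d S 1] unfolding BO_def by (cases c) auto
      then show "\<exists>g. pder c S fst g \<and> Ob b d S n 1 g" using pder_fst[OF assms] by blast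
    qed
  qed
  then show ?thesis by (simp add: BO_def)
qed

section \<open>Functions of theta alone, and comparison with the smoothness of the statement\<close>

lemma smooth1_deriv: "smooth1 f \<Longrightarrow> smooth1 (deriv f)"
  unfolding smooth1_def
proof (intro allI)
  fix n x assume "\<forall>n x. (deriv ^^ n) f differentiable at x"
  then have "(deriv ^^ Suc n) f differentiable at x" by blast
  then show "(deriv ^^ n) (deriv f) differentiable at x" by (simp add: funpow_Suc_right del: funpow.simps)
qed

lemma smooth1_DERIV: "smooth1 f \<Longrightarrow> (f has_real_derivative deriv f x) (at x)"
  unfolding smooth1_def
  by (metis DERIV_deriv_iff_real_differentiable funpow_0)

lemma pder_snd:
  "smooth1 f \<Longrightarrow> pder c S (\<lambda>x. f (snd x)) (\<lambda>x. if c then 0 else deriv f (snd x))"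
  unfolding pder_def line_def crd_def wt_def
  using smooth1_DERIV by (cases c) auto

lemma BO_snd:
  assumes "smooth1 f" "region S"
  shows "BO b d S 0 (\<lambda>x. f (snd x))"
proof -
  have "Ob b d S n 0 (\<lambda>x. f (snd x))" for n
    using assms(1)
  proof (induction n arbitrary: f)
    case (0 f)
    have c: "continuous_on A f" for A
      using smooth1_DERIV[OF 0] by (meson DERIV_isCont continuous_at_imp_continuous_on)
    obtain M where M: "\<And>x. x \<in> S \<Longrightarrow> \<bar>snd x\<bar> \<le> M" using assms(2) by (auto simp: region_def)
    obtain B where B: "\<And>y. y \<in> {-M..M} \<Longrightarrow> \<bar>f y\<bar> \<le> B"
      using compact_imp_bounded[OF compact_continuous_image[OF c[of "{-M..M}"] compact_Icc]]
      unfolding bounded_iff by (metis imageI real_norm_def)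
    have "\<forall>x\<in>S. \<bar>f (snd x)\<bar> \<le> B * fst x powr 0"
      using M B assms(2) by (fastforce simp: region_def abs_le_iff)
    moreover have "continuous_on S (\<lambda>x. f (snd x))"
      using continuous_on_compose2[OF c[of UNIV], of S snd] continuous_on_snd[OF continuous_on_id] by blast
    ultimately show ?case unfolding Ob.simps Ob0_def by blast
  next
    case (Suc n)
    show ?case
    proof (rule Ob_SucI)
      show "Ob0 d S 0 (\<lambda>x. f (snd x))" using Suc Ob_imp_Ob0 by blast
      fix c assume "c \<longrightarrow> b"
      have "Ob b d S n 0 (\<lambda>x. if c then 0 else deriv f (snd x))"
        using Suc.IH[OF smooth1_deriv[OF Suc.prems]] BO_zero[of b d S 0] unfolding BO_def by (cases c) auto
      then show "\<exists>g. pder c S (\<lambda>x. f (snd x)) g \<and> Ob b d S n 0 g" using pder_snd[OF Suc.prems] by blast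
    qed
  qed
  then show ?thesis by (simp add: BO_def)
qed

text \<open>The loss 2 instead of 1 stems from the strict gap in \<open>BO_powr\<close>. It does no
  harm in the passage to ordinary t-derivatives, where bounds are dropped.\<close>

lemma BO_divide_fst:
  assumes "BO b d S a f" "region S" "d \<Longrightarrow> e \<le> a - 2"
  shows "BO b d S e (\<lambda>x. f x / fst x)"
proof -
  have "BO b d S (- 2) (\<lambda>x. fst x powr (\<lambda>_. - 1) x)"
    using assms(2) by (intro BO_powr[where e="-1"] BO_const) auto
  then have "BO b d S e (\<lambda>x. f x * fst x powr (- 1))"
    by (intro BO_mult[OF assms(1) _ assms(2)]) (use assms(3) in auto)
  then show ?thesis
    by (rule BO_cong) (use assms(2) in \<open>fastforce simp: region_def powr_minus divide_inverse\<close>)+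
qed

lemma pder_True_dt: "pder True S f f' \<Longrightarrow> x \<in> S \<Longrightarrow> dt f x = f' x / fst x"
  unfolding pder_def dt_def line_def crd_def wt_def
  by (auto dest!: bspec DERIV_imp_deriv simp: divide_inverse)

text \<open>An ordinary t-derivative is a scaling derivative divided by t. This ruins decay rates
  but not smoothness at t > 0, hence the bounds are given up before the induction over the word of
  derivatives.\<close>

lemma BO_imp_smooth2:
  assumes "BO True d S a f" "region S"
  shows "smooth2_on S f"
proof -
  have S: "open S" using assms(2) by (simp add: region_def)
  have f: "BO True False S 0 f" using BO_smooth_any[OF BO_mode[OF assms(1)]] assms(2) by blast
  have w: "BO True False S 0 (pderivs w f)" for w
  proof (induction w)
    case (Cons c w)
    show ?case
    proof (cases c)
      case True
      have "BO True False S 0 (\<lambda>x. Dop (pderivs w f) x / fst x)"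
        using BO_divide_fst BO_Dop Cons assms(2) by blast
      then show ?thesis
        using True S pder_True_dt[OF BO_Dop(1)[OF Cons assms(2)]] by (auto intro: BO_cong)
    next
      case False
      then show ?thesis using BO_dth Cons assms(2) by auto
    qed
  qed (use f in simp)
  show ?thesis
    unfolding smooth2_on_def
  proof (intro allI conjI ballI)
    fix w
    show "continuous_on S (pderivs w f)" using w BO_cont by blast
    fix x assume x: "x \<in> S"
    show "(\<lambda>s. pderivs w f (s, snd x)) differentiable at (fst x)"
      using BO_Dop(1)[OF w assms(2)] x unfolding pder_def line_def crd_def real_differentiable_def by auto
    show "(\<lambda>s. pderivs w f (fst x, s)) differentiable at (snd x)"
      using BO_dth(1)[OF w assms(2)] x unfolding pder_def line_def crd_def real_differentiable_def by auto
  qed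
qed

lemma smooth2_imp_BO:
  assumes "smooth2_on S f" "region S"
  shows "BO True False S a f"
proof -
  have "Ob True False S n a f" for n
    using assms(1)
  proof (induction n arbitrary: f a)
    case 0
    then show ?case unfolding smooth2_on_def Ob.simps Ob0_def by (metis pderivs.simps(1))
  next
    case (Suc n)
    have app: "pderivs w (pderivs v f) = pderivs (w @ v) f" for w v
      by (induction w rule: list.induct) (auto, metis (full_types) pderivs.simps(2,3))
    have sm: "smooth2_on S (pderivs v f)" for v
      using Suc.prems unfolding smooth2_on_def app by blast
    have d: "(\<lambda>s. f (s, snd x)) differentiable at (fst x)" "(\<lambda>s. f (fst x, s)) differentiable at (snd x)"
      if "x \<in> S" for x
      using Suc.prems that unfolding smooth2_on_def by (metis pderivs.simps(1))+
    show ?case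
    proof (rule Ob_SucI)
      show "Ob0 False S a f" using Suc Ob_imp_Ob0 by blast
      fix c :: bool assume "c \<longrightarrow> True"
      show "\<exists>g. pder c S f g \<and> Ob True False S n a g"
      proof (cases c)
        case True
        have "pder c S f (\<lambda>x. fst x * dt f x)"
          unfolding pder_def line_def crd_def wt_def dt_def using True d(1) assms(2)
          by (auto simp: region_def DERIV_deriv_iff_real_differentiable mult.assoc[symmetric])
        moreover have "BO True False S 1 fst" by (rule BO_fst[OF assms(2)])
        then have "Ob True False S n a (\<lambda>x. fst x * dt f x)"
          using Suc.IH[OF sm[of "[True]"]] assms(2) unfolding BO_def
          by (intro Ob_mult[where a=1 and a'="a - 1"]) auto
        ultimately show ?thesis by blast
      next
        case False
        have "pder c S f (dth f)"
          unfolding pder_def line_def crd_def wt_def dth_def using False d(2)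
          by (auto simp: DERIV_deriv_iff_real_differentiable)
        then show ?thesis using Suc.IH[OF sm[of "[False]"]] by auto
      qed
    qed
  qed
  then show ?thesis by (simp add: BO_def)
qed

subsection \<open>Integration along characteristics\<close>

text \<open>The point with time fraction \<open>\<sigma>\<close> on the characteristic through x
  along which theta + lam * t is constant. Normalising the parameter to [0, 1] keeps the interval of
  integration fixed when x varies.\<close>

definition pt :: "real \<Rightarrow> real \<times> real \<Rightarrow> real \<Rightarrow> real \<times> real" where
  "pt lam x \<sigma> = (fst x * \<sigma>, snd x + lam * fst x * (1 - \<sigma>))"

text \<open>Solves \<open>Dop u - lam * t * dth u = f\<close> with zero data at \<open>t = 0\<close>; at \<open>\<sigma> = 0\<close> the integrand
  takes the junk value \<open>0\<close>, which is its limit when \<open>f = O(t\<^sup>a)\<close> with \<open>a > 1\<close>.\<close>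

definition char_integral :: "real \<Rightarrow> (real \<times> real \<Rightarrow> real) \<Rightarrow> real \<times> real \<Rightarrow> real" where
  "char_integral lam f x = fst x * integral {0..1} (\<lambda>\<sigma>. f (pt lam x \<sigma>) / fst (pt lam x \<sigma>))"

text \<open>The value 0 of the parameter is excluded because S lies in t > 0. The slopes cover both
  wave directions and also slope 0, the integration at fixed theta.\<close>

definition backward_closed :: "(real \<times> real) set \<Rightarrow> bool" where
  "backward_closed S \<longleftrightarrow> region S \<and> (\<forall>x\<in>S. \<forall>\<sigma>\<in>{0<..1}. \<forall>lam\<in>{-1..1}. pt lam x \<sigma> \<in> S)"

lemma backward_closed_region: "backward_closed S \<Longrightarrow> region S" by (simp add: backward_closed_def)

lemma pt_in:
  assumes "backward_closed S" "x \<in> S" "\<sigma> \<in> {0..1}" "\<bar>lam\<bar> \<le> 1"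
  shows "pt lam x \<sigma> \<in> S \<union> {y. fst y = 0}"
proof (cases "\<sigma> = 0")
  case False
  then have "pt lam x \<sigma> \<in> S" using assms unfolding backward_closed_def by (auto simp: abs_le_iff)
  then show ?thesis by simp
qed (simp add: pt_def)

text \<open>At t = 0 the quotient has the HOL value 0, and this is its limit since |f| / t is at
  most C * t powr (a - 1) with a > 1. Adding the whole line t = 0 avoids describing the boundary of
  S.\<close>

lemma cont_quotient:
  assumes "Ob0 True S a f" "a > 1" "region S"
  shows "continuous_on (S \<union> {x. fst x = 0}) (\<lambda>x. f x / fst x)"
proof -
  obtain C where C: "C > 0" "\<And>x. x \<in> S \<Longrightarrow> \<bar>f x\<bar> \<le> C * fst x powr a"
    using Ob0_bound[OF assms(1)] by blast
  have S: "open S" "\<And>x. x \<in> S \<Longrightarrow> 0 < fst x" using assms(3) by (auto simp: region_def)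
  have bd: "\<bar>f y / fst y\<bar> \<le> C * \<bar>fst y\<bar> powr (a - 1)" if y: "y \<in> S \<union> {x. fst x = 0}" for y
  proof (cases "fst y = 0")
    case False
    then have "y \<in> S" using y by auto
    have "\<bar>f y\<bar> / fst y \<le> C * fst y powr a / fst y"
      using C(2)[OF \<open>y \<in> S\<close>] S(2)[OF \<open>y \<in> S\<close>] by (intro divide_right_mono) auto
    then show ?thesis using S(2)[OF \<open>y \<in> S\<close>] by (simp add: powr_diff)
  qed simp
  have "((\<lambda>x. f x / fst x) \<longlongrightarrow> f x / fst x) (at x within S \<union> {x. fst x = 0})"
    if x: "x \<in> S \<union> {x. fst x = 0}" for x
  proof (cases "fst x = 0")
    case True
    have "((\<lambda>y::real\<times>real. \<bar>fst y\<bar>) \<longlongrightarrow> \<bar>fst x\<bar>) (at x within S \<union> {x. fst x = 0})"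
      by (intro tendsto_intros)
    then have "((\<lambda>y::real\<times>real. \<bar>fst y\<bar> powr (a - 1)) \<longlongrightarrow> \<bar>fst x\<bar> powr (a - 1)) (at x within S \<union> {x. fst x = 0})"
      by (rule tendsto_powr'[OF _ tendsto_const]) (use assms(2) in auto)
    then have "((\<lambda>y::real\<times>real. C * \<bar>fst y\<bar> powr (a - 1)) \<longlongrightarrow> C * \<bar>fst x\<bar> powr (a - 1)) (at x within S \<union> {x. fst x = 0})"
      by (rule tendsto_mult[OF tendsto_const])
    then have "((\<lambda>y::real\<times>real. C * \<bar>fst y\<bar> powr (a - 1)) \<longlongrightarrow> 0) (at x within S \<union> {x. fst x = 0})"
      using True by simp
    then have "((\<lambda>x. f x / fst x) \<longlongrightarrow> 0) (at x within S \<union> {x. fst x = 0})"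
      by (rule Lim_null_comparison[rotated]) (use bd in \<open>auto simp: eventually_at_filter simp del: abs_divide\<close>)
    then show ?thesis using True by simp
  next
    case False
    then have "x \<in> S" using x by auto
    have "continuous_on S (\<lambda>x. f x / fst x)"
      using assms(1) S(2) unfolding Ob0_def by (intro continuous_intros) (auto dest: S(2))
    then have "isCont (\<lambda>x. f x / fst x) x" using S(1) \<open>x \<in> S\<close> continuous_on_eq_continuous_at by blast
    then show ?thesis unfolding isCont_def using tendsto_within_subset by blast
  qed
  then show ?thesis unfolding continuous_on_def by blast
qed

lemma char_integral_integrand_cont:
  assumes "Ob0 True S a f" "a > 1" "backward_closed S" "\<bar>lam\<bar> \<le> 1"
  shows "continuous_on (S \<times> {0..1}) (\<lambda>(x, \<sigma>). f (pt lam x \<sigma>) / fst (pt lam x \<sigma>))"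
proof -
  have 1: "continuous_on (S \<times> {0..1}) (\<lambda>z. pt lam (fst z) (snd z))"
    unfolding pt_def by (intro continuous_intros)
  have 2: "(\<lambda>z. pt lam (fst z) (snd z)) ` (S \<times> {0..1}) \<subseteq> S \<union> {y. fst y = 0}"
    using pt_in[OF assms(3) _ _ assms(4)] by fastforce
  show ?thesis
    using continuous_on_compose2[OF cont_quotient[OF assms(1,2) backward_closed_region[OF assms(3)]] 1 2]
    by (simp add: case_prod_beta)
qed

lemma char_integral_integrand_cont1:
  assumes "Ob0 True S a f" "a > 1" "backward_closed S" "\<bar>lam\<bar> \<le> 1" "x \<in> S"
  shows "continuous_on {0..1} (\<lambda>\<sigma>. f (pt lam x \<sigma>) / fst (pt lam x \<sigma>))"
proof -
  have "continuous_on {0..1} (\<lambda>\<sigma>. (x, \<sigma>::real))" by (intro continuous_intros)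
  then show ?thesis
    using continuous_on_compose2[OF char_integral_integrand_cont[OF assms(1-4)], of "{0..1}" "\<lambda>\<sigma>. (x, \<sigma>)"] assms(5)
    by auto
qed

lemma char_integral_integrable:
  assumes "Ob0 True S a f" "a > 1" "backward_closed S" "\<bar>lam\<bar> \<le> 1" "x \<in> S"
  shows "(\<lambda>\<sigma>. f (pt lam x \<sigma>) / fst (pt lam x \<sigma>)) integrable_on {0..1}"
  using char_integral_integrand_cont1[OF assms] by (rule integrable_continuous_real)

lemma char_integral_cont:
  assumes "Ob0 True S a f" "a > 1" "backward_closed S" "\<bar>lam\<bar> \<le> 1"
  shows "continuous_on S (char_integral lam f)"
proof -
  have "continuous_on S (\<lambda>x. integral (cbox 0 1) (\<lambda>\<sigma>. f (pt lam x \<sigma>) / fst (pt lam x \<sigma>)))"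
    by (rule integral_continuous_on_param) (use char_integral_integrand_cont[OF assms] in simp)
  then have "continuous_on S (\<lambda>x. fst x * integral {0..1} (\<lambda>\<sigma>. f (pt lam x \<sigma>) / fst (pt lam x \<sigma>)))"
    by (intro continuous_on_mult continuous_on_fst continuous_on_id) simp
  then show ?thesis by (simp add: char_integral_def[abs_def])
qed

text \<open>The gain 1 / a is the integral of \<open>\<sigma> powr (a - 1)\<close> over [0, 1]; both
  contraction arguments rest on a gain of this kind.\<close>

lemma char_integral_bound:
  assumes "Ob0 True S a f" "a > 1" "backward_closed S" "\<bar>lam\<bar> \<le> 1" "x \<in> S"
    and "\<And>y. y \<in> S \<Longrightarrow> \<bar>f y\<bar> \<le> C * fst y powr a" "C \<ge> 0"
  shows "\<bar>char_integral lam f x\<bar> \<le> C / a * fst x powr a"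
proof -
  have x: "0 < fst x" using backward_closed_region[OF assms(3)] assms(5) by (auto simp: region_def)
  have "((\<lambda>\<sigma>. \<sigma> powr (a - 1)) has_integral (1 powr (a - 1 + 1) / (a - 1 + 1))) {0..1::real}"
    using assms(2) by (intro has_integral_powr_from_0) auto
  then have hi: "((\<lambda>\<sigma>. (C * fst x powr (a - 1)) * \<sigma> powr (a - 1)) has_integral (C * fst x powr (a - 1)) * (1 / a)) {0..1::real}"
    by (intro has_integral_mult_right) simp
  have bd: "norm (f (pt lam x \<sigma>) / fst (pt lam x \<sigma>)) \<le> (C * fst x powr (a - 1)) * \<sigma> powr (a - 1)"
    if "\<sigma> \<in> {0..1}" for \<sigma>
  proof (cases "\<sigma> = 0")
    case True
    then show ?thesis using assms(7) by (simp add: pt_def)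
  next
    case False
    have p: "pt lam x \<sigma> \<in> S" using pt_in[OF assms(3,5) that assms(4)] False x by (auto simp: pt_def)
    have pos: "0 < fst (pt lam x \<sigma>)" using False that x by (simp add: pt_def)
    have "\<bar>f (pt lam x \<sigma>)\<bar> / fst (pt lam x \<sigma>) \<le> C * fst (pt lam x \<sigma>) powr a / fst (pt lam x \<sigma>)"
      using assms(6)[OF p] pos by (intro divide_right_mono) auto
    also have "\<dots> = C * fst (pt lam x \<sigma>) powr (a - 1)" using pos by (simp add: powr_diff)
    also have "\<dots> = C * fst x powr (a - 1) * \<sigma> powr (a - 1)"
      using x that False by (simp add: pt_def powr_mult)
    finally show ?thesis using pos by simp
  qed
  have "norm (integral {0..1} (\<lambda>\<sigma>. f (pt lam x \<sigma>) / fst (pt lam x \<sigma>))) \<le> (C * fst x powr (a - 1)) * (1 / a)"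
    using integral_norm_bound_integral[OF char_integral_integrable[OF assms(1-5)] has_integral_integrable[OF hi] bd]
    unfolding integral_unique[OF hi] .
  then have "fst x * norm (integral {0..1} (\<lambda>\<sigma>. f (pt lam x \<sigma>) / fst (pt lam x \<sigma>)))
      \<le> fst x * ((C * fst x powr (a - 1)) * (1 / a))"
    using x by (intro mult_left_mono) auto
  also have "\<dots> = C / a * fst x powr a" using x by (simp add: powr_diff)
  finally show ?thesis using x unfolding char_integral_def by (simp add: abs_mult)
qed

lemma char_integral_Ob0:
  assumes "Ob0 True S a f" "a > 1" "backward_closed S" "\<bar>lam\<bar> \<le> 1"
  shows "Ob0 True S a (char_integral lam f)"
proof -
  obtain C where C: "C > 0" "\<And>x. x \<in> S \<Longrightarrow> \<bar>f x\<bar> \<le> C * fst x powr a"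
    using Ob0_bound[OF assms(1)] by blast
  have "\<forall>x\<in>S. \<bar>char_integral lam f x\<bar> \<le> C / a * fst x powr a"
    using char_integral_bound[OF assms _ C(2)] C(1) by (simp add: less_imp_le)
  then show ?thesis using char_integral_cont[OF assms] unfolding Ob0_def by blast
qed

lemma char_integral_cmult: "char_integral lam (\<lambda>x. c * f x) x = c * char_integral lam f x"
proof -
  have "(\<lambda>\<sigma>. c * f (pt lam x \<sigma>) / fst (pt lam x \<sigma>)) = (\<lambda>\<sigma>. c * (f (pt lam x \<sigma>) / fst (pt lam x \<sigma>)))"
    by simp
  then show ?thesis unfolding char_integral_def by (simp only: integral_mult_right) simp
qed

lemma char_integral_sum:
  assumes "finite A" "\<And>i. i \<in> A \<Longrightarrow> Ob0 True S a (f i)" "a > 1" "backward_closed S" "\<bar>lam\<bar> \<le> 1" "x \<in> S"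
  shows "char_integral lam (\<lambda>x. \<Sum>i\<in>A. f i x) x = (\<Sum>i\<in>A. char_integral lam (f i) x)"
  unfolding char_integral_def sum_distrib_left[symmetric] sum_divide_distrib
  by (subst integral_sum) (use assms(1) char_integral_integrable[OF assms(2) assms(3-6)] in auto)

lemma char_integral_diff:
  assumes "Ob0 True S a f" "Ob0 True S a g" "a > 1" "backward_closed S" "\<bar>lam\<bar> \<le> 1" "x \<in> S"
  shows "char_integral lam (\<lambda>x. f x - g x) x = char_integral lam f x - char_integral lam g x"
  unfolding char_integral_def diff_divide_distrib right_diff_distrib[symmetric]
  by (subst integral_diff) (use char_integral_integrable[OF assms(1) assms(3-6)] char_integral_integrable[OF assms(2) assms(3-6)] in auto)

section \<open>Differentiating the characteristic integral\<close>

lemma region_slice: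
  fixes S :: "(real \<times> real) set"
  assumes "open S" "x \<in> S"
  obtains r where "r > 0" "\<And>s y. \<bar>s - fst x\<bar> < r \<Longrightarrow> \<bar>y - snd x\<bar> < r \<Longrightarrow> (s, y) \<in> S"
proof -
  obtain e where e: "e > 0" "ball x e \<subseteq> S" using assms open_contains_ball by blast
  have "(s, y) \<in> S" if "\<bar>s - fst x\<bar> < e / 2" "\<bar>y - snd x\<bar> < e / 2" for s y
  proof -
    have "dist x (s, y) \<le> \<bar>fst x - s\<bar> + \<bar>snd x - y\<bar>"
      unfolding dist_prod_def by (rule order_trans[OF sqrt_sum_squares_le_sum_abs]) (simp add: dist_real_def)
    then have "(s, y) \<in> ball x e" using that by (simp add: abs_minus_commute)
    then show ?thesis using e by blast
  qed
  then show ?thesis using that[of "e / 2"] e by auto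
qed

text \<open>Characteristics have constant speed, so shifting x in theta shifts the whole path: the
  derivative passes under the integral without a factor from the flow.\<close>

lemma pder_char_integral_False:
  assumes "Ob0 True S a f" "pder False S f f'" "Ob0 True S a f'" "a > 1" "backward_closed S" "\<bar>lam\<bar> \<le> 1"
  shows "pder False S (char_integral lam f) (char_integral lam f')"
  unfolding pder_def
proof
  fix x assume x: "x \<in> S"
  have S: "open S" using backward_closed_region[OF assms(5)] by (simp add: region_def)
  obtain r where r: "r > 0" "\<And>s y. \<bar>s - fst x\<bar> < r \<Longrightarrow> \<bar>y - snd x\<bar> < r \<Longrightarrow> (s, y) \<in> S"
    using region_slice[OF S x] by metis
  define U where "U = {snd x - r<..<snd x + r}"
  have U: "(fst x, y) \<in> S" if "y \<in> U" for y using r that unfolding U_def by (simp add: abs_less_iff)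
  have fx: "((\<lambda>y. f (pt lam (fst x, y) \<sigma>) / fst (pt lam (fst x, y) \<sigma>)) has_field_derivative
      f' (pt lam (fst x, y) \<sigma>) / fst (pt lam (fst x, y) \<sigma>)) (at y within U)"
    if y: "y \<in> U" and s: "\<sigma> \<in> cbox 0 1" for y \<sigma>
  proof (cases "\<sigma> = 0")
    case True
    then show ?thesis by (simp add: pt_def)
  next
    case False
    have s': "\<sigma> \<in> {0<..1}" using s False by auto
    have p: "pt lam (fst x, y) \<sigma> \<in> S" using U[OF y] s' assms(5,6) unfolding backward_closed_def by (auto simp: abs_le_iff)
    let ?h = "lam * fst x * (1 - \<sigma>)"
    have "((\<lambda>z. f (fst x * \<sigma>, z)) has_real_derivative f' (pt lam (fst x, y) \<sigma>)) (at (y + ?h))"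
      using assms(2) p unfolding pder_def line_def crd_def wt_def pt_def by force
    then have "((\<lambda>z. f (fst x * \<sigma>, z + ?h)) has_real_derivative f' (pt lam (fst x, y) \<sigma>)) (at y)"
      by (simp add: DERIV_shift)
    then have "((\<lambda>z. f (pt lam (fst x, z) \<sigma>) / (fst x * \<sigma>)) has_real_derivative f' (pt lam (fst x, y) \<sigma>) / (fst x * \<sigma>)) (at y)"
      unfolding pt_def fst_conv snd_conv by (rule DERIV_cdivide)
    then show ?thesis by (auto simp: pt_def intro: has_field_derivative_at_within)
  qed
  have "continuous_on (U \<times> cbox 0 1) (\<lambda>z. ((fst x, fst z), snd z))" by (intro continuous_intros)
  then have cont: "continuous_on (U \<times> cbox 0 1) (\<lambda>(y, \<sigma>). f' (pt lam (fst x, y) \<sigma>) / fst (pt lam (fst x, y) \<sigma>))"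
    using continuous_on_compose2[OF char_integral_integrand_cont[OF assms(3-6)], of "U \<times> cbox 0 1" "\<lambda>z. ((fst x, fst z), snd z)"] U
    by (fastforce simp: case_prod_beta)
  have "((\<lambda>y. integral (cbox 0 1) (\<lambda>\<sigma>. f (pt lam (fst x, y) \<sigma>) / fst (pt lam (fst x, y) \<sigma>))) has_field_derivative
      integral (cbox 0 1) (\<lambda>\<sigma>. f' (pt lam (fst x, snd x) \<sigma>) / fst (pt lam (fst x, snd x) \<sigma>))) (at (snd x) within U)"
    by (rule leibniz_rule_field_derivative[OF fx _ cont])
      (use U char_integral_integrable[OF assms(1,4-6)] r in \<open>auto simp: U_def\<close>)
  then have "((\<lambda>y. integral {0..1} (\<lambda>\<sigma>. f (pt lam (fst x, y) \<sigma>) / fst (pt lam (fst x, y) \<sigma>))) has_field_derivative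
      integral {0..1} (\<lambda>\<sigma>. f' (pt lam x \<sigma>) / fst (pt lam x \<sigma>))) (at (snd x))"
    using r at_within_open[of "snd x" U] by (simp add: U_def)
  then have "((\<lambda>y. fst x * integral {0..1} (\<lambda>\<sigma>. f (pt lam (fst x, y) \<sigma>) / fst (pt lam (fst x, y) \<sigma>))) has_field_derivative
      fst x * integral {0..1} (\<lambda>\<sigma>. f' (pt lam x \<sigma>) / fst (pt lam x \<sigma>))) (at (snd x))"
    by (rule DERIV_cmult)
  then show "((\<lambda>s. char_integral lam f (line False x s)) has_real_derivative wt False x * char_integral lam f' x) (at (crd False x))"
    by (simp add: char_integral_def line_def crd_def wt_def)
qed

text \<open>The function u is only known to have a continuous theta-derivative, so the chain rule
  for a total derivative is not at hand. On each time slice the mean value bound is applied to u -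
  u'(x) * theta; continuity of u' makes it uniform for times near that of x. Adding or subtracting
  the result exchanges the derivative along t for the one along a characteristic.\<close>

lemma slant_derivative:
  assumes "open S" "x \<in> S" "pder False S u u'" "continuous_on S u'" "\<bar>lam\<bar> \<le> 1"
  shows "((\<lambda>s. u (s, snd x) - u (s, snd x + lam * (fst x - s))) has_real_derivative lam * u' x) (at (fst x))"
  unfolding has_field_derivative_iff
proof (rule tendstoI)
  fix e :: real assume e: "e > 0"
  have "isCont u' x" using assms(1,2,4) continuous_on_eq_continuous_at by blast
  then obtain \<delta> where \<delta>: "\<delta> > 0" "\<And>y. dist y x < \<delta> \<Longrightarrow> dist (u' y) (u' x) < e / 2"
    using half_gt_zero[OF e] unfolding continuous_at_eps_delta by blast
  obtain r where r: "r > 0" "\<And>s y. \<bar>s - fst x\<bar> < r \<Longrightarrow> \<bar>y - snd x\<bar> < r \<Longrightarrow> (s, y) \<in> S"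
    using region_slice[OF assms(1,2)] by metis
  define m where "m = min (\<delta> / 2) r"
  have m: "m > 0" using \<delta> r by (simp add: m_def)
  have "dist (((u (s, snd x) - u (s, snd x + lam * (fst x - s)))
        - (u (fst x, snd x) - u (fst x, snd x + lam * (fst x - fst x)))) / (s - fst x)) (lam * u' x) < e"
    if s: "s \<noteq> fst x" "\<bar>s - fst x\<bar> < m" for s
  proof -
    have "\<bar>lam * (fst x - s)\<bar> \<le> 1 * \<bar>s - fst x\<bar>"
      unfolding abs_mult using assms(5) by (intro mult_mono) auto
    then have l: "\<bar>lam * (fst x - s)\<bar> < m" using s by simp
    define K where "K = {y. \<bar>y - snd x\<bar> < m}"
    have Keq: "K = {snd x - m<..<snd x + m}" unfolding K_def by auto
    have der: "((\<lambda>y. u (s, y) - u' x * y) has_field_derivative u' (s, y) - u' x) (at y within K)" if "y \<in> K" for y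
    proof -
      have "(s, y) \<in> S" using r(2)[of s y] s(2) that unfolding K_def m_def by auto
      then have "((\<lambda>y. u (s, y)) has_real_derivative u' (s, y)) (at y)"
        using assms(3) unfolding pder_def line_def crd_def wt_def by force
      then have "((\<lambda>y. u (s, y) - u' x * y) has_real_derivative u' (s, y) - u' x) (at y)"
        by (auto intro!: derivative_eq_intros)
      then show ?thesis by (rule has_field_derivative_at_within)
    qed
    have bd: "norm (u' (s, y) - u' x) \<le> e / 2" if "y \<in> K" for y
    proof -
      have "dist (s, y) x \<le> \<bar>s - fst x\<bar> + \<bar>y - snd x\<bar>"
        unfolding dist_prod_def by (rule order_trans[OF sqrt_sum_squares_le_sum_abs]) (simp add: dist_real_def)
      also have "\<dots> < \<delta>" using s(2) that unfolding K_def m_def by simp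
      finally have "dist (s, y) x < \<delta>" .
      from \<delta>(2)[OF this] show ?thesis by (simp add: dist_real_def)
    qed
    have "norm ((u (s, snd x) - u' x * snd x) - (u (s, snd x + lam * (fst x - s)) - u' x * (snd x + lam * (fst x - s))))
       \<le> e / 2 * norm (snd x - (snd x + lam * (fst x - s)))"
    proof (rule field_differentiable_bound[OF _ der bd])
      show "convex K" unfolding Keq by (rule convex_real_interval)
      show "snd x \<in> K" "snd x + lam * (fst x - s) \<in> K" using l m unfolding K_def by simp_all
    qed assumption+
    moreover have "\<bar>lam * (fst x - s)\<bar> \<le> \<bar>s - fst x\<bar>"
      using \<open>\<bar>lam * (fst x - s)\<bar> \<le> 1 * \<bar>s - fst x\<bar>\<close> by simp
    then have "e / 2 * norm (snd x - (snd x + lam * (fst x - s))) \<le> e / 2 * \<bar>s - fst x\<bar>"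
      using e by (intro mult_left_mono) auto
    moreover have eq: "(u (s, snd x) - u' x * snd x) - (u (s, snd x + lam * (fst x - s)) - u' x * (snd x + lam * (fst x - s)))
        = (u (s, snd x) - u (s, snd x + lam * (fst x - s))) - lam * u' x * (s - fst x)"
      by (simp add: algebra_simps)
    ultimately have "\<bar>(u (s, snd x) - u (s, snd x + lam * (fst x - s))) - lam * u' x * (s - fst x)\<bar> \<le> e / 2 * \<bar>s - fst x\<bar>"
      unfolding eq real_norm_def by linarith
    then have "\<bar>((u (s, snd x) - u (s, snd x + lam * (fst x - s))) - lam * u' x * (s - fst x)) / (s - fst x)\<bar> \<le> e / 2"
      unfolding abs_divide using s(1) by (subst pos_divide_le_eq) auto
    moreover have "((u (s, snd x) - u (s, snd x + lam * (fst x - s))) - lam * u' x * (s - fst x)) / (s - fst x)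
      = (u (s, snd x) - u (s, snd x + lam * (fst x - s))) / (s - fst x) - lam * u' x"
      using s(1) by (simp add: diff_divide_distrib)
    ultimately show ?thesis using e by (simp add: dist_real_def)
  qed
  then show "\<forall>\<^sub>F s in at (fst x). dist (((u (s, snd x) - u (s, snd x + lam * (fst x - s)))
        - (u (fst x, snd x) - u (fst x, snd x + lam * (fst x - fst x)))) / (s - fst x)) (lam * u' x) < e"
    unfolding eventually_at dist_real_def using m by blast
qed

lemma char_to_time:
  assumes "open S" "x \<in> S" "pder False S u u'" "continuous_on S u'" "\<bar>lam\<bar> \<le> 1"
    and "((\<lambda>s. u (s, snd x + lam * (fst x - s))) has_real_derivative d) (at (fst x))"
  shows "((\<lambda>s. u (s, snd x)) has_real_derivative d + lam * u' x) (at (fst x))"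
  using DERIV_add[OF assms(6) slant_derivative[OF assms(1-5)]] by simp

lemma time_to_char:
  assumes "open S" "x \<in> S" "pder False S u u'" "continuous_on S u'" "\<bar>lam\<bar> \<le> 1"
    and "((\<lambda>s. u (s, snd x)) has_real_derivative d) (at (fst x))"
  shows "((\<lambda>s. u (s, snd x + lam * (fst x - s))) has_real_derivative d - lam * u' x) (at (fst x))"
  using DERIV_diff[OF assms(6) slant_derivative[OF assms(1-5)]] by simp

lemma char_integral_char_derivative:
  assumes "Ob0 True S a f" "a > 1" "backward_closed S" "\<bar>lam\<bar> \<le> 1" "x \<in> S"
  shows "((\<lambda>s. char_integral lam f (s, snd x + lam * (fst x - s))) has_real_derivative f x / fst x) (at (fst x))"
proof -
  have R: "region S" using assms(3) by (rule backward_closed_region)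
  have S: "open S" and x0: "0 < fst x" using R assms(5) by (auto simp: region_def)
  obtain r where r: "r > 0" "\<And>s y. \<bar>s - fst x\<bar> < r \<Longrightarrow> \<bar>y - snd x\<bar> < r \<Longrightarrow> (s, y) \<in> S"
    using region_slice[OF S assms(5)] by metis
  \<comment> \<open>The characteristic is prolonged beyond x, so that the time of x is interior to
    {0..t1} and the fundamental theorem gives a two-sided derivative.\<close>
  define t1 where "t1 = fst x + r / 2"
  define x1 where "x1 = (t1, snd x + lam * (fst x - t1))"
  have t1: "t1 > fst x" "t1 > 0" using r x0 by (auto simp: t1_def)
  have "\<bar>lam * (r / 2)\<bar> \<le> 1 * \<bar>r / 2\<bar>" unfolding abs_mult using assms(4) by (intro mult_right_mono) auto
  then have x1: "x1 \<in> S" unfolding x1_def using r(1) by (intro r(2)) (auto simp: t1_def)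
  define g where "g = (\<lambda>q. f (q, snd x + lam * (fst x - q)) / q)"
  have gS: "(q, snd x + lam * (fst x - q)) \<in> S \<union> {y. fst y = 0}" if "q \<in> {0..t1}" for q
  proof -
    have "pt lam x1 (q / t1) \<in> S \<union> {y. fst y = 0}" using that t1 by (intro pt_in[OF assms(3) x1 _ assms(4)]) auto
    moreover have "pt lam x1 (q / t1) = (q, snd x + lam * (fst x - q))"
      using t1 by (simp add: pt_def x1_def field_simps)
    ultimately show ?thesis by simp
  qed
  have gc: "continuous_on {0..t1} g"
  proof -
    have "continuous_on {0..t1} (\<lambda>q. (q, snd x + lam * (fst x - q)))" by (intro continuous_intros)
    then show ?thesis
      using continuous_on_compose2[OF cont_quotient[OF assms(1,2) R], of "{0..t1}" "\<lambda>q. (q, snd x + lam * (fst x - q))"] gS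
      by (force simp: g_def)
  qed
  have phi: "char_integral lam f (s, snd x + lam * (fst x - s)) = integral {0..s} g" if s: "0 < s" "s \<le> t1" for s
  proof -
    have sub: "((\<lambda>\<sigma>. s *\<^sub>R g (s * \<sigma>)) has_integral integral {s * 0..s * 1} g) {0..1}"
    proof (rule has_integral_substitution[where c=0 and d=t1])
      show "(\<lambda>\<sigma>. s * \<sigma>) ` {0..1} \<subseteq> {0..t1}"
        using s by (auto simp: mult_left_le order_trans[of _ "s"])
    qed (use s gc in \<open>auto intro!: derivative_eq_intros\<close>)
    have "(\<lambda>\<sigma>. s * (f (pt lam (s, snd x + lam * (fst x - s)) \<sigma>) / fst (pt lam (s, snd x + lam * (fst x - s)) \<sigma>)))
        = (\<lambda>\<sigma>. s *\<^sub>R g (s * \<sigma>))"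
      by (simp add: g_def pt_def algebra_simps)
    then have "char_integral lam f (s, snd x + lam * (fst x - s)) = integral {0..1} (\<lambda>\<sigma>. s *\<^sub>R g (s * \<sigma>))"
      unfolding char_integral_def fst_conv by (simp only: integral_mult_right[symmetric])
    then show ?thesis using integral_unique[OF sub] by simp
  qed
  have "((\<lambda>s. integral {0..s} g) has_real_derivative g (fst x)) (at (fst x) within {0..t1})"
    by (rule integral_has_real_derivative[OF gc]) (use x0 t1 in auto)
  then have "((\<lambda>s. integral {0..s} g) has_real_derivative g (fst x)) (at (fst x))"
    using x0 t1 by (subst (asm) at_within_interior) auto
  moreover have "\<forall>\<^sub>F s in nhds (fst x). s \<in> {0<..<t1}"
    using x0 t1 by (intro eventually_nhds_in_open) auto
  then have "\<forall>\<^sub>F s in nhds (fst x). integral {0..s} g = char_integral lam f (s, snd x + lam * (fst x - s))"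
    by eventually_elim (use phi in auto)
  then have ev: "\<forall>\<^sub>F s in nhds (fst x). integral {0..s} g = char_integral lam f (s, snd x + lam * (fst x - s))"
    by simp
  ultimately have "((\<lambda>s. char_integral lam f (s, snd x + lam * (fst x - s))) has_real_derivative g (fst x)) (at (fst x))"
    using DERIV_cong_ev[OF refl ev refl] by blast
  then show ?thesis by (simp add: g_def)
qed

lemma pder_char_integral_True:
  assumes "Ob0 True S a f" "pder False S f f'" "Ob0 True S a f'" "a > 1" "backward_closed S" "\<bar>lam\<bar> \<le> 1"
  shows "pder True S (char_integral lam f) (\<lambda>x. f x + lam * fst x * char_integral lam f' x)"
  unfolding pder_def
proof
  fix x assume x: "x \<in> S"
  have R: "region S" using assms(5) by (rule backward_closed_region)
  have S: "open S" and x0: "0 < fst x" using R x by (auto simp: region_def)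
  have "((\<lambda>s. char_integral lam f (s, snd x)) has_real_derivative f x / fst x + lam * char_integral lam f' x) (at (fst x))"
    by (rule char_to_time[OF S x pder_char_integral_False[OF assms] char_integral_cont[OF assms(3-6)] assms(6)
          char_integral_char_derivative[OF assms(1,4-6) x]])
  moreover have "f x / fst x + lam * char_integral lam f' x = wt True x * (f x + lam * fst x * char_integral lam f' x)"
    using x0 by (simp add: wt_def field_simps)
  ultimately show "((\<lambda>s. char_integral lam f (line True x s)) has_real_derivative
      wt True x * (f x + lam * fst x * char_integral lam f' x)) (at (crd True x))"
    by (simp add: line_def crd_def)
qed

text \<open>The time derivative undoes the integral and the theta-derivative passes inside it, so
  the induction closes on functions already known to be in the class.\<close>

lemma BO_char_integral0:
  assumes "BO True True S a f" "a > 1" "backward_closed S"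
  shows "BO True True S a (char_integral 0 f)" "pder True S (char_integral 0 f) f"
proof -
  have R: "region S" using assms(3) by (rule backward_closed_region)
  have D: "pder True S (char_integral 0 f) f" if f: "BO True True S a f" for f
    using pder_char_integral_True[OF BO_imp_Ob0[OF f] BO_dth(1)[OF f R] BO_imp_Ob0[OF BO_dth(2)[OF f R]] assms(2,3), of 0]
    by simp
  have "Ob True True S n a (char_integral 0 f)" for n
    using assms(1)
  proof (induction n arbitrary: f)
    case 0
    then show ?case using char_integral_Ob0[OF BO_imp_Ob0 assms(2,3)] by simp
  next
    case (Suc n)
    show ?case
    proof (rule Ob_SucI)
      show "Ob0 True S a (char_integral 0 f)" using Suc Ob_imp_Ob0 by blast
      fix c :: bool
      show "\<exists>h. pder c S (char_integral 0 f) h \<and> Ob True True S n a h"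
      proof (cases c)
        case True
        then show ?thesis using D[OF Suc.prems] Suc.prems unfolding BO_def by auto
      next
        case False
        have "pder False S (char_integral 0 f) (char_integral 0 (dth f))"
          by (rule pder_char_integral_False[OF BO_imp_Ob0[OF Suc.prems] BO_dth(1)[OF Suc.prems R]
              BO_imp_Ob0[OF BO_dth(2)[OF Suc.prems R]] assms(2,3)]) simp
        then show ?thesis using False Suc.IH[OF BO_dth(2)[OF Suc.prems R]] by auto
      qed
    qed
  qed
  then show "BO True True S a (char_integral 0 f)" by (simp add: BO_def)
  show "pder True S (char_integral 0 f) f" using D assms(1) by blast
qed

subsection \<open>Jets as formal power series\<close>

text \<open>Truncation at order m avoids any convergence condition on the jets;
  \<open>\<eta>\<close> is a free weight, later made small depending on m.\<close>

definition fnorm :: "nat \<Rightarrow> real \<Rightarrow> real fps \<Rightarrow> real" where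
  "fnorm m \<eta> F = (\<Sum>j\<le>m. \<eta> ^ j * \<bar>F $ j\<bar>)"

lemma fnorm_zero [simp]: "fnorm m \<eta> 0 = 0"
  by (simp add: fnorm_def)

lemma fnorm_nonneg: "\<eta> \<ge> 0 \<Longrightarrow> 0 \<le> fnorm m \<eta> F"
  unfolding fnorm_def by (intro sum_nonneg) auto

lemma fnorm_add: "\<eta> \<ge> 0 \<Longrightarrow> fnorm m \<eta> (F + G) \<le> fnorm m \<eta> F + fnorm m \<eta> G"
  unfolding fnorm_def sum.distrib[symmetric] distrib_left[symmetric]
  by (intro sum_mono mult_left_mono) auto

lemma fnorm_minus: "fnorm m \<eta> (- F) = fnorm m \<eta> F"
  unfolding fnorm_def by simp

lemma fnorm_diff: "\<eta> \<ge> 0 \<Longrightarrow> fnorm m \<eta> (F - G) \<le> fnorm m \<eta> F + fnorm m \<eta> G"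
  using fnorm_add[of \<eta> m F "- G"] by (simp add: fnorm_minus)

lemma fnorm_cmult: "fnorm m \<eta> (fps_const c * F) = \<bar>c\<bar> * fnorm m \<eta> F"
  unfolding fnorm_def sum_distrib_left by (simp add: abs_mult algebra_simps)

lemma fnorm_sum: "\<eta> \<ge> 0 \<Longrightarrow> fnorm m \<eta> (\<Sum>i\<in>A. F i) \<le> (\<Sum>i\<in>A. fnorm m \<eta> (F i))"
proof (induction A rule: infinite_finite_induct)
  case (insert i A)
  then show ?case using fnorm_add[of \<eta> m "F i" "\<Sum>i\<in>A. F i"] by simp
qed simp_all

text \<open>The weights are multiplicative, and truncating the Cauchy product at total degree m only
  discards nonnegative terms of the product of the two norms.\<close>

lemma fnorm_mult:
  assumes "\<eta> \<ge> 0"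
  shows "fnorm m \<eta> (F * G) \<le> fnorm m \<eta> F * fnorm m \<eta> G"
proof -
  have "fnorm m \<eta> (F * G) \<le> (\<Sum>k\<le>m. \<Sum>i\<le>k. (\<eta> ^ i * \<bar>F $ i\<bar>) * (\<eta> ^ (k - i) * \<bar>G $ (k - i)\<bar>))"
    unfolding fnorm_def
  proof (rule sum_mono)
    fix k assume "k \<in> {..m}"
    have "\<bar>(F * G) $ k\<bar> \<le> (\<Sum>i\<le>k. \<bar>F $ i\<bar> * \<bar>G $ (k - i)\<bar>)"
      unfolding fps_mult_nth atMost_atLeast0 using sum_abs[of "\<lambda>i. F $ i * G $ (k - i)" "{0..k}"] by (simp add: abs_mult)
    then have "\<eta> ^ k * \<bar>(F * G) $ k\<bar> \<le> \<eta> ^ k * (\<Sum>i\<le>k. \<bar>F $ i\<bar> * \<bar>G $ (k - i)\<bar>)"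
      using assms by (intro mult_left_mono) auto
    also have "\<dots> = (\<Sum>i\<le>k. (\<eta> ^ i * \<bar>F $ i\<bar>) * (\<eta> ^ (k - i) * \<bar>G $ (k - i)\<bar>))"
      unfolding sum_distrib_left
    proof (rule sum.cong[OF refl])
      fix i assume "i \<in> {..k}"
      then have "\<eta> ^ k = \<eta> ^ i * \<eta> ^ (k - i)" by (simp flip: power_add)
      then show "\<eta> ^ k * (\<bar>F $ i\<bar> * \<bar>G $ (k - i)\<bar>) = (\<eta> ^ i * \<bar>F $ i\<bar>) * (\<eta> ^ (k - i) * \<bar>G $ (k - i)\<bar>)"
        by simp
    qed
    finally show "\<eta> ^ k * \<bar>(F * G) $ k\<bar> \<le> (\<Sum>i\<le>k. (\<eta> ^ i * \<bar>F $ i\<bar>) * (\<eta> ^ (k - i) * \<bar>G $ (k - i)\<bar>))" .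
  qed
  also have "\<dots> = (\<Sum>(i, j)\<in>{(i, j). i + j \<le> m}. (\<eta> ^ i * \<bar>F $ i\<bar>) * (\<eta> ^ j * \<bar>G $ j\<bar>))"
    by (rule sum.triangle_reindex_eq[symmetric])
  also have "\<dots> \<le> (\<Sum>(i, j)\<in>{..m} \<times> {..m}. (\<eta> ^ i * \<bar>F $ i\<bar>) * (\<eta> ^ j * \<bar>G $ j\<bar>))"
    using assms by (intro sum_mono2) auto
  also have "\<dots> = fnorm m \<eta> F * fnorm m \<eta> G"
    unfolding fnorm_def by (simp add: sum_product sum.cartesian_product)
  finally show ?thesis .
qed

lemma nth_le_fnorm: "\<eta> > 0 \<Longrightarrow> j \<le> m \<Longrightarrow> \<bar>F $ j\<bar> \<le> inverse (\<eta> ^ j) * fnorm m \<eta> F"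
proof -
  assume "\<eta> > 0" "j \<le> m"
  then have "\<eta> ^ j * \<bar>F $ j\<bar> \<le> fnorm m \<eta> F"
    unfolding fnorm_def by (intro member_le_sum) auto
  then show ?thesis using \<open>\<eta> > 0\<close> by (simp add: field_simps)
qed

text \<open>Encodes that coefficient j is the j-th theta-derivative of coefficient 0 divided by j!,
  through one condition: differentiation in theta is formal differentiation. The Leibniz rule then
  becomes the product of power series.\<close>

definition isjet :: "(real \<times> real) set \<Rightarrow> (real \<times> real \<Rightarrow> real fps) \<Rightarrow> bool" where
  "isjet S W \<longleftrightarrow> (\<forall>j. continuous_on S (\<lambda>x. W x $ j) \<and>
      pder False S (\<lambda>x. W x $ j) (\<lambda>x. fps_deriv (W x) $ j))"

lemma isjet_const: "isjet S (\<lambda>x. fps_const c)"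
  unfolding isjet_def using pder_const by auto

lemma isjet_add: "isjet S V \<Longrightarrow> isjet S W \<Longrightarrow> isjet S (\<lambda>x. V x + W x)"
  unfolding isjet_def by (auto intro!: continuous_intros pder_add)

lemma isjet_diff: "isjet S V \<Longrightarrow> isjet S W \<Longrightarrow> isjet S (\<lambda>x. V x - W x)"
  unfolding isjet_def by (auto intro!: continuous_intros pder_diff)

lemma isjet_sum: "(\<And>i. i \<in> A \<Longrightarrow> isjet S (W i)) \<Longrightarrow> isjet S (\<lambda>x. \<Sum>i\<in>A. W i x)"
proof (induction A rule: infinite_finite_induct)
  case (insert i A)
  then show ?case by (simp add: isjet_add)
qed (use isjet_const[of S 0] in simp_all)

lemma isjet_mult:
  assumes "isjet S V" "isjet S W" shows "isjet S (\<lambda>x. V x * W x)"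
  unfolding isjet_def
proof (intro allI conjI)
  fix j
  show "continuous_on S (\<lambda>x. (V x * W x) $ j)"
    unfolding fps_mult_nth using assms unfolding isjet_def by (auto intro!: continuous_intros)
  have "pder False S (\<lambda>x. \<Sum>i=0..j. V x $ i * W x $ (j - i))
     (\<lambda>x. \<Sum>i=0..j. fps_deriv (V x) $ i * W x $ (j - i) + V x $ i * fps_deriv (W x) $ (j - i))"
    using assms unfolding isjet_def by (intro pder_sum pder_mult) blast+
  then show "pder False S (\<lambda>x. (V x * W x) $ j) (\<lambda>x. fps_deriv (V x * W x) $ j)"
    unfolding fps_mult_nth fps_deriv_mult fps_add_nth by (simp add: sum.distrib add.commute)
qed

definition Jfps :: "real \<Rightarrow> (real \<times> real \<Rightarrow> real fps) \<Rightarrow> real \<times> real \<Rightarrow> real fps" where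
  "Jfps lam W x = Abs_fps (\<lambda>j. char_integral lam (\<lambda>y. W y $ j) x)"

lemma isjet_Jfps:
  assumes "isjet S W" "\<And>j. Ob0 True S a (\<lambda>x. W x $ j)" "a > 1" "backward_closed S" "\<bar>lam\<bar> \<le> 1"
  shows "isjet S (Jfps lam W)"
    "pder True S (\<lambda>x. Jfps lam W x $ j) (\<lambda>x. W x $ j + lam * fst x * fps_deriv (Jfps lam W x) $ j)"
proof -
  have d: "Ob0 True S a (\<lambda>x. fps_deriv (W x) $ j)" for j
  proof -
    have "Ob True True S 0 a (\<lambda>x. real (Suc j) * W x $ Suc j)"
      using Ob_mult[OF Ob_const[of True 0 S True 0 "real (Suc j)"], of a "\<lambda>x. W x $ Suc j" a]
        assms(2)[of "Suc j"] backward_closed_region[OF assms(4)] by simp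
    then show ?thesis by (simp add: fps_deriv_nth mult.commute)
  qed
  have e: "char_integral lam (\<lambda>x. fps_deriv (W x) $ j) x = fps_deriv (Jfps lam W x) $ j" for j x
    using char_integral_cmult[of lam "real (Suc j)" "\<lambda>y. W y $ Suc j" x] by (simp add: Jfps_def fps_deriv_nth mult.commute)
  have p: "pder False S (\<lambda>x. W x $ j) (\<lambda>x. fps_deriv (W x) $ j)" for j
    using assms(1) unfolding isjet_def by blast
  show "isjet S (Jfps lam W)"
    unfolding isjet_def
  proof (intro allI conjI)
    fix j
    show "continuous_on S (\<lambda>x. Jfps lam W x $ j)"
      using char_integral_cont[OF assms(2-5)] by (simp add: Jfps_def)
    show "pder False S (\<lambda>x. Jfps lam W x $ j) (\<lambda>x. fps_deriv (Jfps lam W x) $ j)"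
      using pder_char_integral_False[OF assms(2) p d assms(3-5)] unfolding e by (simp add: Jfps_def)
  qed
  show "pder True S (\<lambda>x. Jfps lam W x $ j) (\<lambda>x. W x $ j + lam * fst x * fps_deriv (Jfps lam W x) $ j)"
    using pder_char_integral_True[OF assms(2) p d assms(3-5)] unfolding e by (simp add: Jfps_def)
qed

lemma Ob_sum:
  "(\<And>i. i \<in> A \<Longrightarrow> Ob b d S n a (f i)) \<Longrightarrow> Ob b d S n a (\<lambda>x. \<Sum>i\<in>A. f i x)"
proof (induction A rule: infinite_finite_induct)
  case (insert i A)
  then show ?case by (simp add: Ob_add)
qed (use BO_zero[of b d S a] in \<open>simp_all add: BO_def\<close>)

lemma Ob_cmult:
  "Ob b d S n a f \<Longrightarrow> region S \<Longrightarrow> Ob b d S n a (\<lambda>x. c * f x)"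
  by (rule Ob_mult[OF Ob_const[of d 0]]) auto

text \<open>Estimating the coefficients one at a time would cost a factor m + 1. With the signs of
  the integrals at the point x inserted, the weighted norm becomes the characteristic integral of a
  single scalar function, bounded by the norm of W, so the constant 1 / a survives.\<close>

lemma fnorm_Jfps:
  assumes "\<And>j. Ob0 True S a (\<lambda>x. W x $ j)" "a > 1" "backward_closed S" "\<bar>lam\<bar> \<le> 1" "\<eta> > 0"
    and "\<And>y. y \<in> S \<Longrightarrow> fnorm m \<eta> (W y) \<le> C * fst y powr a" "C \<ge> 0" "x \<in> S"
  shows "fnorm m \<eta> (Jfps lam W x) \<le> C / a * fst x powr a"
proof -
  define s where "s = (\<lambda>j. \<eta> ^ j * sgn (char_integral lam (\<lambda>y. W y $ j) x))"
  have ob: "Ob0 True S a (\<lambda>x. s j * W x $ j)" for j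
    using Ob_cmult[of True True S 0 a "\<lambda>x. W x $ j" "s j"] assms(1) backward_closed_region[OF assms(3)] by simp
  have obs: "Ob0 True S a (\<lambda>x. \<Sum>j\<le>m. s j * W x $ j)"
    using Ob_sum[of "{..m}" True True S 0 a "\<lambda>j x. s j * W x $ j"] ob by simp
  have "fnorm m \<eta> (Jfps lam W x) = (\<Sum>j\<le>m. s j * char_integral lam (\<lambda>y. W y $ j) x)"
    unfolding fnorm_def Jfps_def s_def by (simp add: abs_sgn mult.commute mult.left_commute)
  also have "\<dots> = char_integral lam (\<lambda>y. \<Sum>j\<le>m. s j * W y $ j) x"
    by (subst char_integral_sum[OF _ ob assms(2-4,8)]) (simp_all add: char_integral_cmult)
  also have "\<dots> \<le> \<bar>char_integral lam (\<lambda>y. \<Sum>j\<le>m. s j * W y $ j) x\<bar>" by simp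
  also have "\<dots> \<le> C / a * fst x powr a"
  proof (rule char_integral_bound[OF obs assms(2-4,8) _ assms(7)])
    fix y assume y: "y \<in> S"
    have "\<bar>\<Sum>j\<le>m. s j * W y $ j\<bar> \<le> (\<Sum>j\<le>m. \<bar>s j * W y $ j\<bar>)" by (rule sum_abs)
    also have "\<dots> \<le> fnorm m \<eta> (W y)"
      unfolding fnorm_def s_def using assms(5)
      by (intro sum_mono) (auto simp: abs_mult sgn_if power_abs)
    finally show "\<bar>\<Sum>j\<le>m. s j * W y $ j\<bar> \<le> C * fst y powr a" using assms(6)[OF y] by simp
  qed
  finally show ?thesis .
qed

section \<open>Fixed points of jet equations\<close>

lemma geometric_limit:
  fixes u :: "nat \<Rightarrow> real"
  assumes "\<And>n. \<bar>u (Suc n) - u n\<bar> \<le> K * q ^ n" "0 \<le> q" "q < 1"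
  shows "u \<longlonglongrightarrow> lim u" "\<bar>u n - lim u\<bar> \<le> K / (1 - q) * q ^ n"
proof -
  have gs: "summable (\<lambda>k. K * q ^ k)" using assms by (intro summable_mult summable_geometric) simp
  have s: "summable (\<lambda>k. u (Suc k) - u k)"
    by (rule summable_comparison_test'[OF gs]) (use assms(1) in simp)
  then have "(\<lambda>n. \<Sum>k<n. u (Suc k) - u k) \<longlonglongrightarrow> suminf (\<lambda>k. u (Suc k) - u k)"
    by (rule summable_LIMSEQ)
  then have "(\<lambda>n. (u n - u 0) + u 0) \<longlonglongrightarrow> suminf (\<lambda>k. u (Suc k) - u k) + u 0"
    unfolding sum_lessThan_telescope by (intro tendsto_intros)
  then have conv: "convergent u" by (auto simp: convergent_def)
  then show lim: "u \<longlonglongrightarrow> lim u" by (simp add: convergent_LIMSEQ_iff)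
  have "\<bar>u (n + p) - u n\<bar> \<le> K / (1 - q) * q ^ n * (1 - q ^ p)" for p
  proof (induction p)
    case (Suc p)
    have "\<bar>u (n + Suc p) - u n\<bar> \<le> K * q ^ (n + p) + K / (1 - q) * q ^ n * (1 - q ^ p)"
      using assms(1)[of "n + p"] Suc by simp
    also have "\<dots> = K / (1 - q) * q ^ n * (1 - q ^ Suc p)"
    proof -
      define c where "c = K / (1 - q)"
      have K: "K = c * (1 - q)" using assms(3) by (simp add: c_def)
      show ?thesis unfolding c_def[symmetric] unfolding K by (simp add: algebra_simps power_add)
    qed
    finally show ?case .
  qed simp
  moreover have K: "0 \<le> K" using assms(1)[of 0] by simp
  moreover have "K / (1 - q) * q ^ n * (1 - q ^ p) \<le> K / (1 - q) * q ^ n * 1" for p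
    using K assms by (intro mult_left_mono) auto
  ultimately have "\<bar>u (n + p) - u n\<bar> \<le> K / (1 - q) * q ^ n * 1" for p
    by (meson order_trans)
  then have b: "\<bar>u (p + n) - u n\<bar> \<le> K / (1 - q) * q ^ n" for p
    by (simp add: add.commute[of p n])
  have "(\<lambda>p. \<bar>u (p + n) - u n\<bar>) \<longlonglongrightarrow> \<bar>lim u - u n\<bar>"
    using LIMSEQ_ignore_initial_segment[OF lim, of n] by (intro tendsto_intros)
  then have "\<bar>lim u - u n\<bar> \<le> K / (1 - q) * q ^ n"
    by (rule LIMSEQ_le_const2) (use b in auto)
  then show "\<bar>u n - lim u\<bar> \<le> K / (1 - q) * q ^ n" by (simp add: abs_minus_commute)
qed

text \<open>Uniform convergence of coefficient j + 1 is, up to the factor j + 1, uniform convergence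
  of the theta-derivative of coefficient j; this permits differentiation of the limit.\<close>

lemma isjet_limit:
  assumes "\<And>n. isjet S (V n)" "\<And>m n x. x \<in> S \<Longrightarrow> \<bar>V n x $ m - W x $ m\<bar> \<le> C m * q ^ n"
    and "0 \<le> q" "q < 1" "open S"
  shows "isjet S W"
  unfolding isjet_def
proof (intro allI conjI)
  fix j
  have small: "\<forall>\<^sub>F n in sequentially. \<forall>x\<in>S. \<bar>V n x $ m - W x $ m\<bar> < e" if e: "e > 0" for m e
  proof -
    have "(\<lambda>n. C m * q ^ n) \<longlonglongrightarrow> C m * 0"
      using assms by (intro tendsto_intros LIMSEQ_power_zero) simp
    then have "\<forall>\<^sub>F n in sequentially. C m * q ^ n < e" using e by (simp add: order_tendstoD)
    then show ?thesis
    proof eventually_elim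
      case (elim n)
      show ?case using le_less_trans[OF assms(2) elim] by blast
    qed
  qed
  have unif: "uniform_limit S (\<lambda>n x. V n x $ m) (\<lambda>x. W x $ m) sequentially" for m
    using small[of _ m] by (intro uniform_limitI) (simp add: dist_real_def)
  show "continuous_on S (\<lambda>x. W x $ j)"
    using assms(1) by (intro uniform_limit_theorem[OF _ unif]) (auto simp: isjet_def)
  show "pder False S (\<lambda>x. W x $ j) (\<lambda>x. fps_deriv (W x) $ j)"
    unfolding pder_def
  proof
    fix x assume x: "x \<in> S"
    obtain r where r: "r > 0" "\<And>s y. \<bar>s - fst x\<bar> < r \<Longrightarrow> \<bar>y - snd x\<bar> < r \<Longrightarrow> (s, y) \<in> S"
      using region_slice[OF assms(5) x] by metis
    define U where "U = {snd x - r<..<snd x + r}"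
    have U: "(fst x, y) \<in> S" if "y \<in> U" for y using r that unfolding U_def by (simp add: abs_less_iff)
    have xU: "snd x \<in> U" using r by (simp add: U_def)
    have "\<exists>g. \<forall>y\<in>U. (\<lambda>n. V n (fst x, y) $ j) \<longlonglongrightarrow> g y \<and>
        (g has_derivative (\<lambda>h. fps_deriv (W (fst x, y)) $ j * h)) (at y within U)"
    proof (rule has_derivative_sequence[where f'="\<lambda>n y h. fps_deriv (V n (fst x, y)) $ j * h" and ?x0.0="snd x"])
      show "convex U" unfolding U_def by (rule convex_real_interval)
      show "snd x \<in> U" by (rule xU)
      show "(\<lambda>n. V n (fst x, snd x) $ j) \<longlonglongrightarrow> W (fst x, snd x) $ j"
        using tendsto_uniform_limitI[OF unif[of j] x] by simp
      fix n y assume "y \<in> U"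
      then have "((\<lambda>y. V n (fst x, y) $ j) has_real_derivative fps_deriv (V n (fst x, y)) $ j) (at y)"
        using assms(1)[of n] U unfolding isjet_def pder_def line_def crd_def wt_def by force
      then show "((\<lambda>y. V n (fst x, y) $ j) has_derivative (\<lambda>h. fps_deriv (V n (fst x, y)) $ j * h)) (at y within U)"
        unfolding has_field_derivative_def by (rule has_derivative_at_withinI)
    next
      fix e :: real assume e: "e > 0"
      have "\<forall>\<^sub>F n in sequentially. \<forall>x\<in>S. \<bar>V n x $ Suc j - W x $ Suc j\<bar> < e / real (Suc j)"
        using e by (intro small) auto
      then show "\<forall>\<^sub>F n in sequentially. \<forall>y\<in>U. \<forall>h. norm (fps_deriv (V n (fst x, y)) $ j * h - fps_deriv (W (fst x, y)) $ j * h) \<le> e * norm h"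
      proof eventually_elim
        case (elim n)
        show ?case
        proof (intro ballI allI)
          fix y h assume "y \<in> U"
          then have "\<bar>V n (fst x, y) $ Suc j - W (fst x, y) $ Suc j\<bar> < e / real (Suc j)" using elim U by blast
          then have "real (Suc j) * \<bar>V n (fst x, y) $ Suc j - W (fst x, y) $ Suc j\<bar> \<le> e"
            by (simp add: pos_less_divide_eq mult.commute less_imp_le)
          moreover have "\<bar>fps_deriv (V n (fst x, y)) $ j - fps_deriv (W (fst x, y)) $ j\<bar>
              = real (Suc j) * \<bar>V n (fst x, y) $ Suc j - W (fst x, y) $ Suc j\<bar>"
            unfolding fps_deriv_nth right_diff_distrib[symmetric] abs_mult by (simp add: )
          ultimately have "\<bar>fps_deriv (V n (fst x, y)) $ j - fps_deriv (W (fst x, y)) $ j\<bar> * \<bar>h\<bar> \<le> e * \<bar>h\<bar>"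
            by (intro mult_right_mono) auto
          then show "norm (fps_deriv (V n (fst x, y)) $ j * h - fps_deriv (W (fst x, y)) $ j * h) \<le> e * norm h"
            by (simp only: real_norm_def left_diff_distrib[symmetric] abs_mult)
        qed
      qed
    qed
    then obtain g where g: "\<And>y. y \<in> U \<Longrightarrow> (\<lambda>n. V n (fst x, y) $ j) \<longlonglongrightarrow> g y"
        "\<And>y. y \<in> U \<Longrightarrow> (g has_derivative (\<lambda>h. fps_deriv (W (fst x, y)) $ j * h)) (at y within U)"
      by blast
    have geq: "g y = W (fst x, y) $ j" if "y \<in> U" for y
      using LIMSEQ_unique[OF g(1)[OF that] tendsto_uniform_limitI[OF unif[of j] U[OF that]]] .
    have "(g has_field_derivative fps_deriv (W x) $ j) (at (snd x))"
      using g(2)[OF xU] at_within_open[of "snd x" U] xU unfolding has_field_derivative_def by (simp add: U_def)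
    moreover have ev: "\<forall>\<^sub>F y in nhds (snd x). g y = W (fst x, y) $ j"
      using eventually_nhds_in_open[of U "snd x"] xU geq by (auto simp: U_def elim: eventually_mono)
    ultimately have "((\<lambda>y. W (fst x, y) $ j) has_real_derivative fps_deriv (W x) $ j) (at (snd x))"
      using DERIV_cong_ev[OF refl ev refl] by blast
    then show "((\<lambda>s. W (line False x s) $ j) has_real_derivative wt False x * fps_deriv (W x) $ j) (at (crd False x))"
      by (simp add: line_def crd_def wt_def)
  qed
qed

text \<open>The constants \<open>q\<close>, \<open>r\<close> and the domain are common to all orders
  m, only \<open>\<eta>\<close> depends on m. Hence one Picard sequence converges at every order on
  one domain, which does not shrink as the order grows. The Lipschitz constant q * mu of G is
  divided by mu in \<open>fnorm_Jfps\<close>, which leaves the contraction factor q.\<close>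

lemma isjet_fixpoint:
  fixes G :: "'i \<Rightarrow> real \<times> real \<Rightarrow> ('i \<Rightarrow> real fps) \<Rightarrow> real fps" and lam :: "'i \<Rightarrow> real"
  assumes S: "backward_closed S" and mu: "mu > 1" and q: "0 \<le> q" "q < 1" and r: "0 \<le> r"
    and lam: "\<And>i. \<bar>lam i\<bar> \<le> 1"
    and jetG: "\<And>W i. (\<And>j. j \<in> Is \<Longrightarrow> isjet S (W j)) \<Longrightarrow> i \<in> Is \<Longrightarrow> isjet S (\<lambda>x. G i x (\<lambda>j. W j x))"
    and est: "\<And>m. \<exists>\<eta>>0. \<forall>i\<in>Is. \<forall>x\<in>S. fnorm m \<eta> (G i x (\<lambda>_. 0)) \<le> (1 - q) * mu * r * fst x powr mu \<and>
        (\<forall>w w' d. (\<forall>j\<in>Is. fnorm m \<eta> (w j) \<le> r * fst x powr mu \<and> fnorm m \<eta> (w' j) \<le> r * fst x powr mu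
            \<and> fnorm m \<eta> (w j - w' j) \<le> d) \<longrightarrow> fnorm m \<eta> (G i x w - G i x w') \<le> q * mu * d)"
  obtains W where "\<And>i. i \<in> Is \<Longrightarrow> isjet S (W i)"
    "\<And>i m. i \<in> Is \<Longrightarrow> Ob0 True S mu (\<lambda>x. W i x $ m)"
    "\<And>i m. i \<in> Is \<Longrightarrow> Ob0 True S mu (\<lambda>x. G i x (\<lambda>j. W j x) $ m)"
    "\<And>i x. i \<in> Is \<Longrightarrow> x \<in> S \<Longrightarrow> W i x = Jfps (lam i) (\<lambda>y. G i y (\<lambda>j. W j y)) x"
proof -
  have R: "region S" using S by (rule backward_closed_region)
  have oS: "open S" and pos: "\<And>x. x \<in> S \<Longrightarrow> 0 < fst x" and lt1: "\<And>x. x \<in> S \<Longrightarrow> fst x < 1"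
    using R by (auto simp: region_def)
  define good where "good = (\<lambda>m \<eta>. \<eta> > 0 \<and> (\<forall>i\<in>Is. \<forall>x\<in>S. fnorm m \<eta> (G i x (\<lambda>_. 0)) \<le> (1 - q) * mu * r * fst x powr mu \<and>
        (\<forall>w w' d. (\<forall>j\<in>Is. fnorm m \<eta> (w j) \<le> r * fst x powr mu \<and> fnorm m \<eta> (w' j) \<le> r * fst x powr mu
            \<and> fnorm m \<eta> (w j - w' j) \<le> d) \<longrightarrow> fnorm m \<eta> (G i x w - G i x w') \<le> q * mu * d)))"
  have "\<forall>m. \<exists>\<eta>. good m \<eta>" unfolding good_def using est by blast
  then obtain eta where eta: "\<And>m. good m (eta m)" by metis
  have eta0: "eta m > 0" for m using eta[of m] by (simp add: good_def)
  define inv where "inv = (\<lambda>V. \<forall>i\<in>Is. isjet S (V i) \<and> (\<forall>m. \<forall>x\<in>S. fnorm m (eta m) (V i x) \<le> r * fst x powr mu))"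
  define rhs where "rhs = (\<lambda>V i x. G i x (\<lambda>j. V j x))"
  define \<Phi> where "\<Phi> = (\<lambda>V i. Jfps (lam i) (rhs V i))"
  have rhs_bd: "fnorm m (eta m) (rhs V i x) \<le> mu * r * fst x powr mu" if "inv V" "i \<in> Is" "x \<in> S" for V i x m
  proof -
    have "fnorm m (eta m) (G i x (\<lambda>j. V j x) - G i x (\<lambda>_. 0)) \<le> q * mu * (r * fst x powr mu)"
      using eta[of m] that r unfolding good_def inv_def by (auto simp: less_imp_le)
    moreover have "fnorm m (eta m) (G i x (\<lambda>_. 0)) \<le> (1 - q) * mu * r * fst x powr mu"
      using eta[of m] that unfolding good_def by auto
    moreover have "fnorm m (eta m) (rhs V i x) \<le> fnorm m (eta m) (G i x (\<lambda>j. V j x) - G i x (\<lambda>_. 0)) + fnorm m (eta m) (G i x (\<lambda>_. 0))"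
      using fnorm_add[OF less_imp_le[OF eta0], of m m "G i x (\<lambda>j. V j x) - G i x (\<lambda>_. 0)" "G i x (\<lambda>_. 0)"] by (simp add: rhs_def)
    ultimately show ?thesis by (simp add: algebra_simps)
  qed
  have coef_Ob0: "Ob0 True S mu (\<lambda>x. V x $ m)"
    if "isjet S V" "\<And>x. x \<in> S \<Longrightarrow> fnorm m (eta m) (V x) \<le> C * fst x powr mu" for V C m
  proof -
    have "\<bar>V x $ m\<bar> \<le> (inverse (eta m ^ m) * C) * fst x powr mu" if x: "x \<in> S" for x
    proof -
      have "\<bar>V x $ m\<bar> \<le> inverse (eta m ^ m) * fnorm m (eta m) (V x)" using eta0 by (intro nth_le_fnorm) auto
      also have "\<dots> \<le> inverse (eta m ^ m) * (C * fst x powr mu)"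
        using eta0[of m] \<open>\<And>x. x \<in> S \<Longrightarrow> fnorm m (eta m) (V x) \<le> C * fst x powr mu\<close>[OF x] by (intro mult_left_mono) auto
      finally show ?thesis by (simp add: mult.assoc)
    qed
    then show ?thesis using that(1) unfolding Ob0_def isjet_def by blast
  qed
  have rhs_jet: "isjet S (rhs V i)" if "inv V" "i \<in> Is" for V i
    unfolding rhs_def using that by (intro jetG) (auto simp: inv_def)
  have rhs_Ob0: "Ob0 True S mu (\<lambda>x. rhs V i x $ m)" if "inv V" "i \<in> Is" for V i m
    using coef_Ob0[OF rhs_jet[OF that] rhs_bd[OF that]] .
  have invPhi: "inv (\<Phi> V)" if V: "inv V" for V
    unfolding inv_def
  proof (intro ballI conjI allI)
    fix i assume i: "i \<in> Is"
    show "isjet S (\<Phi> V i)" unfolding \<Phi>_def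
      by (rule isjet_Jfps[OF rhs_jet[OF V i] rhs_Ob0[OF V i] mu S lam])
    fix m x assume x: "x \<in> S"
    have "fnorm m (eta m) (\<Phi> V i x) \<le> (mu * r) / mu * fst x powr mu" unfolding \<Phi>_def
      by (rule fnorm_Jfps[OF rhs_Ob0[OF V i] mu S lam eta0 rhs_bd[OF V i] _ x]) (use mu r in auto)
    then show "fnorm m (eta m) (\<Phi> V i x) \<le> r * fst x powr mu" using mu by simp
  qed
  have contr: "fnorm m (eta m) (\<Phi> V i x - \<Phi> V' i x) \<le> q * d * fst x powr mu"
    if V: "inv V" "inv V'" and d: "d \<ge> 0" "\<And>j y. j \<in> Is \<Longrightarrow> y \<in> S \<Longrightarrow> fnorm m (eta m) (V j y - V' j y) \<le> d * fst y powr mu"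
      and i: "i \<in> Is" and x: "x \<in> S" for V V' d m i x
  proof -
    have ob: "Ob0 True S mu (\<lambda>x. (rhs V i x - rhs V' i x) $ j)" for j
    proof -
      have "Ob0 True S mu (\<lambda>x. (-1) * rhs V' i x $ j)"
        using Ob_cmult[of True True S 0 mu "\<lambda>x. rhs V' i x $ j" "-1"] rhs_Ob0[OF V(2) i] R by simp
      then have "Ob0 True S mu (\<lambda>x. rhs V i x $ j + (-1) * rhs V' i x $ j)"
        by (rule Ob0_add[OF rhs_Ob0[OF V(1) i]])
      then show ?thesis by simp
    qed
    have eq: "\<Phi> V i x - \<Phi> V' i x = Jfps (lam i) (\<lambda>y. rhs V i y - rhs V' i y) x"
      unfolding \<Phi>_def Jfps_def
      by (rule fps_ext) (simp add: char_integral_diff[OF rhs_Ob0[OF V(1) i] rhs_Ob0[OF V(2) i] mu S lam x])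
    have "fnorm m (eta m) (Jfps (lam i) (\<lambda>y. rhs V i y - rhs V' i y) x) \<le> (q * mu * d) / mu * fst x powr mu"
    proof (rule fnorm_Jfps[OF ob mu S lam eta0 _ _ x])
      show "0 \<le> q * mu * d" using q mu d by simp
      fix y assume y: "y \<in> S"
      have "fnorm m (eta m) (rhs V i y - rhs V' i y) \<le> q * mu * (d * fst y powr mu)"
        unfolding rhs_def using eta[of m] V d i y unfolding good_def inv_def by auto
      then show "fnorm m (eta m) (rhs V i y - rhs V' i y) \<le> q * mu * d * fst y powr mu" by (simp add: mult.assoc)
    qed
    then show ?thesis unfolding eq using mu by simp
  qed
  define wn where "wn = rec_nat (\<lambda>i x. 0) (\<lambda>n. \<Phi>)"
  have wn0: "wn 0 = (\<lambda>i x. 0)" and wnS: "wn (Suc n) = \<Phi> (wn n)" for n unfolding wn_def by auto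
  have wninv: "inv (wn n)" for n
  proof (induction n)
    case 0
    then show ?case unfolding wn0 inv_def using isjet_const[of S 0] r by auto
  next
    case (Suc n)
    then show ?case unfolding wnS by (rule invPhi)
  qed
  have step: "fnorm m (eta m) (wn (Suc n) i x - wn n i x) \<le> q ^ n * r * fst x powr mu" if "i \<in> Is" "x \<in> S" for n m i x
    using that
  proof (induction n arbitrary: i x)
    case 0
    have "fnorm m (eta m) (wn (Suc 0) i x) \<le> r * fst x powr mu" using wninv[of "Suc 0"] 0 unfolding inv_def by blast
    then show ?case by (simp add: wn0)
  next
    case (Suc n)
    have "fnorm m (eta m) (\<Phi> (wn (Suc n)) i x - \<Phi> (wn n) i x) \<le> q * (q ^ n * r) * fst x powr mu"
      by (rule contr[OF wninv wninv _ _ Suc.prems]) (use q r Suc.IH in auto)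
    then show ?case unfolding wnS by (simp add: mult.assoc)
  qed
  define K where "K = (\<lambda>m. inverse (eta m ^ m) * r)"
  have K0: "K m \<ge> 0" for m unfolding K_def using eta0[of m] r by simp
  have cstep: "\<bar>wn (Suc n) i x $ m - wn n i x $ m\<bar> \<le> (K m * fst x powr mu) * q ^ n" if "i \<in> Is" "x \<in> S" for n m i x
  proof -
    have "\<bar>(wn (Suc n) i x - wn n i x) $ m\<bar> \<le> inverse (eta m ^ m) * fnorm m (eta m) (wn (Suc n) i x - wn n i x)"
      using eta0 by (intro nth_le_fnorm) auto
    also have "\<dots> \<le> inverse (eta m ^ m) * (q ^ n * r * fst x powr mu)"
      using eta0[of m] step[OF that] by (intro mult_left_mono) auto
    finally show ?thesis by (simp add: K_def algebra_simps)
  qed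
  define W where "W = (\<lambda>i x. Abs_fps (\<lambda>m. lim (\<lambda>n. wn n i x $ m)))"
  have Wlim: "(\<lambda>n. wn n i x $ m) \<longlonglongrightarrow> W i x $ m" if "i \<in> Is" "x \<in> S" for i x m
    using geometric_limit(1)[of "\<lambda>n. wn n i x $ m", OF cstep[OF that] q] by (simp add: W_def)
  have Wdist: "\<bar>wn n i x $ m - W i x $ m\<bar> \<le> K m / (1 - q) * fst x powr mu * q ^ n" if "i \<in> Is" "x \<in> S" for i x m n
    using geometric_limit(2)[of "\<lambda>n. wn n i x $ m", OF cstep[OF that] q, of n] by (simp add: W_def)
  have Wjet: "isjet S (W i)" if i: "i \<in> Is" for i
  proof (rule isjet_limit[OF _ _ q oS])
    show "isjet S (wn n i)" for n using wninv[of n] i unfolding inv_def by blast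
    fix m n x assume x: "x \<in> S"
    have "fst x powr mu \<le> fst x powr 0" using pos[OF x] lt1[OF x] mu by (intro powr_mono_01) auto
    then have "K m / (1 - q) * fst x powr mu * q ^ n \<le> K m / (1 - q) * 1 * q ^ n"
      using K0 q pos[OF x] by (intro mult_right_mono mult_left_mono) auto
    then show "\<bar>wn n i x $ m - W i x $ m\<bar> \<le> K m / (1 - q) * q ^ n" using Wdist[OF i x, of n m] by simp
  qed
  have Winv: "inv W"
    unfolding inv_def
  proof (intro ballI conjI allI Wjet)
    fix i m x assume i: "i \<in> Is" and x: "x \<in> S"
    have "(\<lambda>n. fnorm m (eta m) (wn n i x)) \<longlonglongrightarrow> fnorm m (eta m) (W i x)"
      unfolding fnorm_def by (intro tendsto_intros Wlim[OF i x])
    then show "fnorm m (eta m) (W i x) \<le> r * fst x powr mu"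
      by (rule LIMSEQ_le_const2) (use wninv i x in \<open>auto simp: inv_def\<close>)
  qed
  \<comment> \<open>The contraction estimate gives coefficientwise convergence of \<Phi> (wn n) to
    \<Phi> W, while the same sequence is wn shifted by one and tends to W.\<close>
  have fixed: "\<Phi> W i x = W i x" if i: "i \<in> Is" and x: "x \<in> S" for i x
  proof (rule fps_ext)
    fix m
    define c where "c = (\<Sum>j\<le>m. eta m ^ j * (K j / (1 - q)))"
    have c0: "c \<ge> 0" unfolding c_def using K0 q eta0[of m] by (intro sum_nonneg) auto
    have wW: "fnorm m (eta m) (W j y - wn n j y) \<le> c * q ^ n * fst y powr mu" if "j \<in> Is" "y \<in> S" for j y n
    proof -
      have "fnorm m (eta m) (W j y - wn n j y) \<le> (\<Sum>k\<le>m. eta m ^ k * (K k / (1 - q) * fst y powr mu * q ^ n))"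
        unfolding fnorm_def
      proof (intro sum_mono mult_left_mono)
        fix k show "\<bar>(W j y - wn n j y) $ k\<bar> \<le> K k / (1 - q) * fst y powr mu * q ^ n"
          using Wdist[OF that, of n k] by (simp add: abs_minus_commute)
        show "0 \<le> eta m ^ k" using eta0[of m] by simp
      qed
      also have "\<dots> = c * q ^ n * fst y powr mu" unfolding c_def sum_distrib_right by (simp add: algebra_simps)
      finally show ?thesis .
    qed
    have bd: "\<bar>\<Phi> W i x $ m - wn (Suc n) i x $ m\<bar> \<le> inverse (eta m ^ m) * (q * (c * q ^ n) * fst x powr mu)" for n
    proof -
      have "\<bar>(\<Phi> W i x - \<Phi> (wn n) i x) $ m\<bar> \<le> inverse (eta m ^ m) * fnorm m (eta m) (\<Phi> W i x - \<Phi> (wn n) i x)"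
        using eta0 by (intro nth_le_fnorm) auto
      also have "\<dots> \<le> inverse (eta m ^ m) * (q * (c * q ^ n) * fst x powr mu)"
      proof (rule mult_left_mono)
        show "fnorm m (eta m) (\<Phi> W i x - \<Phi> (wn n) i x) \<le> q * (c * q ^ n) * fst x powr mu"
          by (rule contr[OF Winv wninv _ wW i x]) (use c0 q in simp)
        show "0 \<le> inverse (eta m ^ m)" using eta0[of m] by simp
      qed
      finally show ?thesis by (simp add: wnS)
    qed
    have "(\<lambda>n. inverse (eta m ^ m) * (q * (c * q ^ n) * fst x powr mu)) \<longlonglongrightarrow> inverse (eta m ^ m) * (q * (c * 0) * fst x powr mu)"
      using q by (intro tendsto_intros LIMSEQ_power_zero) simp
    then have lim0: "(\<lambda>n. inverse (eta m ^ m) * (q * (c * q ^ n) * fst x powr mu)) \<longlonglongrightarrow> 0" by simp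
    have l0: "(\<lambda>n. \<Phi> W i x $ m - wn (Suc n) i x $ m) \<longlonglongrightarrow> 0"
      by (rule Lim_null_comparison[OF always_eventually lim0]) (use bd in simp)
    have "(\<lambda>n. \<Phi> W i x $ m - wn (Suc n) i x $ m) \<longlonglongrightarrow> \<Phi> W i x $ m - W i x $ m"
      by (intro tendsto_diff tendsto_const LIMSEQ_Suc[OF Wlim[OF i x]])
    from LIMSEQ_unique[OF this l0] show "\<Phi> W i x $ m = W i x $ m" by simp
  qed
  show ?thesis
  proof (rule that[of W])
    show "i \<in> Is \<Longrightarrow> isjet S (W i)" for i by (rule Wjet)
    show "Ob0 True S mu (\<lambda>x. W i x $ m)" if i: "i \<in> Is" for i m
    proof -
      have "\<And>x. x \<in> S \<Longrightarrow> fnorm m (eta m) (W i x) \<le> r * fst x powr mu"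
        using Winv i unfolding inv_def by blast
      from coef_Ob0[OF Wjet[OF i] this] show ?thesis .
    qed
    show "Ob0 True S mu (\<lambda>x. G i x (\<lambda>j. W j x) $ m)" if i: "i \<in> Is" for i m
      using rhs_Ob0[OF Winv i, of m] unfolding rhs_def .
    show "W i x = Jfps (lam i) (\<lambda>y. G i y (\<lambda>j. W j y)) x" if "i \<in> Is" "x \<in> S" for i x
    proof -
      have "\<Phi> W i x = Jfps (lam i) (\<lambda>y. G i y (\<lambda>j. W j y)) x"
        unfolding \<Phi>_def rhs_def by (rule refl)
      with fixed[OF that, symmetric] show ?thesis by (rule trans)
    qed
  qed
qed

section \<open>Taylor jets of given functions, and full smoothness of jet solutions\<close>

definition jet :: "(real \<times> real \<Rightarrow> real) \<Rightarrow> real \<times> real \<Rightarrow> real fps" where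
  "jet f x = Abs_fps (\<lambda>j. (dth ^^ j) f x / fact j)"

lemma jet_nth_0 [simp]: "jet f x $ 0 = f x"
  by (simp add: jet_def)

lemma BO_dth_iter: "BO b d S a f \<Longrightarrow> region S \<Longrightarrow> BO b d S a ((dth ^^ j) f)"
  by (induction j) (simp_all add: BO_dth(2))

lemma BO_jet: "BO b d S a f \<Longrightarrow> region S \<Longrightarrow> BO b d S a (\<lambda>x. jet f x $ j)"
  using BO_cmult[OF BO_dth_iter, of b d S a f "inverse (fact j)" j] by (simp add: jet_def divide_inverse mult.commute)

lemma isjet_jet:
  assumes "BO b d S a f" "region S" shows "isjet S (jet f)"
  unfolding isjet_def
proof (intro allI conjI)
  fix j
  show "continuous_on S (\<lambda>x. jet f x $ j)" using BO_jet[OF assms] BO_cont by blast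
  have "pder False S (\<lambda>x. inverse (fact j) * (dth ^^ j) f x) (\<lambda>x. inverse (fact j) * dth ((dth ^^ j) f) x)"
    by (intro pder_cmult BO_dth(1)[OF BO_dth_iter[OF assms] assms(2)])
  moreover have "inverse (fact j) * dth ((dth ^^ j) f) x = fps_deriv (jet f x) $ j" for x
    by (simp add: jet_def fps_deriv_nth field_simps del: of_nat_Suc)
  ultimately show "pder False S (\<lambda>x. jet f x $ j) (\<lambda>x. fps_deriv (jet f x) $ j)"
    by (simp add: jet_def divide_inverse mult.commute)
qed

text \<open>Shrinking \<open>\<eta>\<close> makes the weighted norm of a jet as close to the sup norm as desired; hence the
  smallness conditions of the fixed point argument only concern functions, not their derivatives.\<close>

lemma eventually_fnorm_jet:
  assumes "BO b True S a f" "region S" "\<delta> > 0"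
  shows "\<forall>\<^sub>F \<eta> in at_right 0. \<forall>x\<in>S. fnorm m \<eta> (jet f x) \<le> \<bar>f x\<bar> + \<delta> * fst x powr a"
proof -
  have "\<exists>C. C > 0 \<and> (\<forall>x\<in>S. \<bar>jet f x $ j\<bar> \<le> C * fst x powr a)" for j
    using BO_bound[OF BO_jet[OF assms(1,2)]] by metis
  then obtain C where C: "\<And>j. C j > 0" "\<And>j x. x \<in> S \<Longrightarrow> \<bar>jet f x $ j\<bar> \<le> C j * fst x powr a" by metis
  define B where "B = (\<Sum>j\<in>{1..m}. C j)"
  have B: "B \<ge> 0" unfolding B_def using C(1) by (intro sum_nonneg) (auto intro: less_imp_le)
  have "\<forall>\<^sub>F \<eta> in at_right (0::real). \<eta> < min 1 (\<delta> / (B + 1))"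
    using assms(3) B by (intro eventually_at_right_less order_tendstoD(2)[of "\<lambda>x. x"] tendsto_ident_at) auto
  moreover have "\<forall>\<^sub>F \<eta> in at_right (0::real). \<eta> > 0" by (rule eventually_at_right_less)
  ultimately show ?thesis
  proof eventually_elim
    case (elim \<eta>)
    have eB: "\<eta> * B \<le> \<delta>"
    proof -
      have "\<eta> * (B + 1) < \<delta>" using elim B by (simp add: pos_less_divide_eq)
      then show ?thesis using elim by (simp add: algebra_simps)
    qed
    show ?case
    proof
      fix x assume x: "x \<in> S"
      have "fnorm m \<eta> (jet f x) = \<eta> ^ 0 * \<bar>jet f x $ 0\<bar> + (\<Sum>j\<in>{1..m}. \<eta> ^ j * \<bar>jet f x $ j\<bar>)"
        unfolding fnorm_def by (simp add: atMost_atLeast0 sum.atLeast_Suc_atMost)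
      also have "(\<Sum>j\<in>{1..m}. \<eta> ^ j * \<bar>jet f x $ j\<bar>) \<le> (\<Sum>j\<in>{1..m}. \<eta> * (C j * fst x powr a))"
      proof (intro sum_mono mult_mono)
        fix j assume j: "j \<in> {1..m}"
        show "\<eta> ^ j \<le> \<eta>" using elim j power_decreasing[of 1 j \<eta>] by auto
        show "\<bar>jet f x $ j\<bar> \<le> C j * fst x powr a" by (rule C(2)[OF x])
      qed (use elim in auto)
      also have "\<dots> = \<eta> * B * fst x powr a" unfolding B_def sum_distrib_left sum_distrib_right by (simp add: mult.assoc)
      also have "\<dots> \<le> \<delta> * fst x powr a" using eB by (intro mult_right_mono) auto
      finally show "fnorm m \<eta> (jet f x) \<le> \<bar>f x\<bar> + \<delta> * fst x powr a" by simp
    qed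
  qed
qed

definition FOb :: "(real \<times> real) set \<Rightarrow> nat \<Rightarrow> real \<Rightarrow> (real \<times> real \<Rightarrow> real fps) \<Rightarrow> bool" where
  "FOb S n a W \<longleftrightarrow> (\<forall>m. Ob True True S n a (\<lambda>x. W x $ m))"

lemma FOb_mult:
  assumes "FOb S n a V" "FOb S n a' W" "region S" "e \<le> a + a'"
  shows "FOb S n e (\<lambda>x. V x * W x)"
  unfolding FOb_def fps_mult_nth
proof (intro allI Ob_sum)
  fix m i
  have "Ob True True S n a (\<lambda>x. V x $ i)" "Ob True True S n a' (\<lambda>x. W x $ (m - i))"
    using assms(1,2) unfolding FOb_def by blast+
  then show "Ob True True S n e (\<lambda>x. V x $ i * W x $ (m - i))"
    by (rule Ob_mult) (use assms(3,4) in auto)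
qed

lemma FOb_add: "FOb S n a V \<Longrightarrow> FOb S n a W \<Longrightarrow> FOb S n a (\<lambda>x. V x + W x)"
  unfolding FOb_def by (simp add: Ob_add)

lemma FOb_sum: "(\<And>i. i \<in> A \<Longrightarrow> FOb S n a (W i)) \<Longrightarrow> FOb S n a (\<lambda>x. \<Sum>i\<in>A. W i x)"
  unfolding FOb_def fps_sum_nth by (simp add: Ob_sum)

lemma FOb_cmult: "FOb S n a W \<Longrightarrow> region S \<Longrightarrow> FOb S n a (\<lambda>x. fps_const c * W x)"
  unfolding FOb_def by (simp add: Ob_cmult)

lemma FOb_diff: "FOb S n a V \<Longrightarrow> FOb S n a W \<Longrightarrow> region S \<Longrightarrow> FOb S n a (\<lambda>x. V x - W x)"
  using Ob_add[of True True S n a "\<lambda>x. V x $ m" "\<lambda>x. (-1) * W x $ m" for m] Ob_cmult[of True True S n a "\<lambda>x. W x $ m" "-1" for m]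
  unfolding FOb_def by simp

lemma FOb_jet: "BO True True S a f \<Longrightarrow> region S \<Longrightarrow> FOb S n a (jet f)"
  unfolding FOb_def using BO_jet BO_def by blast

text \<open>The fixed point controls all theta-derivatives but no further time derivatives. The
  equation expresses a time derivative by H and by the next jet coefficient times t, both one order
  lower in the induction; theta-derivatives come free because the induction treats all coefficients
  at once.\<close>

lemma jet_solution_BO:
  assumes "region S" and "\<And>i. i \<in> Is \<Longrightarrow> isjet S (W i)"
    "\<And>i m. i \<in> Is \<Longrightarrow> Ob0 True S mu (\<lambda>x. W i x $ m)"
    "\<And>i m. i \<in> Is \<Longrightarrow> pder True S (\<lambda>x. W i x $ m) (\<lambda>x. H i x $ m + lam i * fst x * fps_deriv (W i x) $ m)"
    "\<And>n i. (\<And>j. j \<in> Is \<Longrightarrow> FOb S n mu (W j)) \<Longrightarrow> i \<in> Is \<Longrightarrow> FOb S n mu (H i)"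
    "i \<in> Is"
  shows "BO True True S mu (\<lambda>x. W i x $ m)"
proof -
  have "FOb S n mu (W i)" if "i \<in> Is" for n i
    using that
  proof (induction n arbitrary: i)
    case 0
    then show ?case using assms(3) by (simp add: FOb_def)
  next
    case (Suc n)
    show ?case
      unfolding FOb_def
    proof (intro allI Ob_SucI)
      fix m
      show "Ob0 True S mu (\<lambda>x. W i x $ m)" using Suc.prems assms(3) by blast
      have d: "Ob True True S n mu (\<lambda>x. fps_deriv (W i x) $ m)"
        using Ob_cmult[of True True S n mu "\<lambda>x. W i x $ Suc m" "real (Suc m)"] Suc.IH[OF Suc.prems] assms(1)
        by (simp add: FOb_def fps_deriv_nth mult.commute)
      fix c :: bool
      show "\<exists>f'. pder c S (\<lambda>x. W i x $ m) f' \<and> Ob True True S n mu f'"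
      proof (cases c)
        case True
        have f: "Ob True True S n 1 fst" using BO_fst[OF assms(1)] by (simp add: BO_def)
        have "Ob True True S n mu (\<lambda>x. lam i * (fst x * fps_deriv (W i x) $ m))"
          by (intro Ob_cmult Ob_mult[OF f d]) (use assms(1) in auto)
        then have "Ob True True S n mu (\<lambda>x. H i x $ m + lam i * fst x * fps_deriv (W i x) $ m)"
          using Ob_add assms(5)[OF Suc.IH Suc.prems] by (simp add: FOb_def mult.assoc)
        then show ?thesis using True assms(4)[OF Suc.prems, of m] by auto
      next
        case False
        then show ?thesis using d assms(2)[OF Suc.prems] unfolding isjet_def by auto
      qed
    qed
  qed
  then show ?thesis using assms(6) unfolding FOb_def BO_def by blast
qed

subsection \<open>The first order system in an orthonormal frame\<close>

text \<open>A domain of dependence for speed 1: backwards in time its width grows as fast as the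
  characteristics can spread.\<close>

definition Tri :: "real \<Rightarrow> real \<Rightarrow> real \<Rightarrow> (real \<times> real) set" where
  "Tri c L T = {x. 0 < fst x \<and> fst x < T \<and> \<bar>snd x - c\<bar> < L - fst x}"

lemma Tri_mono: "T \<le> T' \<Longrightarrow> Tri c L T \<subseteq> Tri c L T'"
  by (auto simp: Tri_def)

lemma backward_closed_Tri:
  assumes "T \<le> 1" shows "backward_closed (Tri c L T)"
proof -
  have "open {x::real \<times> real. 0 < fst x}" "open {x::real \<times> real. fst x < T}"
    "open {x::real \<times> real. \<bar>snd x - c\<bar> < L - fst x}"
    by (intro open_Collect_less continuous_intros)+
  then have "open ({x. 0 < fst x} \<inter> {x. fst x < T} \<inter> {x. \<bar>snd x - c\<bar> < L - fst x})"
    by (intro open_Int)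
  moreover have "{x. 0 < fst x} \<inter> {x. fst x < T} \<inter> {x. \<bar>snd x - c\<bar> < L - fst x} = Tri c L T"
    by (auto simp: Tri_def)
  ultimately have op: "open (Tri c L T)" by simp
  have "\<forall>x\<in>Tri c L T. \<bar>snd x\<bar> \<le> \<bar>c\<bar> + \<bar>L\<bar>" by (auto simp: Tri_def)
  then have "region (Tri c L T)"
    unfolding region_def using op assms by (auto simp: Tri_def intro!: exI[of _ "\<bar>c\<bar> + \<bar>L\<bar>"])
  moreover have "pt lam x \<sigma> \<in> Tri c L T" if x: "x \<in> Tri c L T" and s: "\<sigma> \<in> {0<..1}" and l: "lam \<in> {-1..1}" for x \<sigma> lam
  proof -
    have x0: "0 < fst x" "fst x < T" "\<bar>snd x - c\<bar> < L - fst x" using x by (auto simp: Tri_def)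
    have 1: "fst x * \<sigma> \<le> fst x" using x0 s by (simp add: mult_left_le)
    have "\<bar>lam * (fst x * (1 - \<sigma>))\<bar> \<le> 1 * \<bar>fst x * (1 - \<sigma>)\<bar>"
      unfolding abs_mult[of lam] using l by (intro mult_right_mono) auto
    moreover have "0 \<le> fst x * (1 - \<sigma>)" using x0 s by simp
    ultimately have "\<bar>lam * (fst x * (1 - \<sigma>))\<bar> \<le> fst x - fst x * \<sigma>" by (simp add: algebra_simps)
    moreover have "lam * fst x * (1 - \<sigma>) = lam * (fst x * (1 - \<sigma>))" by simp
    ultimately have "\<bar>snd x + lam * fst x * (1 - \<sigma>) - c\<bar> < L - fst x * \<sigma>"
      using x0(3) by linarith
    moreover have "0 < fst x * \<sigma>" using x0 s by simp
    moreover have "fst x * \<sigma> < T" using 1 x0 by linarith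
    ultimately show ?thesis unfolding Tri_def pt_def by simp
  qed
  ultimately show ?thesis unfolding backward_closed_def by blast
qed

lemma region_Tri: "T \<le> 1 \<Longrightarrow> region (Tri c L T)"
  using backward_closed_Tri backward_closed_region by blast

text \<open>The linear map that sends P to the exponents PP; applied to D P or t dth P it gives the
  same derivative of PP.\<close>

definition ZZ :: "'i set \<Rightarrow> ('i \<Rightarrow> 'b \<Rightarrow> real) \<Rightarrow> 'i \<Rightarrow> 'b \<Rightarrow> real" where
  "ZZ Ix V I x = (\<Sum>J\<in>Ix. V J x) + V I x"

text \<open>The weight exp (- PP) in X and Y removes all exponentials from the right-hand sides and
  leaves quadratic terms. That W and Y are theta-derivatives of potentials is not built in; it is
  recovered after the system has been solved.\<close>

definition frame :: "'i set \<Rightarrow> (real \<times> real) set \<Rightarrow> ('i \<Rightarrow> real \<times> real \<Rightarrow> real) \<Rightarrow> ('i \<Rightarrow> real \<times> real \<Rightarrow> real)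
    \<Rightarrow> ('i \<Rightarrow> real \<times> real \<Rightarrow> real) \<Rightarrow> ('i \<Rightarrow> real \<times> real \<Rightarrow> real) \<Rightarrow> bool" where
  "frame Ix S V W X Y \<longleftrightarrow> (\<forall>I\<in>Ix.
     pder True S (V I) (\<lambda>x. fst x * dth (W I) x - ((X I x)\<^sup>2 - (Y I x)\<^sup>2) / 2) \<and>
     pder True S (W I) (\<lambda>x. fst x * dth (V I) x + W I x) \<and>
     pder True S (X I) (\<lambda>x. fst x * dth (Y I) x + ZZ Ix V I x * X I x - ZZ Ix W I x * Y I x) \<and>
     pder True S (Y I) (\<lambda>x. fst x * dth (X I) x + Y I x - ZZ Ix V I x * Y I x + ZZ Ix W I x * X I x))"

lemma powr_lim0: "a > 0 \<Longrightarrow> ((\<lambda>s::real. C * s powr a) \<longlongrightarrow> 0) (at_right 0)"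
proof -
  assume a: "a > 0"
  have "((\<lambda>s::real. s powr a) \<longlongrightarrow> 0 powr a) (at_right 0)"
    by (rule tendsto_powr'[OF tendsto_ident_at tendsto_const]) (use a in \<open>auto simp: eventually_at_filter\<close>)
  from tendsto_mult[OF tendsto_const[of C] this] show ?thesis by simp
qed

lemma eventually_small:
  assumes "Ob0 True S a f" "a > 0" "s > 0"
  shows "\<forall>\<^sub>F T in at_right 0. \<forall>x\<in>S. 0 < fst x \<and> fst x < T \<longrightarrow> \<bar>f x\<bar> \<le> s"
proof -
  obtain C where C: "C > 0" "\<And>x. x \<in> S \<Longrightarrow> \<bar>f x\<bar> \<le> C * fst x powr a"
    using Ob0_bound[OF assms(1)] by blast
  have "\<forall>\<^sub>F T in at_right (0::real). C * T powr a < s"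
    by (rule order_tendstoD(2)[OF powr_lim0[OF assms(2)] assms(3)])
  then show ?thesis
  proof eventually_elim
    case (elim T)
    show ?case
    proof (intro ballI impI)
      fix x assume x: "x \<in> S" "0 < fst x \<and> fst x < T"
      have "C * fst x powr a \<le> C * T powr a"
        using x(2) C(1) assms(2) by (intro mult_left_mono powr_mono2) auto
      then show "\<bar>f x\<bar> \<le> s" using C(2)[OF x(1)] elim by linarith
    qed
  qed
qed

section \<open>Contraction estimate for the characteristic system\<close>

lemma fnorm_le_add: "\<eta> \<ge> 0 \<Longrightarrow> fnorm m \<eta> F \<le> A \<Longrightarrow> fnorm m \<eta> G \<le> B \<Longrightarrow> fnorm m \<eta> (F + G) \<le> A + B"
  using fnorm_add[of \<eta> m F G] by linarith

lemma fnorm_le_diff: "\<eta> \<ge> 0 \<Longrightarrow> fnorm m \<eta> F \<le> A \<Longrightarrow> fnorm m \<eta> G \<le> B \<Longrightarrow> fnorm m \<eta> (F - G) \<le> A + B"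
  using fnorm_diff[of \<eta> m F G] by linarith

lemma fnorm_le_mult:
  assumes "\<eta> \<ge> 0" "fnorm m \<eta> F \<le> A" "fnorm m \<eta> G \<le> B" shows "fnorm m \<eta> (F * G) \<le> A * B"
proof -
  have "0 \<le> A" using fnorm_nonneg[OF assms(1), of m F] assms(2) by linarith
  then have "fnorm m \<eta> F * fnorm m \<eta> G \<le> A * B"
    using assms by (intro mult_mono) (auto intro: fnorm_nonneg)
  then show ?thesis using fnorm_mult[OF assms(1), of m F G] by linarith
qed

lemma fnorm_le_half: "fnorm m \<eta> F \<le> A \<Longrightarrow> fnorm m \<eta> (fps_const (1 / 2) * F) \<le> A / 2"
  by (simp add: fnorm_cmult)

definition wsum :: "'i set \<Rightarrow> ('i \<times> nat \<Rightarrow> real fps) \<Rightarrow> 'i \<Rightarrow> nat \<Rightarrow> real fps" where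
  "wsum Ix w I c = (\<Sum>J\<in>Ix. w (J, c)) + w (I, c)"

lemma wsum_diff: "wsum Ix w I c - wsum Ix w' I c = wsum Ix (\<lambda>j. w j - w' j) I c"
  by (simp add: wsum_def sum_subtractf)

lemma fnorm_wsum:
  assumes "\<eta> \<ge> 0" "finite Ix" "\<And>J. J \<in> Ix \<Longrightarrow> fnorm m \<eta> (w (J, c)) \<le> B" "I \<in> Ix"
  shows "fnorm m \<eta> (wsum Ix w I c) \<le> (real (card Ix) + 1) * B"
proof -
  have "fnorm m \<eta> (\<Sum>J\<in>Ix. w (J, c)) \<le> (\<Sum>J\<in>Ix. fnorm m \<eta> (w (J, c)))" by (rule fnorm_sum[OF assms(1)])
  also have "\<dots> \<le> (\<Sum>J\<in>Ix. B)" by (intro sum_mono assms(3))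
  finally have "fnorm m \<eta> (\<Sum>J\<in>Ix. w (J, c)) \<le> real (card Ix) * B" by simp
  then show ?thesis
    unfolding wsum_def using fnorm_le_add[OF assms(1) _ assms(3)[OF assms(4)]] by (simp add: distrib_right)
qed

text \<open>The characteristic form of the perturbation equations around a background: the components
  \<open>0, 1, 2, 3\<close> are \<open>v + w\<close>, \<open>v - w\<close>, \<open>x + y\<close> and \<open>x - y\<close>.\<close>

definition Gchar :: "'i set \<Rightarrow> ('i \<Rightarrow> real fps) \<Rightarrow> ('i \<Rightarrow> real fps) \<Rightarrow> ('i \<Rightarrow> real fps) \<Rightarrow> ('i \<Rightarrow> real fps)
    \<Rightarrow> (nat \<Rightarrow> 'i \<Rightarrow> real fps) \<Rightarrow> ('i \<times> nat) \<Rightarrow> ('i \<times> nat \<Rightarrow> real fps) \<Rightarrow> real fps" where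
  "Gchar Ix PJ MJ QP QM F i w = (let I = fst i; h = fps_const (1 / 2) in
     if snd i = 0 then F 0 I + h * (w (I, 0) - w (I, 1)) - h * (PJ I * w (I, 3) + w (I, 2) * MJ I + w (I, 2) * w (I, 3))
     else if snd i = 1 then F 1 I - h * (w (I, 0) - w (I, 1)) - h * (PJ I * w (I, 3) + w (I, 2) * MJ I + w (I, 2) * w (I, 3))
     else if snd i = 2 then F 2 I + h * w (I, 2) + QP I * w (I, 3) + wsum Ix w I 0 * MJ I + wsum Ix w I 0 * w (I, 3)
     else F 3 I + h * w (I, 3) + QM I * w (I, 2) + wsum Ix w I 1 * PJ I + wsum Ix w I 1 * w (I, 2))"

text \<open>The leading 1 is the row sum of the linear part: 1/2 + 1/2 in components 0 and 1, and
  1/2 plus the bound 1/2 on \<open>QP\<close> or \<open>QM\<close> in components 2 and 3. Every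
  remaining term carries a factor of size s; differences of products are split as difference times w
  plus w' times difference.\<close>

lemma fnorm_Gchar_diff:
  assumes eta: "\<eta> \<ge> 0" and fin: "finite Ix" and I: "I \<in> Ix" and c: "c \<in> {0, 1, 2, 3}"
    and s: "s \<ge> 0" and P: "fnorm m \<eta> (PJ I) \<le> s" and M: "fnorm m \<eta> (MJ I) \<le> s"
    and QP: "fnorm m \<eta> (QP I) \<le> 1 / 2" and QM: "fnorm m \<eta> (QM I) \<le> 1 / 2"
    and w: "\<And>j. j \<in> Ix \<times> {0, 1, 2, 3} \<Longrightarrow> fnorm m \<eta> (w j) \<le> s"
    and w': "\<And>j. j \<in> Ix \<times> {0, 1, 2, 3} \<Longrightarrow> fnorm m \<eta> (w' j) \<le> s"
    and d: "\<And>j. j \<in> Ix \<times> {0, 1, 2, 3} \<Longrightarrow> fnorm m \<eta> (w j - w' j) \<le> d"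
  shows "fnorm m \<eta> (Gchar Ix PJ MJ QP QM F (I, c) w - Gchar Ix PJ MJ QP QM F (I, c) w')
    \<le> (1 + 3 * (real (card Ix) + 1) * s) * d"
proof -
  let ?h = "fps_const (1 / 2) :: real fps"
  define n1 where "n1 = real (card Ix) + 1"
  define \<delta> where "\<delta> = (\<lambda>j. w j - w' j)"
  have j: "(I, k) \<in> Ix \<times> {0, 1, 2, 3}" if "k \<in> {0, 1, 2, 3::nat}" for k using I that by simp
  have D: "fnorm m \<eta> (\<delta> (I, k)) \<le> d" if "k \<in> {0, 1, 2, 3::nat}" for k
    unfolding \<delta>_def using d[OF j[OF that]] .
  have d0: "0 \<le> d" using fnorm_nonneg[OF eta, of m "\<delta> (I, 0)"] D[of 0] by simp
  have n1: "n1 \<ge> 1" by (simp add: n1_def)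
  have sd0: "0 \<le> s * d" using s d0 by simp
  have sd: "s * d \<le> n1 * (s * d)" using mult_right_mono[OF n1 sd0] by simp
  have wd: "fnorm m \<eta> (wsum Ix \<delta> I k) \<le> n1 * d" if "k \<in> {0, 1, 2, 3}" for k
    unfolding n1_def \<delta>_def by (rule fnorm_wsum[OF eta fin d I]) (use that in simp)
  have ws': "fnorm m \<eta> (wsum Ix w' I k) \<le> n1 * s" if "k \<in> {0, 1, 2, 3}" for k
    unfolding n1_def by (rule fnorm_wsum[OF eta fin w' I]) (use that in simp)
  have quad: "fnorm m \<eta> (?h * (PJ I * \<delta> (I, 3) + \<delta> (I, 2) * MJ I + (\<delta> (I, 2) * w (I, 3) + w' (I, 2) * \<delta> (I, 3))))
      \<le> ((s * d + d * s) + (d * s + s * d)) / 2"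
    by (intro fnorm_le_half fnorm_le_add fnorm_le_mult eta P M D w w' j) simp_all
  have lin: "fnorm m \<eta> (?h * (\<delta> (I, 0) - \<delta> (I, 1))) \<le> (d + d) / 2"
    by (intro fnorm_le_half fnorm_le_diff eta D) simp_all
  consider "c = 0" | "c = 1" | "c = 2" | "c = 3" using c by auto
  then have "fnorm m \<eta> (Gchar Ix PJ MJ QP QM F (I, c) w - Gchar Ix PJ MJ QP QM F (I, c) w') \<le> d + 3 * (n1 * (s * d))"
  proof cases
    case 1
    have "Gchar Ix PJ MJ QP QM F (I, c) w - Gchar Ix PJ MJ QP QM F (I, c) w' =
        ?h * (\<delta> (I, 0) - \<delta> (I, 1)) - ?h * (PJ I * \<delta> (I, 3) + \<delta> (I, 2) * MJ I + (\<delta> (I, 2) * w (I, 3) + w' (I, 2) * \<delta> (I, 3)))"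
      using 1 by (simp add: Gchar_def Let_def \<delta>_def algebra_simps)
    then have "fnorm m \<eta> (Gchar Ix PJ MJ QP QM F (I, c) w - Gchar Ix PJ MJ QP QM F (I, c) w')
       \<le> (d + d) / 2 + ((s * d + d * s) + (d * s + s * d)) / 2"
      using fnorm_le_diff[OF eta lin quad] by simp
    moreover have "d * s = s * d" by simp
    ultimately show ?thesis using sd sd0 by simp
  next
    case 2
    have "Gchar Ix PJ MJ QP QM F (I, c) w - Gchar Ix PJ MJ QP QM F (I, c) w' =
        - (?h * (\<delta> (I, 0) - \<delta> (I, 1))) - ?h * (PJ I * \<delta> (I, 3) + \<delta> (I, 2) * MJ I + (\<delta> (I, 2) * w (I, 3) + w' (I, 2) * \<delta> (I, 3)))"
      using 2 by (simp add: Gchar_def Let_def \<delta>_def algebra_simps)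
    moreover have lin': "fnorm m \<eta> (- (?h * (\<delta> (I, 0) - \<delta> (I, 1)))) \<le> (d + d) / 2"
      using lin by (simp only: fnorm_minus)
    ultimately have "fnorm m \<eta> (Gchar Ix PJ MJ QP QM F (I, c) w - Gchar Ix PJ MJ QP QM F (I, c) w')
       \<le> (d + d) / 2 + ((s * d + d * s) + (d * s + s * d)) / 2"
      using fnorm_le_diff[OF eta lin' quad] by simp
    moreover have "d * s = s * d" by simp
    ultimately show ?thesis using sd sd0 by simp
  next
    case 3
    have "Gchar Ix PJ MJ QP QM F (I, c) w - Gchar Ix PJ MJ QP QM F (I, c) w' =
        ?h * \<delta> (I, 2) + QP I * \<delta> (I, 3) + wsum Ix \<delta> I 0 * MJ I + (wsum Ix \<delta> I 0 * w (I, 3) + wsum Ix w' I 0 * \<delta> (I, 3))"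
      using 3 wsum_diff[of Ix w I 0 w'] unfolding Gchar_def Let_def \<delta>_def[symmetric]
      by (simp flip: wsum_diff add: algebra_simps \<delta>_def)
    moreover have "fnorm m \<eta> (?h * \<delta> (I, 2) + QP I * \<delta> (I, 3) + wsum Ix \<delta> I 0 * MJ I + (wsum Ix \<delta> I 0 * w (I, 3) + wsum Ix w' I 0 * \<delta> (I, 3)))
      \<le> d / 2 + 1 / 2 * d + n1 * d * s + (n1 * d * s + n1 * s * d)"
      by (intro fnorm_le_half fnorm_le_add fnorm_le_mult eta P M QP D w wd ws' j) simp_all
    ultimately show ?thesis by (simp add: algebra_simps)
  next
    case 4
    have "Gchar Ix PJ MJ QP QM F (I, c) w - Gchar Ix PJ MJ QP QM F (I, c) w' =
        ?h * \<delta> (I, 3) + QM I * \<delta> (I, 2) + wsum Ix \<delta> I 1 * PJ I + (wsum Ix \<delta> I 1 * w (I, 2) + wsum Ix w' I 1 * \<delta> (I, 2))"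
      using 4 by (simp flip: wsum_diff add: Gchar_def Let_def algebra_simps \<delta>_def)
    moreover have "fnorm m \<eta> (?h * \<delta> (I, 3) + QM I * \<delta> (I, 2) + wsum Ix \<delta> I 1 * PJ I + (wsum Ix \<delta> I 1 * w (I, 2) + wsum Ix w' I 1 * \<delta> (I, 2)))
      \<le> d / 2 + 1 / 2 * d + n1 * d * s + (n1 * d * s + n1 * s * d)"
      by (intro fnorm_le_half fnorm_le_add fnorm_le_mult eta P M QM D w wd ws' j) simp_all
    ultimately show ?thesis by (simp add: algebra_simps)
  qed
  then show ?thesis by (simp add: n1_def algebra_simps)
qed

lemma wsum_simps: "wsum Ix (\<lambda>_. 0) I c = 0"
  by (simp add: wsum_def)

lemma Gchar_zero:
  "c \<in> {0, 1, 2, 3} \<Longrightarrow> Gchar Ix PJ MJ QP QM F (I, c) (\<lambda>_. 0) = F c I"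
  by (auto simp: Gchar_def Let_def wsum_simps)

lemma isjet_Gchar:
  assumes "\<And>I. I \<in> Ix \<Longrightarrow> isjet S (PJ I)" "\<And>I. I \<in> Ix \<Longrightarrow> isjet S (MJ I)"
    "\<And>I. I \<in> Ix \<Longrightarrow> isjet S (QP I)" "\<And>I. I \<in> Ix \<Longrightarrow> isjet S (QM I)"
    "\<And>I c. I \<in> Ix \<Longrightarrow> isjet S (F c I)" "\<And>j. j \<in> Ix \<times> {0, 1, 2, 3} \<Longrightarrow> isjet S (W j)" "I \<in> Ix"
  shows "isjet S (\<lambda>x. Gchar Ix (\<lambda>I. PJ I x) (\<lambda>I. MJ I x) (\<lambda>I. QP I x) (\<lambda>I. QM I x) (\<lambda>c I. F c I x) (I, c) (\<lambda>j. W j x))"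
proof -
  have ws: "isjet S (\<lambda>x. wsum Ix (\<lambda>j. W j x) I k)" if "k \<in> {0, 1, 2, 3}" for k
    unfolding wsum_def using that assms(6,7) by (intro isjet_add isjet_sum) auto
  have w: "isjet S (W (I, k))" if "k \<in> {0, 1, 2, 3}" for k using assms(6)[of "(I, k)"] assms(7) that by simp
  have e0: "isjet S (\<lambda>x. F 0 I x + fps_const (1 / 2) * (W (I, 0) x - W (I, 1) x) - fps_const (1 / 2) * (PJ I x * W (I, 3) x + W (I, 2) x * MJ I x + W (I, 2) x * W (I, 3) x))"
    by (intro isjet_add isjet_diff isjet_mult isjet_const ws w assms(1-5) assms(7); simp)+
  have e1: "isjet S (\<lambda>x. F 1 I x - fps_const (1 / 2) * (W (I, 0) x - W (I, 1) x) - fps_const (1 / 2) * (PJ I x * W (I, 3) x + W (I, 2) x * MJ I x + W (I, 2) x * W (I, 3) x))"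
    by (intro isjet_add isjet_diff isjet_mult isjet_const ws w assms(1-5) assms(7); simp)+
  have e2: "isjet S (\<lambda>x. F 2 I x + fps_const (1 / 2) * W (I, 2) x + QP I x * W (I, 3) x + wsum Ix (\<lambda>j. W j x) I 0 * MJ I x + wsum Ix (\<lambda>j. W j x) I 0 * W (I, 3) x)"
    by (intro isjet_add isjet_diff isjet_mult isjet_const ws w assms(1-5) assms(7); simp)+
  have e3: "isjet S (\<lambda>x. F 3 I x + fps_const (1 / 2) * W (I, 3) x + QM I x * W (I, 2) x + wsum Ix (\<lambda>j. W j x) I 1 * PJ I x + wsum Ix (\<lambda>j. W j x) I 1 * W (I, 2) x)"
    by (intro isjet_add isjet_diff isjet_mult isjet_const ws w assms(1-5) assms(7); simp)+
  consider "c = 0" | "c = 1" | "c = 2" | "c \<noteq> 0 \<and> c \<noteq> 1 \<and> c \<noteq> 2" by blast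
  then show ?thesis
    unfolding Gchar_def Let_def fst_conv snd_conv
    by cases (use e0 e1 e2 e3 in simp_all)
qed

lemma FOb_Gchar:
  assumes S: "region S" and mu: "mu \<ge> 0" and "\<And>I. I \<in> Ix \<Longrightarrow> FOb S n 0 (PJ I)" "\<And>I. I \<in> Ix \<Longrightarrow> FOb S n 0 (MJ I)"
    "\<And>I. I \<in> Ix \<Longrightarrow> FOb S n 0 (QP I)" "\<And>I. I \<in> Ix \<Longrightarrow> FOb S n 0 (QM I)"
    "\<And>I c. I \<in> Ix \<Longrightarrow> FOb S n mu (F c I)" "\<And>j. j \<in> Ix \<times> {0, 1, 2, 3} \<Longrightarrow> FOb S n mu (W j)" "I \<in> Ix"
  shows "FOb S n mu (\<lambda>x. Gchar Ix (\<lambda>I. PJ I x) (\<lambda>I. MJ I x) (\<lambda>I. QP I x) (\<lambda>I. QM I x) (\<lambda>c I. F c I x) (I, c) (\<lambda>j. W j x))"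
proof -
  have ws: "FOb S n mu (\<lambda>x. wsum Ix (\<lambda>j. W j x) I k)" if "k \<in> {0, 1, 2, 3}" for k
    unfolding wsum_def using that assms(8,9) by (intro FOb_add FOb_sum) auto
  have w: "FOb S n mu (W (I, k))" if "k \<in> {0, 1, 2, 3}" for k using assms(8)[of "(I, k)"] assms(9) that by simp
  have m1: "FOb S n mu (\<lambda>x. A x * B x)" if "FOb S n 0 A" "FOb S n mu B" for A B
    by (rule FOb_mult[OF that S]) simp
  have m2: "FOb S n mu (\<lambda>x. A x * B x)" if "FOb S n mu A" "FOb S n 0 B" for A B
    by (rule FOb_mult[OF that S]) simp
  have m3: "FOb S n mu (\<lambda>x. A x * B x)" if "FOb S n mu A" "FOb S n mu B" for A B
    by (rule FOb_mult[OF that S]) (use mu in simp)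
  note ps = assms(3)[OF assms(9)] assms(4)[OF assms(9)] assms(5)[OF assms(9)] assms(6)[OF assms(9)] assms(7)[OF assms(9)]
  have 0: "FOb S n mu (\<lambda>x. PJ I x * W (I, 3) x)" "FOb S n mu (\<lambda>x. W (I, 2) x * MJ I x)"
    "FOb S n mu (\<lambda>x. W (I, 2) x * W (I, 3) x)" "FOb S n mu (\<lambda>x. QP I x * W (I, 3) x)" "FOb S n mu (\<lambda>x. QM I x * W (I, 2) x)"
    "FOb S n mu (\<lambda>x. wsum Ix (\<lambda>j. W j x) I 0 * MJ I x)" "FOb S n mu (\<lambda>x. wsum Ix (\<lambda>j. W j x) I 1 * PJ I x)"
    "FOb S n mu (\<lambda>x. wsum Ix (\<lambda>j. W j x) I 0 * W (I, 3) x)" "FOb S n mu (\<lambda>x. wsum Ix (\<lambda>j. W j x) I 1 * W (I, 2) x)"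
    using m1[OF ps(1) w[of 3]] m2[OF w[of 2] ps(2)] m3[OF w[of 2] w[of 3]] m1[OF ps(3) w[of 3]] m1[OF ps(4) w[of 2]]
      m2[OF ws[of 0] ps(2)] m2[OF ws[of 1] ps(1)] m3[OF ws[of 0] w[of 3]] m3[OF ws[of 1] w[of 2]] by simp_all
  have e0: "FOb S n mu (\<lambda>x. F 0 I x + fps_const (1 / 2) * (W (I, 0) x - W (I, 1) x) - fps_const (1 / 2) * (PJ I x * W (I, 3) x + W (I, 2) x * MJ I x + W (I, 2) x * W (I, 3) x))"
    by (intro FOb_add FOb_diff FOb_cmult 0 w S ps; simp)+
  have e1: "FOb S n mu (\<lambda>x. F 1 I x - fps_const (1 / 2) * (W (I, 0) x - W (I, 1) x) - fps_const (1 / 2) * (PJ I x * W (I, 3) x + W (I, 2) x * MJ I x + W (I, 2) x * W (I, 3) x))"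
    by (intro FOb_add FOb_diff FOb_cmult 0 w S ps; simp)+
  have e2: "FOb S n mu (\<lambda>x. F 2 I x + fps_const (1 / 2) * W (I, 2) x + QP I x * W (I, 3) x + wsum Ix (\<lambda>j. W j x) I 0 * MJ I x + wsum Ix (\<lambda>j. W j x) I 0 * W (I, 3) x)"
    by (intro FOb_add FOb_diff FOb_cmult 0 w S ps; simp)+
  have e3: "FOb S n mu (\<lambda>x. F 3 I x + fps_const (1 / 2) * W (I, 3) x + QM I x * W (I, 2) x + wsum Ix (\<lambda>j. W j x) I 1 * PJ I x + wsum Ix (\<lambda>j. W j x) I 1 * W (I, 2) x)"
    by (intro FOb_add FOb_diff FOb_cmult 0 w S ps; simp)+
  consider "c = 0" | "c = 1" | "c = 2" | "c \<noteq> 0 \<and> c \<noteq> 1 \<and> c \<noteq> 2" by blast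
  then show ?thesis
    unfolding Gchar_def Let_def fst_conv snd_conv
    by cases (use e0 e1 e2 e3 in simp_all)
qed

text \<open>The order of choices matters: s and q from mu, then r from the sources, then T from sup
  norms of the functions alone, and last the jet weight for each m. So T is independent of the
  number of derivatives.\<close>

lemma frame_perturbation:
  fixes Vb Wb Xb Yb :: "'i \<Rightarrow> real \<times> real \<Rightarrow> real" and r1 r2 r3 r4 :: "'i \<Rightarrow> real \<times> real \<Rightarrow> real"
  assumes fin: "finite Ix" and mu: "mu > 1" and T0: "0 < T0" "T0 \<le> 1" and ga: "ga > 0"
    and Vb: "\<And>I. I \<in> Ix \<Longrightarrow> BO True True (Tri c L T0) 0 (Vb I)"
    and Wb: "\<And>I. I \<in> Ix \<Longrightarrow> BO True True (Tri c L T0) ga (Wb I)"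
    and Xb: "\<And>I. I \<in> Ix \<Longrightarrow> BO True True (Tri c L T0) ga (Xb I)"
    and Yb: "\<And>I. I \<in> Ix \<Longrightarrow> BO True True (Tri c L T0) ga (Yb I)"
    and r1: "\<And>I. I \<in> Ix \<Longrightarrow> BO True True (Tri c L T0) mu (r1 I)"
    and r2: "\<And>I. I \<in> Ix \<Longrightarrow> BO True True (Tri c L T0) mu (r2 I)"
    and r3: "\<And>I. I \<in> Ix \<Longrightarrow> BO True True (Tri c L T0) mu (r3 I)"
    and r4: "\<And>I. I \<in> Ix \<Longrightarrow> BO True True (Tri c L T0) mu (r4 I)"
    and eq1: "\<And>I. I \<in> Ix \<Longrightarrow> pder True (Tri c L T0) (Vb I) (\<lambda>x. fst x * dth (Wb I) x - ((Xb I x)\<^sup>2 - (Yb I x)\<^sup>2) / 2 + r1 I x)"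
    and eq2: "\<And>I. I \<in> Ix \<Longrightarrow> pder True (Tri c L T0) (Wb I) (\<lambda>x. fst x * dth (Vb I) x + Wb I x + r2 I x)"
    and eq3: "\<And>I. I \<in> Ix \<Longrightarrow> pder True (Tri c L T0) (Xb I) (\<lambda>x. fst x * dth (Yb I) x + ZZ Ix Vb I x * Xb I x - ZZ Ix Wb I x * Yb I x + r3 I x)"
    and eq4: "\<And>I. I \<in> Ix \<Longrightarrow> pder True (Tri c L T0) (Yb I) (\<lambda>x. fst x * dth (Xb I) x + Yb I x - ZZ Ix Vb I x * Yb I x + ZZ Ix Wb I x * Xb I x + r4 I x)"
    and half: "\<And>I x. I \<in> Ix \<Longrightarrow> x \<in> Tri c L T0 \<Longrightarrow> \<bar>ZZ Ix Vb I x - 1 / 2\<bar> \<le> 7 / 20"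
  obtains T v w x y where "0 < T" "T \<le> T0"
    "\<And>I. I \<in> Ix \<Longrightarrow> BO True True (Tri c L T) mu (v I)" "\<And>I. I \<in> Ix \<Longrightarrow> BO True True (Tri c L T) mu (w I)"
    "\<And>I. I \<in> Ix \<Longrightarrow> BO True True (Tri c L T) mu (x I)" "\<And>I. I \<in> Ix \<Longrightarrow> BO True True (Tri c L T) mu (y I)"
    "frame Ix (Tri c L T) (\<lambda>I z. Vb I z + v I z) (\<lambda>I z. Wb I z + w I z) (\<lambda>I z. Xb I z + x I z) (\<lambda>I z. Yb I z + y I z)"
proof -
  define S0 where "S0 = Tri c L T0"
  have R0: "region S0" unfolding S0_def using T0 by (intro region_Tri)
  note bo0 = Vb[folded S0_def] Wb[folded S0_def] Xb[folded S0_def] Yb[folded S0_def]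
    r1[folded S0_def] r2[folded S0_def] r3[folded S0_def] r4[folded S0_def]
  define n1 where "n1 = real (card Ix) + 1"
  have n1: "n1 \<ge> 1" by (simp add: n1_def)
  \<comment> \<open>The same s bounds the background and the perturbation. The factor 6 makes 1 + 3
    * n1 * s at most (1 + mu) / 2.\<close>
  define s where "s = min (1 / 100) ((mu - 1) / (6 * n1))"
  have s: "s > 0" "s \<le> 1 / 100" "3 * n1 * s \<le> (mu - 1) / 2"
  proof -
    show "s > 0" using mu n1 by (simp add: s_def)
    show "s \<le> 1 / 100" by (simp add: s_def)
    have "3 * n1 * s \<le> 3 * n1 * ((mu - 1) / (6 * n1))" using n1 by (intro mult_left_mono) (auto simp: s_def)
    also have "\<dots> = (mu - 1) / 2" using n1 by (simp add: field_simps)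
    finally show "3 * n1 * s \<le> (mu - 1) / 2" .
  qed
  \<comment> \<open>Chosen so that q * mu is the midpoint of 1 and mu: above the row sum, yet with q
    < 1.\<close>
  define q where "q = (1 + mu) / (2 * mu)"
  have q: "0 \<le> q" "q < 1" "q * mu = (1 + mu) / 2" "(1 - q) * mu = (mu - 1) / 2"
    using mu by (auto simp: q_def field_simps)
  define Pb where "Pb = (\<lambda>I z. Xb I z + Yb I z)"
  define Mb where "Mb = (\<lambda>I z. Xb I z - Yb I z)"
  \<comment> \<open>The shift by 1/2 arises from the linear term y in the equation for Y: y is half
    the difference of x + y and x - y.\<close>
  define ZPb where "ZPb = (\<lambda>I z. ZZ Ix Vb I z + ZZ Ix Wb I z - 1 / 2)"
  define ZMb where "ZMb = (\<lambda>I z. ZZ Ix Vb I z - ZZ Ix Wb I z - 1 / 2)"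
  \<comment> \<open>The signs are reversed because the perturbation has to cancel the
    residuals.\<close>
  define src where "src = (\<lambda>(k::nat) I z. if k = 0 then - r1 I z - r2 I z else if k = 1 then r2 I z - r1 I z
     else if k = 2 then - r3 I z - r4 I z else (r4 I z - r3 I z :: real))"
  have ZZV: "BO True True S0 0 (ZZ Ix Vb I)" and ZZW: "BO True True S0 ga (ZZ Ix Wb I)" if "I \<in> Ix" for I
    unfolding ZZ_def[abs_def] using bo0 that by (auto intro!: BO_add BO_sum)
  have Pb: "BO True True S0 ga (Pb I)" and Mb: "BO True True S0 ga (Mb I)" if "I \<in> Ix" for I
    unfolding Pb_def Mb_def using bo0[OF that] by (auto intro!: BO_add BO_diff R0)
  have ZP: "BO True True S0 0 (ZPb I)" and ZM: "BO True True S0 0 (ZMb I)" if "I \<in> Ix" for I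
  proof -
    have w0: "BO True True S0 0 (ZZ Ix Wb I)" using BO_weaken[OF ZZW[OF that] R0] ga by simp
    show "BO True True S0 0 (ZPb I)" "BO True True S0 0 (ZMb I)"
      unfolding ZPb_def ZMb_def using ZZV[OF that] w0 R0
      by (auto intro!: BO_add BO_diff BO_const simp del: )
  qed
  have src: "BO True True S0 mu (src k I)" if "I \<in> Ix" for k I
  proof -
    have "BO True True S0 mu (\<lambda>z. - r1 I z - r2 I z)" "BO True True S0 mu (\<lambda>z. r2 I z - r1 I z)"
      "BO True True S0 mu (\<lambda>z. - r3 I z - r4 I z)" "BO True True S0 mu (\<lambda>z. r4 I z - r3 I z)"
      by (intro BO_diff BO_minus bo0 R0 that)+
    then show ?thesis unfolding src_def by (cases "k = 0"; cases "k = 1"; cases "k = 2") simp_all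
  qed
  have "\<forall>k I. \<exists>C. I \<in> Ix \<longrightarrow> (\<forall>z\<in>S0. \<bar>src k I z\<bar> \<le> C * fst z powr mu)"
    using BO_bound[OF src] by metis
  then obtain CF where "\<forall>k I. I \<in> Ix \<longrightarrow> (\<forall>z\<in>S0. \<bar>src k I z\<bar> \<le> CF k I * fst z powr mu)"
    by metis
  then have CF: "\<And>k I z. I \<in> Ix \<Longrightarrow> z \<in> S0 \<Longrightarrow> \<bar>src k I z\<bar> \<le> CF k I * fst z powr mu" by blast
  define F where "F = (\<Sum>I\<in>Ix. \<Sum>k\<le>3. \<bar>CF k I\<bar>)"
  have F: "\<bar>src k I z\<bar> \<le> F * fst z powr mu" if "I \<in> Ix" "z \<in> S0" "k \<le> 3" for k I z
  proof -
    have "CF k I \<le> \<bar>CF k I\<bar>" by simp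
    also have "\<dots> \<le> (\<Sum>k\<le>3. \<bar>CF k I\<bar>)" by (rule member_le_sum) (use that in auto)
    also have "\<dots> \<le> F" unfolding F_def by (rule member_le_sum[of I]) (use that fin in \<open>auto intro: sum_nonneg\<close>)
    finally have "CF k I * fst z powr mu \<le> F * fst z powr mu" by (intro mult_right_mono) auto
    then show ?thesis using CF[OF that(1,2), of k] by linarith
  qed
  have F0: "F \<ge> 0" unfolding F_def by (intro sum_nonneg) auto
  \<comment> \<open>Solves (1 - q) * mu * r = F + 1: F covers the sources themselves and 1 the
    higher coefficients of their jets.\<close>
  define r where "r = 2 * (F + 1) / (mu - 1)"
  have r: "r > 0" "(1 - q) * mu * r = F + 1" unfolding q r_def using F0 mu by (auto simp: field_simps)
  have "((\<lambda>T::real. r * T powr mu) \<longlongrightarrow> r * 0 powr mu) (at_right 0)"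
    by (rule tendsto_mult[OF tendsto_const tendsto_powr'[OF tendsto_ident_at tendsto_const]])
      (use mu in \<open>auto simp: eventually_at_filter\<close>)
  then have ev1: "\<forall>\<^sub>F T in at_right (0::real). r * T powr mu < s"
    using s(1) by (simp add: order_tendstoD(2))
  have ev2: "\<forall>\<^sub>F T in at_right 0. \<forall>I\<in>Ix. \<forall>x\<in>S0. 0 < fst x \<and> fst x < T \<longrightarrow> \<bar>Pb I x\<bar> \<le> s / 2"
    by (rule eventually_ball_finite[OF fin]) (rule ballI, rule eventually_small[OF BO_imp_Ob0[OF Pb] ga half_gt_zero[OF s(1)]])
  have ev3: "\<forall>\<^sub>F T in at_right 0. \<forall>I\<in>Ix. \<forall>x\<in>S0. 0 < fst x \<and> fst x < T \<longrightarrow> \<bar>Mb I x\<bar> \<le> s / 2"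
    by (rule eventually_ball_finite[OF fin]) (rule ballI, rule eventually_small[OF BO_imp_Ob0[OF Mb] ga half_gt_zero[OF s(1)]])
  \<comment> \<open>The bound 1/20 leaves room for jets: 7/20 from \<open>half\<close>, 1/20 here
    and 1/20 from higher coefficients stay below the admissible 1/2.\<close>
  have ev4: "\<forall>\<^sub>F T in at_right 0. \<forall>I\<in>Ix. \<forall>x\<in>S0. 0 < fst x \<and> fst x < T \<longrightarrow> \<bar>ZZ Ix Wb I x\<bar> \<le> 1 / 20"
    by (rule eventually_ball_finite[OF fin]) (rule ballI, rule eventually_small[OF BO_imp_Ob0[OF ZZW] ga], simp_all)
  have ev5: "\<forall>\<^sub>F T in at_right (0::real). T < T0"
    using T0 by (intro order_tendstoD(2)[OF tendsto_ident_at]) auto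
  have ev6: "\<forall>\<^sub>F T in at_right (0::real). 0 < T" by (rule eventually_at_right_less)
  have "\<forall>\<^sub>F T in at_right (0::real). 0 < T \<and> T < T0 \<and> r * T powr mu < s
      \<and> (\<forall>I\<in>Ix. \<forall>x\<in>S0. 0 < fst x \<and> fst x < T \<longrightarrow> \<bar>Pb I x\<bar> \<le> s / 2)
      \<and> (\<forall>I\<in>Ix. \<forall>x\<in>S0. 0 < fst x \<and> fst x < T \<longrightarrow> \<bar>Mb I x\<bar> \<le> s / 2)
      \<and> (\<forall>I\<in>Ix. \<forall>x\<in>S0. 0 < fst x \<and> fst x < T \<longrightarrow> \<bar>ZZ Ix Wb I x\<bar> \<le> 1 / 20)"
    using ev1 ev2 ev3 ev4 ev5 ev6 by eventually_elim blast
  then have "\<exists>T::real. 0 < T \<and> T < T0 \<and> r * T powr mu < s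
      \<and> (\<forall>I\<in>Ix. \<forall>x\<in>S0. 0 < fst x \<and> fst x < T \<longrightarrow> \<bar>Pb I x\<bar> \<le> s / 2)
      \<and> (\<forall>I\<in>Ix. \<forall>x\<in>S0. 0 < fst x \<and> fst x < T \<longrightarrow> \<bar>Mb I x\<bar> \<le> s / 2)
      \<and> (\<forall>I\<in>Ix. \<forall>x\<in>S0. 0 < fst x \<and> fst x < T \<longrightarrow> \<bar>ZZ Ix Wb I x\<bar> \<le> 1 / 20)"
    by (rule eventually_happens'[OF trivial_limit_at_right_real])
  then obtain T where T0': "0 < T" "T < T0" "r * T powr mu < s"
      "\<forall>I\<in>Ix. \<forall>x\<in>S0. 0 < fst x \<and> fst x < T \<longrightarrow> \<bar>Pb I x\<bar> \<le> s / 2"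
      "\<forall>I\<in>Ix. \<forall>x\<in>S0. 0 < fst x \<and> fst x < T \<longrightarrow> \<bar>Mb I x\<bar> \<le> s / 2"
      "\<forall>I\<in>Ix. \<forall>x\<in>S0. 0 < fst x \<and> fst x < T \<longrightarrow> \<bar>ZZ Ix Wb I x\<bar> \<le> 1 / 20"
    by (elim exE conjE)
  note T = T0'(1-3) T0'(4-6)[rule_format]
  define S where "S = Tri c L T"
  have SS: "S \<subseteq> S0" unfolding S_def S0_def using T by (intro Tri_mono) simp
  have bS: "backward_closed S" unfolding S_def using T T0 by (intro backward_closed_Tri) simp
  have R: "region S" using bS by (rule backward_closed_region)
  have St: "0 < fst x \<and> fst x < T" if "x \<in> S" for x using that by (auto simp: S_def Tri_def)
  define Is where "Is = Ix \<times> {0, 1, 2, 3::nat}"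
  define lam :: "'i \<times> nat \<Rightarrow> real" where "lam = (\<lambda>i. if snd i = 0 \<or> snd i = 2 then 1 else - 1)"
  define G where "G = (\<lambda>i x w. Gchar Ix (\<lambda>I. jet (Pb I) x) (\<lambda>I. jet (Mb I) x) (\<lambda>I. jet (ZPb I) x) (\<lambda>I. jet (ZMb I) x)
      (\<lambda>k I. jet (src k I) x) (fst i, snd i) w)"
  note mono = BO_subset[OF _ SS]
  have powr_small: "r * fst x powr mu \<le> s" if "x \<in> S" for x
  proof -
    have "r * fst x powr mu \<le> r * T powr mu" using St[OF that] mu r by (intro mult_left_mono powr_mono2) auto
    then show ?thesis using T(3) by simp
  qed
  have est: "\<exists>\<eta>>0. \<forall>i\<in>Is. \<forall>x\<in>S. fnorm m \<eta> (G i x (\<lambda>_. 0)) \<le> (1 - q) * mu * r * fst x powr mu \<and>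
        (\<forall>w w' d. (\<forall>j\<in>Is. fnorm m \<eta> (w j) \<le> r * fst x powr mu \<and> fnorm m \<eta> (w' j) \<le> r * fst x powr mu
            \<and> fnorm m \<eta> (w j - w' j) \<le> d) \<longrightarrow> fnorm m \<eta> (G i x w - G i x w') \<le> q * mu * d)" for m
  proof -
    have s2: "s / 2 > 0" using s by simp
    have a: "\<forall>\<^sub>F \<eta> in at_right 0. \<forall>I\<in>Ix. \<forall>x\<in>S. fnorm m \<eta> (jet (Pb I) x) \<le> \<bar>Pb I x\<bar> + s / 2 * fst x powr ga"
      by (rule eventually_ball_finite[OF fin]) (rule ballI, rule eventually_fnorm_jet[OF mono[OF Pb] R s2])
    have b: "\<forall>\<^sub>F \<eta> in at_right 0. \<forall>I\<in>Ix. \<forall>x\<in>S. fnorm m \<eta> (jet (Mb I) x) \<le> \<bar>Mb I x\<bar> + s / 2 * fst x powr ga"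
      by (rule eventually_ball_finite[OF fin]) (rule ballI, rule eventually_fnorm_jet[OF mono[OF Mb] R s2])
    have cc: "\<forall>\<^sub>F \<eta> in at_right 0. \<forall>I\<in>Ix. \<forall>x\<in>S. fnorm m \<eta> (jet (ZPb I) x) \<le> \<bar>ZPb I x\<bar> + 1 / 20 * fst x powr 0"
      by (rule eventually_ball_finite[OF fin]) (rule ballI, rule eventually_fnorm_jet[OF mono[OF ZP] R], simp_all)
    have d: "\<forall>\<^sub>F \<eta> in at_right 0. \<forall>I\<in>Ix. \<forall>x\<in>S. fnorm m \<eta> (jet (ZMb I) x) \<le> \<bar>ZMb I x\<bar> + 1 / 20 * fst x powr 0"
      by (rule eventually_ball_finite[OF fin]) (rule ballI, rule eventually_fnorm_jet[OF mono[OF ZM] R], simp_all)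
    have e: "\<forall>\<^sub>F \<eta> in at_right 0. \<forall>I\<in>Ix. \<forall>k\<in>{..3}. \<forall>x\<in>S. fnorm m \<eta> (jet (src k I) x) \<le> \<bar>src k I x\<bar> + 1 * fst x powr mu"
      by (rule eventually_ball_finite[OF fin], rule ballI, rule eventually_ball_finite[OF finite_atMost], rule ballI)
        (rule eventually_fnorm_jet[OF mono[OF src] R], simp_all)
    have "\<forall>\<^sub>F \<eta> in at_right (0::real). 0 < \<eta>" by (rule eventually_at_right_less)
    with a b cc d e have "\<forall>\<^sub>F \<eta> in at_right (0::real). 0 < \<eta> \<and>
       (\<forall>I\<in>Ix. \<forall>x\<in>S. fnorm m \<eta> (jet (Pb I) x) \<le> \<bar>Pb I x\<bar> + s / 2 * fst x powr ga) \<and>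
       (\<forall>I\<in>Ix. \<forall>x\<in>S. fnorm m \<eta> (jet (Mb I) x) \<le> \<bar>Mb I x\<bar> + s / 2 * fst x powr ga) \<and>
       (\<forall>I\<in>Ix. \<forall>x\<in>S. fnorm m \<eta> (jet (ZPb I) x) \<le> \<bar>ZPb I x\<bar> + 1 / 20 * fst x powr 0) \<and>
       (\<forall>I\<in>Ix. \<forall>x\<in>S. fnorm m \<eta> (jet (ZMb I) x) \<le> \<bar>ZMb I x\<bar> + 1 / 20 * fst x powr 0) \<and>
       (\<forall>I\<in>Ix. \<forall>k\<in>{..3}. \<forall>x\<in>S. fnorm m \<eta> (jet (src k I) x) \<le> \<bar>src k I x\<bar> + 1 * fst x powr mu)"
      by eventually_elim blast
    then have "\<exists>\<eta>::real. 0 < \<eta> \<and>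
       (\<forall>I\<in>Ix. \<forall>x\<in>S. fnorm m \<eta> (jet (Pb I) x) \<le> \<bar>Pb I x\<bar> + s / 2 * fst x powr ga) \<and>
       (\<forall>I\<in>Ix. \<forall>x\<in>S. fnorm m \<eta> (jet (Mb I) x) \<le> \<bar>Mb I x\<bar> + s / 2 * fst x powr ga) \<and>
       (\<forall>I\<in>Ix. \<forall>x\<in>S. fnorm m \<eta> (jet (ZPb I) x) \<le> \<bar>ZPb I x\<bar> + 1 / 20 * fst x powr 0) \<and>
       (\<forall>I\<in>Ix. \<forall>x\<in>S. fnorm m \<eta> (jet (ZMb I) x) \<le> \<bar>ZMb I x\<bar> + 1 / 20 * fst x powr 0) \<and>
       (\<forall>I\<in>Ix. \<forall>k\<in>{..3}. \<forall>x\<in>S. fnorm m \<eta> (jet (src k I) x) \<le> \<bar>src k I x\<bar> + 1 * fst x powr mu)"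
      by (rule eventually_happens'[OF trivial_limit_at_right_real])
    then obtain \<eta> where E: "0 < \<eta>"
       "\<forall>I\<in>Ix. \<forall>x\<in>S. fnorm m \<eta> (jet (Pb I) x) \<le> \<bar>Pb I x\<bar> + s / 2 * fst x powr ga"
       "\<forall>I\<in>Ix. \<forall>x\<in>S. fnorm m \<eta> (jet (Mb I) x) \<le> \<bar>Mb I x\<bar> + s / 2 * fst x powr ga"
       "\<forall>I\<in>Ix. \<forall>x\<in>S. fnorm m \<eta> (jet (ZPb I) x) \<le> \<bar>ZPb I x\<bar> + 1 / 20 * fst x powr 0"
       "\<forall>I\<in>Ix. \<forall>x\<in>S. fnorm m \<eta> (jet (ZMb I) x) \<le> \<bar>ZMb I x\<bar> + 1 / 20 * fst x powr 0"
       "\<forall>I\<in>Ix. \<forall>k\<in>{..3}. \<forall>x\<in>S. fnorm m \<eta> (jet (src k I) x) \<le> \<bar>src k I x\<bar> + 1 * fst x powr mu"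
      by (elim exE conjE)
    note eta = E(1) E(2-6)[rule_format]
    have pg: "s / 2 * fst x powr ga \<le> s / 2" if "x \<in> S" for x
    proof -
      have "fst x powr ga \<le> fst x powr 0" using St[OF that] T T0 ga by (intro powr_mono_01) auto
      then show ?thesis using s St[OF that] by simp
    qed
    have NP: "fnorm m \<eta> (jet (Pb I) x) \<le> s" "fnorm m \<eta> (jet (Mb I) x) \<le> s" if "I \<in> Ix" "x \<in> S" for I x
      using eta(2,3)[OF that] T(4,5)[OF that(1) subsetD[OF SS that(2)] St[OF that(2)]] pg[OF that(2)] by linarith+
    have NZ: "fnorm m \<eta> (jet (ZPb I) x) \<le> 1 / 2" "fnorm m \<eta> (jet (ZMb I) x) \<le> 1 / 2" if "I \<in> Ix" "x \<in> S" for I x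
    proof -
      have x0: "fst x powr 0 = 1" using St[OF that(2)] by simp
      have z: "\<bar>ZZ Ix Vb I x - 1 / 2\<bar> \<le> 7 / 20" using half[OF that(1)] subsetD[OF SS that(2)] unfolding S0_def by blast
      have z': "\<bar>ZZ Ix Wb I x\<bar> \<le> 1 / 20" using T(6)[OF that(1) subsetD[OF SS that(2)] St[OF that(2)]] .
      have "\<bar>ZPb I x\<bar> \<le> 2 / 5" "\<bar>ZMb I x\<bar> \<le> 2 / 5" using z z' unfolding ZPb_def ZMb_def by linarith+
      then show "fnorm m \<eta> (jet (ZPb I) x) \<le> 1 / 2" "fnorm m \<eta> (jet (ZMb I) x) \<le> 1 / 2"
        using eta(4,5)[OF that] x0 by auto
    qed
    show ?thesis
    proof (intro exI[of _ \<eta>] conjI ballI allI impI eta(1))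
      fix i x assume i: "i \<in> Is" and x: "x \<in> S"
      obtain I k where ik: "i = (I, k)" "I \<in> Ix" "k \<in> {0, 1, 2, 3}" using i by (auto simp: Is_def)
      then have k3: "k \<le> 3" "k \<in> {..3}" by auto
      have "fnorm m \<eta> (jet (src k I) x) \<le> F * fst x powr mu + 1 * fst x powr mu"
        using eta(6)[OF ik(2) k3(2) x] F[OF ik(2) subsetD[OF SS x] k3(1)] by linarith
      then show "fnorm m \<eta> (G i x (\<lambda>_. 0)) \<le> (1 - q) * mu * r * fst x powr mu"
        unfolding G_def ik fst_conv snd_conv Gchar_zero[OF ik(3)] r(2) by (simp add: distrib_right)
      fix w w' d
      assume h: "\<forall>j\<in>Is. fnorm m \<eta> (w j) \<le> r * fst x powr mu \<and> fnorm m \<eta> (w' j) \<le> r * fst x powr mu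
            \<and> fnorm m \<eta> (w j - w' j) \<le> d"
      have d0: "0 \<le> d" using h i fnorm_nonneg[OF less_imp_le[OF eta(1)], of m "w i - w' i"] by force
      have "fnorm m \<eta> (G i x w - G i x w') \<le> (1 + 3 * (real (card Ix) + 1) * s) * d"
        unfolding G_def ik fst_conv snd_conv
      proof (rule fnorm_Gchar_diff[OF less_imp_le[OF eta(1)] fin ik(2,3)])
        show "0 \<le> s" using s by simp
        fix j assume "j \<in> Ix \<times> {0, 1, 2, 3::nat}"
        then have j: "j \<in> Is" by (simp add: Is_def)
        show "fnorm m \<eta> (w j) \<le> s" "fnorm m \<eta> (w' j) \<le> s" "fnorm m \<eta> (w j - w' j) \<le> d"
          using h j powr_small[OF x] by (meson order_trans)+
      qed (use NP NZ ik x in auto)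
      also have "\<dots> \<le> (q * mu) * d"
        using s(3) d0 unfolding q(3) n1_def[symmetric] by (intro mult_right_mono) auto
      finally show "fnorm m \<eta> (G i x w - G i x w') \<le> q * mu * d" .
    qed
  qed
  have jetG: "isjet S (\<lambda>x. G i x (\<lambda>j. W j x))" if W: "\<And>j. j \<in> Is \<Longrightarrow> isjet S (W j)" and i: "i \<in> Is" for W i
  proof -
    have jP: "isjet S (jet (Pb I))" and jM: "isjet S (jet (Mb I))" and jZ: "isjet S (jet (ZPb I))"
      and jY: "isjet S (jet (ZMb I))" and jS: "isjet S (jet (src k I))" if "I \<in> Ix" for I k
      using isjet_jet[OF mono[OF Pb[OF that]] R] isjet_jet[OF mono[OF Mb[OF that]] R] isjet_jet[OF mono[OF ZP[OF that]] R]
        isjet_jet[OF mono[OF ZM[OF that]] R] isjet_jet[OF mono[OF src[OF that]] R] .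
    have W': "isjet S (W j)" if "j \<in> Ix \<times> {0, 1, 2, 3}" for j using W that unfolding Is_def by blast
    have i': "fst i \<in> Ix" using i unfolding Is_def by auto
    show ?thesis unfolding G_def by (rule isjet_Gchar[OF jP jM jZ jY jS W' i'])
  qed
  have lam1: "\<bar>lam i\<bar> \<le> 1" for i by (simp add: lam_def)
  obtain U where U: "\<And>i. i \<in> Is \<Longrightarrow> isjet S (U i)"
    "\<And>i m. i \<in> Is \<Longrightarrow> Ob0 True S mu (\<lambda>x. U i x $ m)"
    "\<And>i m. i \<in> Is \<Longrightarrow> Ob0 True S mu (\<lambda>x. G i x (\<lambda>j. U j x) $ m)"
    "\<And>i x. i \<in> Is \<Longrightarrow> x \<in> S \<Longrightarrow> U i x = Jfps (lam i) (\<lambda>y. G i y (\<lambda>j. U j y)) x"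
    using isjet_fixpoint[where G=G and Is=Is and lam=lam, OF bS mu q(1,2) less_imp_le[OF r(1)] lam1 jetG est] by blast
  define H where "H = (\<lambda>i x. G i x (\<lambda>j. U j x))"
  have oS: "open S" using R by (simp add: region_def)
  have UH: "Jfps (lam i) (H i) x = U i x" if "i \<in> Is" "x \<in> S" for i x
    unfolding H_def by (rule U(4)[OF that, symmetric])
  have eqU: "pder True S (\<lambda>x. U i x $ m) (\<lambda>x. H i x $ m + lam i * fst x * fps_deriv (U i x) $ m)" if i: "i \<in> Is" for i m
  proof -
    have "pder True S (\<lambda>x. Jfps (lam i) (H i) x $ m) (\<lambda>x. H i x $ m + lam i * fst x * fps_deriv (Jfps (lam i) (H i) x) $ m)"
      unfolding H_def by (rule isjet_Jfps(2)[OF jetG[OF U(1) i] U(3)[OF i] mu bS lam1])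
    then have "pder True S (\<lambda>x. U i x $ m) (\<lambda>x. H i x $ m + lam i * fst x * fps_deriv (Jfps (lam i) (H i) x) $ m)"
      by (rule pder_cong[OF _ oS]) (simp only: UH[OF i])
    then show ?thesis
      by (rule pder_cong_deriv) (simp only: UH[OF i])
  qed
  have BOU: "BO True True S mu (\<lambda>x. U i x $ m)" if i: "i \<in> Is" for i m
  proof (rule jet_solution_BO[OF R U(1,2) eqU _ i])
    fix n i assume W: "\<And>j. j \<in> Is \<Longrightarrow> FOb S n mu (U j)" and i: "i \<in> Is"
    have jP: "FOb S n 0 (jet (Pb I))" and jM: "FOb S n 0 (jet (Mb I))" if "I \<in> Ix" for I
      using FOb_jet[OF BO_weaken[OF mono[OF Pb[OF that]] R, of 0] R] FOb_jet[OF BO_weaken[OF mono[OF Mb[OF that]] R, of 0] R] ga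
      by simp_all
    have jZ: "FOb S n 0 (jet (ZPb I))" and jY: "FOb S n 0 (jet (ZMb I))" and jS: "FOb S n mu (jet (src k I))" if "I \<in> Ix" for I k
      using FOb_jet[OF mono[OF ZP[OF that]] R] FOb_jet[OF mono[OF ZM[OF that]] R] FOb_jet[OF mono[OF src[OF that]] R] .
    have W': "FOb S n mu (U j)" if "j \<in> Ix \<times> {0, 1, 2, 3}" for j using W that unfolding Is_def by blast
    have i': "fst i \<in> Ix" using i unfolding Is_def by auto
    have mu0: "mu \<ge> 0" using mu by simp
    show "FOb S n mu (H i)"
      unfolding H_def G_def by (rule FOb_Gchar[OF R mu0 jP jM jZ jY jS W' i'])
  qed
  \<comment> \<open>Coefficient 0 of each jet is the actual solution; the higher coefficients have
    served to bound its theta-derivatives.\<close>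
  define u where "u = (\<lambda>k I x. U (I, k) x $ 0)"
  have BOu: "BO True True S mu (u k I)" if "I \<in> Ix" "k \<in> {0, 1, 2, 3}" for k I
    unfolding u_def using that by (intro BOU) (simp add: Is_def)
  have equ: "pder True S (u k I) (\<lambda>x. H (I, k) x $ 0 + lam (I, k) * fst x * dth (u k I) x)"
    if "I \<in> Ix" "k \<in> {0, 1, 2, 3}" for k I
  proof -
    have i: "(I, k) \<in> Is" using that by (simp add: Is_def)
    have "pder False S (\<lambda>x. U (I, k) x $ 0) (\<lambda>x. fps_deriv (U (I, k) x) $ 0)"
      using U(1)[OF i] unfolding isjet_def by blast
    then have "dth (u k I) x = fps_deriv (U (I, k) x) $ 0" if "x \<in> S" for x
      unfolding u_def using that by (rule pder_False_dth)
    then show ?thesis using pder_cong_deriv[OF eqU[OF i, of 0]] unfolding u_def by simp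
  qed
  define v where "v = (\<lambda>I x. (u 0 I x + u 1 I x) / 2)"
  define w where "w = (\<lambda>I x. (u 0 I x - u 1 I x) / 2)"
  define xx where "xx = (\<lambda>I x. (u 2 I x + u 3 I x) / 2)"
  define yy where "yy = (\<lambda>I x. (u 2 I x - u 3 I x) / 2)"
  have halfBO: "BO True True S mu (\<lambda>x. f x / 2)" if "BO True True S mu f" for f
    using BO_cmult[OF that R, of "1 / 2"] by simp
  have BOv: "BO True True S mu (v I)" "BO True True S mu (w I)" "BO True True S mu (xx I)" "BO True True S mu (yy I)" if "I \<in> Ix" for I
    unfolding v_def w_def xx_def yy_def using BOu[OF that] by (auto intro!: halfBO BO_add BO_diff R)
  have dthu: "dth (\<lambda>x. (u k I x + u k' I x) / 2) x = (dth (u k I) x + dth (u k' I) x) / 2"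
      "dth (\<lambda>x. (u k I x - u k' I x) / 2) x = (dth (u k I) x - dth (u k' I) x) / 2"
    if "I \<in> Ix" "k \<in> {0, 1, 2, 3}" "k' \<in> {0, 1, 2, 3}" "x \<in> S" for I k k' x
  proof -
    have "pder False S (\<lambda>x. (1 / 2) * (u k I x + u k' I x)) (\<lambda>x. (1 / 2) * (dth (u k I) x + dth (u k' I) x))"
      "pder False S (\<lambda>x. (1 / 2) * (u k I x - u k' I x)) (\<lambda>x. (1 / 2) * (dth (u k I) x - dth (u k' I) x))"
      by (intro pder_cmult pder_add pder_diff BO_dth(1)[OF BOu R] that)+
    from this[THEN pder_False_dth, OF that(4) ]
    show "dth (\<lambda>x. (u k I x + u k' I x) / 2) x = (dth (u k I) x + dth (u k' I) x) / 2"
      "dth (\<lambda>x. (u k I x - u k' I x) / 2) x = (dth (u k I) x - dth (u k' I) x) / 2" by simp_all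
  qed
  have zz: "ZZ Ix v I x + ZZ Ix w I x = (\<Sum>J\<in>Ix. u 0 J x) + u 0 I x" "ZZ Ix v I x - ZZ Ix w I x = (\<Sum>J\<in>Ix. u 1 J x) + u 1 I x" for I x
    unfolding ZZ_def v_def w_def
    by (simp_all add: sum.distrib[symmetric] sum_subtractf[symmetric] add_divide_distrib diff_divide_distrib)
  have H0: "H (I, 0) x $ 0 = src 0 I x + (u 0 I x - u 1 I x) / 2 - (Pb I x * u 3 I x + u 2 I x * Mb I x + u 2 I x * u 3 I x) / 2"
    "H (I, 1) x $ 0 = src 1 I x - (u 0 I x - u 1 I x) / 2 - (Pb I x * u 3 I x + u 2 I x * Mb I x + u 2 I x * u 3 I x) / 2"
    "H (I, 2) x $ 0 = src 2 I x + u 2 I x / 2 + ZPb I x * u 3 I x + ((\<Sum>J\<in>Ix. u 0 J x) + u 0 I x) * Mb I x + ((\<Sum>J\<in>Ix. u 0 J x) + u 0 I x) * u 3 I x"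
    "H (I, 3) x $ 0 = src 3 I x + u 3 I x / 2 + ZMb I x * u 2 I x + ((\<Sum>J\<in>Ix. u 1 J x) + u 1 I x) * Pb I x + ((\<Sum>J\<in>Ix. u 1 J x) + u 1 I x) * u 2 I x" for I x
    unfolding H_def G_def Gchar_def Let_def wsum_def u_def by (simp_all add: fps_sum_nth)
  have lams: "lam (I, 0) = 1" "lam (I, 1) = -1" "lam (I, 2) = 1" "lam (I, 3) = -1" for I by (simp_all add: lam_def)
  have dsum: "dth (\<lambda>z. Fb z + f z) x = dth Fb x + dth f x" if "BO True True S0 a Fb" "BO True True S mu f" "x \<in> S" for Fb f a x
    using pder_False_dth[OF pder_add[OF BO_dth(1)[OF mono[OF that(1)] R] BO_dth(1)[OF that(2) R]] that(3)] .
  have half_pder: "pder True S (\<lambda>x. f x / 2) (\<lambda>x. f' x / 2)" if "pder True S f f'" for f f'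
    using pder_cmult[OF that, of "1 / 2"] by simp
  have ZZadd: "ZZ Ix (\<lambda>I z. A I z + B I z) I x = ZZ Ix A I x + ZZ Ix B I x" for A B :: "'i \<Rightarrow> real \<times> real \<Rightarrow> real" and I x
    by (simp add: ZZ_def sum.distrib)
  have fr: "frame Ix S (\<lambda>I z. Vb I z + v I z) (\<lambda>I z. Wb I z + w I z) (\<lambda>I z. Xb I z + xx I z) (\<lambda>I z. Yb I z + yy I z)"
    unfolding frame_def
  proof (intro ballI conjI)
    fix I assume I: "I \<in> Ix"
    have k: "0 \<in> {0, 1, 2, 3::nat}" "1 \<in> {0, 1, 2, 3::nat}" "2 \<in> {0, 1, 2, 3::nat}" "3 \<in> {0, 1, 2, 3::nat}" by simp_all
    note p = equ[OF I k(1)] equ[OF I k(2)] equ[OF I k(3)] equ[OF I k(4)]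
    have pv1: "pder True S (v I) (\<lambda>x. ((H (I, 0) x $ 0 + lam (I, 0) * fst x * dth (u 0 I) x) + (H (I, 1) x $ 0 + lam (I, 1) * fst x * dth (u 1 I) x)) / 2)"
      unfolding v_def by (rule half_pder[OF pder_add[OF p(1) p(2)]])
    have pv2: "pder True S (w I) (\<lambda>x. ((H (I, 0) x $ 0 + lam (I, 0) * fst x * dth (u 0 I) x) - (H (I, 1) x $ 0 + lam (I, 1) * fst x * dth (u 1 I) x)) / 2)"
      unfolding w_def by (rule half_pder[OF pder_diff[OF p(1) p(2)]])
    have pv3: "pder True S (xx I) (\<lambda>x. ((H (I, 2) x $ 0 + lam (I, 2) * fst x * dth (u 2 I) x) + (H (I, 3) x $ 0 + lam (I, 3) * fst x * dth (u 3 I) x)) / 2)"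
      unfolding xx_def by (rule half_pder[OF pder_add[OF p(3) p(4)]])
    have pv4: "pder True S (yy I) (\<lambda>x. ((H (I, 2) x $ 0 + lam (I, 2) * fst x * dth (u 2 I) x) - (H (I, 3) x $ 0 + lam (I, 3) * fst x * dth (u 3 I) x)) / 2)"
      unfolding yy_def by (rule half_pder[OF pder_diff[OF p(3) p(4)]])
    note dd = dsum[OF bo0(1)[OF I] BOv(1)[OF I]] dsum[OF bo0(2)[OF I] BOv(2)[OF I]] dsum[OF bo0(3)[OF I] BOv(3)[OF I]] dsum[OF bo0(4)[OF I] BOv(4)[OF I]]
    have du: "dth (v I) x = (dth (u 0 I) x + dth (u 1 I) x) / 2" "dth (w I) x = (dth (u 0 I) x - dth (u 1 I) x) / 2"
      "dth (xx I) x = (dth (u 2 I) x + dth (u 3 I) x) / 2" "dth (yy I) x = (dth (u 2 I) x - dth (u 3 I) x) / 2" if "x \<in> S" for x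
      unfolding v_def w_def xx_def yy_def using dthu[OF I k(1,2) that] dthu[OF I k(3,4) that] .
    have uv: "u 0 I x = v I x + w I x" "u 1 I x = v I x - w I x" "u 2 I x = xx I x + yy I x" "u 3 I x = xx I x - yy I x" for x
      by (simp_all add: v_def w_def xx_def yy_def field_simps)
    have srcs: "src 0 I x = - r1 I x - r2 I x" "src 1 I x = r2 I x - r1 I x" "src 2 I x = - r3 I x - r4 I x" "src 3 I x = r4 I x - r3 I x" for x
      by (simp_all add: src_def)
    note rules = dd du H0[unfolded zz[symmetric]] lams srcs Pb_def Mb_def ZPb_def ZMb_def ZZadd uv
    show "pder True S (\<lambda>z. Vb I z + v I z) (\<lambda>x. fst x * dth (\<lambda>z. Wb I z + w I z) x - ((Xb I x + xx I x)\<^sup>2 - (Yb I x + yy I x)\<^sup>2) / 2)"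
      by (rule pder_cong_deriv[OF pder_add[OF pder_subset[OF eq1[OF I, folded S0_def] SS] pv1]], simp only: rules)
        (simp add: power2_eq_square field_simps)
    show "pder True S (\<lambda>z. Wb I z + w I z) (\<lambda>x. fst x * dth (\<lambda>z. Vb I z + v I z) x + (Wb I x + w I x))"
      by (rule pder_cong_deriv[OF pder_add[OF pder_subset[OF eq2[OF I, folded S0_def] SS] pv2]], simp only: rules)
        (simp add: power2_eq_square field_simps)
    show "pder True S (\<lambda>z. Xb I z + xx I z) (\<lambda>x. fst x * dth (\<lambda>z. Yb I z + yy I z) x + ZZ Ix (\<lambda>I z. Vb I z + v I z) I x * (Xb I x + xx I x) - ZZ Ix (\<lambda>I z. Wb I z + w I z) I x * (Yb I x + yy I x))"
      by (rule pder_cong_deriv[OF pder_add[OF pder_subset[OF eq3[OF I, folded S0_def] SS] pv3]], simp only: rules)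
        (simp add: power2_eq_square field_simps)
    show "pder True S (\<lambda>z. Yb I z + yy I z) (\<lambda>x. fst x * dth (\<lambda>z. Xb I z + xx I z) x + (Yb I x + yy I x) - ZZ Ix (\<lambda>I z. Vb I z + v I z) I x * (Yb I x + yy I x) + ZZ Ix (\<lambda>I z. Wb I z + w I z) I x * (Xb I x + xx I x))"
      by (rule pder_cong_deriv[OF pder_add[OF pder_subset[OF eq4[OF I, folded S0_def] SS] pv4]], simp only: rules)
        (simp add: power2_eq_square field_simps)
  qed
  show ?thesis
    by (rule that[of T v w xx yy]) (use T BOv fr in \<open>auto simp: S_def\<close>)
qed

subsection \<open>From the first order system to the second order system\<close>

text \<open>The mixed derivative is assumed in one order only. On a time interval inside S, f is an
  integral of ft / q; differentiation under the integral sign and the fundamental theorem yield the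
  other order.\<close>

lemma clairaut:
  assumes S: "open S" "\<And>x. x \<in> S \<Longrightarrow> 0 < fst x"
    and ft: "pder True S f ft" and fy: "pder False S f fy" and fty: "pder False S ft fty"
    and ct: "continuous_on S ft" and cty: "continuous_on S fty"
  shows "pder True S fy fty"
  unfolding pder_def
proof
  fix x assume x: "x \<in> S"
  obtain r where r: "r > 0" "\<And>s y. \<bar>s - fst x\<bar> < r \<Longrightarrow> \<bar>y - snd x\<bar> < r \<Longrightarrow> (s, y) \<in> S"
    using region_slice[OF S(1) x] by metis
  define t0 where "t0 = fst x - r / 2"
  define t1 where "t1 = fst x + r / 2"
  define U where "U = {snd x - r<..<snd x + r}"
  have xU: "snd x \<in> U" using r by (simp add: U_def)
  have inS: "(s, y) \<in> S" if "s \<in> {t0..t1}" "y \<in> U" for s y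
    by (rule r(2)) (use that r(1) in \<open>auto simp: U_def t0_def t1_def abs_less_iff\<close>)
  have pos: "0 < s" if "s \<in> {t0..t1}" for s using S(2)[OF inS[OF that xU]] by simp
  have main: "fy (s, snd x) - fy (t0, snd x) = integral {t0..s} (\<lambda>q. fty (q, snd x) / q)" if s: "s \<in> {t0..t1}" for s
  proof -
    have sub: "q \<in> {t0..t1}" if "q \<in> {t0..s}" for q using that s by auto
    have "((\<lambda>q. ft (q, y) / q) has_integral (f (s, y) - f (t0, y))) {t0..s}" if y: "y \<in> U" for y
    proof (rule fundamental_theorem_of_calculus)
      fix q assume q: "q \<in> {t0..s}"
      have "((\<lambda>q. f (q, y)) has_real_derivative inverse q * ft (q, y)) (at q)"
        using ft inS[OF sub[OF q] y] unfolding pder_def line_def crd_def wt_def by force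
      then show "((\<lambda>q. f (q, y)) has_vector_derivative ft (q, y) / q) (at q within {t0..s})"
        by (simp add: has_real_derivative_iff_has_vector_derivative[symmetric] divide_inverse mult.commute
            has_field_derivative_at_within)
    qed (use s in simp)
    then have int: "integral (cbox t0 s) (\<lambda>q. ft (q, y) / q) = f (s, y) - f (t0, y)" if "y \<in> U" for y
      using integral_unique that by auto
    have "((\<lambda>y. integral (cbox t0 s) (\<lambda>q. ft (q, y) / q)) has_field_derivative integral (cbox t0 s) (\<lambda>q. fty (q, snd x) / q)) (at (snd x) within U)"
    proof (rule leibniz_rule_field_derivative)
      fix y q assume y: "y \<in> U" and q: "q \<in> cbox t0 s"
      have "((\<lambda>y. ft (q, y)) has_real_derivative fty (q, y)) (at y)"
        using fty inS[OF sub y] q unfolding pder_def line_def crd_def wt_def by force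
      then have "((\<lambda>y. ft (q, y) / q) has_real_derivative fty (q, y) / q) (at y)" by (rule DERIV_cdivide)
      then show "((\<lambda>y. ft (q, y) / q) has_real_derivative fty (q, y) / q) (at y within U)"
        by (rule has_field_derivative_at_within)
    next
      fix y assume y: "y \<in> U"
      have "continuous_on (cbox t0 s) (\<lambda>q. ft (q, y))"
        by (rule continuous_on_compose2[OF ct]) (use inS sub y in \<open>auto intro!: continuous_intros\<close>)
      then have "continuous_on (cbox t0 s) (\<lambda>q. ft (q, y) / q)"
        using pos sub by (intro continuous_intros) force+
      then show "(\<lambda>q. ft (q, y) / q) integrable_on cbox t0 s" by (rule integrable_continuous)
    next
      have "continuous_on (U \<times> cbox t0 s) (\<lambda>z. fty (snd z, fst z))"
        by (rule continuous_on_compose2[OF cty]) (use inS sub in \<open>auto intro!: continuous_intros\<close>)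
      then have "continuous_on (U \<times> cbox t0 s) (\<lambda>z. fty (snd z, fst z) / snd z)"
        using pos sub by (intro continuous_intros) force+
      then show "continuous_on (U \<times> cbox t0 s) (\<lambda>(y, q). fty (q, y) / q)" by (simp add: case_prod_beta)
    next
      show "convex U" unfolding U_def by (rule convex_real_interval)
    qed (rule xU)
    then have 1: "((\<lambda>y. integral (cbox t0 s) (\<lambda>q. ft (q, y) / q)) has_real_derivative integral (cbox t0 s) (\<lambda>q. fty (q, snd x) / q)) (at (snd x))"
      using at_within_open[of "snd x" U] xU by (simp add: U_def)
    have ev: "\<forall>\<^sub>F y in nhds (snd x). integral (cbox t0 s) (\<lambda>q. ft (q, y) / q) = f (s, y) - f (t0, y)"
      using eventually_nhds_in_open[of U "snd x"] xU int by (auto simp: U_def elim: eventually_mono)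
    have 2: "((\<lambda>y. f (s, y) - f (t0, y)) has_real_derivative integral (cbox t0 s) (\<lambda>q. fty (q, snd x) / q)) (at (snd x))"
      using 1 DERIV_cong_ev[OF refl ev refl] by blast
    have t0: "t0 \<in> {t0..t1}" using r by (simp add: t0_def t1_def)
    have "((\<lambda>y. f (q, y)) has_real_derivative fy (q, snd x)) (at (snd x))" if "q \<in> {t0..t1}" for q
      using fy inS[OF that xU] unfolding pder_def line_def crd_def wt_def by force
    then have 3: "((\<lambda>y. f (s, y) - f (t0, y)) has_real_derivative fy (s, snd x) - fy (t0, snd x)) (at (snd x))"
      using s t0 by (intro DERIV_diff) auto
    show ?thesis using DERIV_unique[OF 3 2] by simp
  qed
  have c: "continuous_on {t0..t1} (\<lambda>q. fty (q, snd x))"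
    by (rule continuous_on_compose2[OF cty]) (use inS xU in \<open>auto intro!: continuous_intros\<close>)
  have "continuous_on {t0..t1} (\<lambda>q. fty (q, snd x) / q)"
    using pos by (intro continuous_on_divide c continuous_on_id) force
  then have "((\<lambda>s. integral {t0..s} (\<lambda>q. fty (q, snd x) / q)) has_real_derivative fty (fst x, snd x) / fst x) (at (fst x) within {t0..t1})"
    by (rule integral_has_real_derivative) (use r in \<open>auto simp: t0_def t1_def\<close>)
  then have 4: "((\<lambda>s. integral {t0..s} (\<lambda>q. fty (q, snd x) / q)) has_real_derivative fty x / fst x) (at (fst x))"
    using r by (subst (asm) at_within_interior) (auto simp: t0_def t1_def)
  have "\<forall>\<^sub>F s in nhds (fst x). s \<in> {t0<..<t1}"
    using r by (intro eventually_nhds_in_open) (auto simp: t0_def t1_def)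
  then have ev: "\<forall>\<^sub>F s in nhds (fst x). integral {t0..s} (\<lambda>q. fty (q, snd x) / q) = fy (s, snd x) - fy (t0, snd x)"
    by eventually_elim (use main in auto)
  have "((\<lambda>s. fy (s, snd x) - fy (t0, snd x)) has_real_derivative fty x / fst x) (at (fst x))"
    using 4 DERIV_cong_ev[OF refl ev refl] by blast
  then have "((\<lambda>s. (fy (s, snd x) - fy (t0, snd x)) + fy (t0, snd x)) has_real_derivative fty x / fst x + 0) (at (fst x))"
    by (intro DERIV_add DERIV_const)
  then show "((\<lambda>s. fy (line True x s)) has_real_derivative wt True x * fty x) (at (crd True x))"
    by (simp add: line_def crd_def wt_def divide_inverse mult.commute)
qed

lemma BO_clairaut:
  assumes "BO True d S a f" "region S"
  shows "pder True S (dth f) (dth (Dop f))"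
  by (rule clairaut[OF _ _ BO_Dop(1)[OF assms] BO_dth(1)[OF assms] BO_dth(1)[OF BO_Dop(2)[OF assms] assms(2)]
      BO_cont[OF BO_Dop(2)[OF assms]] BO_cont[OF BO_dth(2)[OF BO_Dop(2)[OF assms] assms(2)]]])
    (use assms(2) in \<open>auto simp: region_def\<close>)

lemma pder_times_dth:
  assumes f: "BO True d S a f" and S: "region S" and eq: "\<And>x. x \<in> S \<Longrightarrow> Dop f x = g x" and g: "pder False S g g'"
  shows "pder True S (\<lambda>x. fst x * dth f x) (\<lambda>x. fst x * g' x + fst x * dth f x)"
proof -
  have d: "dth (Dop f) x = g' x" if "x \<in> S" for x
  proof (rule pder_False_dth[OF _ that])
    show "pder False S (Dop f) g'" using pder_cong[OF g] S eq by (simp add: region_def)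
  qed
  show ?thesis
    by (rule pder_cong_deriv[OF pder_mult[OF pder_fst[OF S] BO_clairaut[OF f S]]]) (simp add: d)
qed

lemma backward_slice: "backward_closed S \<Longrightarrow> x \<in> S \<Longrightarrow> 0 < s \<Longrightarrow> s \<le> fst x \<Longrightarrow> (s, snd x) \<in> S"
proof -
  assume a: "backward_closed S" "x \<in> S" "0 < s" "s \<le> fst x"
  then have "s / fst x \<in> {0<..1}" by simp
  then have "pt 0 x (s / fst x) \<in> S" using a unfolding backward_closed_def by force
  then show ?thesis using a by (simp add: pt_def)
qed

text \<open>A solution of \<open>Dop g = g\<close> is a multiple of \<open>t\<close> on each line, which the bound excludes.\<close>

lemma homogeneous_zero:
  assumes S: "backward_closed S" and g: "pder True S g g" and bd: "Ob0 True S a g" "a > 1" and x: "x \<in> S"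
  shows "g x = 0"
proof -
  obtain C where C: "C > 0" "\<And>y. y \<in> S \<Longrightarrow> \<bar>g y\<bar> \<le> C * fst y powr a" using Ob0_bound[OF bd(1)] by blast
  have x0: "0 < fst x" using backward_closed_region[OF S] x by (auto simp: region_def)
  have der: "((\<lambda>s. g (s, snd x) / s) has_field_derivative 0) (at s within {0<..fst x})" if s: "s \<in> {0<..fst x}" for s
  proof -
    have "((\<lambda>s. g (s, snd x)) has_real_derivative inverse s * g (s, snd x)) (at s)"
      using g backward_slice[OF S x, of s] s unfolding pder_def line_def crd_def wt_def by force
    then have "((\<lambda>s. g (s, snd x) / s) has_real_derivative (inverse s * g (s, snd x) * s - g (s, snd x) * 1) / (s * s)) (at s)"
      using s by (intro DERIV_divide DERIV_ident) auto
    moreover have "(inverse s * g (s, snd x) * s - g (s, snd x) * 1) / (s * s) = 0" using s by (simp add: field_simps)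
    ultimately have "((\<lambda>s. g (s, snd x) / s) has_real_derivative 0) (at s)" by (simp only:)
    then show ?thesis by (rule has_field_derivative_at_within)
  qed
  obtain k where k: "\<And>s. s \<in> {0<..fst x} \<Longrightarrow> g (s, snd x) / s = k"
    using has_field_derivative_zero_constant[OF convex_real_interval(6) der] by blast
  have eq: "g (s, snd x) / s = g x / fst x" if s: "0 < s" "s \<le> fst x" for s
    using k[of s] k[of "fst x"] s x0 by simp
  have "\<bar>g x / fst x\<bar> \<le> C * s powr (a - 1)" if s: "0 < s" "s \<le> fst x" for s
  proof -
    have "\<bar>g (s, snd x)\<bar> / s \<le> C * s powr a / s"
      using C(2)[OF backward_slice[OF S x s]] s by (intro divide_right_mono) auto
    moreover have "\<bar>g x / fst x\<bar> = \<bar>g (s, snd x)\<bar> / s"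
      unfolding eq[OF s, symmetric] abs_divide using s by simp
    moreover have "C * s powr a / s = C * s powr (a - 1)" using s by (simp add: powr_diff)
    ultimately show ?thesis by linarith
  qed
  note bound = this
  have ev: "\<forall>\<^sub>F s in at_right 0. \<bar>g x / fst x\<bar> \<le> C * s powr (a - 1)"
    using eventually_at_right_real[OF x0] by eventually_elim (use bound in simp)
  have "((\<lambda>s::real. s powr (a - 1)) \<longlongrightarrow> 0 powr (a - 1)) (at_right 0)"
    by (rule tendsto_powr'[OF tendsto_ident_at tendsto_const]) (use bd(2) in \<open>auto simp: eventually_at_filter\<close>)
  then have "((\<lambda>s::real. C * s powr (a - 1)) \<longlongrightarrow> C * 0 powr (a - 1)) (at_right 0)"
    by (rule tendsto_mult[OF tendsto_const])
  then have "((\<lambda>s::real. C * s powr (a - 1)) \<longlongrightarrow> 0) (at_right 0)" by simp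
  then have "\<bar>g x / fst x\<bar> \<le> 0"
    by (rule tendsto_lowerbound[OF _ ev trivial_limit_at_right_real])
  then have "g x / fst x = 0" by (simp only: abs_le_zero_iff)
  then show ?thesis using x0 by simp
qed

lemma pder_snd_const: "pder True S (\<lambda>x. f (snd x)) (\<lambda>x. 0)"
  unfolding pder_def line_def by simp

lemma pder_snd_powr:
  assumes "region S"
  shows "pder True S (\<lambda>x. a (snd x) * fst x powr h (snd x)) (\<lambda>x. h (snd x) * (a (snd x) * fst x powr h (snd x)))"
proof (rule pder_cong_deriv)
  have "pder True S (\<lambda>x. fst x powr h (snd x)) (\<lambda>x. (0 * ln (fst x) + h (snd x) * (if True then 1 else 0)) * fst x powr h (snd x))"
    by (rule pder_powr[OF pder_snd_const assms])
  from pder_mult[OF pder_snd_const this]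
  show "pder True S (\<lambda>x. a (snd x) * fst x powr h (snd x))
     (\<lambda>x. 0 * fst x powr h (snd x) + a (snd x) * ((0 * ln (fst x) + h (snd x) * (if True then 1 else 0)) * fst x powr h (snd x)))" .
qed simp

text \<open>Once the theta-derivatives of P and Q are identified as W / t and exp (PP) * Y / t, the
  equations for V and X are the two second order equations; the weights exp (PP) cancel.\<close>

lemma einstein_of_frame:
  assumes S: "region S"
    and P: "\<And>I. I \<in> {3..D-1} \<Longrightarrow> pder True S (P I) (V I)" "\<And>I. I \<in> {3..D-1} \<Longrightarrow> pder False S (P I) (\<lambda>x. W I x / fst x)"
    and Q: "\<And>I. I \<in> {3..D-1} \<Longrightarrow> pder True S (Q I) (\<lambda>x. exp (ZZ {3..D-1} P I x) * X I x)"
       "\<And>I. I \<in> {3..D-1} \<Longrightarrow> pder False S (Q I) (\<lambda>x. exp (ZZ {3..D-1} P I x) * Y I x / fst x)"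
    and fr: "frame {3..D-1} S V W X Y"
    and d: "\<And>I. I \<in> {3..D-1} \<Longrightarrow> pder False S (W I) (dth (W I))" "\<And>I. I \<in> {3..D-1} \<Longrightarrow> pder False S (Y I) (dth (Y I))"
    and I: "I \<in> {3..D-1}" and x: "x \<in> S"
  shows "einstein_sys D P Q I x"
proof -
  let ?Z = "\<lambda>y. (\<Sum>J = 3..D-1. P J y) + P I y"
  have oS: "open S" and t: "0 < fst x" using S x by (auto simp: region_def)
  have pos: "0 < fst y" if "y \<in> S" for y using S that by (auto simp: region_def)
  have Z: "?Z = ZZ {3..D-1} P I" by (simp add: ZZ_def fun_eq_iff)
  have ZT: "pder True S (ZZ {3..D-1} P I) (ZZ {3..D-1} V I)"
    unfolding ZZ_def[abs_def] by (intro pder_add pder_sum P I)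
  have ZF: "pder False S (ZZ {3..D-1} P I) (\<lambda>x. ZZ {3..D-1} W I x / fst x)"
    using pder_add[OF pder_sum[OF P(2), of "{3..D-1}" "\<lambda>i. i"] P(2)[OF I]]
    unfolding ZZ_def[abs_def] by (simp add: add_divide_distrib sum_divide_distrib)
  have divF: "pder False S (\<lambda>x. f x / fst x) (\<lambda>x. f' x / fst x)" if "pder False S f f'" for f f'
    using that unfolding pder_def line_def crd_def wt_def by (auto intro: DERIV_cdivide)
  note f = fr[unfolded frame_def, rule_format, OF I]
  have D1: "pder True S (Dop (P I)) (\<lambda>x. fst x * dth (W I) x - ((X I x)\<^sup>2 - (Y I x)\<^sup>2) / 2)"
    by (rule pder_cong[OF conjunct1[OF f] oS]) (simp add: pder_True_Dop[OF P(1)[OF I] _ pos])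
  have D2: "pder False S (dth (P I)) (\<lambda>x. dth (W I) x / fst x)"
    by (rule pder_cong[OF divF[OF d(1)[OF I]] oS]) (simp add: pder_False_dth[OF P(2)[OF I]])
  have X: "pder True S (X I) (\<lambda>x. fst x * dth (Y I) x + ZZ {3..D-1} V I x * X I x - ZZ {3..D-1} W I x * Y I x)"
    using f by blast
  have D3: "pder True S (Dop (Q I)) (\<lambda>x. ZZ {3..D-1} V I x * exp (ZZ {3..D-1} P I x) * X I x + exp (ZZ {3..D-1} P I x) * (fst x * dth (Y I) x + ZZ {3..D-1} V I x * X I x - ZZ {3..D-1} W I x * Y I x))"
    by (rule pder_cong[OF pder_mult[OF pder_exp[OF ZT] X] oS]) (simp add: pder_True_Dop[OF Q(1)[OF I] _ pos])
  have D4: "pder False S (dth (Q I)) (\<lambda>x. ((ZZ {3..D-1} W I x / fst x) * exp (ZZ {3..D-1} P I x) * Y I x + exp (ZZ {3..D-1} P I x) * dth (Y I) x) / fst x)"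
    by (rule pder_cong[OF divF[OF pder_mult[OF pder_exp[OF ZF] d(2)[OF I]]] oS]) (simp add: pder_False_dth[OF Q(2)[OF I]])
  note ev = pder_True_Dop[OF D1 x t] pder_False_dth[OF D2 x] pder_True_Dop[OF D3 x t] pder_False_dth[OF D4 x]
    pder_True_Dop[OF Q(1)[OF I] x t] pder_False_dth[OF Q(2)[OF I] x] pder_True_Dop[OF ZT x t] pder_False_dth[OF ZF x]
  have ex: "exp (- 2 * z) * (exp z * a)\<^sup>2 = a\<^sup>2" for z a :: real
    by (simp add: power_mult_distrib mult.assoc[symmetric] exp_double[symmetric] exp_add[symmetric])
  show ?thesis
    unfolding einstein_sys_def Let_def Z ev
  proof
    have e1: "fst x * dth (W I) x = (fst x)\<^sup>2 * (dth (W I) x / fst x)" using t by (simp add: power2_eq_square)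
    have "fst x * (exp (ZZ {3..D-1} P I x) * Y I x / fst x) = exp (ZZ {3..D-1} P I x) * Y I x" using t by simp
    then have "- 1 / 2 * exp (- 2 * ZZ {3..D-1} P I x) * ((exp (ZZ {3..D-1} P I x) * X I x)\<^sup>2 - (fst x * (exp (ZZ {3..D-1} P I x) * Y I x / fst x))\<^sup>2)
       = - 1 / 2 * ((X I x)\<^sup>2 - (Y I x)\<^sup>2)"
      by (simp only: mult.assoc right_diff_distrib ex)
    then show "fst x * dth (W I) x - ((X I x)\<^sup>2 - (Y I x)\<^sup>2) / 2 - (fst x)\<^sup>2 * (dth (W I) x / fst x) =
      - 1 / 2 * exp (- 2 * ZZ {3..D-1} P I x) * ((exp (ZZ {3..D-1} P I x) * X I x)\<^sup>2 - (fst x * (exp (ZZ {3..D-1} P I x) * Y I x / fst x))\<^sup>2)"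
      using e1 by simp
    show "ZZ {3..D-1} V I x * exp (ZZ {3..D-1} P I x) * X I x + exp (ZZ {3..D-1} P I x) * (fst x * dth (Y I) x + ZZ {3..D-1} V I x * X I x - ZZ {3..D-1} W I x * Y I x) -
      (fst x)\<^sup>2 * (((ZZ {3..D-1} W I x / fst x) * exp (ZZ {3..D-1} P I x) * Y I x + exp (ZZ {3..D-1} P I x) * dth (Y I) x) / fst x) =
      2 * (ZZ {3..D-1} V I x * (exp (ZZ {3..D-1} P I x) * X I x) - (fst x)\<^sup>2 * (ZZ {3..D-1} W I x / fst x) * (exp (ZZ {3..D-1} P I x) * Y I x / fst x))"
      using t by (simp add: power2_eq_square field_simps)
  qed
qed

lemma BO_regular:
  assumes "BO True True S a f" "a > 0" "region S" "\<Omega> = {0<..<T} \<times> {l<..<r}" "\<Omega> \<subseteq> S"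
  shows "regular_on \<Omega> f" "\<theta> \<in> {l<..<r} \<Longrightarrow> T > 0 \<Longrightarrow> ((\<lambda>t. f (t, \<theta>)) \<longlongrightarrow> 0) (at_right 0)"
proof -
  have op: "open \<Omega>" unfolding assms(4) by (intro open_Times) auto
  have R: "region \<Omega>" using assms(3,5) op unfolding region_def by blast
  have B: "BO True True \<Omega> a f" using BO_subset[OF assms(1,5)] .
  have cut: "\<Omega> \<inter> {x. fst x > 0} = \<Omega>" unfolding assms(4) by auto
  show "regular_on \<Omega> f"
    unfolding regular_on_def cut
  proof (intro conjI allI BO_imp_smooth2[OF B R])
    fix n :: nat
    \<comment> \<open>Multiplying by t raises the order to 1 + a > 1, so that
      \<open>cont_quotient\<close>, which divides by t again, gives the extension by 0 to t =
      0.\<close>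
    have "BO True True \<Omega> (1 + a) (\<lambda>x. fst x * (dth ^^ n) f x)"
      by (rule BO_mult[OF BO_fst[OF R] BO_dth_iter[OF B R] R]) simp
    then have "continuous_on (\<Omega> \<union> {x. fst x = 0}) (\<lambda>x. fst x * (dth ^^ n) f x / fst x)"
      by (intro cont_quotient[OF BO_imp_Ob0 _ R]) (use assms(2) in auto)
    then have "continuous_on (\<Omega> \<union> closure \<Omega> \<inter> {x. fst x = 0}) (\<lambda>x. fst x * (dth ^^ n) f x / fst x)"
      by (rule continuous_on_subset) auto
    then show "\<exists>g. continuous_on (\<Omega> \<union> closure \<Omega> \<inter> {x. fst x = 0}) g \<and> (\<forall>x\<in>\<Omega>. g x = (dth ^^ n) f x)"
      using R by (intro exI conjI) (auto simp: region_def)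
  qed
  assume th: "\<theta> \<in> {l<..<r}" and T: "T > 0"
  obtain C where C: "C > 0" "\<And>x. x \<in> \<Omega> \<Longrightarrow> \<bar>f x\<bar> \<le> C * fst x powr a" using BO_bound[OF B] by blast
  have lim: "((\<lambda>s::real. C * s powr a) \<longlongrightarrow> 0) (at_right 0)" by (rule powr_lim0[OF assms(2)])
  have "\<forall>\<^sub>F s in at_right 0. s \<in> {0<..<T}" using T by (rule eventually_at_right_real)
  then have "\<forall>\<^sub>F s in at_right 0. norm (f (s, \<theta>)) \<le> C * s powr a"
  proof eventually_elim
    case (elim s)
    then show ?case using C(2)[of "(s, \<theta>)"] th unfolding assms(4) by simp
  qed
  then show "((\<lambda>t. f (t, \<theta>)) \<longlongrightarrow> 0) (at_right 0)" using lim by (rule Lim_null_comparison)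
qed

subsection \<open>The approximate solution\<close>

text \<open>\<open>K I\<close> is the value of \<open>k\<^sub>I\<close> at the centre \<open>c\<close>; the margin \<open>e\<close> absorbs the logarithms created by
  differentiating \<open>t powr k\<^sub>I(\<theta>)\<close> and the oscillation of \<open>k\<^sub>I\<close>.\<close>

locale twisted =
  fixes D :: nat and p0 p1 q0 q1 :: "nat \<Rightarrow> real \<Rightarrow> real" and eps :: "nat \<Rightarrow> real"
    and c L e :: real and K :: "nat \<Rightarrow> real"
  assumes sm: "\<And>I. I \<in> {3..D-1} \<Longrightarrow> smooth1 (p0 I)" "\<And>I. I \<in> {3..D-1} \<Longrightarrow> smooth1 (p1 I)"
      "\<And>I. I \<in> {3..D-1} \<Longrightarrow> smooth1 (q0 I)" "\<And>I. I \<in> {3..D-1} \<Longrightarrow> smooth1 (q1 I)"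
    and L: "0 < L" and e: "0 < e" "e < 1 / 60"
    and kK: "\<And>I \<theta>. I \<in> {3..D-1} \<Longrightarrow> \<bar>\<theta> - c\<bar> < L \<Longrightarrow> \<bar>kI D p0 I \<theta> - K I\<bar> \<le> e"
    and m1: "\<And>I. I \<in> {3..D-1} \<Longrightarrow> 1 / 2 + 10 * e < K I" and m2: "\<And>I. I \<in> {3..D-1} \<Longrightarrow> K I < 5 / 6 - 10 * e"
    and m3: "\<And>I J. I \<in> {3..D-1} \<Longrightarrow> J \<in> {3..D-1} \<Longrightarrow> eps J + 10 * e < 2 * K I - 1"
    and m4: "\<And>I J. I \<in> {3..D-1} \<Longrightarrow> J \<in> {3..D-1} \<Longrightarrow> eps J + 10 * e < 2 - 2 * K I"
    and m5: "\<And>J. J \<in> {3..D-1} \<Longrightarrow> 10 * e < 2 - 2 * K J + eps J"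
begin

abbreviation "Ix \<equiv> {3..D-1}"
abbreviation "S0 \<equiv> Tri c L 1"

text \<open>Inserting \<open>T1\<close> into the exponential of the equation for \<open>P\<^sub>I\<close> creates terms of size
  \<open>t powr (4 - 2 * k\<^sub>I - 2 * k\<^sub>J)\<close>, whose exponent may be below \<open>1\<close>. The corrections \<open>T2\<close> remove them;
  what remains has size \<open>t powr (6 - 2 * k\<^sub>I - 2 * k\<^sub>J - 2 * k\<^sub>L)\<close>, and this exponent exceeds \<open>1\<close> since all \<open>k\<^sub>I < 5/6\<close>.\<close>

definition "k I x = kI D p0 I (snd x)" for x :: "real \<times> real"
definition "pp I x = ZZ Ix (\<lambda>J x. p1 J (snd x)) I x" for x :: "real \<times> real"
definition "al I x = alphaI D p0 p1 q0 I (snd x)" for x :: "real \<times> real"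
definition "ee I x = 2 - 2 * k I x"
text \<open>Chosen so that (ee I + ee J)^2 * T2 I J, summed over J, equals -2 * (ee I)^2 * T1 I * ZZ
  T1 I, the first order term of (ee I)^2 * T1 I * exp (- 2 * SS I) in T1. The factor 2 for I = J
  reflects that \<open>ZZ\<close> counts its own index twice.\<close>

definition "be I J x = - 2 * (ee I x)\<^sup>2 * al I x * al J x * (if I = J then 2 else 1) * inverse ((ee I x + ee J x)\<^sup>2)"
definition "T1 I x = al I x * fst x powr ee I x"
definition "T2 I J x = be I J x * fst x powr (ee I x + ee J x)"
definition "S2 I x = (\<Sum>J\<in>Ix. T2 I J x)"
definition "SS I x = ZZ Ix (\<lambda>J x. T1 J x + S2 J x) I x"
definition "PS I x = p0 I (snd x) * ln (fst x) + p1 I (snd x) + (T1 I x + S2 I x)"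
definition "VS I x = p0 I (snd x) + (ee I x * T1 I x + (\<Sum>J\<in>Ix. (ee I x + ee J x) * T2 I J x))"
text \<open>The limit at t = 0 of the momentum exp (- 2 PP) * D Q: the term q1 * t powr (2 k) gives
  D Q = 2 k q1 t powr (2 k), and exp (2 PP) behaves like t powr (2 k) * exp (2 pp).\<close>

definition "R0f I x = 2 * (k I x * (q1 I (snd x) * exp (- 2 * pp I x)))"

section \<open>Orders of the approximate solution\<close>

lemma RS0: "region S0" by (rule region_Tri) simp

lemma S0t: "x \<in> S0 \<Longrightarrow> 0 < fst x" "x \<in> S0 \<Longrightarrow> fst x < 1" "x \<in> S0 \<Longrightarrow> \<bar>snd x - c\<bar> < L"
  by (auto simp: Tri_def)

lemma k_bd: "I \<in> Ix \<Longrightarrow> x \<in> S0 \<Longrightarrow> \<bar>k I x - K I\<bar> \<le> e"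
  unfolding k_def by (rule kK[OF _ S0t(3)])

lemma ee_bd: "I \<in> Ix \<Longrightarrow> x \<in> S0 \<Longrightarrow> \<bar>ee I x - (2 - 2 * K I)\<bar> \<le> 2 * e"
  using k_bd[of I x] unfolding ee_def by linarith

lemma ee_lower: "I \<in> Ix \<Longrightarrow> x \<in> S0 \<Longrightarrow> 1 / 3 \<le> ee I x"
  using ee_bd[of I x] m2[of I] e by linarith

lemma BO_k: "I \<in> Ix \<Longrightarrow> BO b d S0 0 (k I)"
  unfolding k_def[abs_def] kI_def[abs_def] using sm RS0 by (intro BO_add BO_sum BO_snd) auto

lemma BO_ee: "I \<in> Ix \<Longrightarrow> BO b d S0 0 (ee I)"
  unfolding ee_def[abs_def] by (intro BO_diff BO_const BO_cmult BO_k RS0) auto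

lemma BO_pp: "I \<in> Ix \<Longrightarrow> BO b d S0 0 (pp I)"
  unfolding pp_def[abs_def] ZZ_def using sm RS0 by (intro BO_add BO_sum BO_snd) auto

lemma BO_mult0: "BO b d S0 a f \<Longrightarrow> BO b d S0 0 g \<Longrightarrow> BO b d S0 a (\<lambda>x. f x * g x)"
  by (rule BO_mult[OF _ _ RS0]) auto

lemma al_eq: "al I x = 1 / 2 * (deriv (q0 I) (snd x) * inverse (ee I x))\<^sup>2 * exp (- 2 * pp I x)"
  unfolding al_def alphaI_def ee_def pp_def ZZ_def k_def divide_inverse by (simp only: add.commute)

lemma BO_inv_ee: "I \<in> Ix \<Longrightarrow> BO b d S0 0 (\<lambda>x. inverse (ee I x))"
  by (rule BO_inverse[OF BO_ee RS0, of _ "1 / 3"]) (use ee_lower in \<open>force+\<close>)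

lemma BO_q0': "I \<in> Ix \<Longrightarrow> BO b d S0 0 (\<lambda>x. deriv (q0 I) (snd x))"
  by (intro BO_snd smooth1_deriv sm RS0)

lemma BO_exp_pp: "I \<in> Ix \<Longrightarrow> BO b d S0 0 (\<lambda>x. exp (r * pp I x))"
  by (intro BO_exp BO_cmult BO_pp RS0)

lemma BO_al: "I \<in> Ix \<Longrightarrow> BO b d S0 0 (al I)"
proof -
  assume I: "I \<in> Ix"
  have h: "BO b d S0 0 (\<lambda>x. deriv (q0 I) (snd x) * inverse (ee I x))"
    by (rule BO_mult0[OF BO_q0'[OF I] BO_inv_ee[OF I]])
  have "BO b d S0 0 (\<lambda>x. (1 / 2) * ((deriv (q0 I) (snd x) * inverse (ee I x)) * (deriv (q0 I) (snd x) * inverse (ee I x))))"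
    by (rule BO_cmult[OF BO_mult0[OF h h] RS0])
  from BO_mult0[OF this BO_exp_pp[OF I, of b d "-2"]]
  show ?thesis unfolding al_eq[abs_def] power2_eq_square by simp
qed

lemma BO_be:
  assumes "I \<in> Ix" "J \<in> Ix" shows "BO b d S0 0 (be I J)"
proof -
  have "BO b d S0 0 (\<lambda>x. inverse (ee I x + ee J x))"
  proof (rule BO_inverse[OF BO_add[OF BO_ee BO_ee] RS0, of _ _ "1 / 3"])
    fix x assume "x \<in> S0"
    then show "1 / 3 \<le> \<bar>ee I x + ee J x\<bar>" using ee_lower[OF assms(1), of x] ee_lower[OF assms(2), of x] by linarith
  qed (use assms in auto)
  then have "BO b d S0 0 (\<lambda>x. - 2 * (ee I x * ee I x) * al I x * al J x * (if I = J then 2 else 1) * (inverse (ee I x + ee J x) * inverse (ee I x + ee J x)))"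
    using assms by (intro BO_mult0 BO_const BO_ee BO_al RS0) auto
  then show ?thesis
    unfolding be_def[abs_def] by (simp add: power2_eq_square)
qed

lemma BO_powr_ee: "I \<in> Ix \<Longrightarrow> BO b d S0 (2 - 2 * K I - 3 * e) (\<lambda>x. fst x powr ee I x)"
  by (rule BO_powr[OF BO_ee RS0, where e="2 - 2 * K I - 2 * e"]) (use ee_bd[of I] e in \<open>fastforce simp: abs_le_iff\<close>)+

text \<open>Of the loss, |n| * e is the oscillation of n * k around its value at the centre, and one
  further e is the price of the logarithms.\<close>

lemma BO_powr_k:
  assumes "I \<in> Ix" shows "BO b d S0 (n * K I - (\<bar>n\<bar> + 1) * e) (\<lambda>x. fst x powr (n * k I x))"
proof (rule BO_powr[OF BO_cmult[OF BO_k[OF assms] RS0] RS0, where e="n * K I - \<bar>n\<bar> * e"])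
  show "\<forall>x\<in>S0. n * K I - \<bar>n\<bar> * e \<le> n * k I x"
  proof
    fix x assume "x \<in> S0"
    then have "\<bar>n * (k I x - K I)\<bar> \<le> \<bar>n\<bar> * e"
      unfolding abs_mult using k_bd[OF assms] by (intro mult_left_mono) auto
    then show "n * K I - \<bar>n\<bar> * e \<le> n * k I x" by (simp add: right_diff_distrib abs_le_iff)
  qed
qed (use e in \<open>simp add: algebra_simps\<close>)

lemma BO_T1: "I \<in> Ix \<Longrightarrow> BO b d S0 (2 - 2 * K I - 3 * e) (T1 I)"
  unfolding T1_def[abs_def] by (rule BO_mult[OF BO_al BO_powr_ee RS0]) auto

lemma BO_T1': "I \<in> Ix \<Longrightarrow> BO b d S0 (1 / 3 + 10 * e) (T1 I)"
  by (rule BO_weaken[OF BO_T1 RS0]) (use m2[of I] e in auto)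

lemma BO_T2: "I \<in> Ix \<Longrightarrow> J \<in> Ix \<Longrightarrow> BO b d S0 (4 - 2 * K I - 2 * K J - 6 * e) (T2 I J)"
proof -
  assume I: "I \<in> Ix" and J: "J \<in> Ix"
  have p: "fst x powr (ee I x + ee J x) = fst x powr ee I x * fst x powr ee J x" for x by (rule powr_add)
  have "BO b d S0 (4 - 2 * K I - 2 * K J - 6 * e) (\<lambda>x. fst x powr ee I x * fst x powr ee J x)"
    by (rule BO_mult[OF BO_powr_ee[OF I] BO_powr_ee[OF J] RS0]) simp
  from BO_mult[OF BO_be[OF I J] this RS0]
  show ?thesis unfolding T2_def[abs_def] p by simp
qed

lemma BO_S2: "I \<in> Ix \<Longrightarrow> BO b d S0 (2 / 3 + 20 * e) (S2 I)"
  unfolding S2_def[abs_def]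
proof (rule BO_sum)
  fix J assume "I \<in> Ix" "J \<in> Ix"
  then show "BO b d S0 (2 / 3 + 20 * e) (T2 I J)"
    by (intro BO_weaken[OF BO_T2 RS0]) (use m2[of I] m2[of J] e in simp_all)
qed

text \<open>The correction has to fit into the slot t powr (ee I + eps I) of the prescribed
  remainder; this is the purpose of the bound eps I < 2 - 2 k_J for all J.\<close>

lemma BO_S2': "I \<in> Ix \<Longrightarrow> BO b d S0 (2 - 2 * K I + eps I + 4 * e) (S2 I)"
  unfolding S2_def[abs_def]
proof (rule BO_sum)
  fix J assume "I \<in> Ix" "J \<in> Ix"
  then show "BO b d S0 (2 - 2 * K I + eps I + 4 * e) (T2 I J)"
    by (intro BO_weaken[OF BO_T2 RS0]) (use m4[of J I] e in simp_all)
qed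

lemma BO_TS: "I \<in> Ix \<Longrightarrow> BO b d S0 (1 / 3 + 10 * e) (\<lambda>x. T1 I x + S2 I x)"
  by (intro BO_add BO_T1' BO_weaken[OF BO_S2 RS0]) (use e in auto)

lemma BO_SS: "I \<in> Ix \<Longrightarrow> BO b d S0 (1 / 3 + 10 * e) (SS I)"
  unfolding SS_def[abs_def] ZZ_def by (intro BO_add BO_sum BO_TS) auto

lemma BO_PS: "I \<in> Ix \<Longrightarrow> BO b d S0 (- e) (PS I)"
proof -
  assume I: "I \<in> Ix"
  have 1: "BO b d S0 (- e) (\<lambda>x. p0 I (snd x) * ln (fst x))"
    by (rule BO_mult[OF BO_snd BO_ln RS0]) (use e sm RS0 I in auto)
  have 2: "BO b d S0 (- e) (\<lambda>x. p1 I (snd x))"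
    by (rule BO_weaken[OF BO_snd RS0]) (use e sm RS0 I in auto)
  have 3: "BO b d S0 (- e) (\<lambda>x. T1 I x + S2 I x)"
    by (rule BO_weaken[OF BO_TS RS0]) (use e I in auto)
  show ?thesis unfolding PS_def[abs_def] by (rule BO_add[OF BO_add[OF 1 2] 3])
qed

lemma ZZ_PS: "ZZ Ix PS I x = k I x * ln (fst x) + pp I x + SS I x"
  unfolding ZZ_def PS_def k_def kI_def pp_def SS_def
  by (simp add: sum.distrib sum_distrib_left algebra_simps)

lemma exp_ZZ_PS: "x \<in> S0 \<Longrightarrow> exp (n * ZZ Ix PS I x) = fst x powr (n * k I x) * exp (n * (pp I x + SS I x))"
  using S0t(1)[of x] unfolding ZZ_PS powr_def by (simp add: exp_add[symmetric] algebra_simps)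

lemma BO_exp_ZZ_PS:
  assumes "I \<in> Ix" shows "BO b d S0 (n * K I - (\<bar>n\<bar> + 1) * e) (\<lambda>x. exp (n * ZZ Ix PS I x))"
proof -
  have "BO b d S0 0 (\<lambda>x. exp (n * (pp I x + SS I x)))"
    by (intro BO_exp BO_cmult BO_add BO_pp BO_weaken[OF BO_SS RS0] RS0) (use assms e in auto)
  from BO_mult[OF BO_powr_k[OF assms, of b d n] this RS0]
  have "BO b d S0 (n * K I - (\<bar>n\<bar> + 1) * e) (\<lambda>x. fst x powr (n * k I x) * exp (n * (pp I x + SS I x)))" by simp
  then show ?thesis by (rule BO_cong) (use RS0 exp_ZZ_PS in \<open>auto simp: region_def\<close>)
qed

lemma BO_VS: "I \<in> Ix \<Longrightarrow> BO b d S0 (1 / 3 + 10 * e) (\<lambda>x. ee I x * T1 I x + (\<Sum>J\<in>Ix. (ee I x + ee J x) * T2 I J x))"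
proof (intro BO_add BO_sum)
  assume I: "I \<in> Ix"
  show "BO b d S0 (1 / 3 + 10 * e) (\<lambda>x. ee I x * T1 I x)"
    using BO_mult[OF BO_ee[OF I] BO_T1'[OF I] RS0] by simp
  fix J assume J: "J \<in> Ix"
  have "BO b d S0 (1 / 3 + 10 * e) (T2 I J)"
    by (rule BO_weaken[OF BO_T2 RS0]) (use I J m2[of I] m2[of J] e in simp_all)
  then show "BO b d S0 (1 / 3 + 10 * e) (\<lambda>x. (ee I x + ee J x) * T2 I J x)"
    using BO_mult[OF BO_add[OF BO_ee[OF I] BO_ee[OF J]] _ RS0, of b d "1 / 3 + 10 * e"] by simp
qed

lemma pder_T1: "pder True S0 (T1 I) (\<lambda>x. ee I x * T1 I x)"
  using pder_snd_powr[OF RS0, of "\<lambda>\<theta>. alphaI D p0 p1 q0 I \<theta>" "\<lambda>\<theta>. 2 - 2 * kI D p0 I \<theta>"]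
  unfolding T1_def[abs_def] ee_def al_def k_def .

lemma be_snd: "be I J x = be I J (t, snd x)" "ee I x = ee I (t, snd x)"
  unfolding be_def al_def ee_def k_def by simp_all

lemma pder_T2: "pder True S0 (T2 I J) (\<lambda>x. (ee I x + ee J x) * T2 I J x)"
  using pder_snd_powr[OF RS0, of "\<lambda>\<theta>. be I J (0, \<theta>)" "\<lambda>\<theta>. ee I (0, \<theta>) + ee J (0, \<theta>)"]
  unfolding T2_def[abs_def] be_snd[where t=0, symmetric] .

lemma pder_ee_mult: "pder True S0 f f' \<Longrightarrow> pder True S0 (\<lambda>x. ee I x * f x) (\<lambda>x. ee I x * f' x)"
  using pder_mult[OF pder_snd_const[of S0 "\<lambda>\<theta>. ee I (0, \<theta>)"], of f f'] unfolding be_snd(2)[where t=0, symmetric] by simp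

lemma pder_PS: "I \<in> Ix \<Longrightarrow> pder True S0 (PS I) (VS I)"
proof -
  assume I: "I \<in> Ix"
  have "pder True S0 (\<lambda>x. p0 I (snd x) * ln (fst x)) (\<lambda>x. 0 * ln (fst x) + p0 I (snd x) * (if True then 1 else 0))"
    by (rule pder_mult[OF pder_snd_const pder_ln[OF RS0]])
  then have "pder True S0 (\<lambda>x. p0 I (snd x) * ln (fst x)) (\<lambda>x. p0 I (snd x))" by simp
  from pder_add[OF pder_add[OF this pder_snd_const[of _ "p1 I"]] pder_add[OF pder_T1 pder_sum[where A=Ix and f="T2 I" and f'="\<lambda>J x. (ee I x + ee J x) * T2 I J x", OF pder_T2]]]
  show ?thesis unfolding PS_def[abs_def] VS_def[abs_def] S2_def by simp
qed

lemma pder_VS: "I \<in> Ix \<Longrightarrow> pder True S0 (VS I) (\<lambda>x. (ee I x)\<^sup>2 * T1 I x + (\<Sum>J\<in>Ix. (ee I x + ee J x)\<^sup>2 * T2 I J x))"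
proof -
  have 1: "pder True S0 (\<lambda>x. (ee I x + ee J x) * T2 I J x) (\<lambda>x. (ee I x + ee J x)\<^sup>2 * T2 I J x)" for J
    using pder_add[OF pder_ee_mult[OF pder_T2, of I I J] pder_ee_mult[OF pder_T2, of J I J]]
    by (simp add: power2_eq_square algebra_simps)
  have 2: "pder True S0 (\<lambda>x. ee I x * T1 I x) (\<lambda>x. (ee I x)\<^sup>2 * T1 I x)"
    using pder_ee_mult[OF pder_T1, of I I] by (simp add: power2_eq_square mult.assoc)
  from pder_add[OF pder_snd_const[of _ "p0 I"] pder_add[OF 2 pder_sum[where A=Ix and f="\<lambda>J x. (ee I x + ee J x) * T2 I J x" and f'="\<lambda>J x. (ee I x + ee J x)\<^sup>2 * T2 I J x", OF 1]]]
  show ?thesis unfolding VS_def[abs_def] by simp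
qed

section \<open>The approximate frame and its residuals\<close>

definition "WS I x = fst x * dth (PS I) x" for x
text \<open>The Q-part of the frame is not taken from an approximate Q: \<open>XS\<close> freezes
  the momentum at its limit, and \<open>YS\<close> keeps only the derivative of q0.\<close>

definition "XS I x = R0f I x * exp (1 * ZZ Ix PS I x)"
definition "YS I x = fst x * deriv (q0 I) (snd x) * exp (- 1 * ZZ Ix PS I x)"

lemma BO_R0f: "I \<in> Ix \<Longrightarrow> BO b d S0 0 (R0f I)"
  unfolding R0f_def[abs_def] by (intro BO_mult0 BO_cmult BO_k BO_snd sm BO_exp_pp RS0)

lemma BO_WS: "I \<in> Ix \<Longrightarrow> BO b d S0 (1 - e) (WS I)"
  unfolding WS_def[abs_def] by (rule BO_mult[OF BO_fst[OF RS0] BO_dth(2)[OF BO_PS RS0] RS0]) auto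

lemma BO_XS: "I \<in> Ix \<Longrightarrow> BO b d S0 (K I - 2 * e) (XS I)"
  unfolding XS_def[abs_def] by (rule BO_mult[OF BO_R0f BO_exp_ZZ_PS RS0]) auto

lemma BO_YS: "I \<in> Ix \<Longrightarrow> BO b d S0 (1 - K I - 2 * e) (YS I)"
  unfolding YS_def[abs_def] by (rule BO_mult[OF BO_mult[OF BO_fst[OF RS0] BO_q0' RS0, where e=1] BO_exp_ZZ_PS RS0]) auto

lemma BO_VS0: "I \<in> Ix \<Longrightarrow> BO b d S0 0 (VS I)"
  unfolding VS_def[abs_def] by (intro BO_add[OF BO_snd BO_weaken[OF BO_VS RS0]]) (use sm RS0 e in auto)

lemma ZZ_VS: "ZZ Ix VS I x = k I x + ZZ Ix (\<lambda>I x. ee I x * T1 I x + (\<Sum>J\<in>Ix. (ee I x + ee J x) * T2 I J x)) I x"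
  unfolding ZZ_def VS_def k_def kI_def by (simp add: sum.distrib)

lemma BO_ZZ_VS: "I \<in> Ix \<Longrightarrow> BO b d S0 (1 / 3 + 10 * e) (ZZ Ix (\<lambda>I x. ee I x * T1 I x + (\<Sum>J\<in>Ix. (ee I x + ee J x) * T2 I J x)) I)"
  unfolding ZZ_def[abs_def] by (intro BO_add BO_sum BO_VS)

lemma BO_ZZ_WS: "I \<in> Ix \<Longrightarrow> BO b d S0 (1 - e) (ZZ Ix WS I)"
  unfolding ZZ_def[abs_def] by (intro BO_add BO_sum BO_WS)

lemma pder_exp_ZZ_PS: "I \<in> Ix \<Longrightarrow> pder True S0 (\<lambda>x. exp (n * ZZ Ix PS I x)) (\<lambda>x. (n * ZZ Ix VS I x) * exp (n * ZZ Ix PS I x))"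
  unfolding ZZ_def by (intro pder_exp pder_cmult pder_add pder_sum pder_PS)

text \<open>What the corrections leave of the exponential: the contribution of S2 to its linear term
  and the Taylor remainder. The terms with X^2 and with the theta-derivative are left
  uncorrected.\<close>

definition "r1f I x = (ee I x)\<^sup>2 * T1 I x * (2 * ZZ Ix S2 I x - (exp (- 2 * SS I x) - 1 - (- 2 * SS I x)))
   + (XS I x)\<^sup>2 / 2 - fst x * dth (WS I) x"

lemma BO_t_dth: "BO b d S0 a f \<Longrightarrow> BO b d S0 (1 + a) (\<lambda>x. fst x * dth f x)"
  by (rule BO_mult[OF BO_fst[OF RS0] BO_dth(2)[OF _ RS0] RS0]) auto

text \<open>The exponential part has order (1/3 + 10 e) + (2/3 + 20 e), so the margins lift it above
  1. X^2 has order 2 K - 4 e with K > 1/2 + 10 e, and the theta-term has order 2 - e.\<close>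

lemma BO_r1f: assumes I: "I \<in> Ix" shows "BO True True S0 (1 + e) (r1f I)"
proof -
  have "BO True True S0 (2 * (1 / 3 + 10 * e)) (\<lambda>x. exp (- 2 * SS I x) - 1 - (- 2 * SS I x))"
    by (rule BO_exp_taylor2[OF BO_cmult[OF BO_SS[OF I] RS0] RS0]) (use e in simp)
  note h1 = this
  have "BO True True S0 (2 * (1 / 3 + 10 * e)) (\<lambda>x. 2 * ZZ Ix S2 I x)"
    unfolding ZZ_def by (intro BO_cmult BO_add BO_sum BO_weaken[OF BO_S2 RS0] RS0 I) (use e in auto)
  then have 1: "BO True True S0 (2 * (1 / 3 + 10 * e)) (\<lambda>x. 2 * ZZ Ix S2 I x - (exp (- 2 * SS I x) - 1 - (- 2 * SS I x)))"
    by (rule BO_diff[OF _ h1 RS0])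
  have 2: "BO True True S0 (1 / 3 + 10 * e) (\<lambda>x. (ee I x)\<^sup>2 * T1 I x)"
    unfolding power2_eq_square using BO_mult[OF BO_mult0[OF BO_ee[OF I] BO_ee[OF I]] BO_T1'[OF I] RS0] by simp
  have a: "BO True True S0 (1 + e) (\<lambda>x. (ee I x)\<^sup>2 * T1 I x * (2 * ZZ Ix S2 I x - (exp (- 2 * SS I x) - 1 - (- 2 * SS I x))))"
    by (rule BO_mult[OF 2 1 RS0]) (use e in simp)
  have b: "BO True True S0 (1 + e) (\<lambda>x. (XS I x)\<^sup>2 / 2)"
    using BO_cmult[OF BO_mult[OF BO_XS[OF I] BO_XS[OF I] RS0, where e="1 + e" and b=True and d=True] RS0, of "1 / 2"] m1[OF I] e
    by (simp add: power2_eq_square)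
  have c: "BO True True S0 (1 + e) (\<lambda>x. fst x * dth (WS I) x)"
    by (rule BO_weaken[OF BO_t_dth[OF BO_WS[OF I]] RS0]) (use e in simp)
  show ?thesis unfolding r1f_def[abs_def] by (intro BO_add[OF a b, THEN BO_diff] c RS0)
qed

text \<open>This identity is the origin of \<open>alphaI\<close>: its square and the division by 2 -
  2 k are arranged so that the second scaling derivative of T1 balances the leading part of Y^2 /
  2.\<close>

lemma YS_sq:
  assumes "I \<in> Ix" "x \<in> S0" shows "(YS I x)\<^sup>2 / 2 = (ee I x)\<^sup>2 * T1 I x * exp (- 2 * SS I x)"
proof -
  have t: "0 < fst x" using S0t assms by auto
  have ex: "exp (- 1 * ZZ Ix PS I x) * exp (- 1 * ZZ Ix PS I x) = exp (- 2 * ZZ Ix PS I x)"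
    by (simp add: exp_add[symmetric])
  have tp: "fst x * fst x * fst x powr (- 2 * k I x) = fst x powr ee I x"
    using t powr_add[of "fst x" 2 "- 2 * k I x"] unfolding ee_def by (simp add: powr_numeral power2_eq_square)
  have nz: "ee I x \<noteq> 0" using ee_lower[OF assms] by simp
  have q: "(ee I x)\<^sup>2 * al I x = 1 / 2 * (deriv (q0 I) (snd x))\<^sup>2 * exp (- 2 * pp I x)"
    unfolding al_eq using nz by (simp add: power_mult_distrib field_simps)
  have "(YS I x)\<^sup>2 / 2 = 1 / 2 * (deriv (q0 I) (snd x))\<^sup>2 * (fst x * fst x) * (exp (- 1 * ZZ Ix PS I x) * exp (- 1 * ZZ Ix PS I x))"
    unfolding YS_def power2_eq_square by (simp only: ac_simps divide_inverse mult_1 mult_1_right)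
  also have "\<dots> = 1 / 2 * (deriv (q0 I) (snd x))\<^sup>2 * (fst x * fst x * fst x powr (- 2 * k I x)) * exp (- 2 * (pp I x + SS I x))"
    unfolding ex exp_ZZ_PS[OF assms(2), of "- 2"] by (simp only: ac_simps)
  also have "exp (- 2 * (pp I x + SS I x)) = exp (- 2 * pp I x) * exp (- 2 * SS I x)"
    by (simp add: exp_add[symmetric] distrib_left)
  also have "1 / 2 * (deriv (q0 I) (snd x))\<^sup>2 * (fst x * fst x * fst x powr (- 2 * k I x)) * (exp (- 2 * pp I x) * exp (- 2 * SS I x))
     = (1 / 2 * (deriv (q0 I) (snd x))\<^sup>2 * exp (- 2 * pp I x)) * fst x powr ee I x * exp (- 2 * SS I x)"
    unfolding tp by (simp only: ac_simps)
  finally show ?thesis unfolding q[symmetric] T1_def by (simp only: mult.assoc)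
qed

lemma approximate_V:
  assumes I: "I \<in> Ix"
  shows "pder True S0 (VS I) (\<lambda>x. fst x * dth (WS I) x - ((XS I x)\<^sup>2 - (YS I x)\<^sup>2) / 2 + r1f I x)"
proof (rule pder_cong_deriv[OF pder_VS[OF I]])
  fix x assume x: "x \<in> S0"
  have "(ee I x + ee J x)\<^sup>2 * T2 I J x = - 2 * (ee I x)\<^sup>2 * T1 I x * (if I = J then 2 * T1 J x else T1 J x)" if J: "J \<in> Ix" for J
  proof -
    have "ee I x + ee J x \<noteq> 0" using ee_lower[OF I x] ee_lower[OF J x] by simp
    then have q: "(ee I x + ee J x)\<^sup>2 * inverse ((ee I x + ee J x)\<^sup>2) = 1" by simp
    have "(ee I x + ee J x)\<^sup>2 * T2 I J x = ((ee I x + ee J x)\<^sup>2 * inverse ((ee I x + ee J x)\<^sup>2)) *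
       (- 2 * (ee I x)\<^sup>2 * T1 I x * (T1 J x * (if I = J then 2 else 1)))"
      unfolding T2_def be_def T1_def powr_add by (simp only: ac_simps)
    then show ?thesis unfolding q by simp
  qed
  then have "(\<Sum>J\<in>Ix. (ee I x + ee J x)\<^sup>2 * T2 I J x) = (\<Sum>J\<in>Ix. - 2 * (ee I x)\<^sup>2 * T1 I x * (T1 J x + (if I = J then T1 J x else 0)))"
    by (intro sum.cong) auto
  also have "\<dots> = - 2 * (ee I x)\<^sup>2 * T1 I x * ZZ Ix T1 I x"
    unfolding sum_distrib_left[symmetric] sum.distrib ZZ_def using I by simp
  finally have s: "(\<Sum>J\<in>Ix. (ee I x + ee J x)\<^sup>2 * T2 I J x) = - 2 * (ee I x)\<^sup>2 * T1 I x * ZZ Ix T1 I x" .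
  have z: "SS I x = ZZ Ix T1 I x + ZZ Ix S2 I x" unfolding SS_def ZZ_def by (simp add: sum.distrib)
  have "((XS I x)\<^sup>2 - (YS I x)\<^sup>2) / 2 = (XS I x)\<^sup>2 / 2 - (ee I x)\<^sup>2 * T1 I x * exp (- 2 * SS I x)"
    unfolding YS_sq[OF I x, symmetric] by (simp add: diff_divide_distrib)
  then show "(ee I x)\<^sup>2 * T1 I x + (\<Sum>J\<in>Ix. (ee I x + ee J x)\<^sup>2 * T2 I J x) = fst x * dth (WS I) x - ((XS I x)\<^sup>2 - (YS I x)\<^sup>2) / 2 + r1f I x"
    unfolding s r1f_def by (simp add: z algebra_simps)
qed

lemma approximate_W:
  assumes I: "I \<in> Ix"
  shows "pder True S0 (WS I) (\<lambda>x. fst x * dth (VS I) x + WS I x)"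
  unfolding WS_def[abs_def]
  by (rule pder_times_dth[OF BO_PS[OF I] RS0 _ BO_dth(1)[OF BO_VS0[OF I] RS0]])
    (rule pder_True_Dop[OF pder_PS[OF I] _ S0t(1)])

text \<open>\<open>XS\<close> is exp (PP) times a factor independent of t, so its time derivative is
  exactly ZZ VS * XS; all theta-terms are residual. For \<open>YS\<close> the factor t contributes
  the additional term YS.\<close>

lemma approximate_X:
  assumes I: "I \<in> Ix"
  shows "pder True S0 (XS I) (\<lambda>x. fst x * dth (YS I) x + ZZ Ix VS I x * XS I x - ZZ Ix WS I x * YS I x
      + (ZZ Ix WS I x * YS I x - fst x * dth (YS I) x))"
proof -
  have "pder True S0 (R0f I) (\<lambda>x. 0)"
    using pder_snd_const[of S0 "\<lambda>\<theta>. R0f I (0, \<theta>)"] unfolding R0f_def[abs_def] k_def pp_def ZZ_def by simp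
  from pder_mult[OF this pder_exp_ZZ_PS[OF I, of 1]]
  show ?thesis unfolding XS_def[abs_def] by (rule pder_cong_deriv) simp
qed

lemma approximate_Y:
  assumes I: "I \<in> Ix"
  shows "pder True S0 (YS I) (\<lambda>x. fst x * dth (XS I) x + YS I x - ZZ Ix VS I x * YS I x + ZZ Ix WS I x * XS I x
      + (- (fst x * dth (XS I) x) - ZZ Ix WS I x * XS I x))"
proof -
  have "pder True S0 (\<lambda>x. fst x * deriv (q0 I) (snd x)) (\<lambda>x. fst x * deriv (q0 I) (snd x))"
    using pder_mult[OF pder_fst[OF RS0, of True] pder_snd_const[of _ "deriv (q0 I)"]] by simp
  from pder_mult[OF this pder_exp_ZZ_PS[OF I, of "-1"]]
  show ?thesis unfolding YS_def[abs_def] by (rule pder_cong_deriv) (simp add: algebra_simps)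
qed

lemma BO_r3: assumes I: "I \<in> Ix" shows "BO True True S0 (1 + e) (\<lambda>x. ZZ Ix WS I x * YS I x - fst x * dth (YS I) x)"
proof (rule BO_diff[OF _ _ RS0])
  show "BO True True S0 (1 + e) (\<lambda>x. ZZ Ix WS I x * YS I x)"
    by (rule BO_mult[OF BO_ZZ_WS[OF I] BO_YS[OF I] RS0]) (use m2[OF I] e in simp)
  show "BO True True S0 (1 + e) (\<lambda>x. fst x * dth (YS I) x)"
    by (rule BO_weaken[OF BO_t_dth[OF BO_YS[OF I]] RS0]) (use m2[OF I] e in simp)
qed

lemma BO_r4: assumes I: "I \<in> Ix" shows "BO True True S0 (1 + e) (\<lambda>x. - (fst x * dth (XS I) x) - ZZ Ix WS I x * XS I x)"
proof (rule BO_diff[OF BO_minus _ RS0])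
  show "BO True True S0 (1 + e) (\<lambda>x. ZZ Ix WS I x * XS I x)"
    by (rule BO_mult[OF BO_ZZ_WS[OF I] BO_XS[OF I] RS0]) (use m1[OF I] e in simp)
  show "BO True True S0 (1 + e) (\<lambda>x. fst x * dth (XS I) x)"
    by (rule BO_weaken[OF BO_t_dth[OF BO_XS[OF I]] RS0]) (use m1[OF I] e in simp)
qed (rule RS0)

end

context twisted
begin

text \<open>7/20 = 1/3 + 1/60: from 1/2 < k < 5/6 follows |k - 1/2| <= 1/3, and 1/60 bounds the
  decaying part of VS for small t.\<close>

lemma eventually_ZZ_VS: "\<exists>T0. 0 < T0 \<and> T0 < 1 \<and> (\<forall>I\<in>Ix. \<forall>x\<in>Tri c L T0. \<bar>ZZ Ix VS I x - 1 / 2\<bar> \<le> 7 / 20)"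
proof -
  let ?r = "\<lambda>I x. ee I x * T1 I x + (\<Sum>J\<in>Ix. (ee I x + ee J x) * T2 I J x)"
  have "\<forall>\<^sub>F T in at_right 0. \<forall>I\<in>Ix. \<forall>x\<in>S0. 0 < fst x \<and> fst x < T \<longrightarrow> \<bar>ZZ Ix ?r I x\<bar> \<le> 1 / 60"
    by (rule eventually_ball_finite[OF finite_atLeastAtMost], rule ballI, rule eventually_small[OF BO_imp_Ob0[OF BO_ZZ_VS]]) (use e in simp_all)
  moreover have "\<forall>\<^sub>F T in at_right (0::real). T \<in> {0<..<1}" by (rule eventually_at_right_real) simp
  ultimately have "\<forall>\<^sub>F T in at_right (0::real). T \<in> {0<..<1} \<and> (\<forall>I\<in>Ix. \<forall>x\<in>S0. 0 < fst x \<and> fst x < T \<longrightarrow> \<bar>ZZ Ix ?r I x\<bar> \<le> 1 / 60)"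
    by eventually_elim blast
  then have "\<exists>T::real. T \<in> {0<..<1} \<and> (\<forall>I\<in>Ix. \<forall>x\<in>S0. 0 < fst x \<and> fst x < T \<longrightarrow> \<bar>ZZ Ix ?r I x\<bar> \<le> 1 / 60)"
    by (rule eventually_happens'[OF trivial_limit_at_right_real])
  then obtain T where T: "T \<in> {0<..<1}" "\<forall>I\<in>Ix. \<forall>x\<in>S0. 0 < fst x \<and> fst x < T \<longrightarrow> \<bar>ZZ Ix ?r I x\<bar> \<le> 1 / 60"
    by blast
  have "\<bar>ZZ Ix VS I x - 1 / 2\<bar> \<le> 7 / 20" if I: "I \<in> Ix" and x: "x \<in> Tri c L T" for I x
  proof -
    have x0: "x \<in> S0" using x T(1) by (auto simp: Tri_def)
    have "\<bar>ZZ Ix ?r I x\<bar> \<le> 1 / 60" using T(2) I x0 x unfolding Tri_def by blast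
    moreover have "\<bar>k I x - 1 / 2\<bar> \<le> 1 / 3" using k_bd[OF I x0] m1[OF I] m2[OF I] e by linarith
    ultimately show ?thesis unfolding ZZ_VS by linarith
  qed
  then show ?thesis using T(1) by (intro exI[of _ T]) auto
qed

lemma existence:
  shows "\<exists>T a b \<pi> \<kappa>. a < c \<and> c < b \<and> is_expansion_solution D p0 p1 q0 q1 eps T a b \<pi> \<kappa>"
proof -
  obtain T0 where T0: "0 < T0" "T0 < 1" "\<And>I x. I \<in> Ix \<Longrightarrow> x \<in> Tri c L T0 \<Longrightarrow> \<bar>ZZ Ix VS I x - 1 / 2\<bar> \<le> 7 / 20"
    using eventually_ZZ_VS by blast
  have S00: "Tri c L T0 \<subseteq> S0" by (rule Tri_mono) (use T0 in simp)
  note s0 = BO_subset[OF _ S00]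
  note p0' = pder_subset[OF _ S00]
  have mu: "1 + e > 1" and e0: "0 < e" using e by auto
  obtain T v w x y where T: "0 < T" "T \<le> T0"
    and v: "\<And>I. I \<in> Ix \<Longrightarrow> BO True True (Tri c L T) (1 + e) (v I)"
    and w: "\<And>I. I \<in> Ix \<Longrightarrow> BO True True (Tri c L T) (1 + e) (w I)"
    and x: "\<And>I. I \<in> Ix \<Longrightarrow> BO True True (Tri c L T) (1 + e) (x I)"
    and y: "\<And>I. I \<in> Ix \<Longrightarrow> BO True True (Tri c L T) (1 + e) (y I)"
    and fr: "frame Ix (Tri c L T) (\<lambda>I z. VS I z + v I z) (\<lambda>I z. WS I z + w I z) (\<lambda>I z. XS I z + x I z) (\<lambda>I z. YS I z + y I z)"
  \<comment> \<open>1/10 is a common lower bound for the orders 1 - e, K - 2 e and 1 - K - 2 e of W,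
    X and Y; the last one exceeds 1/6.\<close>
  proof (rule frame_perturbation[of Ix "1 + e" T0 "1 / 10" c L VS WS XS YS r1f "\<lambda>_ _. 0"
        "\<lambda>I x. ZZ Ix WS I x * YS I x - fst x * dth (YS I) x" "\<lambda>I x. - (fst x * dth (XS I) x) - ZZ Ix WS I x * XS I x"])
    show "finite Ix" "1 + e > 1" "0 < T0" "T0 \<le> 1" "(0::real) < 1 / 10" using mu T0 by auto
    fix I assume I: "I \<in> Ix"
    show "BO True True (Tri c L T0) 0 (VS I)" by (rule s0[OF BO_VS0[OF I]])
    show "BO True True (Tri c L T0) (1 / 10) (WS I)"
      by (rule s0[OF BO_weaken[OF BO_WS[OF I] RS0]]) (use e in simp)
    show "BO True True (Tri c L T0) (1 / 10) (XS I)"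
      by (rule s0[OF BO_weaken[OF BO_XS[OF I] RS0]]) (use e m1[OF I] in simp)
    show "BO True True (Tri c L T0) (1 / 10) (YS I)"
      by (rule s0[OF BO_weaken[OF BO_YS[OF I] RS0]]) (use e m2[OF I] in simp)
    show "BO True True (Tri c L T0) (1 + e) (r1f I)" by (rule s0[OF BO_r1f[OF I]])
    show "BO True True (Tri c L T0) (1 + e) (\<lambda>_. 0)" by (rule BO_zero)
    show "BO True True (Tri c L T0) (1 + e) (\<lambda>x. ZZ Ix WS I x * YS I x - fst x * dth (YS I) x)"
      by (rule s0[OF BO_r3[OF I]])
    show "BO True True (Tri c L T0) (1 + e) (\<lambda>x. - (fst x * dth (XS I) x) - ZZ Ix WS I x * XS I x)"
      by (rule s0[OF BO_r4[OF I]])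
    show "pder True (Tri c L T0) (VS I) (\<lambda>x. fst x * dth (WS I) x - ((XS I x)\<^sup>2 - (YS I x)\<^sup>2) / 2 + r1f I x)"
      by (rule p0'[OF approximate_V[OF I]])
    show "pder True (Tri c L T0) (WS I) (\<lambda>x. fst x * dth (VS I) x + WS I x + 0)"
      using p0'[OF approximate_W[OF I]] by simp
    show "pder True (Tri c L T0) (XS I) (\<lambda>x. fst x * dth (YS I) x + ZZ Ix VS I x * XS I x - ZZ Ix WS I x * YS I x
      + (ZZ Ix WS I x * YS I x - fst x * dth (YS I) x))"
      by (rule p0'[OF approximate_X[OF I]])
    show "pder True (Tri c L T0) (YS I) (\<lambda>x. fst x * dth (XS I) x + YS I x - ZZ Ix VS I x * YS I x + ZZ Ix WS I x * XS I x
      + (- (fst x * dth (XS I) x) - ZZ Ix WS I x * XS I x))"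
      by (rule p0'[OF approximate_Y[OF I]])
    fix z assume "z \<in> Tri c L T0"
    then show "\<bar>ZZ Ix VS I z - 1 / 2\<bar> \<le> 7 / 20" by (rule T0(3)[OF I])
  qed (rule that)
  define S where "S = Tri c L T"
  have T1: "T \<le> 1" using T T0 by simp
  have bS: "backward_closed S" unfolding S_def by (rule backward_closed_Tri[OF T1])
  have R: "region S" using bS by (rule backward_closed_region)
  have oS: "open S" using R by (simp add: region_def)
  have SS0: "S \<subseteq> S0" unfolding S_def by (rule Tri_mono[OF T1])
  note mono = BO_subset[OF _ SS0] and pmono = pder_subset[OF _ SS0]
  have tpos: "0 < fst z" if "z \<in> S" for z using that by (auto simp: S_def Tri_def)
  note v = v[folded S_def] and w = w[folded S_def] and x = x[folded S_def] and y = y[folded S_def] and fr = fr[folded S_def]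
  \<comment> \<open>P is recovered by integrating the correction of V from zero data; the result is
    O(t powr (1 + e)), so p0 and p1 are unaffected.\<close>
  define \<delta> where "\<delta> = (\<lambda>I. char_integral 0 (v I))"
  define P where "P = (\<lambda>I z. PS I z + \<delta> I z)"
  define V where "V = (\<lambda>I z. VS I z + v I z)"
  define W where "W = (\<lambda>I z. WS I z + w I z)"
  define X where "X = (\<lambda>I z. XS I z + x I z)"
  define Y where "Y = (\<lambda>I z. YS I z + y I z)"
  have fr': "frame Ix S V W X Y" using fr unfolding V_def W_def X_def Y_def .
  note f = fr'[unfolded frame_def, rule_format]
  have BOd: "BO True True S (1 + e) (\<delta> I)" and pd: "pder True S (\<delta> I) (v I)" if "I \<in> Ix" for I
    unfolding \<delta>_def using BO_char_integral0[OF v[OF that] mu bS] by auto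
  have BOP: "BO True True S (- e) (P I)" if I: "I \<in> Ix" for I
    unfolding P_def using e0 by (intro BO_add[OF mono[OF BO_PS[OF I]]] BO_weaken[OF BOd[OF I] R]) simp
  have PT: "pder True S (P I) (V I)" if I: "I \<in> Ix" for I
    unfolding P_def V_def by (rule pder_add[OF pmono[OF pder_PS[OF I]] pd[OF I]])
  have BOV: "BO True True S 0 (V I)" if I: "I \<in> Ix" for I
    unfolding V_def using e0 by (intro BO_add[OF mono[OF BO_VS0[OF I]]] BO_weaken[OF v[OF I] R]) simp
  have BOW: "BO True True S 0 (W I)" if I: "I \<in> Ix" for I
    unfolding W_def by (intro BO_add BO_weaken[OF mono[OF BO_WS[OF I]] R] BO_weaken[OF w[OF I] R]) (use e in simp_all)
  have BOX: "BO True True S 0 (X I)" if I: "I \<in> Ix" for I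
    unfolding X_def by (intro BO_add BO_weaken[OF mono[OF BO_XS[OF I]] R] BO_weaken[OF x[OF I] R]) (use e m1[OF I] in simp_all)
  have BOY: "BO True True S 0 (Y I)" if I: "I \<in> Ix" for I
    unfolding Y_def by (intro BO_add BO_weaken[OF mono[OF BO_YS[OF I]] R] BO_weaken[OF y[OF I] R]) (use e m2[OF I] in simp_all)
  have tdth: "BO True True S (1 + a) (\<lambda>z. fst z * dth g z)" if "BO True True S a g" for a g
    by (rule BO_mult[OF BO_fst[OF R] BO_dth(2)[OF that R] R]) simp
  \<comment> \<open>The defect W - t dth P solves D g = g. It is O(t powr (1 + e)) since the
    approximate parts cancel by definition of \<open>WS\<close>, hence it vanishes.\<close>
  have WP: "W I z = fst z * dth (P I) z" if I: "I \<in> Ix" and z: "z \<in> S" for I z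
  proof -
    define g where "g = (\<lambda>z. W I z - fst z * dth (P I) z)"
    have 1: "pder True S (\<lambda>z. fst z * dth (P I) z) (\<lambda>z. fst z * dth (V I) z + fst z * dth (P I) z)"
      by (rule pder_times_dth[OF BOP[OF I] R pder_True_Dop[OF PT[OF I]] BO_dth(1)[OF BOV[OF I] R]]) (use tpos in auto)
    have "pder True S (W I) (\<lambda>z. fst z * dth (V I) z + W I z)" using f[OF I] by blast
    from pder_diff[OF this 1] have gg: "pder True S g g" unfolding g_def by (rule pder_cong_deriv) simp
    have "BO True True S (1 + e) (\<lambda>z. w I z - fst z * dth (\<delta> I) z)"
      by (intro BO_diff[OF w[OF I]] BO_weaken[OF tdth[OF BOd[OF I]] R] R) simp
    moreover have "dth (P I) z = dth (PS I) z + dth (\<delta> I) z" if "z \<in> S" for z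
      using pder_False_dth[OF pder_add[OF BO_dth(1)[OF mono[OF BO_PS[OF I]] R] BO_dth(1)[OF BOd[OF I] R]] that]
      unfolding P_def by simp
    then have "w I z - fst z * dth (\<delta> I) z = g z" if "z \<in> S" for z
      using that unfolding g_def W_def WS_def by (simp add: algebra_simps)
    ultimately have "BO True True S (1 + e) g" using BO_cong[OF _ oS] by blast
    then have "g z = 0" by (rule homogeneous_zero[OF bS gg BO_imp_Ob0 mu z])
    then show ?thesis by (simp add: g_def)
  qed
  have PF: "pder False S (P I) (\<lambda>z. W I z / fst z)" if I: "I \<in> Ix" for I
    by (rule pder_cong_deriv[OF BO_dth(1)[OF BOP[OF I] R]]) (use WP[OF I] tpos in fastforce)
  have BOzd: "BO True True S (1 + e) (ZZ Ix \<delta> I)" if I: "I \<in> Ix" for I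
    unfolding ZZ_def[abs_def] by (intro BO_add BO_sum BOd I)
  have BOzd0: "BO True True S 0 (ZZ Ix \<delta> I)" if I: "I \<in> Ix" for I
    by (rule BO_weaken[OF BOzd[OF I] R]) (use e in simp)
  have ZZP: "ZZ Ix P I z = 1 * ZZ Ix PS I z + ZZ Ix \<delta> I z" for I z
    unfolding ZZ_def P_def by (simp add: sum.distrib)
  define EP where "EP = (\<lambda>I z. exp (ZZ Ix P I z))"
  have EPeq: "EP I z = exp (1 * ZZ Ix PS I z) * exp (ZZ Ix \<delta> I z)" for I z
    unfolding EP_def ZZP exp_add ..
  have BOEP: "BO True True S (K I - 2 * e) (EP I)" if I: "I \<in> Ix" for I
    unfolding EPeq[abs_def] by (rule BO_mult[OF mono[OF BO_exp_ZZ_PS[OF I]] BO_exp[OF BOzd0[OF I] R] R]) simp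
  \<comment> \<open>D Q minus the contribution of the explicit term q1 * t powr (2 k). This part has
    order 2 K + 1/6 > 1 and can be integrated from t = 0; the 1/6 is the distance from 5/6 to 1,
    needed for the product of exp (PP) with the correction of X.\<close>
  define H where "H = (\<lambda>I z. EP I z * X I z - 2 * k I z * (q1 I (snd z) * fst z powr (2 * k I z)))"
  have Heq: "H I z = 2 * (k I z * q1 I (snd z)) * fst z powr (2 * k I z) * (exp (2 * SS I z + ZZ Ix \<delta> I z) - 1) + EP I z * x I z"
    if I: "I \<in> Ix" and z: "z \<in> S" for I z
  proof -
    have zS0: "z \<in> S0" using SS0 z by blast
    have "EP I z * XS I z = R0f I z * (exp (1 * ZZ Ix PS I z) * exp (1 * ZZ Ix PS I z)) * exp (ZZ Ix \<delta> I z)"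
      unfolding EPeq XS_def by (simp only: ac_simps)
    also have "exp (1 * ZZ Ix PS I z) * exp (1 * ZZ Ix PS I z) = exp (2 * ZZ Ix PS I z)" by (simp add: exp_add[symmetric])
    also have "exp (2 * ZZ Ix PS I z) = fst z powr (2 * k I z) * exp (2 * (pp I z + SS I z))" by (rule exp_ZZ_PS[OF zS0])
    also have "R0f I z * (fst z powr (2 * k I z) * exp (2 * (pp I z + SS I z))) * exp (ZZ Ix \<delta> I z)
      = 2 * (k I z * q1 I (snd z)) * fst z powr (2 * k I z) * (exp (- 2 * pp I z) * exp (2 * (pp I z + SS I z)) * exp (ZZ Ix \<delta> I z))"
      unfolding R0f_def by (simp only: ac_simps)
    also have "exp (- 2 * pp I z) * exp (2 * (pp I z + SS I z)) * exp (ZZ Ix \<delta> I z) = exp (2 * SS I z + ZZ Ix \<delta> I z)"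
      by (simp add: exp_add[symmetric] algebra_simps)
    finally have "EP I z * XS I z = 2 * (k I z * q1 I (snd z)) * fst z powr (2 * k I z) * exp (2 * SS I z + ZZ Ix \<delta> I z)" .
    then show ?thesis unfolding H_def X_def by (simp add: algebra_simps)
  qed
  have BOpk: "BO True True S (2 * K I - 3 * e) (\<lambda>z. fst z powr (2 * k I z))" if I: "I \<in> Ix" for I
    using mono[OF BO_powr_k[OF I, of True True 2]] by simp
  have BOH: "BO True True S (2 * K I + 1 / 6) (H I)" if I: "I \<in> Ix" for I
  proof -
    have 1: "BO True True S 0 (\<lambda>z. 2 * (k I z * q1 I (snd z)))"
      by (intro BO_cmult R BO_mult[OF mono[OF BO_k[OF I]] BO_snd[OF sm(4)[OF I] R] R]) simp
    have 2: "BO True True S (2 * K I - 3 * e) (\<lambda>z. 2 * (k I z * q1 I (snd z)) * fst z powr (2 * k I z))"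
      by (rule BO_mult[OF 1 BOpk[OF I] R]) simp
    have "BO True True S (1 / 3 + 10 * e) (\<lambda>z. 2 * SS I z + ZZ Ix \<delta> I z)"
      by (intro BO_add BO_cmult mono[OF BO_SS[OF I]] BO_weaken[OF BOzd[OF I] R] R) (use e in simp)
    then have 3: "BO True True S (1 / 3 + 10 * e) (\<lambda>z. exp (2 * SS I z + ZZ Ix \<delta> I z) - 1)"
      by (rule BO_expm1[OF _ R]) (use e in simp)
    have "BO True True S (2 * K I + 1 / 6) (\<lambda>z. 2 * (k I z * q1 I (snd z)) * fst z powr (2 * k I z) * (exp (2 * SS I z + ZZ Ix \<delta> I z) - 1))"
      by (rule BO_mult[OF 2 3 R]) (use e in simp)
    moreover have "BO True True S (2 * K I + 1 / 6) (\<lambda>z. EP I z * x I z)"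
      by (rule BO_mult[OF BOEP[OF I] x[OF I] R]) (use e m2[OF I] in simp)
    ultimately have "BO True True S (2 * K I + 1 / 6) (\<lambda>z. 2 * (k I z * q1 I (snd z)) * fst z powr (2 * k I z) * (exp (2 * SS I z + ZZ Ix \<delta> I z) - 1) + EP I z * x I z)"
      by (rule BO_add)
    then show ?thesis by (rule BO_cong[OF _ oS]) (simp add: Heq[OF I])
  qed
  have K2: "2 * K I + 1 / 6 > 1" if "I \<in> Ix" for I using m1[OF that] e by simp
  define JH where "JH = (\<lambda>I. char_integral 0 (H I))"
  have BOJ: "BO True True S (2 * K I + 1 / 6) (JH I)" and pJ: "pder True S (JH I) (H I)" if I: "I \<in> Ix" for I
    unfolding JH_def using BO_char_integral0[OF BOH[OF I] K2[OF I] bS] by auto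
  define Q1 where "Q1 = (\<lambda>I z. q1 I (snd z) * fst z powr (2 * k I z) + JH I z)"
  define Q where "Q = (\<lambda>I z. q0 I (snd z) + Q1 I z)"
  have BOQ1: "BO True True S (2 * K I - 3 * e) (Q1 I)" if I: "I \<in> Ix" for I
    unfolding Q1_def
    by (rule BO_add[OF BO_mult[OF BO_snd[OF sm(4)[OF I] R] BOpk[OF I] R] BO_weaken[OF BOJ[OF I] R]]) (use e in simp_all)
  have BOQ: "BO True True S 0 (Q I)" if I: "I \<in> Ix" for I
    unfolding Q_def by (rule BO_add[OF BO_snd[OF sm(3)[OF I] R] BO_weaken[OF BOQ1[OF I] R]]) (use e m1[OF I] in simp)
  have QT: "pder True S (Q I) (\<lambda>z. EP I z * X I z)" if I: "I \<in> Ix" for I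
  proof -
    have "pder True S (\<lambda>z. q1 I (snd z) * fst z powr (2 * k I z)) (\<lambda>z. 2 * k I z * (q1 I (snd z) * fst z powr (2 * k I z)))"
      using pder_snd_powr[OF R, of "q1 I" "\<lambda>\<theta>. 2 * kI D p0 I \<theta>"] unfolding k_def .
    from pder_add[OF pder_snd_const[of S "q0 I"] pder_add[OF this pJ[OF I]]]
    show ?thesis unfolding Q_def Q1_def by (rule pder_cong_deriv) (simp add: H_def)
  qed
  have ZZPT: "pder True S (ZZ Ix P I) (ZZ Ix V I)" if I: "I \<in> Ix" for I
    unfolding ZZ_def[abs_def] by (intro pder_add pder_sum PT I)
  have ZZPF: "pder False S (ZZ Ix P I) (\<lambda>z. ZZ Ix W I z / fst z)" if I: "I \<in> Ix" for I
    using pder_add[OF pder_sum[where A=Ix and f=P and f'="\<lambda>I z. W I z / fst z", OF PF] PF[OF I]]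
    unfolding ZZ_def[abs_def] by (simp add: add_divide_distrib sum_divide_distrib)
  \<comment> \<open>As for W: the defect between exp (PP) * Y and t dth Q solves D g = g. The
    leading parts t * q0' cancel, and what is left is O(t powr (1 + e)).\<close>
  have QY: "EP I z * Y I z = fst z * dth (Q I) z" if I: "I \<in> Ix" and z: "z \<in> S" for I z
  proof -
    define g where "g = (\<lambda>z. EP I z * Y I z - fst z * dth (Q I) z)"
    have "pder False S (\<lambda>z. EP I z * X I z) (\<lambda>z. (ZZ Ix W I z / fst z) * EP I z * X I z + EP I z * dth (X I) z)"
      unfolding EP_def by (rule pder_mult[OF pder_exp[OF ZZPF[OF I]] BO_dth(1)[OF BOX[OF I] R]])
    then have 1: "pder True S (\<lambda>z. fst z * dth (Q I) z) (\<lambda>z. fst z * ((ZZ Ix W I z / fst z) * EP I z * X I z + EP I z * dth (X I) z) + fst z * dth (Q I) z)"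
      by (rule pder_times_dth[OF BOQ[OF I] R pder_True_Dop[OF QT[OF I]], rotated 2]) (use tpos in auto)
    have "pder True S (Y I) (\<lambda>x. fst x * dth (X I) x + Y I x - ZZ Ix V I x * Y I x + ZZ Ix W I x * X I x)"
      using f[OF I] by blast
    from pder_mult[OF pder_exp[OF ZZPT[OF I]] this]
    have 2: "pder True S (\<lambda>z. EP I z * Y I z) (\<lambda>z. ZZ Ix V I z * EP I z * Y I z + EP I z * (fst z * dth (X I) z + Y I z - ZZ Ix V I z * Y I z + ZZ Ix W I z * X I z))"
      unfolding EP_def .
    have gg: "pder True S g g"
      unfolding g_def
    proof (rule pder_cong_deriv[OF pder_diff[OF 2 1]])
      fix z assume "z \<in> S"
      then have "fst z \<noteq> 0" using tpos[of z] by simp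
      then show "ZZ Ix V I z * EP I z * Y I z + EP I z * (fst z * dth (X I) z + Y I z - ZZ Ix V I z * Y I z + ZZ Ix W I z * X I z) -
         (fst z * ((ZZ Ix W I z / fst z) * EP I z * X I z + EP I z * dth (X I) z) + fst z * dth (Q I) z) = EP I z * Y I z - fst z * dth (Q I) z"
        by (simp add: field_simps)
    qed
    have a: "BO True True S (1 + e) (\<lambda>z. fst z * deriv (q0 I) (snd z) * (exp (ZZ Ix \<delta> I z) - 1))"
    proof (rule BO_mult[OF BO_mult[OF BO_fst[OF R] mono[OF BO_q0'[OF I]] R, where e=1] BO_expm1[OF BOzd[OF I] R] R])
    qed (use e in simp_all)
    have b: "BO True True S (1 + e) (\<lambda>z. EP I z * y I z)"
      by (rule BO_mult[OF BOEP[OF I] y[OF I] R]) (use e m1[OF I] in simp)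
    have c: "BO True True S (1 + e) (\<lambda>z. fst z * dth (Q1 I) z)"
      by (rule BO_weaken[OF tdth[OF BOQ1[OF I]] R]) (use e m1[OF I] in simp)
    have "BO True True S (1 + e) g"
    proof (rule BO_cong[OF BO_diff[OF BO_add[OF a b] c R] oS])
      fix z assume z: "z \<in> S"
      have dq: "pder False S (\<lambda>z. q0 I (snd z)) (\<lambda>z. if False then 0 else deriv (q0 I) (snd z))"
        by (rule pder_snd[OF sm(3)[OF I]])
      have dQ: "dth (Q I) z = deriv (q0 I) (snd z) + dth (Q1 I) z"
        using pder_False_dth[OF pder_add[OF dq BO_dth(1)[OF BOQ1[OF I] R]] z] unfolding Q_def by simp
      have "EP I z * YS I z = fst z * deriv (q0 I) (snd z) * (exp (1 * ZZ Ix PS I z) * exp (- 1 * ZZ Ix PS I z)) * exp (ZZ Ix \<delta> I z)"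
        unfolding EPeq YS_def by (simp only: ac_simps)
      also have "exp (1 * ZZ Ix PS I z) * exp (- 1 * ZZ Ix PS I z) = 1" by (simp add: exp_add[symmetric])
      finally show "fst z * deriv (q0 I) (snd z) * (exp (ZZ Ix \<delta> I z) - 1) + EP I z * y I z - fst z * dth (Q1 I) z = g z"
        unfolding g_def Y_def dQ by (simp add: algebra_simps)
    qed
    then have "g z = 0" by (rule homogeneous_zero[OF bS gg BO_imp_Ob0 mu z])
    then show ?thesis by (simp add: g_def)
  qed
  have QF: "pder False S (Q I) (\<lambda>z. EP I z * Y I z / fst z)" if I: "I \<in> Ix" for I
    by (rule pder_cong_deriv[OF BO_dth(1)[OF BOQ[OF I] R]]) (use QY[OF I] tpos in fastforce)
  \<comment> \<open>The remainders are whatever is not explicit in P and Q, divided by the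
    prescribed powers of t.\<close>
  define \<pi> where "\<pi> = (\<lambda>I z. (S2 I z + \<delta> I z) * fst z powr (- (ee I z + eps I)))"
  define \<kappa> where "\<kappa> = (\<lambda>I z. JH I z * fst z powr (- 2 * k I z))"
  have Peq: "P I z = Pform D p0 p1 q0 eps \<pi> I z" if z: "z \<in> S" for I z
  proof -
    have "fst z powr (ee I z + eps I) * fst z powr (- (ee I z + eps I)) = 1"
      using tpos[OF z] by (simp add: powr_add[symmetric])
    then have "fst z powr (ee I z + eps I) * \<pi> I z = S2 I z + \<delta> I z"
      unfolding \<pi>_def by (metis mult.commute mult.left_commute mult_1)
    then show ?thesis
      unfolding Pform_def Let_def P_def PS_def T1_def al_def ee_def k_def by (simp add: add.assoc)
  qed
  have Qeq: "Q I z = Qform D p0 q0 q1 \<kappa> I z" if z: "z \<in> S" for I z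
  proof -
    have "fst z powr (2 * k I z) * fst z powr (- 2 * k I z) = 1"
      using tpos[OF z] by (simp add: powr_add[symmetric])
    then have "fst z powr (2 * k I z) * \<kappa> I z = JH I z"
      unfolding \<kappa>_def by (metis mult.commute mult.left_commute mult_1)
    then show ?thesis
      unfolding Qform_def Let_def Q_def Q1_def k_def by (simp add: mult.commute)
  qed
  have ZZeq: "exp (ZZ Ix (Pform D p0 p1 q0 eps \<pi>) I z) = EP I z" if "z \<in> S" for I z
    unfolding EP_def ZZ_def using Peq[OF that] by simp
  have ein: "einstein_sys D (Pform D p0 p1 q0 eps \<pi>) (Qform D p0 q0 q1 \<kappa>) I z" if I: "I \<in> Ix" and z: "z \<in> S" for I z
  proof (rule einstein_of_frame[OF R _ _ _ _ fr' _ _ I z])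
    fix I assume I: "I \<in> Ix"
    show "pder True S (Pform D p0 p1 q0 eps \<pi> I) (V I)" by (rule pder_cong[OF PT[OF I] oS]) (rule Peq)
    show "pder False S (Pform D p0 p1 q0 eps \<pi> I) (\<lambda>z. W I z / fst z)" by (rule pder_cong[OF PF[OF I] oS]) (rule Peq)
    show "pder True S (Qform D p0 q0 q1 \<kappa> I) (\<lambda>z. exp (ZZ Ix (Pform D p0 p1 q0 eps \<pi>) I z) * X I z)"
      by (rule pder_cong_deriv[OF pder_cong[OF QT[OF I] oS]]) (rule Qeq, assumption, simp only: ZZeq)
    show "pder False S (Qform D p0 q0 q1 \<kappa> I) (\<lambda>z. exp (ZZ Ix (Pform D p0 p1 q0 eps \<pi>) I z) * Y I z / fst z)"
      by (rule pder_cong_deriv[OF pder_cong[OF QF[OF I] oS]]) (rule Qeq, assumption, simp only: ZZeq)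
    show "pder False S (W I) (dth (W I))" by (rule BO_dth(1)[OF BOW[OF I] R])
    show "pder False S (Y I) (dth (Y I))" by (rule BO_dth(1)[OF BOY[OF I] R])
  qed
  have BOpi: "BO True True S e (\<pi> I)" if I: "I \<in> Ix" for I
  proof -
    have "BO True True S0 0 (\<lambda>z. - (ee I z + eps I))"
      by (intro BO_minus BO_add BO_ee BO_const RS0 I) simp
    then have p: "BO True True S0 (- (2 - 2 * K I + eps I) - 3 * e) (\<lambda>z. fst z powr (- (ee I z + eps I)))"
      by (rule BO_powr[OF _ RS0, where e="- (2 - 2 * K I + eps I) - 2 * e"])
        (use ee_bd[OF I] e in \<open>fastforce simp: abs_le_iff\<close>)+
    \<comment> \<open>The bound eps I < 2 K - 1 keeps the exponent of the slot below 1, so the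
      correction \<delta> of order 1 + e fits as well.\<close>
    have "BO True True S (2 - 2 * K I + eps I + 4 * e) (\<lambda>z. S2 I z + \<delta> I z)"
      by (rule BO_add[OF mono[OF BO_S2'[OF I]] BO_weaken[OF BOd[OF I] R]]) (use m3[OF I I] e in simp)
    then show ?thesis unfolding \<pi>_def by (rule BO_mult[OF _ mono[OF p] R]) simp
  qed
  have BOka: "BO True True S e (\<kappa> I)" if I: "I \<in> Ix" for I
    unfolding \<kappa>_def by (rule BO_mult[OF BOJ[OF I] mono[OF BO_powr_k[OF I, of _ _ "-2"]] R]) (use e in simp)
  \<comment> \<open>A rectangle inside the triangle: times below L / 2 and distance below L / 2 from
    the centre.\<close>
  define T' where "T' = min T (L / 2)"
  define \<Omega> where "\<Omega> = {0<..<T'} \<times> {c - L / 2<..<c + L / 2}"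
  have T': "0 < T'" using T L by (simp add: T'_def)
  have OS: "\<Omega> \<subseteq> S" unfolding \<Omega>_def S_def Tri_def T'_def by (auto simp: abs_less_iff)
  have "is_expansion_solution D p0 p1 q0 q1 eps T' (c - L / 2) (c + L / 2) \<pi> \<kappa>"
    unfolding is_expansion_solution_def \<Omega>_def[symmetric]
  proof (intro conjI ballI)
    show "0 < T'" by (rule T')
    show "c - L / 2 < c + L / 2" using L by simp
    fix I assume I: "I \<in> Ix"
    show "regular_on \<Omega> (\<pi> I)" by (rule BO_regular(1)[OF BOpi[OF I] e0 R \<Omega>_def OS])
    show "regular_on \<Omega> (\<kappa> I)" by (rule BO_regular(1)[OF BOka[OF I] e0 R \<Omega>_def OS])
    show "((\<lambda>t. \<pi> I (t, \<theta>)) \<longlongrightarrow> 0) (at_right 0)" if "\<theta> \<in> {c - L / 2<..<c + L / 2}" for \<theta>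
      by (rule BO_regular(2)[OF BOpi[OF I] e0 R \<Omega>_def OS that T'])
    show "((\<lambda>t. \<kappa> I (t, \<theta>)) \<longlongrightarrow> 0) (at_right 0)" if "\<theta> \<in> {c - L / 2<..<c + L / 2}" for \<theta>
      by (rule BO_regular(2)[OF BOka[OF I] e0 R \<Omega>_def OS that T'])
    fix z assume "z \<in> \<Omega>"
    then show "einstein_sys D (Pform D p0 p1 q0 eps \<pi>) (Qform D p0 q0 q1 \<kappa>) I z" using ein[OF I] OS by blast
  qed
  then show ?thesis using L by (intro exI[of _ T'] exI[of _ "c - L / 2"] exI[of _ "c + L / 2"] exI[of _ \<pi>] exI[of _ \<kappa>]) auto
qed

end

subsection \<open>Estimates on lines of constant \<open>\<theta>\<close>\<close>

text \<open>Monotonicity in time of C / a * t powr a plus or minus f replaces an integration of f',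
  whose integrability up to t = 0 is then never discussed.\<close>

lemma radial_bound:
  assumes S: "backward_closed S" and f: "pder True S f f'" and C: "\<And>x. x \<in> S \<Longrightarrow> \<bar>f' x\<bar> \<le> C * fst x powr a" and a: "a > 0"
    and x: "x \<in> S" and s: "0 < s" "s \<le> fst x"
  shows "\<bar>f (s, snd x) - f x\<bar> \<le> C / a * (fst x powr a - s powr a)"
proof -
  have der: "((\<lambda>r. f (r, snd x)) has_real_derivative f' (r, snd x) / r) (at r)" and bd: "\<bar>f' (r, snd x) / r\<bar> \<le> C * r powr (a - 1)"
    if r: "s \<le> r" "r \<le> fst x" for r
  proof -
    have r0: "0 < r" using s r by simp
    have i: "(r, snd x) \<in> S" by (rule backward_slice[OF S x r0 r(2)])
    show "((\<lambda>r. f (r, snd x)) has_real_derivative f' (r, snd x) / r) (at r)"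
      using f i unfolding pder_def line_def crd_def wt_def by (fastforce simp: divide_inverse mult.commute)
    have "\<bar>f' (r, snd x)\<bar> / r \<le> C * r powr a / r" using C[OF i] r0 by (intro divide_right_mono) auto
    then show "\<bar>f' (r, snd x) / r\<bar> \<le> C * r powr (a - 1)" using r0 by (simp add: powr_diff)
  qed
  have p: "((\<lambda>r. C / a * r powr a) has_real_derivative C * r powr (a - 1)) (at r)" if "s \<le> r" for r
    using s that a by (auto intro!: derivative_eq_intros)
  have "C / a * s powr a - f (s, snd x) \<le> C / a * fst x powr a - f (fst x, snd x)"
  proof (rule DERIV_nonneg_imp_nondecreasing[OF s(2)])
    fix r assume r: "s \<le> r" "r \<le> fst x"
    show "\<exists>y. ((\<lambda>r. C / a * r powr a - f (r, snd x)) has_real_derivative y) (at r) \<and> 0 \<le> y"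
      using DERIV_diff[OF p[OF r(1)] der[OF r]] bd[OF r] by (intro exI conjI) (assumption, linarith)
  qed
  moreover have "C / a * s powr a + f (s, snd x) \<le> C / a * fst x powr a + f (fst x, snd x)"
  proof (rule DERIV_nonneg_imp_nondecreasing[OF s(2)])
    fix r assume r: "s \<le> r" "r \<le> fst x"
    show "\<exists>y. ((\<lambda>r. C / a * r powr a + f (r, snd x)) has_real_derivative y) (at r) \<and> 0 \<le> y"
      using DERIV_add[OF p[OF r(1)] der[OF r]] bd[OF r] by (intro exI conjI) (assumption, linarith)
  qed
  ultimately show ?thesis by (simp add: abs_le_iff right_diff_distrib)
qed

text \<open>The bound depends on the larger of two times only. So the values along t / (n + 1) form
  a Cauchy sequence, and the limit extends to all small times.\<close>

lemma radial_limit: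
  assumes S: "backward_closed S" and f: "pder True S f f'" and b: "Ob0 True S a f'" and a: "a > 0" and x: "x \<in> S"
  obtains l where "((\<lambda>s. f (s, snd x)) \<longlongrightarrow> l) (at_right 0)"
proof -
  obtain C where C: "C > 0" "\<And>x. x \<in> S \<Longrightarrow> \<bar>f' x\<bar> \<le> C * fst x powr a" using Ob0_bound[OF b] by blast
  have x0: "0 < fst x" using backward_closed_region[OF S] x by (auto simp: region_def)
  define u where "u = (\<lambda>n::nat. fst x / (real n + 1))"
  have u: "0 < u n" "u n \<le> fst x" for n using x0 by (auto simp: u_def field_simps)
  have gen: "\<bar>f (s, snd x) - f (t, snd x)\<bar> \<le> C / a * t powr a" if "0 < s" "s \<le> t" "t \<le> fst x" for s t
  proof -
    have i: "(t, snd x) \<in> S" using that by (intro backward_slice[OF S x]) auto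
    have "\<bar>f (s, snd x) - f (t, snd x)\<bar> \<le> C / a * (t powr a - s powr a)"
      using radial_bound[OF S f C(2) a i] that by simp
    also have "\<dots> \<le> C / a * t powr a" using C a by (intro mult_left_mono) auto
    finally show ?thesis .
  qed
  have ulim: "u \<longlonglongrightarrow> 0"
    using tendsto_mult[OF tendsto_const LIMSEQ_inverse_real_of_nat, of "fst x"] by (simp add: u_def divide_inverse add.commute)
  have pl: "((\<lambda>t::real. C / a * t powr a) \<longlongrightarrow> 0) (at_right 0)"
  proof -
    have "((\<lambda>s::real. s powr a) \<longlongrightarrow> 0 powr a) (at_right 0)"
      by (rule tendsto_powr'[OF tendsto_ident_at tendsto_const]) (use a in \<open>auto simp: eventually_at_filter\<close>)
    from tendsto_mult[OF tendsto_const[of "C / a"] this] show ?thesis by simp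
  qed
  have uat: "filterlim u (at_right 0) sequentially"
    using ulim less_imp_neq[OF u(1), symmetric] u(1) by (simp add: filterlim_at)
  have pu: "(\<lambda>n. C / a * u n powr a) \<longlonglongrightarrow> 0" by (rule filterlim_compose[OF pl uat])
  have dec: "u n \<le> u m" if "m \<le> n" for m n using x0 that by (auto simp: u_def intro!: divide_left_mono)
  have "Cauchy (\<lambda>n. f (u n, snd x))"
  proof (rule CauchyI)
    fix d :: real assume d: "0 < d"
    obtain N where N: "\<And>n. n \<ge> N \<Longrightarrow> C / a * u n powr a < d"
      using order_tendstoD(2)[OF pu d] unfolding eventually_sequentially by blast
    have w: "\<bar>f (u m, snd x) - f (u n, snd x)\<bar> < d" if "n \<le> m" "n \<ge> N" for m n
      using gen[OF u(1) dec[OF that(1)] u(2)] N[OF that(2)] by linarith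
    have "norm (f (u m, snd x) - f (u n, snd x)) < d" if "m \<ge> N" "n \<ge> N" for m n
      using w[of m n] w[of n m] that by (cases "m \<le> n") (auto simp: abs_minus_commute)
    then show "\<exists>M. \<forall>m\<ge>M. \<forall>n\<ge>M. norm (f (u m, snd x) - f (u n, snd x)) < d" by blast
  qed
  then obtain l where l: "(\<lambda>n. f (u n, snd x)) \<longlonglongrightarrow> l" using Cauchy_convergent convergent_def by blast
  have "\<bar>f (t, snd x) - l\<bar> \<le> C / a * t powr a" if t: "0 < t" "t \<le> fst x" for t
  proof -
    have "\<forall>\<^sub>F n in sequentially. u n < t" using order_tendstoD(2)[OF ulim t(1)] .
    then have "\<forall>\<^sub>F n in sequentially. \<bar>f (u n, snd x) - f (t, snd x)\<bar> \<le> C / a * t powr a"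
      by eventually_elim (use gen u t in force)
    moreover have "(\<lambda>n. \<bar>f (u n, snd x) - f (t, snd x)\<bar>) \<longlonglongrightarrow> \<bar>l - f (t, snd x)\<bar>"
      by (intro tendsto_intros l)
    ultimately have "\<bar>l - f (t, snd x)\<bar> \<le> C / a * t powr a"
      by (intro tendsto_upperbound[where F=sequentially and f="\<lambda>n. \<bar>f (u n, snd x) - f (t, snd x)\<bar>"]) auto
    then show ?thesis by (simp add: abs_minus_commute)
  qed
  note bound = this
  have "\<forall>\<^sub>F t in at_right 0. norm (f (t, snd x) - l) \<le> C / a * t powr a"
    using eventually_at_right_real[OF x0] by eventually_elim (use bound in simp)
  then have "((\<lambda>t. f (t, snd x) - l) \<longlongrightarrow> 0) (at_right 0)" using pl by (rule Lim_null_comparison)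
  then have "((\<lambda>t. f (t, snd x)) \<longlongrightarrow> l) (at_right 0)" by (simp add: LIM_zero_iff)
  then show ?thesis by (rule that)
qed

lemma radial_decay:
  assumes S: "backward_closed S" and f: "pder True S f f'" and b: "Ob0 True S a f'" and a: "a > 0" and cf: "continuous_on S f"
    and lim: "\<And>x. x \<in> S \<Longrightarrow> ((\<lambda>s. f (s, snd x)) \<longlongrightarrow> 0) (at_right 0)"
  shows "Ob0 True S a f"
proof -
  obtain C where C: "C > 0" "\<And>x. x \<in> S \<Longrightarrow> \<bar>f' x\<bar> \<le> C * fst x powr a" using Ob0_bound[OF b] by blast
  have "\<bar>f x\<bar> \<le> C / a * fst x powr a" if x: "x \<in> S" for x
  proof -
    have x0: "0 < fst x" using backward_closed_region[OF S] x by (auto simp: region_def)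
    have w: "\<bar>f (s, snd x) - f x\<bar> \<le> C / a * fst x powr a" if "0 < s" "s \<le> fst x" for s
    proof -
      have "\<bar>f (s, snd x) - f x\<bar> \<le> C / a * (fst x powr a - s powr a)" by (rule radial_bound[OF S f C(2) a x that])
      also have "\<dots> \<le> C / a * fst x powr a" using C a by (intro mult_left_mono) auto
      finally show ?thesis .
    qed
    have "\<forall>\<^sub>F s in at_right 0. \<bar>f (s, snd x) - f x\<bar> \<le> C / a * fst x powr a"
      using eventually_at_right_real[OF x0] by eventually_elim (use w in simp)
    moreover have "((\<lambda>s. \<bar>f (s, snd x) - f x\<bar>) \<longlongrightarrow> \<bar>0 - f x\<bar>) (at_right 0)"
      by (intro tendsto_intros lim[OF x])
    ultimately have "\<bar>0 - f x\<bar> \<le> C / a * fst x powr a"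
      by (intro tendsto_upperbound[OF _ _ trivial_limit_at_right_real[of 0]]) auto
    then show ?thesis by simp
  qed
  then show ?thesis using cf unfolding Ob0_def by blast
qed

lemma Ob0_expm1:
  assumes "Ob0 True S a f" "region S" "0 \<le> a" shows "Ob0 True S a (\<lambda>x. exp (f x) - 1)"
proof -
  obtain C where C: "C > 0" "\<And>x. x \<in> S \<Longrightarrow> \<bar>f x\<bar> \<le> C * fst x powr a" using Ob0_bound[OF assms(1)] by blast
  have "\<bar>exp (f x) - 1\<bar> \<le> (C * exp C) * fst x powr a" if x: "x \<in> S" for x
  proof -
    have "fst x powr a \<le> fst x powr 0" using assms(2,3) x by (intro powr_mono_01) (auto simp: region_def)
    then have "C * fst x powr a \<le> C * 1" using C assms(2) x by (intro mult_left_mono) (auto simp: region_def)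
    then have "\<bar>f x\<bar> \<le> C" using C(2)[OF x] by simp
    then have "\<bar>f x\<bar> * exp \<bar>f x\<bar> \<le> (C * fst x powr a) * exp C"
      using C(2)[OF x] C(1) by (intro mult_mono) auto
    then show ?thesis using abs_expm1_le[of "f x"] by (simp add: algebra_simps)
  qed
  moreover have "continuous_on S (\<lambda>x. exp (f x) - 1)" using assms(1) unfolding Ob0_def by (intro continuous_intros) auto
  ultimately show ?thesis unfolding Ob0_def by blast
qed

lemma Ob0_cmult: "Ob0 d S a f \<Longrightarrow> region S \<Longrightarrow> Ob0 d S a (\<lambda>x. r * f x)"
  using Ob_cmult[of False d S 0 a f r] by simp

lemma Ob0_diff: "Ob0 d S a f \<Longrightarrow> Ob0 d S a g \<Longrightarrow> region S \<Longrightarrow> Ob0 d S a (\<lambda>x. f x - g x)"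
  using Ob0_add[OF _ Ob0_cmult[of d S a g "-1"], of f] by simp

lemma Ob0_sum: "(\<And>i. i \<in> A \<Longrightarrow> Ob0 d S a (f i)) \<Longrightarrow> Ob0 d S a (\<lambda>x. \<Sum>i\<in>A. f i x)"
  using Ob_sum[of A False d S 0 a f] by simp

lemma Ob0_ZZ: "(\<And>I. I \<in> Ix \<Longrightarrow> Ob0 d S a (f I)) \<Longrightarrow> I \<in> Ix \<Longrightarrow> Ob0 d S a (ZZ Ix f I)"
  unfolding ZZ_def[abs_def] by (intro Ob0_add Ob0_sum) auto

subsection \<open>Solutions of the prescribed form\<close>

text \<open>The definition of regularity bounds \<open>\<theta>\<close>-derivatives only, and gives smoothness without bounds:
  hence the classes with exactly one of the two flags \<open>b\<close> and \<open>d\<close> of \<^const>\<open>BO\<close>.\<close>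

locale expansion = twisted +
  fixes TT :: real and pi kap :: "nat \<Rightarrow> real \<times> real \<Rightarrow> real"
  assumes TT: "0 < TT" "TT \<le> 1"
    and BOpi: "\<And>b d I. I \<in> {3..D-1} \<Longrightarrow> b \<noteq> d \<Longrightarrow> BO b d (Tri c L TT) 0 (pi I)"
    and BOkap: "\<And>b d I. I \<in> {3..D-1} \<Longrightarrow> b \<noteq> d \<Longrightarrow> BO b d (Tri c L TT) 0 (kap I)"
    and limkap: "\<And>I x. I \<in> {3..D-1} \<Longrightarrow> x \<in> Tri c L TT \<Longrightarrow> ((\<lambda>s. kap I (s, snd x)) \<longlongrightarrow> 0) (at_right 0)"
    and ein: "\<And>I x. I \<in> {3..D-1} \<Longrightarrow> x \<in> Tri c L TT \<Longrightarrow>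
        einstein_sys D (Pform D p0 p1 q0 eps pi) (Qform D p0 q0 q1 kap) I x"
begin

abbreviation "S \<equiv> Tri c L TT"
abbreviation "P \<equiv> Pform D p0 p1 q0 eps pi"
abbreviation "Q \<equiv> Qform D p0 q0 q1 kap"

definition "pr I x = T1 I x + fst x powr (ee I x + eps I) * pi I x"
definition "Q1 I x = fst x powr (2 * k I x) * (q1 I (snd x) + kap I x)"
definition "V I = Dop (P I)" for I
definition "W I x = fst x * dth (P I) x" for x
definition "Rm I x = exp (- 2 * ZZ Ix P I x) * Dop (Q I) x"
definition "X I x = exp (1 * ZZ Ix P I x) * Rm I x"
definition "Y I x = exp (- 1 * ZZ Ix P I x) * (fst x * dth (Q I) x)"
text \<open>The flux of the momentum: the equation for Q reads D Rm = t^2 * dth bb.\<close>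

definition "bb I x = exp (- 2 * ZZ Ix P I x) * dth (Q I) x"

section \<open>Frame of an exact solution\<close>

lemma bS: "backward_closed S" by (rule backward_closed_Tri[OF TT(2)])
lemma RS: "region S" by (rule backward_closed_region[OF bS])
lemma oS: "open S" using RS by (simp add: region_def)
lemma SS0: "S \<subseteq> S0" by (rule Tri_mono[OF TT(2)])
lemma St: "x \<in> S \<Longrightarrow> 0 < fst x" "x \<in> S \<Longrightarrow> fst x < 1" using RS by (auto simp: region_def)

lemmas mono = BO_subset[OF _ SS0]

lemma P_eq: "P I x = p0 I (snd x) * ln (fst x) + p1 I (snd x) + pr I x"
  unfolding Pform_def Let_def pr_def T1_def al_def ee_def k_def by (simp add: add.assoc)

lemma Q_eq: "Q I x = q0 I (snd x) + Q1 I x"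
  unfolding Qform_def Let_def Q1_def k_def by (simp add: algebra_simps)

text \<open>The margin \<open>m5\<close>, which encodes the lower bound on eps, makes the exponent
  ee + eps positive; hence this part of P decays even though \<open>pi\<close> enters only as a
  bounded function.\<close>

lemma BO_pr: "I \<in> Ix \<Longrightarrow> b \<noteq> d \<Longrightarrow> BO b d S (7 * e) (pr I)"
proof -
  assume I: "I \<in> Ix" and bd: "b \<noteq> d"
  have "BO b d S0 0 (\<lambda>z. ee I z + eps I)"
    by (intro BO_add BO_ee BO_const RS0 I) simp
  then have "BO b d S0 (7 * e) (\<lambda>z. fst z powr (ee I z + eps I))"
    by (rule BO_powr[OF _ RS0, where e="8 * e"]) (use ee_bd[OF I] m5[OF I] e in \<open>fastforce simp: abs_le_iff\<close>)+
  from BO_mult[OF mono[OF this] BOpi[OF I bd] RS]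
  have "BO b d S (7 * e) (\<lambda>z. fst z powr (ee I z + eps I) * pi I z)" by simp
  moreover have "BO b d S (7 * e) (T1 I)" by (rule BO_weaken[OF mono[OF BO_T1'[OF I]] RS]) (use e in simp)
  ultimately show ?thesis unfolding pr_def[abs_def] by (intro BO_add)
qed

lemma BO_zr: "I \<in> Ix \<Longrightarrow> b \<noteq> d \<Longrightarrow> BO b d S (7 * e) (ZZ Ix pr I)"
  unfolding ZZ_def[abs_def] by (intro BO_add BO_sum BO_pr)

lemma ZZP: "ZZ Ix P I x = k I x * ln (fst x) + pp I x + ZZ Ix pr I x"
  unfolding ZZ_def P_eq k_def kI_def pp_def by (simp add: sum.distrib sum_distrib_left algebra_simps)

lemma exp_ZZP: "x \<in> S \<Longrightarrow> exp (n * ZZ Ix P I x) = fst x powr (n * k I x) * exp (n * (pp I x + ZZ Ix pr I x))"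
  using St(1)[of x] unfolding ZZP powr_def by (simp add: exp_add[symmetric] algebra_simps)

lemma BO_P: "I \<in> Ix \<Longrightarrow> b \<noteq> d \<Longrightarrow> BO b d S (- e) (P I)"
proof -
  assume I: "I \<in> Ix" and bd: "b \<noteq> d"
  have 1: "BO b d S (- e) (\<lambda>x. p0 I (snd x) * ln (fst x))"
    by (rule BO_mult[OF BO_snd BO_ln RS]) (use e sm RS I in auto)
  have 2: "BO b d S (- e) (\<lambda>x. p1 I (snd x))"
    by (rule BO_weaken[OF BO_snd RS]) (use e sm RS I in auto)
  have 3: "BO b d S (- e) (pr I)"
    by (rule BO_weaken[OF BO_pr[OF I bd] RS]) (use e in auto)
  show ?thesis unfolding P_eq[abs_def] by (rule BO_add[OF BO_add[OF 1 2] 3])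
qed

lemma BO_exp_ZZP:
  assumes "I \<in> Ix" "b \<noteq> d" shows "BO b d S (n * K I - (\<bar>n\<bar> + 1) * e) (\<lambda>x. exp (n * ZZ Ix P I x))"
proof -
  have "BO b d S 0 (\<lambda>x. exp (n * (pp I x + ZZ Ix pr I x)))"
    by (intro BO_exp BO_cmult BO_add mono[OF BO_pp] BO_weaken[OF BO_zr RS] RS) (use assms e in auto)
  from BO_mult[OF mono[OF BO_powr_k[OF assms(1), of b d n]] this RS]
  have "BO b d S (n * K I - (\<bar>n\<bar> + 1) * e) (\<lambda>x. fst x powr (n * k I x) * exp (n * (pp I x + ZZ Ix pr I x)))" by simp
  then show ?thesis by (rule BO_cong) (use oS exp_ZZP in auto)
qed

lemma BO_Q1: "I \<in> Ix \<Longrightarrow> b \<noteq> d \<Longrightarrow> BO b d S (2 * K I - 3 * e) (Q1 I)"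
proof -
  assume I: "I \<in> Ix" and bd: "b \<noteq> d"
  have "BO b d S 0 (\<lambda>x. q1 I (snd x) + kap I x)" by (intro BO_add BO_snd sm RS BOkap I bd)
  from BO_mult[OF mono[OF BO_powr_k[OF I, of b d 2]] this RS] show ?thesis unfolding Q1_def[abs_def] by simp
qed

lemma BO_Q: "I \<in> Ix \<Longrightarrow> b \<noteq> d \<Longrightarrow> BO b d S 0 (Q I)"
proof -
  assume I: "I \<in> Ix" and bd: "b \<noteq> d"
  have 1: "BO b d S 0 (\<lambda>x. q0 I (snd x))" by (intro BO_snd sm RS I)
  have 2: "BO b d S 0 (Q1 I)" by (rule BO_weaken[OF BO_Q1[OF I bd] RS]) (use m1[OF I] e in simp)
  show ?thesis unfolding Q_eq[abs_def] by (rule BO_add[OF 1 2])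
qed

lemma BO_dthQ: "I \<in> Ix \<Longrightarrow> b \<noteq> d \<Longrightarrow> BO b d S 0 (dth (Q I))"
  by (rule BO_dth(2)[OF BO_Q RS])

lemma BO_bb: "I \<in> Ix \<Longrightarrow> b \<noteq> d \<Longrightarrow> BO b d S (- 2 * K I - 3 * e) (bb I)"
  unfolding bb_def[abs_def] by (rule BO_mult[OF BO_exp_ZZP BO_dthQ RS]) auto

lemma smP: "I \<in> Ix \<Longrightarrow> BO True False S 0 (P I)" using BO_smooth_any[OF BO_P RS, of I True] by simp

lemma smV: "I \<in> Ix \<Longrightarrow> BO True False S 0 (V I)" unfolding V_def by (rule BO_Dop(2)[OF smP RS])
lemma smW: "I \<in> Ix \<Longrightarrow> BO True False S 0 (W I)"
  unfolding W_def[abs_def] by (rule BO_mult[OF BO_fst[OF RS] BO_dth(2)[OF smP RS] RS]) auto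
lemma smexp: "I \<in> Ix \<Longrightarrow> BO True False S 0 (\<lambda>x. exp (n * ZZ Ix P I x))"
  by (rule BO_smooth_any[OF BO_exp_ZZP RS]) simp_all
lemma smR: "I \<in> Ix \<Longrightarrow> BO True False S 0 (Rm I)"
  unfolding Rm_def[abs_def] by (rule BO_mult[OF smexp BO_Dop(2)[OF BO_Q RS] RS]) auto
lemma smX: "I \<in> Ix \<Longrightarrow> BO True False S 0 (X I)"
  unfolding X_def[abs_def] by (rule BO_mult[OF smexp smR RS]) auto
lemma smY: "I \<in> Ix \<Longrightarrow> BO True False S 0 (Y I)"
  unfolding Y_def[abs_def] by (rule BO_mult[OF smexp BO_mult[OF BO_fst[OF RS] BO_dthQ RS, where e=0] RS]) auto
lemma smb: "I \<in> Ix \<Longrightarrow> BO True False S 0 (bb I)" using BO_smooth_any[OF BO_bb RS, of I True] by simp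

lemma pP: "I \<in> Ix \<Longrightarrow> pder True S (P I) (V I)" unfolding V_def by (rule BO_Dop(1)[OF smP RS])
lemma pQ: "I \<in> Ix \<Longrightarrow> pder True S (Q I) (Dop (Q I))" by (rule BO_Dop(1)[OF BO_Q RS]) auto
lemma pZZ: "I \<in> Ix \<Longrightarrow> pder True S (ZZ Ix P I) (ZZ Ix V I)"
  unfolding ZZ_def[abs_def] by (intro pder_add pder_sum pP)
lemma pZZF: "I \<in> Ix \<Longrightarrow> pder False S (ZZ Ix P I) (\<lambda>x. ZZ Ix W I x / fst x)"
proof -
  assume I: "I \<in> Ix"
  have 1: "pder False S (P J) (\<lambda>x. W J x / fst x)" if "J \<in> Ix" for J
    by (rule pder_cong_deriv[OF BO_dth(1)[OF smP[OF that] RS]]) (use St(1) in \<open>fastforce simp: W_def\<close>)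
  show ?thesis
    using pder_add[OF pder_sum[where A=Ix and f=P and f'="\<lambda>I z. W I z / fst z", OF 1] 1[OF I]]
    unfolding ZZ_def[abs_def] by (simp add: add_divide_distrib sum_divide_distrib)
qed

lemma sum_is_ZZ: "(\<lambda>y. (\<Sum>J = 3..D-1. P J y) + P I y) = ZZ Ix P I"
  by (simp add: ZZ_def fun_eq_iff)

lemma eqP: "I \<in> Ix \<Longrightarrow> x \<in> S \<Longrightarrow> Dop (V I) x = (fst x)\<^sup>2 * dth (dth (P I)) x
    - 1 / 2 * exp (- 2 * ZZ Ix P I x) * ((Dop (Q I) x)\<^sup>2 - (fst x * dth (Q I) x)\<^sup>2)"
  using ein[of I x] unfolding einstein_sys_def Let_def sum_is_ZZ V_def by (simp add: algebra_simps)

lemma eqQ: "I \<in> Ix \<Longrightarrow> x \<in> S \<Longrightarrow> Dop (Dop (Q I)) x = (fst x)\<^sup>2 * dth (dth (Q I)) x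
    + 2 * (ZZ Ix V I x * Dop (Q I) x - (fst x)\<^sup>2 * (ZZ Ix W I x / fst x) * dth (Q I) x)"
  using ein[of I x] pder_True_Dop[OF pZZ _ St(1), of I x] pder_False_dth[OF pZZF, of I x]
  unfolding einstein_sys_def Let_def sum_is_ZZ by (simp add: algebra_simps)

lemma dth_bb: "I \<in> Ix \<Longrightarrow> x \<in> S \<Longrightarrow> dth (bb I) x = exp (- 2 * ZZ Ix P I x) * (dth (dth (Q I)) x - 2 * (ZZ Ix W I x / fst x) * dth (Q I) x)"
proof -
  assume I: "I \<in> Ix" and x: "x \<in> S"
  have "pder False S (bb I) (\<lambda>x. - 2 * (ZZ Ix W I x / fst x) * exp (- 2 * ZZ Ix P I x) * dth (Q I) x + exp (- 2 * ZZ Ix P I x) * dth (dth (Q I)) x)"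
    unfolding bb_def[abs_def]
    by (rule pder_mult[OF pder_exp[OF pder_cmult[OF pZZF[OF I]]] BO_dth(1)[OF BO_dthQ[OF I, of True False] RS]]) simp
  from pder_False_dth[OF this x] show ?thesis by (simp add: algebra_simps)
qed

text \<open>The momentum \<open>exp (- 2 * PP\<^sub>I) * Dop Q\<^sub>I\<close> is conserved up to \<open>\<theta>\<close>-derivatives, whose bounds are part of
  regularity.\<close>

lemma pR: assumes I: "I \<in> Ix" shows "pder True S (Rm I) (\<lambda>x. (fst x)\<^sup>2 * dth (bb I) x)"
proof -
  have "pder True S (Dop (Q I)) (Dop (Dop (Q I)))" by (rule BO_Dop(1)[OF BO_Dop(2)[OF BO_Q[OF I, of True False] RS] RS]) simp
  from pder_mult[OF pder_exp[OF pder_cmult[OF pZZ[OF I]]] this]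
  show ?thesis unfolding Rm_def[abs_def]
    by (rule pder_cong_deriv) (simp add: eqQ[OF I] dth_bb[OF I] algebra_simps)
qed

lemma DopQ: "Dop (Q I) x = exp (1 * ZZ Ix P I x) * X I x" "Dop (Q I) x = exp (2 * ZZ Ix P I x) * Rm I x"
  unfolding X_def Rm_def by (simp_all add: mult.assoc[symmetric] exp_add[symmetric])

lemma XY_sq: "exp (- 2 * ZZ Ix P I x) * ((Dop (Q I) x)\<^sup>2 - (fst x * dth (Q I) x)\<^sup>2) = (X I x)\<^sup>2 - (Y I x)\<^sup>2"
proof -
  have a: "exp (- 2 * z) * (exp (1 * z) * a)\<^sup>2 = a\<^sup>2" for z a :: real
    by (simp add: power_mult_distrib mult.assoc[symmetric] exp_double[symmetric] exp_add[symmetric])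
  have b: "exp (- 2 * z) * a\<^sup>2 = (exp (- 1 * z) * a)\<^sup>2" for z a :: real
    by (simp add: power_mult_distrib exp_double[symmetric])
  show ?thesis unfolding DopQ(1) Y_def right_diff_distrib a unfolding b by (rule refl)
qed

text \<open>Here W and Y are genuine theta-derivatives, so their equations are commutation of
  derivatives, while the equations for V and X restate the second order system.\<close>

lemma frame_PQ: "frame Ix S V W X Y"
  unfolding frame_def
proof (intro ballI conjI)
  fix I assume I: "I \<in> Ix"
  have dW: "dth (W I) x = fst x * dth (dth (P I)) x" if x: "x \<in> S" for x
    using pder_False_dth[OF pder_mult[OF pder_fst[OF RS, of False] BO_dth(1)[OF BO_dth(2)[OF smP[OF I] RS] RS]] x]
    unfolding W_def[abs_def] by simp
  show "pder True S (V I) (\<lambda>x. fst x * dth (W I) x - ((X I x)\<^sup>2 - (Y I x)\<^sup>2) / 2)"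
  proof (rule pder_cong_deriv[OF BO_Dop(1)[OF smV[OF I] RS]])
    fix x assume x: "x \<in> S"
    show "Dop (V I) x = fst x * dth (W I) x - ((X I x)\<^sup>2 - (Y I x)\<^sup>2) / 2"
      unfolding eqP[OF I x] dW[OF x] XY_sq[symmetric] by (simp add: power2_eq_square)
  qed
  show "pder True S (W I) (\<lambda>x. fst x * dth (V I) x + W I x)"
    unfolding W_def[abs_def] by (rule pder_times_dth[OF smP[OF I] RS _ BO_dth(1)[OF smV[OF I] RS]]) (simp add: V_def)
  \<comment> \<open>Expressing Y by the flux makes dth Y contain dth bb, the source in the momentum
    equation.\<close>
  have Yb: "Y I x = exp (1 * ZZ Ix P I x) * (fst x * bb I x)" for x
    unfolding Y_def bb_def by (simp add: mult.left_commute mult.assoc[symmetric] exp_add[symmetric])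
  have dY: "dth (Y I) x = (1 * (ZZ Ix W I x / fst x)) * exp (1 * ZZ Ix P I x) * (fst x * bb I x) + exp (1 * ZZ Ix P I x) * (fst x * dth (bb I) x)"
    if x: "x \<in> S" for x
    using pder_False_dth[OF pder_mult[OF pder_exp[OF pder_cmult[OF pZZF[OF I], of 1]] pder_mult[OF pder_fst[OF RS, of False] BO_dth(1)[OF smb[OF I] RS]]] x]
    unfolding Yb[abs_def] by simp
  show "pder True S (X I) (\<lambda>x. fst x * dth (Y I) x + ZZ Ix V I x * X I x - ZZ Ix W I x * Y I x)"
    unfolding X_def[abs_def]
  proof (rule pder_cong_deriv[OF pder_mult[OF pder_exp[OF pder_cmult[OF pZZ[OF I]]] pR[OF I]]])
    fix x assume x: "x \<in> S"
    have "fst x \<noteq> 0" using St(1)[OF x] by simp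
    then show "1 * ZZ Ix V I x * exp (1 * ZZ Ix P I x) * Rm I x + exp (1 * ZZ Ix P I x) * ((fst x)\<^sup>2 * dth (bb I) x) =
      fst x * dth (Y I) x + ZZ Ix V I x * (exp (1 * ZZ Ix P I x) * Rm I x) - ZZ Ix W I x * Y I x"
      unfolding dY[OF x] Yb by (simp add: power2_eq_square field_simps)
  qed
  have dX: "pder False S (\<lambda>x. exp (1 * ZZ Ix P I x) * X I x) (\<lambda>x. (1 * (ZZ Ix W I x / fst x)) * exp (1 * ZZ Ix P I x) * X I x + exp (1 * ZZ Ix P I x) * dth (X I) x)"
    by (rule pder_mult[OF pder_exp[OF pder_cmult[OF pZZF[OF I]]] BO_dth(1)[OF smX[OF I] RS]])
  have tQ: "pder True S (\<lambda>x. fst x * dth (Q I) x) (\<lambda>x. fst x * ((1 * (ZZ Ix W I x / fst x)) * exp (1 * ZZ Ix P I x) * X I x + exp (1 * ZZ Ix P I x) * dth (X I) x) + fst x * dth (Q I) x)"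
    by (rule pder_times_dth[OF BO_Q[OF I, of True False] RS DopQ(1) dX]) simp
  show "pder True S (Y I) (\<lambda>x. fst x * dth (X I) x + Y I x - ZZ Ix V I x * Y I x + ZZ Ix W I x * X I x)"
    unfolding Y_def[abs_def]
  proof (rule pder_cong_deriv[OF pder_mult[OF pder_exp[OF pder_cmult[OF pZZ[OF I]]] tQ]])
    fix x assume x: "x \<in> S"
    have t: "fst x \<noteq> 0" using St(1)[OF x] by simp
    have ex: "exp (- 1 * ZZ Ix P I x) * exp (1 * ZZ Ix P I x) = 1" by (simp add: exp_add[symmetric])
    have "exp (- 1 * ZZ Ix P I x) * (fst x * ((1 * (ZZ Ix W I x / fst x)) * exp (1 * ZZ Ix P I x) * X I x + exp (1 * ZZ Ix P I x) * dth (X I) x) + fst x * dth (Q I) x)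
      = (exp (- 1 * ZZ Ix P I x) * exp (1 * ZZ Ix P I x)) * (ZZ Ix W I x * X I x + fst x * dth (X I) x) + exp (- 1 * ZZ Ix P I x) * (fst x * dth (Q I) x)"
      using t by (simp add: distrib_left mult_ac)
    then show "- 1 * ZZ Ix V I x * exp (- 1 * ZZ Ix P I x) * (fst x * dth (Q I) x) +
      exp (- 1 * ZZ Ix P I x) * (fst x * ((1 * (ZZ Ix W I x / fst x)) * exp (1 * ZZ Ix P I x) * X I x + exp (1 * ZZ Ix P I x) * dth (X I) x) + fst x * dth (Q I) x) =
      fst x * dth (X I) x + exp (- 1 * ZZ Ix P I x) * (fst x * dth (Q I) x) - ZZ Ix V I x * (exp (- 1 * ZZ Ix P I x) * (fst x * dth (Q I) x)) + ZZ Ix W I x * X I x"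
      unfolding ex by (simp add: algebra_simps)
  qed
qed

end

section \<open>Uniqueness for the frame\<close>

lemma Ob0_lim0:
  assumes "Ob0 True S a f" "a > 0" "backward_closed S" "x \<in> S"
  shows "((\<lambda>s. f (s, snd x)) \<longlongrightarrow> 0) (at_right 0)"
proof -
  obtain C where C: "C > 0" "\<And>x. x \<in> S \<Longrightarrow> \<bar>f x\<bar> \<le> C * fst x powr a" using Ob0_bound[OF assms(1)] by blast
  have x0: "0 < fst x" using backward_closed_region[OF assms(3)] assms(4) by (auto simp: region_def)
  have "\<forall>\<^sub>F s in at_right 0. norm (f (s, snd x)) \<le> C * s powr a"
    using eventually_at_right_real[OF x0]
  proof eventually_elim
    case (elim s)
    have "(s, snd x) \<in> S" using elim by (intro backward_slice[OF assms(3,4)]) auto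
    from C(2)[OF this] show ?case by simp
  qed
  then show ?thesis using powr_lim0[OF assms(2)] by (rule Lim_null_comparison)
qed

text \<open>The constant M serves to make \<open>\<phi>\<close> vanish at 0; the conclusion involves
  C / a alone, so such an estimate can be iterated.\<close>

lemma decay_bound:
  fixes \<phi> :: "real \<Rightarrow> real"
  assumes d: "\<And>r. 0 < r \<Longrightarrow> r \<le> t \<Longrightarrow> (\<phi> has_real_derivative d r) (at r)" "\<And>r. 0 < r \<Longrightarrow> r \<le> t \<Longrightarrow> \<bar>d r\<bar> \<le> C * r powr (a - 1)"
    and M: "\<And>r. 0 < r \<Longrightarrow> r \<le> t \<Longrightarrow> \<bar>\<phi> r\<bar> \<le> M * r powr a" and a: "a > 0" and t: "t > 0" and C: "C \<ge> 0"
  shows "\<bar>\<phi> t\<bar> \<le> C / a * t powr a"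
proof -
  have p: "((\<lambda>r. C / a * r powr a) has_real_derivative C * r powr (a - 1)) (at r)" if "0 < r" for r
    using that a by (auto intro!: derivative_eq_intros)
  have w: "\<bar>\<phi> t - \<phi> s\<bar> \<le> C / a * t powr a" if s: "0 < s" "s \<le> t" for s
  proof -
    have "C / a * s powr a - \<phi> s \<le> C / a * t powr a - \<phi> t"
    proof (rule DERIV_nonneg_imp_nondecreasing[OF s(2)])
      fix r assume "s \<le> r" "r \<le> t"
      then have r: "0 < r" "r \<le> t" using s by auto
      show "\<exists>y. ((\<lambda>r. C / a * r powr a - \<phi> r) has_real_derivative y) (at r) \<and> 0 \<le> y"
        using DERIV_diff[OF p[OF r(1)] d(1)[OF r]] d(2)[OF r] by (intro exI conjI) (assumption, linarith)
    qed
    moreover have "C / a * s powr a + \<phi> s \<le> C / a * t powr a + \<phi> t"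
    proof (rule DERIV_nonneg_imp_nondecreasing[OF s(2)])
      fix r assume "s \<le> r" "r \<le> t"
      then have r: "0 < r" "r \<le> t" using s by auto
      show "\<exists>y. ((\<lambda>r. C / a * r powr a + \<phi> r) has_real_derivative y) (at r) \<and> 0 \<le> y"
        using DERIV_add[OF p[OF r(1)] d(1)[OF r]] d(2)[OF r] by (intro exI conjI) (assumption, linarith)
    qed
    moreover have "0 \<le> C / a * s powr a" using C a by simp
    ultimately show ?thesis by linarith
  qed
  have "\<bar>\<phi> t\<bar> - M * s powr a \<le> C / a * t powr a" if s: "0 < s" "s \<le> t" for s
    using w[OF s] M[OF s] by linarith
  note b = this
  have "\<forall>\<^sub>F s in at_right 0. \<bar>\<phi> t\<bar> - M * s powr a \<le> C / a * t powr a"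
    using eventually_at_right_real[OF t] by eventually_elim (use b in simp)
  moreover have "((\<lambda>s. \<bar>\<phi> t\<bar> - M * s powr a) \<longlongrightarrow> \<bar>\<phi> t\<bar> - 0) (at_right 0)"
    by (intro tendsto_diff tendsto_const powr_lim0 a)
  ultimately have "\<bar>\<phi> t\<bar> - 0 \<le> C / a * t powr a"
    by (intro tendsto_upperbound[OF _ _ trivial_limit_at_right_real[of 0]]) auto
  then show ?thesis by simp
qed

lemma char_in:
  assumes "backward_closed S" "x \<in> S" "\<bar>lam\<bar> \<le> 1" "0 < s" "s \<le> fst x"
  shows "(s, snd x + lam * (fst x - s)) \<in> S"
proof -
  have "s / fst x \<in> {0<..1}" "lam \<in> {-1..1}" using assms by auto
  then have "pt lam x (s / fst x) \<in> S" using assms(1,2) unfolding backward_closed_def by blast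
  then show ?thesis using assms(4,5) by (simp add: pt_def right_diff_distrib)
qed

text \<open>Counterpart of \<open>char_integral_bound\<close> for a given solution of the transport
  equation: the gain 1 / mu is obtained along the characteristic without representing u as an
  integral.\<close>

lemma char_decay:
  assumes S: "backward_closed S" and lam: "\<bar>lam\<bar> \<le> 1" and mu: "mu > 0"
    and u: "pder True S u (\<lambda>x. h x + lam * fst x * u' x)" and u': "pder False S u u'" "continuous_on S u'"
    and h: "\<And>x. x \<in> S \<Longrightarrow> \<bar>h x\<bar> \<le> C * fst x powr mu" and M: "\<And>x. x \<in> S \<Longrightarrow> \<bar>u x\<bar> \<le> M * fst x powr mu"
    and x: "x \<in> S" and C: "C \<ge> 0"
  shows "\<bar>u x\<bar> \<le> C / mu * fst x powr mu"
proof -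
  have oS: "open S" and x0: "0 < fst x" using backward_closed_region[OF S] x by (auto simp: region_def)
  let ?y = "\<lambda>s. (s, snd x + lam * (fst x - s))"
  have yS: "?y s \<in> S" if "0 < s" "s \<le> fst x" for s by (rule char_in[OF S x lam that])
  have "\<bar>u (?y (fst x))\<bar> \<le> C / mu * fst x powr mu"
  proof (rule decay_bound[where \<phi>="\<lambda>s. u (?y s)" and d="\<lambda>s. h (?y s) / s" and M=M])
    fix s assume s: "0 < s" "s \<le> fst x"
    have "((\<lambda>r. u (r, snd (?y s))) has_real_derivative (h (?y s) + lam * s * u' (?y s)) / s) (at (fst (?y s)))"
      using u yS[OF s] unfolding pder_def line_def crd_def wt_def by (fastforce simp: divide_inverse mult.commute)
    from time_to_char[OF oS yS[OF s] u' lam this]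
    have "((\<lambda>r. u (r, snd x + lam * (fst x - s) + lam * (s - r))) has_real_derivative (h (?y s) + lam * s * u' (?y s)) / s - lam * u' (?y s)) (at s)"
      by simp
    moreover have "snd x + lam * (fst x - s) + lam * (s - r) = snd x + lam * (fst x - r)" for r by (simp add: algebra_simps)
    moreover have "(h (?y s) + lam * s * u' (?y s)) / s - lam * u' (?y s) = h (?y s) / s" using s by (simp add: field_simps)
    ultimately show "((\<lambda>s. u (?y s)) has_real_derivative h (?y s) / s) (at s)" by (simp only:)
    have "\<bar>h (?y s)\<bar> / s \<le> C * s powr mu / s" using h[OF yS[OF s]] s by (intro divide_right_mono) auto
    then show "\<bar>h (?y s) / s\<bar> \<le> C * s powr (mu - 1)" using s by (simp add: powr_diff)
    show "\<bar>u (?y s)\<bar> \<le> M * s powr mu" using M[OF yS[OF s]] by simp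
  qed (use mu x0 C in auto)
  then show ?thesis by simp
qed

text \<open>A common bound M * t powr mu on the characteristic components of the difference improves
  to q * M * t powr mu with q = (1 + n1 * s) / mu < 1. Iteration sends the bound to 0.\<close>

lemma frame_unique:
  fixes V W X Y V' W' X' Y' :: "'i \<Rightarrow> real \<times> real \<Rightarrow> real"
  assumes fin: "finite Ix" and mu: "mu > 1" and T: "0 < T" "T \<le> 1"
    and fr: "frame Ix (Tri c L T) V W X Y" and fr': "frame Ix (Tri c L T) V' W' X' Y'"
    and sm: "\<And>I. I \<in> Ix \<Longrightarrow> BO True False (Tri c L T) 0 (V I)" "\<And>I. I \<in> Ix \<Longrightarrow> BO True False (Tri c L T) 0 (W I)"
      "\<And>I. I \<in> Ix \<Longrightarrow> BO True False (Tri c L T) 0 (X I)" "\<And>I. I \<in> Ix \<Longrightarrow> BO True False (Tri c L T) 0 (Y I)"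
    and sm': "\<And>I. I \<in> Ix \<Longrightarrow> BO True False (Tri c L T) 0 (V' I)" "\<And>I. I \<in> Ix \<Longrightarrow> BO True False (Tri c L T) 0 (W' I)"
      "\<And>I. I \<in> Ix \<Longrightarrow> BO True False (Tri c L T) 0 (X' I)" "\<And>I. I \<in> Ix \<Longrightarrow> BO True False (Tri c L T) 0 (Y' I)"
    and dV: "\<And>I. I \<in> Ix \<Longrightarrow> Ob0 True (Tri c L T) mu (\<lambda>x. V I x - V' I x)"
    and dW: "\<And>I. I \<in> Ix \<Longrightarrow> Ob0 True (Tri c L T) mu (\<lambda>x. W I x - W' I x)"
    and dX: "\<And>I. I \<in> Ix \<Longrightarrow> Ob0 True (Tri c L T) mu (\<lambda>x. X I x - X' I x)"
    and dY: "\<And>I. I \<in> Ix \<Longrightarrow> Ob0 True (Tri c L T) mu (\<lambda>x. Y I x - Y' I x)"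
    and P: "\<And>I x. I \<in> Ix \<Longrightarrow> x \<in> Tri c L T \<Longrightarrow> \<bar>X I x + Y I x\<bar> \<le> s" "\<And>I x. I \<in> Ix \<Longrightarrow> x \<in> Tri c L T \<Longrightarrow> \<bar>X I x - Y I x\<bar> \<le> s"
    and P': "\<And>I x. I \<in> Ix \<Longrightarrow> x \<in> Tri c L T \<Longrightarrow> \<bar>X' I x + Y' I x\<bar> \<le> s" "\<And>I x. I \<in> Ix \<Longrightarrow> x \<in> Tri c L T \<Longrightarrow> \<bar>X' I x - Y' I x\<bar> \<le> s"
    and Z: "\<And>I x. I \<in> Ix \<Longrightarrow> x \<in> Tri c L T \<Longrightarrow> \<bar>ZZ Ix V I x + ZZ Ix W I x - 1 / 2\<bar> \<le> 1 / 2"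
      "\<And>I x. I \<in> Ix \<Longrightarrow> x \<in> Tri c L T \<Longrightarrow> \<bar>ZZ Ix V I x - ZZ Ix W I x - 1 / 2\<bar> \<le> 1 / 2"
    and s: "0 \<le> s" "1 + (real (card Ix) + 1) * s < mu"
    and I: "I \<in> Ix" and x: "x \<in> Tri c L T"
  shows "V I x = V' I x" "X I x = X' I x"
proof -
  define S where "S = Tri c L T"
  have bS: "backward_closed S" unfolding S_def by (rule backward_closed_Tri[OF T(2)])
  have R: "region S" by (rule backward_closed_region[OF bS])
  note sm = sm[folded S_def] and sm' = sm'[folded S_def] and fr = fr[folded S_def] and fr' = fr'[folded S_def]
  note dd = dV[folded S_def] dW[folded S_def] dX[folded S_def] dY[folded S_def]
  define v w xx yy where "v = (\<lambda>I x. V I x - V' I x)" and "w = (\<lambda>I x. W I x - W' I x)"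
    and "xx = (\<lambda>I x. X I x - X' I x)" and "yy = (\<lambda>I x. Y I x - Y' I x)"
  define u where "u = (\<lambda>(k::nat) I x. if k = 0 then v I x + w I x else if k = 1 then v I x - w I x
     else if k = 2 then xx I x + yy I x else xx I x - yy I x)"
  have u: "u 0 I x = v I x + w I x" "u 1 I x = v I x - w I x" "u 2 I x = xx I x + yy I x" "u 3 I x = xx I x - yy I x" for I x
    by (simp_all add: u_def)
  define n1 where "n1 = real (card Ix) + 1"
  have n1: "n1 \<ge> 1" by (simp add: n1_def)
  define zz where "zz = (\<lambda>k I x. (\<Sum>J\<in>Ix. u k J x) + u k I x)"
  have zz: "zz 0 I x = (ZZ Ix V I x + ZZ Ix W I x) - (ZZ Ix V' I x + ZZ Ix W' I x)"
     "zz 1 I x = (ZZ Ix V I x - ZZ Ix W I x) - (ZZ Ix V' I x - ZZ Ix W' I x)" for I x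
    unfolding zz_def u v_def w_def ZZ_def by (simp_all add: sum.distrib sum_subtractf)
  \<comment> \<open>Products are expanded with one factor from each solution, so every term is
    linear in the difference and the constant is 1 + n1 * s.\<close>
  define h where "h = (\<lambda>(k::nat) I x. if k = 0 then (u 0 I x - u 1 I x) / 2 - (u 2 I x * (X I x - Y I x) + (X' I x + Y' I x) * u 3 I x) / 2
     else if k = 1 then - (u 0 I x - u 1 I x) / 2 - (u 2 I x * (X I x - Y I x) + (X' I x + Y' I x) * u 3 I x) / 2
     else if k = 2 then (ZZ Ix V I x + ZZ Ix W I x - 1 / 2) * u 3 I x + u 2 I x / 2 + zz 0 I x * (X' I x - Y' I x)
     else (ZZ Ix V I x - ZZ Ix W I x - 1 / 2) * u 2 I x + u 3 I x / 2 + zz 1 I x * (X' I x + Y' I x))"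
  have h: "h 0 I x = (u 0 I x - u 1 I x) / 2 - (u 2 I x * (X I x - Y I x) + (X' I x + Y' I x) * u 3 I x) / 2"
     "h 1 I x = - (u 0 I x - u 1 I x) / 2 - (u 2 I x * (X I x - Y I x) + (X' I x + Y' I x) * u 3 I x) / 2"
     "h 2 I x = (ZZ Ix V I x + ZZ Ix W I x - 1 / 2) * u 3 I x + u 2 I x / 2 + zz 0 I x * (X' I x - Y' I x)"
     "h 3 I x = (ZZ Ix V I x - ZZ Ix W I x - 1 / 2) * u 2 I x + u 3 I x / 2 + zz 1 I x * (X' I x + Y' I x)" for I x
    by (simp_all add: h_def)
  define lam where "lam = (\<lambda>k::nat. if k = 0 \<or> k = 2 then 1 else - 1 :: real)"
  have lam1: "\<bar>lam k\<bar> \<le> 1" for k by (simp add: lam_def)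
  have smv: "BO True False S 0 (v I)" "BO True False S 0 (w I)" "BO True False S 0 (xx I)" "BO True False S 0 (yy I)" if "I \<in> Ix" for I
    unfolding v_def w_def xx_def yy_def by (intro BO_diff sm sm' R that)+
  have smu: "BO True False S 0 (u k I)" if "I \<in> Ix" "k \<in> {0, 1, 2, 3}" for k I
  proof -
    have "BO True False S 0 (u 0 I)" "BO True False S 0 (u 1 I)" "BO True False S 0 (u 2 I)" "BO True False S 0 (u 3 I)"
      unfolding u[abs_def] using smv[OF that(1)] R by (auto intro: BO_add BO_diff)
    then show ?thesis using that(2) by auto
  qed
  have Obu: "Ob0 True S mu (u k I)" if "I \<in> Ix" "k \<in> {0, 1, 2, 3}" for k I
  proof -
    note o = dd[OF that(1)]
    have "Ob0 True S mu (u 0 I)" "Ob0 True S mu (u 1 I)" "Ob0 True S mu (u 2 I)" "Ob0 True S mu (u 3 I)"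
      unfolding u[abs_def] v_def w_def xx_def yy_def using o R by (auto intro: Ob0_add Ob0_diff)
    then show ?thesis using that(2) by auto
  qed
  have dthd: "dth (\<lambda>x. f x - f' x) x = dth f x - dth f' x" if "BO True False S 0 f" "BO True False S 0 f'" "x \<in> S" for f f' x
    using pder_False_dth[OF pder_diff[OF BO_dth(1)[OF that(1) R] BO_dth(1)[OF that(2) R]] that(3)] .
  have dtha: "dth (\<lambda>x. f x + f' x) x = dth f x + dth f' x" if "BO True False S 0 f" "BO True False S 0 f'" "x \<in> S" for f f' x
    using pder_False_dth[OF pder_add[OF BO_dth(1)[OF that(1) R] BO_dth(1)[OF that(2) R]] that(3)] .
  have equ: "pder True S (u k I) (\<lambda>x. h k I x + lam k * fst x * dth (u k I) x)" if I: "I \<in> Ix" and k: "k \<in> {0, 1, 2, 3}" for k I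
  proof -
    note f = fr[unfolded frame_def, rule_format, OF I] and f' = fr'[unfolded frame_def, rule_format, OF I]
    have vd: "dth (v I) x = dth (V I) x - dth (V' I) x" "dth (w I) x = dth (W I) x - dth (W' I) x"
      "dth (xx I) x = dth (X I) x - dth (X' I) x" "dth (yy I) x = dth (Y I) x - dth (Y' I) x" if "x \<in> S" for x
      unfolding v_def w_def xx_def yy_def by (intro dthd sm sm' I that)+
    have ud: "dth (u 0 I) x = dth (v I) x + dth (w I) x" "dth (u 1 I) x = dth (v I) x - dth (w I) x"
      "dth (u 2 I) x = dth (xx I) x + dth (yy I) x" "dth (u 3 I) x = dth (xx I) x - dth (yy I) x" if "x \<in> S" for x
      unfolding u[abs_def] by (intro dthd dtha smv I that)+
    note pv = pder_diff[OF conjunct1[OF f] conjunct1[OF f']]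
      and pw = pder_diff[OF conjunct1[OF conjunct2[OF f]] conjunct1[OF conjunct2[OF f']]]
      and px = pder_diff[OF conjunct1[OF conjunct2[OF conjunct2[OF f]]] conjunct1[OF conjunct2[OF conjunct2[OF f']]]]
      and py = pder_diff[OF conjunct2[OF conjunct2[OF conjunct2[OF f]]] conjunct2[OF conjunct2[OF conjunct2[OF f']]]]
    have l: "lam 0 = 1" "lam 1 = - 1" "lam 2 = 1" "lam 3 = - 1" by (simp_all add: lam_def)
    have e0: "pder True S (u 0 I) (\<lambda>x. h 0 I x + lam 0 * fst x * dth (u 0 I) x)"
      unfolding u(1)[abs_def] v_def w_def
      by (rule pder_cong_deriv[OF pder_add[OF pv pw]], simp only: h l ud[unfolded u(1)[abs_def] v_def w_def] vd[unfolded v_def w_def])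
         (simp only: u v_def w_def xx_def yy_def, simp add: power2_eq_square field_simps)
    have e1: "pder True S (u 1 I) (\<lambda>x. h 1 I x + lam 1 * fst x * dth (u 1 I) x)"
      unfolding u(2)[abs_def] v_def w_def
      by (rule pder_cong_deriv[OF pder_diff[OF pv pw]], simp only: h l ud[unfolded u(2)[abs_def] v_def w_def] vd[unfolded v_def w_def])
         (simp only: u v_def w_def xx_def yy_def, simp add: power2_eq_square field_simps)
    have e2: "pder True S (u 2 I) (\<lambda>x. h 2 I x + lam 2 * fst x * dth (u 2 I) x)"
      unfolding u(3)[abs_def] xx_def yy_def
      by (rule pder_cong_deriv[OF pder_add[OF px py]], simp only: h l zz ud[unfolded u(3)[abs_def] xx_def yy_def] vd[unfolded xx_def yy_def])
         (simp only: u v_def w_def xx_def yy_def, simp add: power2_eq_square field_simps)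
    have e3: "pder True S (u 3 I) (\<lambda>x. h 3 I x + lam 3 * fst x * dth (u 3 I) x)"
      unfolding u(4)[abs_def] xx_def yy_def
      by (rule pder_cong_deriv[OF pder_diff[OF px py]], simp only: h l zz ud[unfolded u(4)[abs_def] xx_def yy_def] vd[unfolded xx_def yy_def])
         (simp only: u v_def w_def xx_def yy_def, simp add: power2_eq_square field_simps)
    show ?thesis using k e0 e1 e2 e3 by auto
  qed
  define q where "q = (1 + n1 * s) / mu"
  have q: "0 \<le> q" "q < 1" using s mu n1 by (auto simp: q_def n1_def)
  have contract: "\<bar>u k I x\<bar> \<le> q * M * fst x powr mu"
    if M: "\<And>k I x. k \<in> {0, 1, 2, 3} \<Longrightarrow> I \<in> Ix \<Longrightarrow> x \<in> S \<Longrightarrow> \<bar>u k I x\<bar> \<le> M * fst x powr mu" and M0: "M \<ge> 0"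
      and k: "k \<in> {0, 1, 2, 3}" and I: "I \<in> Ix" and x: "x \<in> S" for M k I x
  proof -
    have hb: "\<bar>h k I y\<bar> \<le> (1 + n1 * s) * M * fst y powr mu" if y: "y \<in> S" for y
    proof -
      define B where "B = M * fst y powr mu"
      have B0: "0 \<le> B" using M0 by (simp add: B_def)
      have ub: "\<bar>u k J y\<bar> \<le> B" if "k \<in> {0, 1, 2, 3}" "J \<in> Ix" for k J unfolding B_def by (rule M[OF that y])
      have sB: "0 \<le> s * B" using s B0 by simp
      have sB': "s * B \<le> n1 * (s * B)" using mult_right_mono[OF n1 sB] by simp
      have zb: "\<bar>zz k I y\<bar> \<le> n1 * B" if "k \<in> {0, 1, 2, 3}" for k
      proof -
        have "\<bar>\<Sum>J\<in>Ix. u k J y\<bar> \<le> (\<Sum>J\<in>Ix. B)"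
          by (rule order_trans[OF sum_abs]) (intro sum_mono ub that)
        then show ?thesis unfolding zz_def n1_def using ub[OF that I] by (simp add: distrib_right)
      qed
      have pb: "\<bar>a * b\<bar> \<le> A * C" if "\<bar>a\<bar> \<le> A" "\<bar>b\<bar> \<le> C" for a b A C :: real
        unfolding abs_mult using that by (intro mult_mono) auto
      have y': "y \<in> Tri c L T" using y by (simp add: S_def)
      have 1: "\<bar>u 2 I y * (X I y - Y I y)\<bar> \<le> B * s" "\<bar>(X' I y + Y' I y) * u 3 I y\<bar> \<le> s * B"
        by (intro pb ub P(2)[OF I y'] P'(1)[OF I y'] I; simp)+
      have 2: "\<bar>(ZZ Ix V I y + ZZ Ix W I y - 1 / 2) * u 3 I y\<bar> \<le> 1 / 2 * B" "\<bar>zz 0 I y * (X' I y - Y' I y)\<bar> \<le> n1 * B * s"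
        by (intro pb ub zb P'(2)[OF I y'] Z(1)[OF I y'] I; simp)+
      have 3: "\<bar>(ZZ Ix V I y - ZZ Ix W I y - 1 / 2) * u 2 I y\<bar> \<le> 1 / 2 * B" "\<bar>zz 1 I y * (X' I y + Y' I y)\<bar> \<le> n1 * B * s"
        by (intro pb ub zb P'(1)[OF I y'] Z(2)[OF I y'] I; simp)+
      have c: "B * s = s * B" "n1 * B * s = n1 * (s * B)" by simp_all
      have u4: "\<bar>u 0 I y\<bar> \<le> B" "\<bar>u 1 I y\<bar> \<le> B" "\<bar>u 2 I y\<bar> \<le> B" "\<bar>u 3 I y\<bar> \<le> B" by (intro ub I; simp)+
      have t1: "\<bar>(a - b) / 2 - (c' + d) / 2\<bar> \<le> A + E"
        if "\<bar>a\<bar> \<le> A" "\<bar>b\<bar> \<le> A" "\<bar>c'\<bar> \<le> E" "\<bar>d\<bar> \<le> E" for a b c' d A E :: real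
        using that by (simp add: abs_le_iff field_simps)
      have t1': "\<bar>- (a - b) / 2 - (c' + d) / 2\<bar> \<le> A + E"
        if "\<bar>a\<bar> \<le> A" "\<bar>b\<bar> \<le> A" "\<bar>c'\<bar> \<le> E" "\<bar>d\<bar> \<le> E" for a b c' d A E :: real
        using that by (simp add: abs_le_iff field_simps)
      have t2: "\<bar>a + b / 2 + d\<bar> \<le> A + E" if "\<bar>a\<bar> \<le> 1 / 2 * A" "\<bar>b\<bar> \<le> A" "\<bar>d\<bar> \<le> E" for a b d A E :: real
        using that unfolding abs_le_iff by auto
      note quads = order_trans[OF 1(1)[unfolded c] sB'] order_trans[OF 1(2) sB']
      have "\<bar>h 0 I y\<bar> \<le> B + n1 * (s * B)" "\<bar>h 1 I y\<bar> \<le> B + n1 * (s * B)"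
        unfolding h by (rule t1[OF u4(1,2) quads], rule t1'[OF u4(1,2) quads])
      moreover have "\<bar>h 2 I y\<bar> \<le> B + n1 * (s * B)" unfolding h by (rule t2[OF 2(1) u4(3) 2(2)[unfolded c]])
      moreover have "\<bar>h 3 I y\<bar> \<le> B + n1 * (s * B)" unfolding h by (rule t2[OF 3(1) u4(4) 3(2)[unfolded c]])
      ultimately have "\<bar>h k I y\<bar> \<le> B + n1 * (s * B)" using k by auto
      also have "\<dots> = (1 + n1 * s) * M * fst y powr mu" by (simp add: B_def algebra_simps)
      finally show ?thesis .
    qed
    have "\<bar>u k I x\<bar> \<le> ((1 + n1 * s) * M) / mu * fst x powr mu"
      by (rule char_decay[OF bS lam1 _ equ[OF I k] BO_dth(1)[OF smu[OF I k] R] BO_cont[OF BO_dth(2)[OF smu[OF I k] R]] hb M[OF k I] x])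
        (use mu M0 n1 s in auto)
    then show ?thesis by (simp add: q_def)
  qed
  have "\<exists>M. M > 0 \<and> (\<forall>x\<in>S. \<bar>u k I x\<bar> \<le> M * fst x powr mu)" if "I \<in> Ix" "k \<in> {0, 1, 2, 3}" for k I
    using Ob0_bound[OF Obu[OF that]] by metis
  then have "\<forall>k I. \<exists>M. I \<in> Ix \<longrightarrow> k \<in> {0, 1, 2, 3} \<longrightarrow> M > 0 \<and> (\<forall>x\<in>S. \<bar>u k I x\<bar> \<le> M * fst x powr mu)" by blast
  then obtain CM where CM: "\<forall>k I. I \<in> Ix \<longrightarrow> k \<in> {0, 1, 2, 3} \<longrightarrow> CM k I > 0 \<and> (\<forall>x\<in>S. \<bar>u k I x\<bar> \<le> CM k I * fst x powr mu)" by metis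
  define M where "M = (\<Sum>I\<in>Ix. \<Sum>k\<in>{0, 1, 2, 3}. \<bar>CM k I\<bar>)"
  have M0: "M \<ge> 0" unfolding M_def by (intro sum_nonneg) auto
  have base: "\<bar>u k I x\<bar> \<le> M * fst x powr mu" if k: "k \<in> {0, 1, 2, 3}" and I: "I \<in> Ix" and x: "x \<in> S" for k I x
  proof -
    have "CM k I \<le> \<bar>CM k I\<bar>" by simp
    also have "\<dots> \<le> (\<Sum>k\<in>{0, 1, 2, 3}. \<bar>CM k I\<bar>)" by (rule member_le_sum[OF k]) auto
    also have "\<dots> \<le> M" unfolding M_def by (rule member_le_sum[OF I _ fin]) (intro sum_nonneg, simp)
    finally have "CM k I * fst x powr mu \<le> M * fst x powr mu" by (intro mult_right_mono) auto
    moreover have "\<bar>u k I x\<bar> \<le> CM k I * fst x powr mu" using CM[rule_format, OF I k] x by blast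
    ultimately show ?thesis by (rule order_trans[rotated])
  qed
  have iter: "\<bar>u k I x\<bar> \<le> (q ^ n * M) * fst x powr mu" if "k \<in> {0, 1, 2, 3}" "I \<in> Ix" "x \<in> S" for n k I x
    using that
  proof (induction n arbitrary: k I x)
    case 0
    then show ?case using base by simp
  next
    case (Suc n)
    have "\<bar>u k I x\<bar> \<le> q * (q ^ n * M) * fst x powr mu"
      by (rule contract[OF Suc.IH _ Suc.prems]) (use q M0 in simp_all)
    then show ?case by (simp add: mult.assoc)
  qed
  have zero: "u k I x = 0" if "k \<in> {0, 1, 2, 3}" for k
  proof -
    have xS: "x \<in> S" using x by (simp add: S_def)
    have "(\<lambda>n. (q ^ n * M) * fst x powr mu) \<longlonglongrightarrow> (0 * M) * fst x powr mu"
      using q by (intro tendsto_intros LIMSEQ_power_zero) simp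
    then have "(\<lambda>n. (q ^ n * M) * fst x powr mu) \<longlonglongrightarrow> 0" by simp
    then have "\<bar>u k I x\<bar> \<le> 0"
      by (rule LIMSEQ_le_const) (use iter[OF that I xS] in blast)
    then show ?thesis by simp
  qed
  have "u 0 I x = 0" "u 1 I x = 0" "u 2 I x = 0" "u 3 I x = 0" by (intro zero; simp)+
  then show "V I x = V' I x" "X I x = X' I x" unfolding u v_def w_def xx_def yy_def by linarith+
qed

section \<open>Limits of the momentum and of D P at t = 0\<close>

context expansion
begin

text \<open>The factor t^2 outweighs exp (- 2 PP), which has order -2 K - 3 e; only bounds on
  theta-derivatives enter, and these are what regularity supplies.\<close>

lemma Ob0_DR: "I \<in> Ix \<Longrightarrow> Ob0 True S (2 - 2 * K I - 3 * e) (\<lambda>x. (fst x)\<^sup>2 * dth (bb I) x)"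
proof -
  assume I: "I \<in> Ix"
  have "BO False True S (- 2 * K I - 3 * e) (dth (bb I))" by (rule BO_dth(2)[OF BO_bb[OF I] RS]) simp
  from BO_mult[OF BO_mult[OF BO_fst[OF RS] BO_fst[OF RS] RS, where e=2] this RS, where e="2 - 2 * K I - 3 * e"]
  have "BO False True S (2 - 2 * K I - 3 * e) (\<lambda>x. fst x * fst x * dth (bb I) x)" by simp
  then show ?thesis unfolding power2_eq_square by (rule BO_imp_Ob0)
qed

lemma remainder_exponent: "I \<in> Ix \<Longrightarrow> 2 - 2 * K I - 3 * e > 1 / 3 + 10 * e"
  using m2[of I] e by simp

text \<open>That \<open>kap\<close> tends to 0 says nothing about its t-derivative, so the momentum
  cannot be evaluated directly. Its evolution equation yields some limit l. By l'Hopital's rule Q1 /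
  t powr (2 kk) tends to a multiple of l; since this quotient is q1 + kap, its limit is q1, which
  determines l.\<close>

lemma lim_R:
  assumes I: "I \<in> Ix" and x: "x \<in> S"
  shows "((\<lambda>s. Rm I (s, snd x)) \<longlongrightarrow> R0f I x) (at_right 0)"
proof -
  have x0: "0 < fst x" by (rule St(1)[OF x])
  have inS: "(s, snd x) \<in> S" if "s \<in> {0<..<fst x}" for s using that by (intro backward_slice[OF bS x]) auto
  have ev: "\<forall>\<^sub>F s in at_right 0. s \<in> {0<..<fst x}" by (rule eventually_at_right_real[OF x0])
  have r0: "2 - 2 * K I - 3 * e > 0" using remainder_exponent[OF I] e by simp
  obtain l where l: "((\<lambda>s. Rm I (s, snd x)) \<longlongrightarrow> l) (at_right 0)"
    by (rule radial_limit[OF bS pR[OF I] Ob0_DR[OF I] r0 x])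
  define kk where "kk = k I x"
  have kk: "kk > 1 / 2" using k_bd[OF I subsetD[OF SS0 x]] m1[OF I] e by (simp add: kk_def)
  have ks: "k I (s, snd x) = kk" "pp I (s, snd x) = pp I x" for s by (simp_all add: k_def kk_def pp_def ZZ_def)
  have zr: "((\<lambda>s. ZZ Ix pr I (s, snd x)) \<longlongrightarrow> 0) (at_right 0)"
    by (rule Ob0_lim0[OF BO_imp_Ob0[OF BO_zr[OF I, of False True]] _ bS x]) (use e in auto)
  have "((\<lambda>s. exp (2 * (pp I x + ZZ Ix pr I (s, snd x))) * Rm I (s, snd x) / (2 * kk)) \<longlongrightarrow> exp (2 * (pp I x + 0)) * l / (2 * kk)) (at_right 0)"
    using kk by (intro tendsto_intros zr l) simp
  moreover have "\<forall>\<^sub>F s in at_right 0. exp (2 * (pp I x + ZZ Ix pr I (s, snd x))) * Rm I (s, snd x) / (2 * kk)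
      = (Dop (Q I) (s, snd x) / s) / (2 * kk * s powr (2 * kk - 1))"
    using ev
  proof eventually_elim
    case (elim s)
    have s: "0 < s" using elim by simp
    have sp: "s * s powr (2 * kk - 1) = s powr (2 * kk)" using s powr_add[of s 1 "2 * kk - 1"] by simp
    have "Dop (Q I) (s, snd x) = s powr (2 * kk) * exp (2 * (pp I x + ZZ Ix pr I (s, snd x))) * Rm I (s, snd x)"
      unfolding DopQ(2) exp_ZZP[OF inS[OF elim]] ks by simp
    then have "(Dop (Q I) (s, snd x) / s) / (2 * kk * s powr (2 * kk - 1)) = (s powr (2 * kk) * exp (2 * (pp I x + ZZ Ix pr I (s, snd x))) * Rm I (s, snd x)) / (2 * kk * (s * s powr (2 * kk - 1)))"
      by (simp add: mult_ac)
    then show ?case unfolding sp using s kk by simp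
  qed
  ultimately have q': "((\<lambda>s. (Dop (Q I) (s, snd x) / s) / (2 * kk * s powr (2 * kk - 1))) \<longlongrightarrow> exp (2 * (pp I x + 0)) * l / (2 * kk)) (at_right 0)"
    by (rule Lim_transform_eventually)
  have "((\<lambda>s. Q1 I (s, snd x) / s powr (2 * kk)) \<longlongrightarrow> exp (2 * (pp I x + 0)) * l / (2 * kk)) (at_right 0)"
  proof (rule lhopital_right_0[OF _ _ _ _ _ _ q'])
    show "((\<lambda>s. Q1 I (s, snd x)) \<longlongrightarrow> 0) (at_right 0)"
      by (rule Ob0_lim0[OF BO_imp_Ob0[OF BO_Q1[OF I, of False True]] _ bS x]) (use e m1[OF I] in auto)
    show "((\<lambda>s. s powr (2 * kk)) \<longlongrightarrow> 0) (at_right 0)" using powr_lim0[of "2 * kk" 1] kk by simp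
    show "\<forall>\<^sub>F s in at_right 0. s powr (2 * kk) \<noteq> 0" using ev by eventually_elim simp
    show "\<forall>\<^sub>F s in at_right 0. 2 * kk * s powr (2 * kk - 1) \<noteq> 0" using ev by eventually_elim (use kk in simp)
    show "\<forall>\<^sub>F s in at_right 0. ((\<lambda>s. s powr (2 * kk)) has_real_derivative 2 * kk * s powr (2 * kk - 1)) (at s)"
      using ev by eventually_elim (auto intro!: derivative_eq_intros)
    show "\<forall>\<^sub>F s in at_right 0. ((\<lambda>s. Q1 I (s, snd x)) has_real_derivative Dop (Q I) (s, snd x) / s) (at s)"
      using ev
    proof eventually_elim
      case (elim s)
      have "((\<lambda>s. Q I (s, snd x)) has_real_derivative Dop (Q I) (s, snd x) / s) (at s)"
        using pQ[OF I] inS[OF elim] unfolding pder_def line_def crd_def wt_def by (fastforce simp: divide_inverse mult.commute)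
      from DERIV_diff[OF this DERIV_const[of "q0 I (snd x)"]] show ?case by (simp add: Q_eq)
    qed
  qed
  moreover have "\<forall>\<^sub>F s in at_right 0. Q1 I (s, snd x) / s powr (2 * kk) = q1 I (snd x) + kap I (s, snd x)"
    using ev by eventually_elim (simp add: Q1_def ks)
  ultimately have a: "((\<lambda>s. q1 I (snd x) + kap I (s, snd x)) \<longlongrightarrow> exp (2 * (pp I x + 0)) * l / (2 * kk)) (at_right 0)"
    by (rule Lim_transform_eventually)
  have b: "((\<lambda>s. q1 I (snd x) + kap I (s, snd x)) \<longlongrightarrow> q1 I (snd x) + 0) (at_right 0)"
    by (intro tendsto_intros limkap I x)
  have "exp (2 * pp I x) * l / (2 * kk) = q1 I (snd x)" using tendsto_unique[OF trivial_limit_at_right_real a b] by simp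
  then have "exp (2 * pp I x) * l = 2 * kk * q1 I (snd x)" using kk by (simp add: field_simps)
  then have "exp (- 2 * pp I x) * (exp (2 * pp I x) * l) = exp (- 2 * pp I x) * (2 * kk * q1 I (snd x))" by simp
  then have "l = R0f I x"
    unfolding R0f_def kk_def by (simp add: mult.assoc[symmetric] exp_add[symmetric])
  then show ?thesis using l by simp
qed

lemma R0f_snd: "R0f I (s, snd x) = R0f I x"
  unfolding R0f_def k_def pp_def ZZ_def by simp

lemma Ob0_R: "I \<in> Ix \<Longrightarrow> Ob0 True S (2 - 2 * K I - 3 * e) (\<lambda>x. Rm I x - R0f I x)"
proof -
  assume I: "I \<in> Ix"
  have "pder True S (R0f I) (\<lambda>x. 0)"
    using pder_snd_const[of S "\<lambda>\<theta>. R0f I (0, \<theta>)"] unfolding R0f_snd by simp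
  from pder_diff[OF pR[OF I] this]
  have p: "pder True S (\<lambda>x. Rm I x - R0f I x) (\<lambda>x. (fst x)\<^sup>2 * dth (bb I) x)" by simp
  show ?thesis
  proof (rule radial_decay[OF bS p Ob0_DR[OF I]])
    show "0 < 2 - 2 * K I - 3 * e" using remainder_exponent[OF I] e by simp
    show "continuous_on S (\<lambda>x. Rm I x - R0f I x)"
      by (intro continuous_on_diff BO_cont[OF smR[OF I]] BO_cont[OF mono[OF BO_R0f[OF I]]])
    fix x assume "x \<in> S"
    from tendsto_diff[OF lim_R[OF I this] tendsto_const[of "R0f I x"]]
    show "((\<lambda>s. Rm I (s, snd x) - R0f I (s, snd x)) \<longlongrightarrow> 0) (at_right 0)" unfolding R0f_snd by simp
  qed
qed

lemma Ob0_Rm: "I \<in> Ix \<Longrightarrow> Ob0 True S 0 (Rm I)"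
proof -
  assume I: "I \<in> Ix"
  have "Ob0 True S 0 (\<lambda>x. (Rm I x - R0f I x) + R0f I x)"
    by (intro Ob0_add Ob0_weaken[OF Ob0_R[OF I] RS] BO_imp_Ob0[OF mono[OF BO_R0f[OF I]]]) (use remainder_exponent[OF I] e in simp)
  then show ?thesis by simp
qed

lemma Ob0_exp: "I \<in> Ix \<Longrightarrow> Ob0 True S (n * K I - (\<bar>n\<bar> + 1) * e) (\<lambda>x. exp (n * ZZ Ix P I x))"
  by (rule BO_imp_Ob0[OF BO_exp_ZZP[of I False True]]) auto

lemma Ob0_X: "I \<in> Ix \<Longrightarrow> Ob0 True S (K I - 2 * e) (X I)"
  unfolding X_def[abs_def] by (rule Ob0_mult[OF Ob0_exp Ob0_Rm RS]) auto

lemma Ob0_Y: "I \<in> Ix \<Longrightarrow> Ob0 True S (1 - K I - 2 * e) (Y I)"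
proof -
  assume I: "I \<in> Ix"
  have "Ob0 True S 1 (\<lambda>x. fst x * dth (Q I) x)"
    by (rule BO_imp_Ob0[OF BO_mult[OF BO_fst[OF RS] BO_dthQ[OF I, of False True] RS]]) auto
  then show ?thesis unfolding Y_def[abs_def] by (rule Ob0_mult[OF Ob0_exp[OF I] _ RS]) simp
qed

lemma Ob0_W: "I \<in> Ix \<Longrightarrow> Ob0 True S (1 - e) (W I)"
  unfolding W_def[abs_def] by (rule BO_imp_Ob0[OF BO_mult[OF BO_fst[OF RS] BO_dth(2)[OF BO_P[of I False True] RS] RS]]) auto

lemma Ob0_ddP: "I \<in> Ix \<Longrightarrow> Ob0 True S (1 + e) (\<lambda>x. (fst x)\<^sup>2 * dth (dth (P I)) x)"
proof -
  assume I: "I \<in> Ix"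
  have "BO False True S (- e) (dth (dth (P I)))" by (intro BO_dth(2) RS BO_P I) simp
  from BO_mult[OF BO_mult[OF BO_fst[OF RS] BO_fst[OF RS] RS, where e=2] this RS, where e="1 + e"]
  have "BO False True S (1 + e) (\<lambda>x. fst x * fst x * dth (dth (P I)) x)" using e by simp
  then show ?thesis unfolding power2_eq_square by (rule BO_imp_Ob0)
qed

lemma DV_eq: "I \<in> Ix \<Longrightarrow> x \<in> S \<Longrightarrow> Dop (V I) x = (fst x)\<^sup>2 * dth (dth (P I)) x + ((-1/2) * (X I x * X I x) + (1/2) * (Y I x * Y I x))"
proof -
  assume I: "I \<in> Ix" and x: "x \<in> S"
  have "Dop (V I) x = (fst x)\<^sup>2 * dth (dth (P I)) x - 1 / 2 * (exp (- 2 * ZZ Ix P I x) * ((Dop (Q I) x)\<^sup>2 - (fst x * dth (Q I) x)\<^sup>2))"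
    unfolding eqP[OF I x] by (simp only: mult.assoc)
  then show ?thesis unfolding XY_sq by (simp add: power2_eq_square algebra_simps)
qed

text \<open>The rate 1/3 is set by Y^2, of order 2 - 2 K - 4 e; the other terms are at least of
  order 1 + e.\<close>

lemma Ob0_DV: "I \<in> Ix \<Longrightarrow> Ob0 True S (1 / 3) (Dop (V I))"
proof -
  assume I: "I \<in> Ix"
  have 1: "Ob0 True S (1 / 3) (\<lambda>x. (fst x)\<^sup>2 * dth (dth (P I)) x)"
    by (rule Ob0_weaken[OF Ob0_ddP[OF I] RS]) (use e in simp)
  have 2: "Ob0 True S (1 / 3) (\<lambda>x. X I x * X I x)"
    by (rule Ob0_mult[OF Ob0_X[OF I] Ob0_X[OF I] RS]) (use e m1[OF I] in simp)
  have 3: "Ob0 True S (1 / 3) (\<lambda>x. Y I x * Y I x)"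
    by (rule Ob0_mult[OF Ob0_Y[OF I] Ob0_Y[OF I] RS]) (use e m2[OF I] in simp)
  have "Ob0 True S (1 / 3) (\<lambda>x. (fst x)\<^sup>2 * dth (dth (P I)) x + ((-1/2) * (X I x * X I x) + (1/2) * (Y I x * Y I x)))"
    by (intro Ob0_add 1 Ob0_cmult 2 3 RS)
  then show ?thesis by (rule Ob0_cong) (simp only: DV_eq[OF I])
qed

lemma pV: "I \<in> Ix \<Longrightarrow> pder True S (V I) (Dop (V I))"
  by (rule BO_Dop(1)[OF smV RS])

text \<open>The device of \<open>lim_R\<close> applied to P / (- ln t): the bounded part p1 + pr
  disappears against the logarithm, so the quotient tends to - p0, while l'Hopital's rule gives
  minus the limit of V.\<close>

lemma lim_V:
  assumes I: "I \<in> Ix" and x: "x \<in> S"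
  shows "((\<lambda>s. V I (s, snd x)) \<longlongrightarrow> p0 I (snd x)) (at_right 0)"
proof -
  have x0: "0 < fst x" by (rule St(1)[OF x])
  have inS: "(s, snd x) \<in> S" if "s \<in> {0<..<fst x}" for s using that by (intro backward_slice[OF bS x]) auto
  have ev: "\<forall>\<^sub>F s in at_right 0. s \<in> {0<..<fst x}" by (rule eventually_at_right_real[OF x0])
  obtain l where l: "((\<lambda>s. V I (s, snd x)) \<longlongrightarrow> l) (at_right 0)"
    by (rule radial_limit[OF bS pV[OF I] Ob0_DV[OF I] _ x]) simp
  have lnt: "filterlim (\<lambda>s::real. - ln s) at_top (at_right 0)"
    using ln_at_0 by (simp add: filterlim_uminus_at_bot)
  have "((\<lambda>s. - V I (s, snd x)) \<longlongrightarrow> - l) (at_right 0)" by (intro tendsto_intros l)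
  moreover have "\<forall>\<^sub>F s in at_right 0. - V I (s, snd x) = (V I (s, snd x) / s) / (- (1 / s))"
    using ev by eventually_elim simp
  ultimately have q: "((\<lambda>s. (V I (s, snd x) / s) / (- (1 / s))) \<longlongrightarrow> - l) (at_right 0)"
    by (rule Lim_transform_eventually)
  have a: "((\<lambda>s. P I (s, snd x) / - ln s) \<longlongrightarrow> - l) (at_right 0)"
  proof (rule lhopital_right_0_at_top[where f'="\<lambda>s. V I (s, snd x) / s" and g'="\<lambda>s. - (1 / s)", OF lnt _ _ _ q])
    show "\<forall>\<^sub>F s in at_right (0::real). - (1 / s) \<noteq> 0" using ev by eventually_elim simp
    show "\<forall>\<^sub>F s in at_right 0. ((\<lambda>s. - ln s) has_real_derivative - (1 / s)) (at s)"
      using ev by eventually_elim (auto intro!: derivative_eq_intros)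
    show "\<forall>\<^sub>F s in at_right 0. ((\<lambda>s. P I (s, snd x)) has_real_derivative V I (s, snd x) / s) (at s)"
      using ev
    proof eventually_elim
      case (elim s)
      show ?case
        using pP[OF I] inS[OF elim] unfolding pder_def line_def crd_def wt_def by (fastforce simp: divide_inverse mult.commute)
    qed
  qed
  have pr: "((\<lambda>s. pr I (s, snd x)) \<longlongrightarrow> 0) (at_right 0)"
    by (rule Ob0_lim0[OF BO_imp_Ob0[OF BO_pr[OF I, of False True]] _ bS x]) (use e in auto)
  have "((\<lambda>s. (p1 I (snd x) + pr I (s, snd x)) / - ln s) \<longlongrightarrow> 0) (at_right 0)"
    by (rule real_tendsto_divide_at_top[OF tendsto_add[OF tendsto_const pr] lnt])
  then have "((\<lambda>s. - p0 I (snd x) + (p1 I (snd x) + pr I (s, snd x)) / - ln s) \<longlongrightarrow> - p0 I (snd x) + 0) (at_right 0)"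
    by (intro tendsto_add tendsto_const)
  moreover have "\<forall>\<^sub>F s in at_right 0. - p0 I (snd x) + (p1 I (snd x) + pr I (s, snd x)) / - ln s = P I (s, snd x) / - ln s"
    using ev
  proof eventually_elim
    case (elim s)
    have "ln s \<noteq> 0" using elim St(2)[OF x] by simp
    then show ?case unfolding P_eq by (simp add: field_simps)
  qed
  ultimately have "((\<lambda>s. P I (s, snd x) / - ln s) \<longlongrightarrow> - p0 I (snd x) + 0) (at_right 0)"
    by (rule Lim_transform_eventually)
  from tendsto_unique[OF trivial_limit_at_right_real a this] show ?thesis using l by simp
qed

lemma Ob0_V: "I \<in> Ix \<Longrightarrow> Ob0 True S (1 / 3) (\<lambda>x. V I x - p0 I (snd x))"
proof -
  assume I: "I \<in> Ix"
  from pder_diff[OF pV[OF I] pder_snd_const[of S "p0 I"]]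
  have p: "pder True S (\<lambda>x. V I x - p0 I (snd x)) (Dop (V I))" by simp
  show ?thesis
  proof (rule radial_decay[OF bS p Ob0_DV[OF I]])
    show "continuous_on S (\<lambda>x. V I x - p0 I (snd x))"
      by (intro continuous_on_diff BO_cont[OF smV[OF I]] BO_cont[OF BO_snd[OF sm(1)[OF I] RS, of True True]])
    fix x assume "x \<in> S"
    from tendsto_diff[OF lim_V[OF I this] tendsto_const[of "p0 I (snd x)"]]
    show "((\<lambda>s. V I (s, snd x) - p0 I (snd (s, snd x))) \<longlongrightarrow> 0) (at_right 0)" by simp
  qed simp
qed

lemma dth_Q: "I \<in> Ix \<Longrightarrow> x \<in> S \<Longrightarrow> dth (Q I) x = deriv (q0 I) (snd x) + dth (Q1 I) x"
proof -
  assume I: "I \<in> Ix" and x: "x \<in> S"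
  have "pder False S (\<lambda>x. q0 I (snd x)) (\<lambda>x. if False then 0 else deriv (q0 I) (snd x))" by (rule pder_snd[OF sm(3)[OF I]])
  from pder_False_dth[OF pder_add[OF this BO_dth(1)[OF BO_Q1[OF I, of False True] RS]] x]
  show ?thesis unfolding Q_eq[abs_def] by simp
qed

lemma Ob0_dthQ1: "I \<in> Ix \<Longrightarrow> Ob0 True S (2 * K I - 3 * e) (dth (Q1 I))"
  by (rule BO_imp_Ob0[OF BO_dth(2)[OF BO_Q1[of I False True] RS]]) auto

lemma Ob0_V_small: "I \<in> Ix \<Longrightarrow> Ob0 True S (1 / 3) (\<lambda>x. ZZ Ix V I x - k I x)"
proof -
  assume I: "I \<in> Ix"
  have "Ob0 True S (1 / 3) (ZZ Ix (\<lambda>I x. V I x - p0 I (snd x)) I)" by (rule Ob0_ZZ[OF Ob0_V I])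
  then show ?thesis
    by (rule Ob0_cong) (simp add: ZZ_def k_def kI_def sum_subtractf)
qed

end

lemma frame_subset: "frame Ix S V W X Y \<Longrightarrow> S' \<subseteq> S \<Longrightarrow> frame Ix S' V W X Y"
  unfolding frame_def by (meson pder_subset)

text \<open>Transport with zero speed and zero source, for which \<open>char_decay\<close> returns
  the bound 0.\<close>

lemma static_zero:
  assumes S: "backward_closed S" and u: "BO True False S 0 u" "pder True S u (\<lambda>x. 0)" "Ob0 True S a u" "a > 0" and x: "x \<in> S"
  shows "u x = 0"
proof -
  have R: "region S" by (rule backward_closed_region[OF S])
  obtain M where M: "M > 0" "\<And>x. x \<in> S \<Longrightarrow> \<bar>u x\<bar> \<le> M * fst x powr a" using Ob0_bound[OF u(3)] by blast
  have "\<bar>u x\<bar> \<le> 0 / a * fst x powr a"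
    by (rule char_decay[where h="\<lambda>x. 0" and lam=0 and u'="dth u" and M=M, OF S _ u(4) _ BO_dth(1)[OF u(1) R] BO_cont[OF BO_dth(2)[OF u(1) R]] _ M(2) x])
      (use u(2) in simp_all)
  then show ?thesis by simp
qed

subsection \<open>Local uniqueness\<close>

context twisted
begin

text \<open>The difference of the two P is at first only O(t powr (7 e)). Each pass through the
  equation for P gains 1/3 until order 1 + e is reached; the other frame components follow and
  \<open>frame_unique\<close> applies.\<close>

lemma uniqueness_local:
  assumes A: "expansion D p0 p1 q0 q1 eps c L e K TT \<rho> kap"
    and B: "expansion D p0 p1 q0 q1 eps c L e K TT \<rho>' kap'"
  shows "\<exists>T. 0 < T \<and> T \<le> TT \<and> (\<forall>I\<in>Ix. \<forall>x\<in>Tri c L T. \<rho> I x = \<rho>' I x \<and> kap I x = kap' I x)"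
proof -
  interpret A: expansion D p0 p1 q0 q1 eps c L e K TT \<rho> kap by (rule A)
  interpret B: expansion D p0 p1 q0 q1 eps c L e K TT \<rho>' kap' by (rule B)
  define S where "S = Tri c L TT"
  note RS = A.RS[folded S_def]
  define dP where "dP = (\<lambda>I x. A.P I x - B.P I x)"
  have dP_pr: "dP I = (\<lambda>x. A.pr I x - B.pr I x)" for I by (simp add: dP_def A.P_eq B.P_eq)
  have BOdP: "BO False True S (7 * e) (dP I)" if I: "I \<in> Ix" for I
    unfolding dP_pr S_def by (intro BO_diff A.BO_pr B.BO_pr A.RS I) simp_all
  have smdP: "BO True False S 0 (dP I)" if I: "I \<in> Ix" for I
    unfolding dP_def S_def by (intro BO_diff A.smP B.smP A.RS I)
  have ZZd: "ZZ Ix A.P I x = ZZ Ix B.P I x + ZZ Ix dP I x" for I x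
    unfolding ZZ_def dP_def by (simp add: sum_subtractf)
  have expd: "Ob0 True S (n * K I - (\<bar>n\<bar> + 1) * e + a) (\<lambda>x. exp (n * ZZ Ix A.P I x) - exp (n * ZZ Ix B.P I x))"
    if I: "I \<in> Ix" and a: "0 \<le> a" and d: "\<And>J. J \<in> Ix \<Longrightarrow> Ob0 True S a (dP J)" for I n a
  proof -
    have "Ob0 True S a (\<lambda>x. exp (n * ZZ Ix dP I x) - 1)"
      by (rule Ob0_expm1[OF Ob0_cmult[OF Ob0_ZZ[OF d I] RS] RS a])
    from Ob0_mult[OF B.Ob0_exp[OF I, of n, folded S_def] this RS, where e="n * K I - (\<bar>n\<bar> + 1) * e + a"]
    have "Ob0 True S (n * K I - (\<bar>n\<bar> + 1) * e + a) (\<lambda>x. exp (n * ZZ Ix B.P I x) * (exp (n * ZZ Ix dP I x) - 1))" by simp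
    then show ?thesis
      by (rule Ob0_cong) (simp only: ZZd distrib_left exp_add right_diff_distrib mult_1_right)
  qed
  have tt: "Ob0 True S 2 (\<lambda>x. fst x * fst x)" and t1: "Ob0 True S 1 fst"
    by (rule BO_imp_Ob0[OF BO_mult[where b=True and d=True and e=2, OF BO_fst[OF RS] BO_fst[OF RS] RS]], simp)
      (rule BO_imp_Ob0[OF BO_fst[OF RS, of True True]])
  have q0': "Ob0 True S 0 (\<lambda>x. deriv (q0 I) (snd x))" if "I \<in> Ix" for I
    by (rule BO_imp_Ob0[OF BO_snd[OF smooth1_deriv[OF sm(3)[OF that]] RS, of True True]])
  \<comment> \<open>In the equation for the difference, the theta-terms and X^2 are O(t powr (1 +
    e)) for each solution separately. Only Y^2 needs a comparison: t^2 * q0'^2 multiplies a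
    difference of exponentials, of order 2 - 2 K - 3 e + a > a + 1/3.\<close>
  have step: "Ob0 True S a' (\<lambda>x. A.V I x - B.V I x)" "Ob0 True S a' (dP I)"
    if I: "I \<in> Ix" and a: "0 < a" "0 < a'" "a' \<le> a + 1 / 3" "a' \<le> 1 + e" and d: "\<And>J. J \<in> Ix \<Longrightarrow> Ob0 True S a (dP J)" for I a a'
  proof -
    have E: "Ob0 True S (- 2 * K I - 3 * e + a) (\<lambda>x. exp (- 2 * ZZ Ix A.P I x) - exp (- 2 * ZZ Ix B.P I x))"
      using expd[OF I less_imp_le[OF a(1)] d, of "-2"] by simp
    \<comment> \<open>The square of dth Q without its part q0'^2, which is common to both solutions.
      With the weight of Y^2 it has order 2 - 6 e, so the solutions need not be compared
      here.\<close>
    define mA where "mA = (\<lambda>x. dth (A.Q1 I) x * (2 * deriv (q0 I) (snd x) + dth (A.Q1 I) x))"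
    define mB where "mB = (\<lambda>x. dth (B.Q1 I) x * (2 * deriv (q0 I) (snd x) + dth (B.Q1 I) x))"
    have K0: "0 \<le> 2 * K I - 3 * e" using m1[OF I] e by simp
    have mA: "Ob0 True S (2 * K I - 3 * e) mA" unfolding mA_def
      by (rule Ob0_mult[OF A.Ob0_dthQ1[OF I, folded S_def] Ob0_add[OF Ob0_cmult[OF q0'[OF I] RS] Ob0_weaken[OF A.Ob0_dthQ1[OF I, folded S_def] RS]] RS])
        (use K0 in simp_all)
    have mB: "Ob0 True S (2 * K I - 3 * e) mB" unfolding mB_def
      by (rule Ob0_mult[OF B.Ob0_dthQ1[OF I, folded S_def] Ob0_add[OF Ob0_cmult[OF q0'[OF I] RS] Ob0_weaken[OF B.Ob0_dthQ1[OF I, folded S_def] RS]] RS])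
        (use K0 in simp_all)
    have EtA: "Ob0 True S (2 - 2 * K I - 3 * e) (\<lambda>x. exp (- 2 * ZZ Ix A.P I x) * (fst x * fst x))"
      by (rule Ob0_mult[OF A.Ob0_exp[OF I, folded S_def] tt RS]) simp
    have EtB: "Ob0 True S (2 - 2 * K I - 3 * e) (\<lambda>x. exp (- 2 * ZZ Ix B.P I x) * (fst x * fst x))"
      by (rule Ob0_mult[OF B.Ob0_exp[OF I, folded S_def] tt RS]) simp
    have YA: "A.Y I x * A.Y I x = exp (- 2 * ZZ Ix A.P I x) * (fst x * fst x) * (deriv (q0 I) (snd x) * deriv (q0 I) (snd x) + mA x)" if x: "x \<in> S" for x
    proof -
      have "exp (- 1 * ZZ Ix A.P I x) * exp (- 1 * ZZ Ix A.P I x) = exp (- 2 * ZZ Ix A.P I x)" by (simp add: exp_add[symmetric])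
      moreover have "A.Y I x * A.Y I x = (exp (- 1 * ZZ Ix A.P I x) * exp (- 1 * ZZ Ix A.P I x)) * (fst x * fst x) * (dth (A.Q I) x * dth (A.Q I) x)"
        unfolding A.Y_def by (simp only: ac_simps)
      moreover have "dth (A.Q I) x * dth (A.Q I) x = deriv (q0 I) (snd x) * deriv (q0 I) (snd x) + mA x"
        unfolding A.dth_Q[OF I x[unfolded S_def]] mA_def by (simp add: algebra_simps)
      ultimately show ?thesis by simp
    qed
    have YB: "B.Y I x * B.Y I x = exp (- 2 * ZZ Ix B.P I x) * (fst x * fst x) * (deriv (q0 I) (snd x) * deriv (q0 I) (snd x) + mB x)" if x: "x \<in> S" for x
    proof -
      have "exp (- 1 * ZZ Ix B.P I x) * exp (- 1 * ZZ Ix B.P I x) = exp (- 2 * ZZ Ix B.P I x)" by (simp add: exp_add[symmetric])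
      moreover have "B.Y I x * B.Y I x = (exp (- 1 * ZZ Ix B.P I x) * exp (- 1 * ZZ Ix B.P I x)) * (fst x * fst x) * (dth (B.Q I) x * dth (B.Q I) x)"
        unfolding B.Y_def by (simp only: ac_simps)
      moreover have "dth (B.Q I) x * dth (B.Q I) x = deriv (q0 I) (snd x) * deriv (q0 I) (snd x) + mB x"
        unfolding B.dth_Q[OF I x[unfolded S_def]] mB_def by (simp add: algebra_simps)
      ultimately show ?thesis by simp
    qed
    have y1: "Ob0 True S a' (\<lambda>x. (fst x * fst x) * (deriv (q0 I) (snd x) * deriv (q0 I) (snd x)) * (exp (- 2 * ZZ Ix A.P I x) - exp (- 2 * ZZ Ix B.P I x)))"
    proof (rule Ob0_mult[OF Ob0_mult[OF tt Ob0_mult[OF q0'[OF I] q0'[OF I] RS, where e=0] RS, where e=2] E RS])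
      show "a' \<le> 2 + (- 2 * K I - 3 * e + a)" using a m2[OF I] e by simp
    qed simp_all
    have y2: "Ob0 True S a' (\<lambda>x. exp (- 2 * ZZ Ix A.P I x) * (fst x * fst x) * mA x)"
      by (rule Ob0_mult[OF EtA mA RS]) (use a e in simp)
    have y3: "Ob0 True S a' (\<lambda>x. exp (- 2 * ZZ Ix B.P I x) * (fst x * fst x) * mB x)"
      by (rule Ob0_mult[OF EtB mB RS]) (use a e in simp)
    have yy: "Ob0 True S a' (\<lambda>x. A.Y I x * A.Y I x - B.Y I x * B.Y I x)"
      by (rule Ob0_cong[OF Ob0_diff[OF Ob0_add[OF y1 y2] y3 RS]]) (simp add: YA YB algebra_simps)
    have xA: "Ob0 True S a' (\<lambda>x. A.X I x * A.X I x)"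
      by (rule Ob0_mult[OF A.Ob0_X[OF I, folded S_def] A.Ob0_X[OF I, folded S_def] RS]) (use a e m1[OF I] in simp)
    have xB: "Ob0 True S a' (\<lambda>x. B.X I x * B.X I x)"
      by (rule Ob0_mult[OF B.Ob0_X[OF I, folded S_def] B.Ob0_X[OF I, folded S_def] RS]) (use a e m1[OF I] in simp)
    have pA: "Ob0 True S a' (\<lambda>x. (fst x)\<^sup>2 * dth (dth (A.P I)) x)"
      by (rule Ob0_weaken[OF A.Ob0_ddP[OF I, folded S_def] RS]) (use a in simp)
    have pB: "Ob0 True S a' (\<lambda>x. (fst x)\<^sup>2 * dth (dth (B.P I)) x)"
      by (rule Ob0_weaken[OF B.Ob0_ddP[OF I, folded S_def] RS]) (use a in simp)
    have "Ob0 True S a' (\<lambda>x. ((fst x)\<^sup>2 * dth (dth (A.P I)) x - (fst x)\<^sup>2 * dth (dth (B.P I)) x)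
        + ((- 1 / 2) * (A.X I x * A.X I x - B.X I x * B.X I x) + (1 / 2) * (A.Y I x * A.Y I x - B.Y I x * B.Y I x)))"
      by (rule Ob0_add[OF Ob0_diff[OF pA pB RS] Ob0_add[OF Ob0_cmult[OF Ob0_diff[OF xA xB RS] RS] Ob0_cmult[OF yy RS]]])
    then have D: "Ob0 True S a' (\<lambda>x. Dop (A.V I) x - Dop (B.V I) x)"
      by (rule Ob0_cong) (simp add: A.DV_eq[OF I, folded S_def] B.DV_eq[OF I, folded S_def] algebra_simps)
    show V: "Ob0 True S a' (\<lambda>x. A.V I x - B.V I x)"
    proof (rule radial_decay[OF A.bS[folded S_def] pder_diff[OF A.pV[OF I, folded S_def] B.pV[OF I, folded S_def]] D a(2)])
      show "continuous_on S (\<lambda>x. A.V I x - B.V I x)"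
        unfolding S_def by (intro continuous_on_diff BO_cont[OF A.smV[OF I]] BO_cont[OF B.smV[OF I]])
      fix x assume x: "x \<in> S"
      from tendsto_diff[OF A.lim_V[OF I x[unfolded S_def]] B.lim_V[OF I x[unfolded S_def]]]
      show "((\<lambda>s. A.V I (s, snd x) - B.V I (s, snd x)) \<longlongrightarrow> 0) (at_right 0)" by simp
    qed
    show "Ob0 True S a' (dP I)"
    proof (rule radial_decay[OF A.bS[folded S_def] _ V a(2) BO_cont[OF smdP[OF I]]])
      show "pder True S (dP I) (\<lambda>x. A.V I x - B.V I x)"
        unfolding dP_def S_def by (rule pder_diff[OF A.pP[OF I] B.pP[OF I]])
      fix x assume "x \<in> S"
      then show "((\<lambda>s. dP I (s, snd x)) \<longlongrightarrow> 0) (at_right 0)" by (rule Ob0_lim0[OF d[OF I] a(1) A.bS[folded S_def]])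
    qed
  qed
  \<comment> \<open>Four passes: from 7 e to 1/3, 2/3, 1 and finally 1 + e.\<close>
  have d0: "Ob0 True S (7 * e) (dP I)" if "I \<in> Ix" for I by (rule BO_imp_Ob0[OF BOdP[OF that]])
  have d1: "Ob0 True S (1 / 3) (dP I)" if "I \<in> Ix" for I by (rule step(2)[OF that _ _ _ _ d0]) (use e in auto)
  have d2: "Ob0 True S (2 / 3) (dP I)" if "I \<in> Ix" for I by (rule step(2)[OF that _ _ _ _ d1]) (use e in auto)
  have d3: "Ob0 True S 1 (dP I)" if "I \<in> Ix" for I by (rule step(2)[OF that _ _ _ _ d2]) (use e in auto)
  have d4: "Ob0 True S (1 + e) (dP I)" if "I \<in> Ix" for I by (rule step(2)[OF that _ _ _ _ d3]) (use e in auto)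
  have dV: "Ob0 True S (1 + e) (\<lambda>x. A.V I x - B.V I x)" if "I \<in> Ix" for I by (rule step(1)[OF that _ _ _ _ d3]) (use e in auto)
  \<comment> \<open>No improved estimate is needed: the factor t already raises the initial order 7
    e, valid for theta-derivatives too, above 1 + e.\<close>
  have dW: "Ob0 True S (1 + e) (\<lambda>x. A.W I x - B.W I x)" if I: "I \<in> Ix" for I
  proof -
    have 1: "BO False True S (1 + e) (\<lambda>x. fst x * dth (dP I) x)"
      by (rule BO_mult[OF BO_fst[OF RS] BO_dth(2)[OF BOdP[OF I] RS] RS]) (use e in simp)
    have 2: "dth (dP I) x = dth (A.P I) x - dth (B.P I) x" if "x \<in> S" for x
      using pder_False_dth[OF pder_diff[OF BO_dth(1)[OF A.smP[OF I] A.RS] BO_dth(1)[OF B.smP[OF I] A.RS]]] that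
      unfolding dP_def S_def by blast
    show ?thesis
      by (rule Ob0_cong[OF BO_imp_Ob0[OF 1]]) (simp add: A.W_def B.W_def 2 right_diff_distrib)
  qed
  have e1: "0 \<le> 1 + e" using e by simp
  have dX: "Ob0 True S (1 + e) (\<lambda>x. A.X I x - B.X I x)" if I: "I \<in> Ix" for I
  proof -
    \<comment> \<open>Both momenta have the limit \<open>R0f\<close>, so their difference decays at
      the common rate of convergence.\<close>
    have 1: "Ob0 True S (2 - 2 * K I - 3 * e) (\<lambda>x. (A.Rm I x - R0f I x) - (B.Rm I x - R0f I x))"
      unfolding S_def by (rule Ob0_diff[OF A.Ob0_R[OF I] B.Ob0_R[OF I] A.RS])
    have 2: "Ob0 True S (1 + e) (\<lambda>x. exp (1 * ZZ Ix A.P I x) * ((A.Rm I x - R0f I x) - (B.Rm I x - R0f I x)))"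
      by (rule Ob0_mult[OF A.Ob0_exp[OF I, folded S_def] 1 RS]) (use e m2[OF I] in simp)
    have ke: "2 * e \<le> K I" using e m1[OF I] by linarith
    have 3: "Ob0 True S (1 + e) (\<lambda>x. B.Rm I x * (exp (1 * ZZ Ix A.P I x) - exp (1 * ZZ Ix B.P I x)))"
      by (rule Ob0_mult[OF B.Ob0_Rm[OF I, folded S_def] expd[OF I e1 d4] RS]) (use ke in \<open>simp_all add: algebra_simps\<close>)
    show ?thesis by (rule Ob0_cong[OF Ob0_add[OF 2 3]]) (simp add: A.X_def B.X_def algebra_simps)
  qed
  have dY: "Ob0 True S (1 + e) (\<lambda>x. A.Y I x - B.Y I x)" if I: "I \<in> Ix" for I
  proof -
    have 1: "Ob0 True S (1 + e) (\<lambda>x. fst x * deriv (q0 I) (snd x) * (exp (- 1 * ZZ Ix A.P I x) - exp (- 1 * ZZ Ix B.P I x)))"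
      by (rule Ob0_mult[OF Ob0_mult[OF t1 q0'[OF I] RS, where e=1] expd[OF I e1 d4] RS]) (use e m2[OF I] in simp_all)
    have 2: "Ob0 True S (1 + e) (\<lambda>x. exp (- 1 * ZZ Ix A.P I x) * fst x * dth (A.Q1 I) x)"
      by (rule Ob0_mult[OF Ob0_mult[OF A.Ob0_exp[OF I, folded S_def] t1 RS, where e="1 - K I - 2 * e"] A.Ob0_dthQ1[OF I, folded S_def] RS])
        (use e m1[OF I] in simp_all)
    have 3: "Ob0 True S (1 + e) (\<lambda>x. exp (- 1 * ZZ Ix B.P I x) * fst x * dth (B.Q1 I) x)"
      by (rule Ob0_mult[OF Ob0_mult[OF B.Ob0_exp[OF I, folded S_def] t1 RS, where e="1 - K I - 2 * e"] B.Ob0_dthQ1[OF I, folded S_def] RS])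
        (use e m1[OF I] in simp_all)
    show ?thesis
      by (rule Ob0_cong[OF Ob0_diff[OF Ob0_add[OF 1 2] 3 RS]])
        (simp add: A.Y_def B.Y_def A.dth_Q[OF I, folded S_def] B.dth_Q[OF I, folded S_def] algebra_simps)
  qed
  define n1 where "n1 = real (card Ix) + 1"
  have n1: "n1 \<ge> 1" by (simp add: n1_def)
  \<comment> \<open>Half of e / n1, so that 1 + n1 * s stays strictly below the decay exponent 1 +
    e.\<close>
  define s where "s = e / (2 * n1)"
  have s: "0 < s" "1 + n1 * s < 1 + e" using e n1 by (auto simp: s_def)
  define Bs where "Bs = (\<lambda>I. [\<lambda>x. A.X I x + A.Y I x, \<lambda>x. A.X I x - A.Y I x, \<lambda>x. B.X I x + B.Y I x, \<lambda>x. B.X I x - B.Y I x])"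
  have w: "Ob0 True S (1 / 10) (A.X I)" "Ob0 True S (1 / 10) (A.Y I)" "Ob0 True S (1 / 10) (B.X I)" "Ob0 True S (1 / 10) (B.Y I)" if I: "I \<in> Ix" for I
    by (rule Ob0_weaken[OF A.Ob0_X[OF I, folded S_def] RS], use e m1[OF I] in simp)
      (rule Ob0_weaken[OF A.Ob0_Y[OF I, folded S_def] RS], use e m2[OF I] in simp,
       rule Ob0_weaken[OF B.Ob0_X[OF I, folded S_def] RS], use e m1[OF I] in simp,
       rule Ob0_weaken[OF B.Ob0_Y[OF I, folded S_def] RS], use e m2[OF I] in simp)
  have ev1: "\<forall>\<^sub>F T in at_right 0. \<forall>I\<in>Ix. \<forall>f\<in>set (Bs I). \<forall>x\<in>S. 0 < fst x \<and> fst x < T \<longrightarrow> \<bar>f x\<bar> \<le> s"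
  proof (rule eventually_ball_finite[OF finite_atLeastAtMost], rule ballI, rule eventually_ball_finite[OF finite_set], rule ballI)
    fix I f assume I: "I \<in> Ix" and f: "f \<in> set (Bs I)"
    have "Ob0 True S (1 / 10) f"
      using f w[OF I] RS unfolding Bs_def by (auto intro: Ob0_add Ob0_diff)
    then show "\<forall>\<^sub>F T in at_right 0. \<forall>x\<in>S. 0 < fst x \<and> fst x < T \<longrightarrow> \<bar>f x\<bar> \<le> s"
      by (rule eventually_small) (use s in simp_all)
  qed
  have ev2: "\<forall>\<^sub>F T in at_right 0. \<forall>I\<in>Ix. \<forall>x\<in>S. 0 < fst x \<and> fst x < T \<longrightarrow> \<bar>ZZ Ix A.V I x - k I x\<bar> \<le> 1 / 20"
    unfolding S_def
    by (rule eventually_ball_finite[OF finite_atLeastAtMost], rule ballI, rule eventually_small[OF A.Ob0_V_small]) simp_all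
  have zw: "Ob0 True S (1 - e) (ZZ Ix A.W I)" if "I \<in> Ix" for I by (rule Ob0_ZZ[OF A.Ob0_W[folded S_def] that])
  have ev3: "\<forall>\<^sub>F T in at_right 0. \<forall>I\<in>Ix. \<forall>x\<in>S. 0 < fst x \<and> fst x < T \<longrightarrow> \<bar>ZZ Ix A.W I x\<bar> \<le> 1 / 20"
    by (rule eventually_ball_finite[OF finite_atLeastAtMost], rule ballI, rule eventually_small[OF zw]) (use e in simp_all)
  have ev4: "\<forall>\<^sub>F T in at_right 0. T \<in> {0<..<TT}" by (rule eventually_at_right_real[OF A.TT(1)])
  have "\<forall>\<^sub>F T in at_right 0. T \<in> {0<..<TT} \<and> (\<forall>I\<in>Ix. \<forall>f\<in>set (Bs I). \<forall>x\<in>S. 0 < fst x \<and> fst x < T \<longrightarrow> \<bar>f x\<bar> \<le> s)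
     \<and> (\<forall>I\<in>Ix. \<forall>x\<in>S. 0 < fst x \<and> fst x < T \<longrightarrow> \<bar>ZZ Ix A.V I x - k I x\<bar> \<le> 1 / 20)
     \<and> (\<forall>I\<in>Ix. \<forall>x\<in>S. 0 < fst x \<and> fst x < T \<longrightarrow> \<bar>ZZ Ix A.W I x\<bar> \<le> 1 / 20)"
    using ev1 ev2 ev3 ev4 by eventually_elim blast
  then have "\<exists>T. T \<in> {0<..<TT} \<and> (\<forall>I\<in>Ix. \<forall>f\<in>set (Bs I). \<forall>x\<in>S. 0 < fst x \<and> fst x < T \<longrightarrow> \<bar>f x\<bar> \<le> s)
     \<and> (\<forall>I\<in>Ix. \<forall>x\<in>S. 0 < fst x \<and> fst x < T \<longrightarrow> \<bar>ZZ Ix A.V I x - k I x\<bar> \<le> 1 / 20)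
     \<and> (\<forall>I\<in>Ix. \<forall>x\<in>S. 0 < fst x \<and> fst x < T \<longrightarrow> \<bar>ZZ Ix A.W I x\<bar> \<le> 1 / 20)"
    by (rule eventually_happens'[OF trivial_limit_at_right_real])
  then obtain T where T: "T \<in> {0<..<TT}" "\<forall>I\<in>Ix. \<forall>f\<in>set (Bs I). \<forall>x\<in>S. 0 < fst x \<and> fst x < T \<longrightarrow> \<bar>f x\<bar> \<le> s"
     "\<forall>I\<in>Ix. \<forall>x\<in>S. 0 < fst x \<and> fst x < T \<longrightarrow> \<bar>ZZ Ix A.V I x - k I x\<bar> \<le> 1 / 20"
     "\<forall>I\<in>Ix. \<forall>x\<in>S. 0 < fst x \<and> fst x < T \<longrightarrow> \<bar>ZZ Ix A.W I x\<bar> \<le> 1 / 20"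
    by (elim exE conjE)
  define S' where "S' = Tri c L T"
  have SS: "S' \<subseteq> S" unfolding S'_def S_def by (rule Tri_mono) (use T(1) in simp)
  have SS': "Tri c L T \<subseteq> Tri c L TT" by (rule Tri_mono) (use T(1) in simp)
  have T1: "0 < T" "T \<le> 1" using T(1) A.TT by auto
  have bS': "backward_closed S'" unfolding S'_def by (rule backward_closed_Tri[OF T1(2)])
  have S't: "0 < fst x \<and> fst x < T" if "x \<in> S'" for x using that by (auto simp: S'_def Tri_def)
  note o = Ob0_subset[OF _ SS, unfolded S'_def] and b = BO_subset[OF _ SS']
  have small: "\<bar>f x\<bar> \<le> s" if "I \<in> Ix" "f \<in> set (Bs I)" "x \<in> S'" for I f x
    using T(2) that S't[OF that(3)] SS by blast
  have Z: "\<bar>ZZ Ix A.V I x + ZZ Ix A.W I x - 1 / 2\<bar> \<le> 1 / 2" "\<bar>ZZ Ix A.V I x - ZZ Ix A.W I x - 1 / 2\<bar> \<le> 1 / 2" if I: "I \<in> Ix" and x: "x \<in> S'" for I x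
  proof -
    have "\<bar>ZZ Ix A.V I x - k I x\<bar> \<le> 1 / 20" "\<bar>ZZ Ix A.W I x\<bar> \<le> 1 / 20" using T(3,4) I S't[OF x] SS x by blast+
    moreover have "\<bar>k I x - 1 / 2\<bar> \<le> 1 / 3"
      using k_bd[OF I subsetD[OF A.SS0 subsetD[OF SS', OF x[unfolded S'_def]]]] m1[OF I] m2[OF I] e by linarith
    ultimately show "\<bar>ZZ Ix A.V I x + ZZ Ix A.W I x - 1 / 2\<bar> \<le> 1 / 2" "\<bar>ZZ Ix A.V I x - ZZ Ix A.W I x - 1 / 2\<bar> \<le> 1 / 2" by linarith+
  qed
  have VX: "A.V I x = B.V I x" "A.X I x = B.X I x" if I: "I \<in> Ix" and x: "x \<in> S'" for I x
  proof -
    have bs: "\<bar>A.X J y + A.Y J y\<bar> \<le> s" "\<bar>A.X J y - A.Y J y\<bar> \<le> s" "\<bar>B.X J y + B.Y J y\<bar> \<le> s" "\<bar>B.X J y - B.Y J y\<bar> \<le> s"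
      if "J \<in> Ix" "y \<in> Tri c L T" for J y
      using small[OF that(1), of "\<lambda>x. A.X J x + A.Y J x" y] small[OF that(1), of "\<lambda>x. A.X J x - A.Y J x" y]
        small[OF that(1), of "\<lambda>x. B.X J x + B.Y J x" y] small[OF that(1), of "\<lambda>x. B.X J x - B.Y J x" y] that(2)
      unfolding Bs_def S'_def by simp_all
    have fin: "finite Ix" and mu: "1 + e > 1" and s0: "0 \<le> s" using e s by auto
    show "A.V I x = B.V I x" "A.X I x = B.X I x"
      by (rule frame_unique[OF fin mu T1 frame_subset[OF A.frame_PQ SS'] frame_subset[OF B.frame_PQ SS']
          b[OF A.smV] b[OF A.smW] b[OF A.smX] b[OF A.smY] b[OF B.smV] b[OF B.smW] b[OF B.smX] b[OF B.smY]
          o[OF dV] o[OF dW] o[OF dX] o[OF dY] bs Z[unfolded S'_def] s0 s(2)[unfolded n1_def] I x[unfolded S'_def]], assumption+)+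
  qed
  have Peq: "A.P I x = B.P I x" if I: "I \<in> Ix" and x: "x \<in> S'" for I x
  proof -
    have "pder True S' (dP I) (\<lambda>x. A.V I x - B.V I x)"
      unfolding dP_def S'_def by (rule pder_subset[OF pder_diff[OF A.pP[OF I] B.pP[OF I]] SS'])
    then have "pder True S' (dP I) (\<lambda>x. 0)" by (rule pder_cong_deriv) (simp add: VX[OF I])
    from static_zero[OF bS' BO_subset[OF smdP[OF I] SS] this Ob0_subset[OF d4[OF I] SS] _ x] e
    have "dP I x = 0" by simp
    then show ?thesis by (simp add: dP_def)
  qed
  have Qeq: "A.Q I x = B.Q I x" if I: "I \<in> Ix" and x: "x \<in> S'" for I x
  proof -
    \<comment> \<open>Since P and X agree, so does D Q = exp (PP) * X. Thus the difference of the Q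
      is independent of t, and it decays because q0 is common.\<close>
    define dQ where "dQ = (\<lambda>x. A.Q I x - B.Q I x)"
    have smQ: "BO True False S 0 dQ" unfolding dQ_def S_def by (intro BO_diff A.BO_Q B.BO_Q A.RS I) simp_all
    have "pder True S' dQ (\<lambda>x. Dop (A.Q I) x - Dop (B.Q I) x)"
      unfolding dQ_def S'_def by (rule pder_subset[OF pder_diff[OF A.pQ[OF I] B.pQ[OF I]] SS'])
    then have p: "pder True S' dQ (\<lambda>x. 0)"
    proof (rule pder_cong_deriv)
      fix y assume y: "y \<in> S'"
      have "ZZ Ix A.P I y = ZZ Ix B.P I y" unfolding ZZ_def using Peq[OF _ y] I by simp
      then show "Dop (A.Q I) y - Dop (B.Q I) y = 0" unfolding A.DopQ(1) B.DopQ(1) using VX(2)[OF I y] by simp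
    qed
    have "BO False True S (2 * K I - 3 * e) (\<lambda>x. A.Q1 I x - B.Q1 I x)"
      unfolding S_def by (intro BO_diff A.BO_Q1 B.BO_Q1 A.RS I) simp_all
    moreover have "(\<lambda>x. A.Q1 I x - B.Q1 I x) = dQ" by (simp add: dQ_def A.Q_eq B.Q_eq)
    ultimately have "Ob0 True S (2 * K I - 3 * e) dQ" using BO_imp_Ob0 by metis
    from static_zero[OF bS' BO_subset[OF smQ SS] p Ob0_subset[OF this SS] _ x] e m1[OF I]
    have "dQ x = 0" by simp
    then show ?thesis by (simp add: dQ_def)
  qed
  have "\<rho> I x = \<rho>' I x \<and> kap I x = kap' I x" if I: "I \<in> Ix" and x: "x \<in> S'" for I x
  proof
    have t: "0 < fst x" using S't[OF x] by simp
    have "A.pr I x = B.pr I x" using Peq[OF I x] unfolding A.P_eq B.P_eq by simp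
    then show "\<rho> I x = \<rho>' I x" using t unfolding A.pr_def B.pr_def by simp
    have "A.Q1 I x = B.Q1 I x" using Qeq[OF I x] unfolding A.Q_eq B.Q_eq by simp
    then show "kap I x = kap' I x" using t unfolding A.Q1_def B.Q1_def by simp
  qed
  then show ?thesis using T(1) unfolding S'_def by (intro exI[of _ T]) auto
qed

end

section \<open>From the hypotheses of the statement to the locales\<close>

lemma smooth2_on_subset: "smooth2_on U u \<Longrightarrow> S \<subseteq> U \<Longrightarrow> smooth2_on S u"
  unfolding smooth2_on_def by (meson continuous_on_subset subsetD)

lemma regular_imp_BO:
  assumes f: "regular_on ({0<..<T} \<times> {l<..<r}) f" and TT: "TT < T" "TT \<le> 1" and lr: "l < c - L" "c + L < r"
    and bd: "b \<noteq> d"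
  shows "BO b d (Tri c L TT) 0 f"
proof -
  define \<Omega> where "\<Omega> = {0<..<T} \<times> {l<..<r}"
  define S where "S = Tri c L TT"
  have R: "region S" unfolding S_def by (rule region_Tri[OF TT(2)])
  have pos: "\<Omega> \<inter> {x. fst x > 0} = \<Omega>" by (auto simp: \<Omega>_def)
  have S\<Omega>: "S \<subseteq> \<Omega>" using TT lr by (auto simp: S_def \<Omega>_def Tri_def)
  have "smooth2_on \<Omega> f" using f unfolding regular_on_def \<Omega>_def[symmetric] pos by blast
  then have sm: "BO True False S 0 f" by (rule smooth2_imp_BO[OF smooth2_on_subset[OF _ S\<Omega>] R])
  have bound: "\<exists>C. \<forall>x\<in>S. \<bar>(dth ^^ n) f x\<bar> \<le> C" for n
  proof -
    obtain g where g: "continuous_on (\<Omega> \<union> (closure \<Omega> \<inter> {x. fst x = 0})) g" "\<And>x. x \<in> \<Omega> \<Longrightarrow> g x = (dth ^^ n) f x"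
      using f unfolding regular_on_def \<Omega>_def[symmetric] pos by blast
    \<comment> \<open>A closed rectangle containing S. The strict inequalities for TT, c - L and c +
      L keep it inside the domain of the continuous extension g, so compactness bounds the
      derivative.\<close>
    define C where "C = {0..TT} \<times> {c - L..c + L}"
    have "x \<in> \<Omega> \<union> (closure \<Omega> \<inter> {x. fst x = 0})" if x: "x \<in> C" for x
    proof (cases "fst x = 0")
      case True
      have "0 < T" "l < r" using x TT lr by (auto simp: C_def)
      then have "closure \<Omega> = {0..T} \<times> {l..r}" unfolding \<Omega>_def by (simp add: closure_Times)
      then show ?thesis using True x TT lr by (auto simp: C_def)
    qed (use x TT lr in \<open>auto simp: C_def \<Omega>_def\<close>)
    then have "continuous_on C g" by (intro continuous_on_subset[OF g(1)]) blast
    then have "bounded (g ` C)" by (intro compact_imp_bounded compact_continuous_image) (auto simp: C_def intro: compact_Times)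
    then obtain M where M: "\<And>x. x \<in> C \<Longrightarrow> \<bar>g x\<bar> \<le> M" unfolding bounded_iff by auto
    have "S \<subseteq> C" by (auto simp: S_def C_def Tri_def)
    then show ?thesis using M g(2) S\<Omega> by (intro exI[of _ M]) (metis subsetD)
  qed
  have "Ob False True S n 0 ((dth ^^ m) f)" for n m
  proof (induction n arbitrary: m)
    have O: "Ob0 True S 0 ((dth ^^ m) f)" for m
    proof -
      obtain C where C: "\<forall>x\<in>S. \<bar>(dth ^^ m) f x\<bar> \<le> C" using bound by blast
      have "\<forall>x\<in>S. \<bar>(dth ^^ m) f x\<bar> \<le> C * fst x powr 0"
        using C by (auto simp: S_def Tri_def)
      then show ?thesis using BO_cont[OF BO_dth_iter[OF sm R]] unfolding Ob0_def by blast
    qed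
    { case 0 show ?case using O by simp }
    { case (Suc n)
      show ?case
      proof (rule Ob_SucI[OF O])
        fix c assume "c \<longrightarrow> False"
        then have c: "c = False" by simp
        show "\<exists>f'. pder c S ((dth ^^ m) f) f' \<and> Ob False True S n 0 f'"
          unfolding c using BO_dth(1)[OF BO_dth_iter[OF sm R, of m] R] Suc.IH[of "Suc m"] by auto
      qed }
  qed
  then have "Ob False True S n 0 ((dth ^^ 0) f)" for n .
  then have "BO False True S 0 f" by (simp add: BO_def)
  then show ?thesis using sm bd unfolding S_def by (cases b; cases d) simp_all
qed

lemma (in twisted) expansion_of_solution:
  assumes sol: "is_expansion_solution D p0 p1 q0 q1 eps T l r \<pi> \<kappa>"
    and TT: "0 < TT" "TT \<le> 1" "TT < T" and lr: "l < c - L" "c + L < r"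
  shows "expansion D p0 p1 q0 q1 eps c L e K TT \<pi> \<kappa>"
proof (rule expansion.intro[OF twisted_axioms expansion_axioms.intro])
  fix I assume I: "I \<in> Ix"
  have s: "regular_on ({0<..<T} \<times> {l<..<r}) (\<pi> I)" "regular_on ({0<..<T} \<times> {l<..<r}) (\<kappa> I)"
    "\<forall>\<theta>\<in>{l<..<r}. ((\<lambda>t. \<kappa> I (t, \<theta>)) \<longlongrightarrow> 0) (at_right 0)"
    "\<forall>x\<in>{0<..<T} \<times> {l<..<r}. einstein_sys D (Pform D p0 p1 q0 eps \<pi>) (Qform D p0 q0 q1 \<kappa>) I x"
    using sol I unfolding is_expansion_solution_def by blast+
  show "BO b d (Tri c L TT) 0 (\<pi> I)" "BO b d (Tri c L TT) 0 (\<kappa> I)" if "b \<noteq> d" for b d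
    by (rule regular_imp_BO[OF s(1) TT(3,2) lr that], rule regular_imp_BO[OF s(2) TT(3,2) lr that])
  fix x assume "x \<in> Tri c L TT"
  then have x: "x \<in> {0<..<T} \<times> {l<..<r}" using TT lr by (auto simp: Tri_def mem_Times_iff)
  then show "((\<lambda>t. \<kappa> I (t, snd x)) \<longlongrightarrow> 0) (at_right 0)" using s(3) by (auto simp: mem_Times_iff)
  show "einstein_sys D (Pform D p0 p1 q0 eps \<pi>) (Qform D p0 q0 q1 \<kappa>) I x" using s(4) x by blast
qed (use TT in auto)

text \<open>The margin e is fixed first, from the strict inequalities at the centre; continuity of
  the exponents then gives an L on which they oscillate by at most e.\<close>

lemma twisted_localization:
  fixes p0 p1 q0 q1 :: "nat \<Rightarrow> real \<Rightarrow> real"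
  assumes sm: "\<forall>I\<in>{3..D-1}. smooth1 (p0 I) \<and> smooth1 (p1 I) \<and> smooth1 (q0 I) \<and> smooth1 (q1 I)"
    and k: "\<forall>I\<in>{3..D-1}. 1/2 < kI D p0 I \<theta>0 \<and> kI D p0 I \<theta>0 < 5/6"
    and ep: "\<forall>I\<in>{3..D-1}. \<forall>J\<in>{3..D-1}. 2 * (kI D p0 I \<theta>0 + kI D p0 J \<theta>0) - 3 < \<epsilon> J \<and>
           \<epsilon> J < min (2 * kI D p0 I \<theta>0 - 1) (2 - 2 * kI D p0 I \<theta>0)"
    and L0: "0 < L0"
  shows "\<exists>e L. 0 < L \<and> L \<le> L0 \<and> twisted D p0 p1 q0 q1 \<epsilon> \<theta>0 L e (\<lambda>I. kI D p0 I \<theta>0)"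
proof -
  define A where "A = {3..D-1}"
  have fin: "finite A" by (simp add: A_def)
  define K where "K = (\<lambda>I. kI D p0 I \<theta>0)"
  \<comment> \<open>The least slack in all strict inequalities. The last entry is positive because
    eps_J > 4 k_J - 3 gives 2 - 2 k_J + eps_J > 2 k_J - 1 > 0.\<close>
  define m where "m = (\<lambda>I J. min (min (K I - 1/2) (5/6 - K I)) (min (min (2 * K I - 1 - \<epsilon> J) (2 - 2 * K I - \<epsilon> J)) (2 - 2 * K J + \<epsilon> J)))"
  have m: "0 < m I J" if I: "I \<in> A" and J: "J \<in> A" for I J
  proof -
    have "1/2 < K I" "K I < 5/6" "1/2 < K J" "\<epsilon> J < 2 * K I - 1" "\<epsilon> J < 2 - 2 * K I" "2 * (K J + K J) - 3 < \<epsilon> J"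
      using bspec[OF k I[unfolded A_def]] bspec[OF k J[unfolded A_def]] bspec[OF bspec[OF ep I[unfolded A_def]] J[unfolded A_def]]
        bspec[OF bspec[OF ep J[unfolded A_def]] J[unfolded A_def]] unfolding K_def by simp_all
    then show ?thesis unfolding m_def by simp
  qed
  have ev: "\<forall>\<^sub>F e in at_right (0::real). 10 * e < s" if "0 < s" for s
    by (rule eventually_mono[OF eventually_at_right_real[of 0 "s / 10"]]) (use that in auto)
  have "\<forall>\<^sub>F e in at_right (0::real). \<forall>I\<in>A. \<forall>J\<in>A. 10 * e < m I J"
    by (rule eventually_ball_finite[OF fin], rule ballI, rule eventually_ball_finite[OF fin], rule ballI, rule ev, rule m)
  then have "\<forall>\<^sub>F e in at_right (0::real). 0 < e \<and> 10 * e < 1/6 \<and> (\<forall>I\<in>A. \<forall>J\<in>A. 10 * e < m I J)"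
    using eventually_at_right_less[of 0] ev[of "1/6"] by (auto simp: eventually_conj_iff)
  then obtain e where e: "0 < e" "10 * e < 1/6" "\<And>I J. I \<in> A \<Longrightarrow> J \<in> A \<Longrightarrow> 10 * e < m I J"
    using eventually_happens'[OF trivial_limit_at_right_real] by blast
  have "\<forall>\<^sub>F \<theta> in nhds \<theta>0. \<forall>I\<in>A. dist (kI D p0 I \<theta>) (K I) < e"
  proof (rule eventually_ball_finite[OF fin], rule ballI)
    fix I assume I: "I \<in> A"
    have c: "isCont (p0 J) \<theta>0" if "J \<in> A" for J using DERIV_isCont[OF smooth1_DERIV] sm that unfolding A_def by blast
    have "isCont (kI D p0 I) \<theta>0"
      unfolding kI_def A_def[symmetric] by (intro continuous_add continuous_sum c I)
    then have "(kI D p0 I \<longlongrightarrow> K I) (nhds \<theta>0)" unfolding isCont_def K_def tendsto_at_iff_tendsto_nhds .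
    then show "\<forall>\<^sub>F \<theta> in nhds \<theta>0. dist (kI D p0 I \<theta>) (K I) < e" by (rule tendstoD[OF _ e(1)])
  qed
  then obtain r where r: "r > 0" "\<And>\<theta> I. dist \<theta> \<theta>0 < r \<Longrightarrow> I \<in> A \<Longrightarrow> dist (kI D p0 I \<theta>) (K I) < e"
    unfolding eventually_nhds_metric by blast
  have "twisted D p0 p1 q0 q1 \<epsilon> \<theta>0 (min r L0) e K"
  proof (unfold_locales, unfold A_def[symmetric])
    show "smooth1 (p0 I)" "smooth1 (p1 I)" "smooth1 (q0 I)" "smooth1 (q1 I)" if "I \<in> A" for I
      using sm that unfolding A_def by blast+
    show "\<bar>kI D p0 I \<theta> - K I\<bar> \<le> e" if "I \<in> A" "\<bar>\<theta> - \<theta>0\<bar> < min r L0" for I \<theta>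
      using r(2)[of \<theta> I] that by (simp add: dist_real_def)
    show "1 / 2 + 10 * e < K I" "K I < 5 / 6 - 10 * e" if "I \<in> A" for I using e(3)[OF that that] by (auto simp: m_def)
    show "\<epsilon> J + 10 * e < 2 * K I - 1" "\<epsilon> J + 10 * e < 2 - 2 * K I" if "I \<in> A" "J \<in> A" for I J
      using e(3)[OF that] by (auto simp: m_def)
    show "10 * e < 2 - 2 * K J + \<epsilon> J" if "J \<in> A" for J using e(3)[OF that that] by (auto simp: m_def)
  qed (use r L0 e in auto)
  then show ?thesis using r L0 unfolding K_def by (intro exI[of _ e] exI[of _ "min r L0"]) auto
qed

theorem theorem5:
  fixes D :: nat and p0 p1 q0 q1 :: "nat \<Rightarrow> real \<Rightarrow> real" and \<epsilon> :: "nat \<Rightarrow> real"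
    and \<theta>0 :: real
  assumes "D \<ge> 4"
    and "\<forall>I\<in>{3..D-1}. smooth1 (p0 I) \<and> smooth1 (p1 I) \<and> smooth1 (q0 I) \<and> smooth1 (q1 I)"
    and "\<forall>I\<in>{3..D-1}. \<forall>\<theta>. 1/2 < kI D p0 I \<theta> \<and> kI D p0 I \<theta> < 5/6"
    and "\<forall>I\<in>{3..D-1}. \<forall>J\<in>{3..D-1}. \<forall>\<theta>.
           2 * (kI D p0 I \<theta> + kI D p0 J \<theta>) - 3 < \<epsilon> J \<and>
           \<epsilon> J < min (2 * kI D p0 I \<theta> - 1) (2 - 2 * kI D p0 I \<theta>)"
  shows "(\<exists>T a b \<pi> \<kappa>. a < \<theta>0 \<and> \<theta>0 < b \<and>
            is_expansion_solution D p0 p1 q0 q1 \<epsilon> T a b \<pi> \<kappa>)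
       \<and> (\<forall>T a b \<pi> \<kappa> T' a' b' \<pi>' \<kappa>'.
            a < \<theta>0 \<and> \<theta>0 < b \<and> is_expansion_solution D p0 p1 q0 q1 \<epsilon> T a b \<pi> \<kappa> \<and>
            a' < \<theta>0 \<and> \<theta>0 < b' \<and> is_expansion_solution D p0 p1 q0 q1 \<epsilon> T' a' b' \<pi>' \<kappa>' \<longrightarrow>
            (\<exists>T'' \<delta>. 0 < T'' \<and> T'' \<le> min T T' \<and> 0 < \<delta> \<and>
               max a a' \<le> \<theta>0 - \<delta> \<and> \<theta>0 + \<delta> \<le> min b b' \<and>
               (\<forall>I\<in>{3..D-1}. \<forall>t\<in>{0<..<T''}. \<forall>\<theta>\<in>{\<theta>0-\<delta><..<\<theta>0+\<delta>}.
                  \<pi> I (t, \<theta>) = \<pi>' I (t, \<theta>) \<and> \<kappa> I (t, \<theta>) = \<kappa>' I (t, \<theta>))))"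
proof (intro conjI allI impI)
  note localize = twisted_localization[OF assms(2), of \<theta>0 \<epsilon>]
  have k: "\<forall>I\<in>{3..D-1}. 1/2 < kI D p0 I \<theta>0 \<and> kI D p0 I \<theta>0 < 5/6" using assms(3) by blast
  have ep: "\<forall>I\<in>{3..D-1}. \<forall>J\<in>{3..D-1}. 2 * (kI D p0 I \<theta>0 + kI D p0 J \<theta>0) - 3 < \<epsilon> J \<and>
           \<epsilon> J < min (2 * kI D p0 I \<theta>0 - 1) (2 - 2 * kI D p0 I \<theta>0)" using assms(4) by blast
  obtain e L where "twisted D p0 p1 q0 q1 \<epsilon> \<theta>0 L e (\<lambda>I. kI D p0 I \<theta>0)"
    using localize[OF k ep, of 1] by auto
  from twisted.existence[OF this]
  show "\<exists>T a b \<pi> \<kappa>. a < \<theta>0 \<and> \<theta>0 < b \<and> is_expansion_solution D p0 p1 q0 q1 \<epsilon> T a b \<pi> \<kappa>" .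
  fix T a b \<pi> \<kappa> T' a' b' \<pi>' \<kappa>'
  assume *: "a < \<theta>0 \<and> \<theta>0 < b \<and> is_expansion_solution D p0 p1 q0 q1 \<epsilon> T a b \<pi> \<kappa> \<and>
            a' < \<theta>0 \<and> \<theta>0 < b' \<and> is_expansion_solution D p0 p1 q0 q1 \<epsilon> T' a' b' \<pi>' \<kappa>'"
  then have sol: "is_expansion_solution D p0 p1 q0 q1 \<epsilon> T a b \<pi> \<kappa>" "is_expansion_solution D p0 p1 q0 q1 \<epsilon> T' a' b' \<pi>' \<kappa>'"
    by blast+
  then have T: "0 < T" "0 < T'" unfolding is_expansion_solution_def by blast+
  \<comment> \<open>The halving, here and in \<open>TT\<close>, keeps the closed rectangle strictly
    inside both domains, as \<open>regular_imp_BO\<close> requires.\<close>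
  define L0 where "L0 = min (min (\<theta>0 - a) (b - \<theta>0)) (min (\<theta>0 - a') (b' - \<theta>0)) / 2"
  have L0: "0 < L0" "a < \<theta>0 - L0" "a' < \<theta>0 - L0" "\<theta>0 + L0 < b" "\<theta>0 + L0 < b'"
  proof -
    have "0 < 2 * L0" "2 * L0 \<le> \<theta>0 - a" "2 * L0 \<le> \<theta>0 - a'" "2 * L0 \<le> b - \<theta>0" "2 * L0 \<le> b' - \<theta>0"
      using * unfolding L0_def by simp_all
    then show "0 < L0" "a < \<theta>0 - L0" "a' < \<theta>0 - L0" "\<theta>0 + L0 < b" "\<theta>0 + L0 < b'" by linarith+
  qed
  obtain e L where L: "0 < L" "L \<le> L0" and tw: "twisted D p0 p1 q0 q1 \<epsilon> \<theta>0 L e (\<lambda>I. kI D p0 I \<theta>0)"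
    using localize[OF k ep L0(1)] by auto
  define TT where "TT = min 1 (min T T') / 2"
  have TT: "0 < TT" "TT \<le> 1" "TT < T" "TT < T'" using T unfolding TT_def min_def by (auto split: if_splits)
  have lr: "a < \<theta>0 - L" "\<theta>0 + L < b" "a' < \<theta>0 - L" "\<theta>0 + L < b'" using L0 L by linarith+
  obtain T1 where T1: "0 < T1" "T1 \<le> TT"
      "\<forall>I\<in>{3..D-1}. \<forall>x\<in>Tri \<theta>0 L T1. \<pi> I x = \<pi>' I x \<and> \<kappa> I x = \<kappa>' I x"
    using twisted.uniqueness_local[OF tw twisted.expansion_of_solution[OF tw sol(1) TT(1,2,3) lr(1,2)]
        twisted.expansion_of_solution[OF tw sol(2) TT(1,2,4) lr(3,4)]] by blast
  \<comment> \<open>The triangle of uniqueness contains a rectangle of half its width, restricted to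
    times below L / 2.\<close>
  have "\<pi> I (t, \<theta>) = \<pi>' I (t, \<theta>) \<and> \<kappa> I (t, \<theta>) = \<kappa>' I (t, \<theta>)"
    if "I \<in> {3..D-1}" "t \<in> {0<..<min T1 (L / 2)}" "\<theta> \<in> {\<theta>0 - L / 2<..<\<theta>0 + L / 2}" for I t \<theta>
  proof -
    have "(t, \<theta>) \<in> Tri \<theta>0 L T1" using that(2,3) unfolding Tri_def by (auto simp: abs_less_iff)
    then show ?thesis using T1(3) that(1) by blast
  qed
  then show "\<exists>T'' \<delta>. 0 < T'' \<and> T'' \<le> min T T' \<and> 0 < \<delta> \<and>
               max a a' \<le> \<theta>0 - \<delta> \<and> \<theta>0 + \<delta> \<le> min b b' \<and>
               (\<forall>I\<in>{3..D-1}. \<forall>t\<in>{0<..<T''}. \<forall>\<theta>\<in>{\<theta>0-\<delta><..<\<theta>0+\<delta>}.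
                  \<pi> I (t, \<theta>) = \<pi>' I (t, \<theta>) \<and> \<kappa> I (t, \<theta>) = \<kappa>' I (t, \<theta>))"
    using T1 TT L lr by (intro exI[of _ "min T1 (L / 2)"] exI[of _ "L / 2"] conjI ballI) auto
qed

end
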